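(* Let $G$ be a finite group. Then $G$ is nilpotent if and only if $R(G)=\mathbb{Q}[G^{ab}]$. Moreover, if $G$ is non-nilpotent and $H$ is a non-normal maximal subgroup of $G$, then $\Phi_H^G(M_{(\{T_H\},\emptyset)})=M_{(\{T_G\},D)}\in R(G)\setminus\mathbb{Q}[G^{ab}]$ for some $D\in\mathcal{S}_G$, where $T_H$ and $T_G$ denote the trivial representations of $H$ and $G$.
   Context: $K$ is an algebraically closed field of characteristic $0$; $G^{ab}=G/[G,G]$. Gliders. A glider of length at most $1$ of $G$ (for $K\subset K[G]$) is a $K[G]$-module $\Omega$ with finite-dimensional $K$-subspaces $M_{-1}\subseteq M_0\subseteq\Omega$ with $K[G]M_{-1}\subseteq M_0$; it has length $0$ if $M_{-1}=0$ and length $1$ otherwise. A morphism to $(N_{-1}\subseteq N_0)$ is a $K$-linear $f:M_0\to N_0$ with $f(M_{-1})\subseteq N_{-1}$ and $f(xm)=xf(m)$ for $x\in K[G]$, $m\in M_{-1}$. Direct sums and tensor products (diagonal $G$-action) are formed levelwise. A glider of length $1$ is irreducible iff $\dim M_{-1}=1$ and $M_0=K[G]M_{-1}$. $\overline{R}_1(\widetilde G)$ is the subring generated by the classes of irreducible gliders of length $1$ in the quotient of the split Grothendieck ring of gliders of length $\le 1$ by the ideal additively generated by gliders of length $0$. In it $[Ku\subset U]\cdot[Kv\subset V]=[K(u\otimes v)\subset K[G](u\otimes v)]$. Put $\mathbb{Q}(\widetilde G)=\mathbb{Q}\otimes_{\mathbb Z}\overline R_1(\widetilde G)$. Parametrization.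 For every group fix an isomorphism $z\mapsto T_z$ from $G^{ab}$ to the group of one-dimensional $K[G]$-modules, and identify elements of $G^{ab}$ with the corresponding representations. $\mathcal{S}_G$ is the set of subsets $B$ of $\bigsqcup_{U\in\mathrm{Irr}(G),\dim U>1}\mathrm{Gr}(U)$, $\mathrm{Gr}(U)=\bigsqcup_{j=1}^{\dim U}\mathrm{Gr}(j,U)$, containing at most one point $W_U$ of each $\mathrm{Gr}(U)$. For $A\subseteq G^{ab}$, $B\in\mathcal S_G$, not both empty, $M_{(A,B)}$ is the class of the irreducible glider $Kv\subset\bigoplus_{z\in A}T_z\oplus\bigoplus_U U^{\oplus m_U}$ with $m_U=\dim W_U$ ($0$ if $B\cap\mathrm{Gr}(U)=\emptyset$), where $v$ has nonzero component in each $T_z$ and its components in the copies of $U$ form a basis of $W_U$. Every irreducible glider of length $1$ is isomorphic to exactly one of these. $\mathbb{Q}[G^{ab}]$ is identified with the $\mathbb{Q}$-span of the elements $M_{(\{z\},\emptyset)}$, $z\in G^{ab}$, in $\mathbb{Q}(\widetilde G)$. If the cyclic semigroup $\langle M_{(A,B)}\rangle$ of powers is finite it contains a unique idempotent $e(A,B)$. $R(G)$ is the $\mathbb{Q}$-span of those $M_{(A,B)}$ with $\langle M_{(A,B)}\rangle$ finite and $e(A,B)=M_{(\{e\},D)}$ for some $D\in\mathcal{S}_G$ ($e$ the identity of $G^{ab}$). For $H\le G$, $\Phi_H^G:\mathbb{Q}(\widetilde H)\to\mathbb{Q}(\widetilde G)$ is the $\mathbb{Q}$-linear map induced by $[Ku\subset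 U]\mapsto[K(1\otimes u)\subset K[G]\otimes_{K[H]}U]$. *)

theory Defs
  imports
    "HOL-Algebra.Algebra"
    "HOL-Library.Function_Algebras"
    "HOL-Library.Poly_Mapping"
    "HOL-Computational_Algebra.Polynomial"
begin

section \<open>Vector spaces\<close>

text \<open>
  Vector spaces are subspaces of \<open>'i \<Rightarrow> 'k\<close>. Every \<open>K\<close>-space is isomorphic to one of these for a
  large enough index type, and every finite-dimensional one to one with index type \<^typ>\<open>nat\<close>.
\<close>

definition fscale :: "'k::field \<Rightarrow> ('i \<Rightarrow> 'k) \<Rightarrow> 'i \<Rightarrow> 'k" where
  "fscale c w = (\<lambda>i. c * w i)"

interpretation fv: vector_space "fscale :: 'k::field \<Rightarrow> ('i \<Rightarrow> 'k) \<Rightarrow> 'i \<Rightarrow> 'k"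
  by unfold_locales (auto simp: fscale_def algebra_simps fun_eq_iff)

definition fin_dim :: "('i \<Rightarrow> 'k::field) set \<Rightarrow> bool" where
  "fin_dim V \<longleftrightarrow> (\<exists>S. finite S \<and> V = fv.span S)"

definition lin_on :: "('i \<Rightarrow> 'k::field) set \<Rightarrow> (('i \<Rightarrow> 'k) \<Rightarrow> 'j \<Rightarrow> 'k) \<Rightarrow> bool" where
  "lin_on V f \<longleftrightarrow> (\<forall>u\<in>V. \<forall>v\<in>V. f (u + v) = f u + f v) \<and>
                (\<forall>c. \<forall>u\<in>V. f (fscale c u) = fscale c (f u))"

definition tens :: "('i \<Rightarrow> 'k::field) \<Rightarrow> ('j \<Rightarrow> 'k) \<Rightarrow> 'i \<times> 'j \<Rightarrow> 'k" where
  "tens u v = (\<lambda>(i, j). u i * v j)"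

definition tens_space :: "('i \<Rightarrow> 'k::field) set \<Rightarrow> ('j \<Rightarrow> 'k) set \<Rightarrow> ('i \<times> 'j \<Rightarrow> 'k) set" where
  "tens_space U V = fv.span {tens u v |u v. u \<in> U \<and> v \<in> V}"

text \<open>
  If \<open>f\<close>, \<open>f'\<close> are linear on \<open>U\<close>, \<open>V\<close>, all slices \<open>w(-,j)\<close>, \<open>w(i,-)\<close> of \<open>w \<in> U \<otimes> V\<close> lie in \<open>U\<close>, \<open>V\<close>, and
  applying \<open>f\<close> and then \<open>f'\<close> slicewise is the linear map with \<open>u \<otimes> v \<mapsto> f u \<otimes> f' v\<close>.
\<close>

definition tens_map ::
  "(('i \<Rightarrow> 'k::field) \<Rightarrow> 'i \<Rightarrow> 'k) \<Rightarrow> (('j \<Rightarrow> 'k) \<Rightarrow> 'j \<Rightarrow> 'k) \<Rightarrow> ('i \<times> 'j \<Rightarrow> 'k) \<Rightarrow> 'i \<times> 'j \<Rightarrow> 'k" where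
  "tens_map f f' w = (\<lambda>(i, j). f' (\<lambda>j'. f (\<lambda>i'. w (i', j')) i) j)"

definition dsum_space :: "('i \<Rightarrow> 'k::field) set \<Rightarrow> ('j \<Rightarrow> 'k) set \<Rightarrow> ('i + 'j \<Rightarrow> 'k) set" where
  "dsum_space U V = {case_sum u v |u v. u \<in> U \<and> v \<in> V}"

definition dsum_map ::
  "(('i \<Rightarrow> 'k) \<Rightarrow> 'i \<Rightarrow> 'k) \<Rightarrow> (('j \<Rightarrow> 'k) \<Rightarrow> 'j \<Rightarrow> 'k) \<Rightarrow> ('i + 'j \<Rightarrow> 'k) \<Rightarrow> 'i + 'j \<Rightarrow> 'k" where
  "dsum_map f f' w = case_sum (f (w \<circ> Inl)) (f' (w \<circ> Inr))"

section \<open>Modules over the group algebra of a finite group\<close>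

text \<open>
  \<open>K[G]\<close> consists of the functions \<open>'g \<Rightarrow> 'k\<close> vanishing outside the (finite) carrier of \<open>G\<close>. A
  \<open>K[G]\<close>-module is given by the action of the group elements; only the values \<open>mod_act V g v\<close> with
  \<open>g \<in> carrier G\<close>, \<open>v \<in> mod_space V\<close> matter.
\<close>

definition galg :: "('g, 'm) monoid_scheme \<Rightarrow> ('g \<Rightarrow> 'k::field) set" where
  "galg G = {x. \<forall>g. g \<notin> carrier G \<longrightarrow> x g = 0}"

definition galg_of :: "'g \<Rightarrow> 'g \<Rightarrow> 'k::field" where
  "galg_of g = (\<lambda>h. if h = g then 1 else 0)"

definition galg_mult ::
  "('g, 'm) monoid_scheme \<Rightarrow> ('g \<Rightarrow> 'k::field) \<Rightarrow> ('g \<Rightarrow> 'k) \<Rightarrow> 'g \<Rightarrow> 'k" where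
  "galg_mult G x y = (\<lambda>g. if g \<in> carrier G
     then \<Sum>h\<in>carrier G. x (g \<otimes>\<^bsub>G\<^esub> inv\<^bsub>G\<^esub> h) * y h else 0)"

record ('g, 'k, 'i) kgmod =
  mod_space :: "('i \<Rightarrow> 'k) set"
  mod_act :: "'g \<Rightarrow> ('i \<Rightarrow> 'k) \<Rightarrow> 'i \<Rightarrow> 'k"

definition is_kgmod ::
  "('g, 'm) monoid_scheme \<Rightarrow> ('g, 'k::field, 'i, 'z) kgmod_scheme \<Rightarrow> bool" where
  "is_kgmod G V \<longleftrightarrow> fv.subspace (mod_space V) \<and>
     (\<forall>g\<in>carrier G. mod_act V g \<in> mod_space V \<rightarrow> mod_space V \<and> lin_on (mod_space V) (mod_act V g)) \<and>
     (\<forall>v\<in>mod_space V. mod_act V \<one>\<^bsub>G\<^esub> v = v) \<and>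
     (\<forall>g\<in>carrier G. \<forall>h\<in>carrier G. \<forall>v\<in>mod_space V.
        mod_act V (g \<otimes>\<^bsub>G\<^esub> h) v = mod_act V g (mod_act V h v))"

definition galg_act ::
  "('g, 'm) monoid_scheme \<Rightarrow> ('g, 'k::field, 'i, 'z) kgmod_scheme \<Rightarrow> ('g \<Rightarrow> 'k) \<Rightarrow> ('i \<Rightarrow> 'k) \<Rightarrow> 'i \<Rightarrow> 'k"
  where "galg_act G V x v = (\<Sum>g\<in>carrier G. fscale (x g) (mod_act V g v))"

definition galg_span ::
  "('g, 'm) monoid_scheme \<Rightarrow> ('g, 'k::field, 'i, 'z) kgmod_scheme \<Rightarrow> ('i \<Rightarrow> 'k) set \<Rightarrow> ('i \<Rightarrow> 'k) set"
  where "galg_span G V S = fv.span {galg_act G V x v |x v. x \<in> galg G \<and> v \<in> S}"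

definition kgmod_iso ::
  "('g, 'm) monoid_scheme \<Rightarrow> ('g, 'k::field, 'i) kgmod \<Rightarrow> ('g, 'k, 'j) kgmod \<Rightarrow> bool" where
  "kgmod_iso G V W \<longleftrightarrow> (\<exists>f. bij_betw f (mod_space V) (mod_space W) \<and> lin_on (mod_space V) f \<and>
     (\<forall>x\<in>galg G. \<forall>v\<in>mod_space V. f (galg_act G V x v) = galg_act G W x (f v)))"

definition irreducible_kgmod :: "('g, 'm) monoid_scheme \<Rightarrow> ('g, 'k::field, 'i) kgmod \<Rightarrow> bool" where
  "irreducible_kgmod G V \<longleftrightarrow> is_kgmod G V \<and> mod_space V \<noteq> {0} \<and>
     (\<forall>W. fv.subspace W \<and> W \<subseteq> mod_space V \<and> (\<forall>g\<in>carrier G. mod_act V g ` W \<subseteq> W)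
        \<longrightarrow> W = {0} \<or> W = mod_space V)"

definition unit_line :: "(nat \<Rightarrow> 'k::field) set" where
  "unit_line = {w. \<forall>i. i \<noteq> 0 \<longrightarrow> w i = 0}"

definition trivial_kgmod :: "('g, 'k::field, nat) kgmod" where
  "trivial_kgmod = \<lparr>mod_space = unit_line, mod_act = (\<lambda>g w. w)\<rparr>"

definition tensor_kgmod ::
  "('g, 'k::field, 'i) kgmod \<Rightarrow> ('g, 'k, 'j) kgmod \<Rightarrow> ('g, 'k, 'i \<times> 'j) kgmod" where
  "tensor_kgmod V W = \<lparr>mod_space = tens_space (mod_space V) (mod_space W),
     mod_act = (\<lambda>g. tens_map (mod_act V g) (mod_act W g))\<rparr>"

text \<open>The direct sum of a finite family of modules; \<open>\<lambda>i. w (x, i)\<close> is the component of \<open>w\<close> at \<open>x\<close>.\<close>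

definition dsum_family ::
  "'x set \<Rightarrow> ('x \<Rightarrow> ('g, 'k::field, 'i) kgmod) \<Rightarrow> ('g, 'k, 'x \<times> 'i) kgmod" where
  "dsum_family I V = \<lparr>
     mod_space = {w. \<forall>x. (if x \<in> I then (\<lambda>i. w (x, i)) \<in> mod_space (V x) else \<forall>i. w (x, i) = 0)},
     mod_act = (\<lambda>g w. \<lambda>(x, i). if x \<in> I then mod_act (V x) g (\<lambda>j. w (x, j)) i else 0)\<rparr>"

section \<open>Gliders of length at most 1\<close>

record ('g, 'k, 'i) glider = "('g, 'k, 'i) kgmod" +
  lev_m1 :: "('i \<Rightarrow> 'k) set"
  lev_0 :: "('i \<Rightarrow> 'k) set"

definition is_glider :: "('g, 'm) monoid_scheme \<Rightarrow> ('g, 'k::field, 'i) glider \<Rightarrow> bool" where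
  "is_glider G M \<longleftrightarrow> is_kgmod G M \<and>
     fv.subspace (lev_m1 M) \<and> fin_dim (lev_m1 M) \<and> fv.subspace (lev_0 M) \<and> fin_dim (lev_0 M) \<and>
     lev_m1 M \<subseteq> lev_0 M \<and> lev_0 M \<subseteq> mod_space M \<and> galg_span G M (lev_m1 M) \<subseteq> lev_0 M"

definition length0 :: "('g, 'k::field, 'i) glider \<Rightarrow> bool" where
  "length0 M \<longleftrightarrow> lev_m1 M = {0}"

definition irreducible_glider :: "('g, 'm) monoid_scheme \<Rightarrow> ('g, 'k::field, 'i) glider \<Rightarrow> bool" where
  "irreducible_glider G M \<longleftrightarrow>
     is_glider G M \<and> fv.dim (lev_m1 M) = 1 \<and> lev_0 M = galg_span G M (lev_m1 M)"

definition glider_hom ::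
  "('g, 'm) monoid_scheme \<Rightarrow> ('g, 'k::field, 'i) glider \<Rightarrow> ('g, 'k, 'j) glider
     \<Rightarrow> (('i \<Rightarrow> 'k) \<Rightarrow> 'j \<Rightarrow> 'k) set" where
  "glider_hom G M N = {f. f \<in> lev_0 M \<rightarrow> lev_0 N \<and> lin_on (lev_0 M) f \<and> f ` lev_m1 M \<subseteq> lev_m1 N \<and>
     (\<forall>x\<in>galg G. \<forall>m\<in>lev_m1 M. f (galg_act G M x m) = galg_act G N x (f m))}"

definition glider_iso ::
  "('g, 'm) monoid_scheme \<Rightarrow> ('g, 'k::field, 'i) glider \<Rightarrow> ('g, 'k, 'j) glider \<Rightarrow> bool" where
  "glider_iso G M N \<longleftrightarrow> (\<exists>f\<in>glider_hom G M N. \<exists>h\<in>glider_hom G N M.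
     (\<forall>m\<in>lev_0 M. h (f m) = m) \<and> (\<forall>n\<in>lev_0 N. f (h n) = n))"

definition dsum_glider ::
  "('g, 'k::field, 'i) glider \<Rightarrow> ('g, 'k, 'j) glider \<Rightarrow> ('g, 'k, 'i + 'j) glider" where
  "dsum_glider M N = \<lparr>mod_space = dsum_space (mod_space M) (mod_space N),
     mod_act = (\<lambda>g. dsum_map (mod_act M g) (mod_act N g)),
     lev_m1 = dsum_space (lev_m1 M) (lev_m1 N),
     lev_0 = dsum_space (lev_0 M) (lev_0 N)\<rparr>"

definition tensor_glider ::
  "('g, 'k::field, 'i) glider \<Rightarrow> ('g, 'k, 'j) glider \<Rightarrow> ('g, 'k, 'i \<times> 'j) glider" where
  "tensor_glider M N = \<lparr>mod_space = tens_space (mod_space M) (mod_space N),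
     mod_act = (\<lambda>g. tens_map (mod_act M g) (mod_act N g)),
     lev_m1 = tens_space (lev_m1 M) (lev_m1 N),
     lev_0 = tens_space (lev_0 M) (lev_0 N)\<rparr>"

definition unit_glider :: "('g, 'k::field, nat) glider" where
  "unit_glider = \<lparr>mod_space = unit_line, mod_act = (\<lambda>g w. w),
     lev_m1 = unit_line, lev_0 = unit_line\<rparr>"

text \<open>
  Isomorphism of gliders only sees \<open>M\<^sub>0\<close>, which is finite-dimensional, so every glider is isomorphic to
  one with index type \<^typ>\<open>nat\<close>. These form the set from which Grothendieck groups are built.
\<close>

definition nat_gliders :: "('g, 'm) monoid_scheme \<Rightarrow> ('g, 'k::field, nat) glider set" where
  "nat_gliders G = {M. is_glider G M}"

definition nat_model ::
  "('g, 'm) monoid_scheme \<Rightarrow> ('g, 'k::field, 'i) glider \<Rightarrow> ('g, 'k, nat) glider" where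
  "nat_model G M = (SOME P. P \<in> nat_gliders G \<and> glider_iso G P M)"

section \<open>Grothendieck rings\<close>

text \<open>
  The free abelian group on a set \<open>S\<close> with the bilinear extension of an operation on \<open>S\<close>. It need not be
  a ring, but its quotients used below are.
\<close>

definition free_alg :: "'a set \<Rightarrow> ('a \<Rightarrow> 'a \<Rightarrow> 'a) \<Rightarrow> 'a \<Rightarrow> ('a \<Rightarrow>\<^sub>0 int) ring" where
  "free_alg S m u = \<lparr>carrier = {c. Poly_Mapping.keys c \<subseteq> S},
     monoid.mult = (\<lambda>a b. \<Sum>x\<in>Poly_Mapping.keys a. \<Sum>y\<in>Poly_Mapping.keys b.
        Poly_Mapping.single (m x y) (Poly_Mapping.lookup a x * Poly_Mapping.lookup b y)),
     one = frag_of u, ring.zero = 0, add = (+)\<rparr>"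

definition glider_alg :: "('g, 'm) monoid_scheme \<Rightarrow> (('g, 'k::field, nat) glider \<Rightarrow>\<^sub>0 int) ring" where
  "glider_alg G = free_alg (nat_gliders G) (\<lambda>M N. nat_model G (tensor_glider M N)) unit_glider"

definition split_relations ::
  "('g, 'm) monoid_scheme \<Rightarrow> (('g, 'k::field, nat) glider \<Rightarrow>\<^sub>0 int) set" where
  "split_relations G = generate (add_monoid (glider_alg G))
     ({frag_of M - frag_of N |M N. M \<in> nat_gliders G \<and> N \<in> nat_gliders G \<and> glider_iso G M N} \<union>
      {frag_of P - frag_of M - frag_of N |P M N. P \<in> nat_gliders G \<and> M \<in> nat_gliders G \<and>
         N \<in> nat_gliders G \<and> glider_iso G P (dsum_glider M N)})"

definition split_groth_ring ::
  "('g, 'm) monoid_scheme \<Rightarrow> (('g, 'k::field, nat) glider \<Rightarrow>\<^sub>0 int) set ring" where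
  "split_groth_ring G = glider_alg G Quot split_relations G"

definition split_class ::
  "('g, 'm) monoid_scheme \<Rightarrow> ('g, 'k::field, 'i) glider \<Rightarrow> (('g, 'k, nat) glider \<Rightarrow>\<^sub>0 int) set" where
  "split_class G M = split_relations G +>\<^bsub>glider_alg G\<^esub> frag_of (nat_model G M)"

definition length0_ideal ::
  "('g, 'm) monoid_scheme \<Rightarrow> (('g, 'k::field, nat) glider \<Rightarrow>\<^sub>0 int) set set" where
  "length0_ideal G = generate (add_monoid (split_groth_ring G))
     {split_class G M |M. M \<in> nat_gliders G \<and> length0 M}"

definition reduced_ring ::
  "('g, 'm) monoid_scheme \<Rightarrow> (('g, 'k::field, nat) glider \<Rightarrow>\<^sub>0 int) set set ring" where
  "reduced_ring G = split_groth_ring G Quot length0_ideal G"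

definition glider_class ::
  "('g, 'm) monoid_scheme \<Rightarrow> ('g, 'k::field, 'i) glider \<Rightarrow> (('g, 'k, nat) glider \<Rightarrow>\<^sub>0 int) set set" where
  "glider_class G M = length0_ideal G +>\<^bsub>split_groth_ring G\<^esub> split_class G M"

definition R1bar ::
  "('g, 'm) monoid_scheme \<Rightarrow> (('g, 'k::field, nat) glider \<Rightarrow>\<^sub>0 int) set set ring" where
  "R1bar G = reduced_ring G\<lparr>carrier := generate_ring (reduced_ring G)
     {glider_class G M |M. M \<in> nat_gliders G \<and> irreducible_glider G M}\<rparr>"

definition rat_tensor_alg :: "('r, 'b) ring_scheme \<Rightarrow> (rat \<times> 'r \<Rightarrow>\<^sub>0 int) ring" where
  "rat_tensor_alg R = free_alg (UNIV \<times> carrier R) (\<lambda>(p, a) (q, b). (p * q, a \<otimes>\<^bsub>R\<^esub> b)) (1, \<one>\<^bsub>R\<^esub>)"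

definition bilinear_relations :: "('r, 'b) ring_scheme \<Rightarrow> (rat \<times> 'r \<Rightarrow>\<^sub>0 int) set" where
  "bilinear_relations R = generate (add_monoid (rat_tensor_alg R))
     ({frag_of (p + q, a) - frag_of (p, a) - frag_of (q, a) |p q a. a \<in> carrier R} \<union>
      {frag_of (q, a \<oplus>\<^bsub>R\<^esub> b) - frag_of (q, a) - frag_of (q, b) |q a b. a \<in> carrier R \<and> b \<in> carrier R})"

definition rat_tensor :: "('r, 'b) ring_scheme \<Rightarrow> (rat \<times> 'r \<Rightarrow>\<^sub>0 int) set ring" where
  "rat_tensor R = rat_tensor_alg R Quot bilinear_relations R"

definition pure_tensor :: "('r, 'b) ring_scheme \<Rightarrow> rat \<Rightarrow> 'r \<Rightarrow> (rat \<times> 'r \<Rightarrow>\<^sub>0 int) set" where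
  "pure_tensor R q a = bilinear_relations R +>\<^bsub>rat_tensor_alg R\<^esub> frag_of (q, a)"

definition rat_scale ::
  "('r, 'b) ring_scheme \<Rightarrow> rat \<Rightarrow> (rat \<times> 'r \<Rightarrow>\<^sub>0 int) set \<Rightarrow> (rat \<times> 'r \<Rightarrow>\<^sub>0 int) set" where
  "rat_scale R q x = pure_tensor R q \<one>\<^bsub>R\<^esub> \<otimes>\<^bsub>rat_tensor R\<^esub> x"

definition rat_span ::
  "('r, 'b) ring_scheme \<Rightarrow> (rat \<times> 'r \<Rightarrow>\<^sub>0 int) set set \<Rightarrow> (rat \<times> 'r \<Rightarrow>\<^sub>0 int) set set" where
  "rat_span R S = generate (add_monoid (rat_tensor R)) {rat_scale R q x |q x. x \<in> S}"

definition rat_linear ::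
  "('r, 'b) ring_scheme \<Rightarrow> ('s, 'c) ring_scheme
     \<Rightarrow> ((rat \<times> 'r \<Rightarrow>\<^sub>0 int) set \<Rightarrow> (rat \<times> 's \<Rightarrow>\<^sub>0 int) set) \<Rightarrow> bool" where
  "rat_linear R S f \<longleftrightarrow> f \<in> carrier (rat_tensor R) \<rightarrow> carrier (rat_tensor S) \<and>
     (\<forall>x\<in>carrier (rat_tensor R). \<forall>y\<in>carrier (rat_tensor R).
        f (x \<oplus>\<^bsub>rat_tensor R\<^esub> y) = f x \<oplus>\<^bsub>rat_tensor S\<^esub> f y) \<and>
     (\<forall>q. \<forall>x\<in>carrier (rat_tensor R). f (rat_scale R q x) = rat_scale S q (f x))"

type_synonym ('g, 'k) qglider =
  "(rat \<times> (('g, 'k, nat) glider \<Rightarrow>\<^sub>0 int) set set \<Rightarrow>\<^sub>0 int) set"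

definition QGlider :: "('g, 'm) monoid_scheme \<Rightarrow> ('g, 'k::field) qglider ring" where
  "QGlider G = rat_tensor (R1bar G)"

definition qclass ::
  "('g, 'm) monoid_scheme \<Rightarrow> ('g, 'k::field, 'i) glider \<Rightarrow> ('g, 'k) qglider" where
  "qclass G M = pure_tensor (R1bar G) 1 (glider_class G M)"

section \<open>The parametrization of irreducible gliders\<close>

definition Gab :: "('g, 'm) monoid_scheme \<Rightarrow> 'g set monoid" where
  "Gab G = G Mod derived G (carrier G)"

text \<open>
  \<open>T\<close> represents an isomorphism from \<open>G\<^sup>a\<^sup>b\<close> to the group of isomorphism classes of one-dimensional
  \<open>K[G]\<close>-modules under the tensor product.
\<close>

definition ab_param ::
  "('g, 'm) monoid_scheme \<Rightarrow> ('g set \<Rightarrow> ('g, 'k::field, nat) kgmod) \<Rightarrow> bool" where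
  "ab_param G T \<longleftrightarrow>
     (\<forall>z\<in>carrier (Gab G). is_kgmod G (T z) \<and> fv.dim (mod_space (T z)) = 1) \<and>
     (\<forall>V :: ('g, 'k, nat) kgmod. is_kgmod G V \<and> fv.dim (mod_space V) = 1 \<longrightarrow>
        (\<exists>!z. z \<in> carrier (Gab G) \<and> kgmod_iso G V (T z))) \<and>
     (\<forall>z\<in>carrier (Gab G). \<forall>y\<in>carrier (Gab G).
        kgmod_iso G (T (z \<otimes>\<^bsub>Gab G\<^esub> y)) (tensor_kgmod (T z) (T y)))"

definition ab_elt ::
  "('g, 'm) monoid_scheme \<Rightarrow> ('g set \<Rightarrow> ('g, 'k::field, nat) kgmod) \<Rightarrow> ('g, 'k, nat) kgmod \<Rightarrow> 'g set" where
  "ab_elt G T V = (THE z. z \<in> carrier (Gab G) \<and> kgmod_iso G V (T z))"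

definition irr_reps :: "('g, 'm) monoid_scheme \<Rightarrow> ('g, 'k::field, nat) kgmod set \<Rightarrow> bool" where
  "irr_reps G Irr \<longleftrightarrow> (\<forall>U\<in>Irr. irreducible_kgmod G U) \<and>
     (\<forall>V :: ('g, 'k, nat) kgmod. irreducible_kgmod G V \<longrightarrow> (\<exists>!U. U \<in> Irr \<and> kgmod_iso G V U))"

definition Grass :: "nat \<Rightarrow> ('g, 'k::field, 'i) kgmod \<Rightarrow> ('i \<Rightarrow> 'k) set set" where
  "Grass j U = {W. fv.subspace W \<and> W \<subseteq> mod_space U \<and> fv.dim W = j}"

text \<open>A point of the disjoint union of the Grassmannians is a pair \<open>(U, W)\<close> with \<open>W\<close> a subspace of \<open>U\<close>.\<close>

definition SG ::
  "('g, 'k::field, nat) kgmod set \<Rightarrow> (('g, 'k, nat) kgmod \<times> (nat \<Rightarrow> 'k) set) set set" where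
  "SG Irr = {B. B \<subseteq> (SIGMA U:{U\<in>Irr. fv.dim (mod_space U) > 1}.
                       \<Union>j\<in>{1..fv.dim (mod_space U)}. Grass j U) \<and>
               (\<forall>U W W'. (U, W) \<in> B \<and> (U, W') \<in> B \<longrightarrow> W = W')}"

text \<open>The summand \<open>Inl z\<close> is \<open>T\<^sub>z\<close>; the summand \<open>Inr (U, j)\<close>, \<open>j < m\<^sub>U\<close>, is the \<open>j\<close>-th copy of \<open>U\<close>.\<close>

definition param_index ::
  "'g set set \<Rightarrow> (('g, 'k::field, nat) kgmod \<times> (nat \<Rightarrow> 'k) set) set
     \<Rightarrow> ('g set + ('g, 'k, nat) kgmod \<times> nat) set" where
  "param_index A B = Inl ` A \<union> {Inr (U, j) |U W j. (U, W) \<in> B \<and> j < fv.dim W}"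

definition param_module ::
  "('g set \<Rightarrow> ('g, 'k::field, nat) kgmod) \<Rightarrow> 'g set set
     \<Rightarrow> (('g, 'k, nat) kgmod \<times> (nat \<Rightarrow> 'k) set) set
     \<Rightarrow> ('g, 'k, ('g set + ('g, 'k, nat) kgmod \<times> nat) \<times> nat) kgmod" where
  "param_module T A B = dsum_family (param_index A B) (case_sum T fst)"

definition param_vector ::
  "('g set \<Rightarrow> ('g, 'k::field, nat) kgmod) \<Rightarrow> 'g set set
     \<Rightarrow> (('g, 'k, nat) kgmod \<times> (nat \<Rightarrow> 'k) set) set
     \<Rightarrow> (('g set + ('g, 'k, nat) kgmod \<times> nat) \<times> nat \<Rightarrow> 'k) \<Rightarrow> bool" where
  "param_vector T A B v \<longleftrightarrow> v \<in> mod_space (param_module T A B) \<and>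
     (\<forall>z\<in>A. (\<lambda>i. v (Inl z, i)) \<noteq> 0) \<and>
     (\<forall>(U, W)\<in>B. let comp = (\<lambda>j i. v (Inr (U, j), i)) in
        inj_on comp {..<fv.dim W} \<and> fv.independent (comp ` {..<fv.dim W}) \<and>
        fv.span (comp ` {..<fv.dim W}) = W)"

definition param_glider ::
  "('g set \<Rightarrow> ('g, 'k::field, nat) kgmod) \<Rightarrow> 'g set set
     \<Rightarrow> (('g, 'k, nat) kgmod \<times> (nat \<Rightarrow> 'k) set) set
     \<Rightarrow> ('g, 'k, ('g set + ('g, 'k, nat) kgmod \<times> nat) \<times> nat) glider" where
  "param_glider T A B = \<lparr>mod_space = mod_space (param_module T A B),
     mod_act = mod_act (param_module T A B),
     lev_m1 = fv.span {SOME v. param_vector T A B v},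
     lev_0 = mod_space (param_module T A B)\<rparr>"

definition Mcl ::
  "('g, 'm) monoid_scheme \<Rightarrow> ('g set \<Rightarrow> ('g, 'k::field, nat) kgmod) \<Rightarrow> 'g set set
     \<Rightarrow> (('g, 'k, nat) kgmod \<times> (nat \<Rightarrow> 'k) set) set \<Rightarrow> ('g, 'k) qglider" where
  "Mcl G T A B = qclass G (param_glider T A B)"

definition QGab ::
  "('g, 'm) monoid_scheme \<Rightarrow> ('g set \<Rightarrow> ('g, 'k::field, nat) kgmod) \<Rightarrow> ('g, 'k) qglider set" where
  "QGab G T = rat_span (R1bar G) {Mcl G T {z} {} |z. z \<in> carrier (Gab G)}"

definition cyclic_semigroup :: "('a, 'm) monoid_scheme \<Rightarrow> 'a \<Rightarrow> 'a set" where
  "cyclic_semigroup R x = {x [^]\<^bsub>R\<^esub> (n::nat) |n. n \<ge> 1}"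

definition the_idempotent :: "('a, 'm) monoid_scheme \<Rightarrow> 'a \<Rightarrow> 'a" where
  "the_idempotent R x = (THE y. y \<in> cyclic_semigroup R x \<and> y \<otimes>\<^bsub>R\<^esub> y = y)"

definition RG ::
  "('g, 'm) monoid_scheme \<Rightarrow> ('g set \<Rightarrow> ('g, 'k::field, nat) kgmod) \<Rightarrow> ('g, 'k, nat) kgmod set
     \<Rightarrow> ('g, 'k) qglider set" where
  "RG G T Irr = rat_span (R1bar G)
     {Mcl G T A B |A B. A \<subseteq> carrier (Gab G) \<and> B \<in> SG Irr \<and> \<not> (A = {} \<and> B = {}) \<and>
        finite (cyclic_semigroup (QGlider G) (Mcl G T A B)) \<and>
        (\<exists>D\<in>SG Irr. the_idempotent (QGlider G) (Mcl G T A B) = Mcl G T {\<one>\<^bsub>Gab G\<^esub>} D)}"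

section \<open>Induction of gliders\<close>

text \<open>
  \<open>Y\<close> is a model of \<open>K(1 \<otimes> u) \<subseteq> K[G] \<otimes>\<^bsub>K[H]\<^esub> U\<close>, where \<open>M\<close> is \<open>Ku \<subseteq> U\<close>: the map \<open>t\<close> exhibits the module
  underlying \<open>Y\<close> as the quotient of \<open>K[G] \<otimes>\<^sub>K U\<close> by the span of all \<open>xa \<otimes> v - x \<otimes> av\<close> with \<open>a \<in> K[H]\<close>.
\<close>

definition induced_glider ::
  "('g, 'm) monoid_scheme \<Rightarrow> 'g set \<Rightarrow> ('g, 'k::field, 'i) glider \<Rightarrow> ('g, 'k, 'j) glider \<Rightarrow> bool" where
  "induced_glider G H M Y \<longleftrightarrow> is_glider G Y \<and> lev_0 Y = mod_space Y \<and>
     (\<exists>t. lin_on (tens_space (galg G) (lev_0 M)) t \<and>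
          t ` tens_space (galg G) (lev_0 M) = mod_space Y \<and>
          {w \<in> tens_space (galg G) (lev_0 M). t w = 0} =
            fv.span {tens (galg_mult G x a) v - tens x (galg_act (G\<lparr>carrier := H\<rparr>) M a v) |x a v.
                       x \<in> galg G \<and> a \<in> galg (G\<lparr>carrier := H\<rparr>) \<and> v \<in> lev_0 M} \<and>
          (\<forall>y\<in>galg G. \<forall>x\<in>galg G. \<forall>v\<in>lev_0 M.
             t (tens (galg_mult G y x) v) = galg_act G Y y (t (tens x v))) \<and>
          lev_m1 Y = {t (tens (galg_of \<one>\<^bsub>G\<^esub>) u) |u. u \<in> lev_m1 M})"

definition Phi ::
  "('g, 'm) monoid_scheme \<Rightarrow> 'g set \<Rightarrow> ('g, 'k::field) qglider \<Rightarrow> ('g, 'k) qglider" where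
  "Phi G H = (THE f. f \<in> extensional (carrier (QGlider (G\<lparr>carrier := H\<rparr>))) \<and>
     rat_linear (R1bar (G\<lparr>carrier := H\<rparr>)) (R1bar G) f \<and>
     (\<forall>M\<in>nat_gliders (G\<lparr>carrier := H\<rparr>). \<forall>Y\<in>nat_gliders G.
        irreducible_glider (G\<lparr>carrier := H\<rparr>) M \<and> induced_glider G H M Y \<longrightarrow>
        f (qclass (G\<lparr>carrier := H\<rparr>) M) = qclass G Y))"

section \<open>Group theory\<close>

fun lower_central :: "('g, 'm) monoid_scheme \<Rightarrow> nat \<Rightarrow> 'g set" where
  "lower_central G 0 = carrier G"
| "lower_central G (Suc n) = generate G
     (\<Union>x\<in>lower_central G n. \<Union>y\<in>carrier G. {x \<otimes>\<^bsub>G\<^esub> y \<otimes>\<^bsub>G\<^esub> inv\<^bsub>G\<^esub> x \<otimes>\<^bsub>G\<^esub> inv\<^bsub>G\<^esub> y})"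

definition nilpotent_group :: "('g, 'm) monoid_scheme \<Rightarrow> bool" where
  "nilpotent_group G \<longleftrightarrow> (\<exists>n. lower_central G n = {\<one>\<^bsub>G\<^esub>})"

definition maximal_subgroup :: "'g set \<Rightarrow> ('g, 'm) monoid_scheme \<Rightarrow> bool" where
  "maximal_subgroup H G \<longleftrightarrow> subgroup H G \<and> H \<noteq> carrier G \<and>
     (\<forall>L. subgroup L G \<and> H \<subseteq> L \<longrightarrow> L = H \<or> L = carrier G)"

end

theory Submission
 imports Defs
begin

text \<open>
  An irreducible glider \<open>Ku \<subseteq> K[G]u\<close> is determined by the annihilator of \<open>u\<close> in \<open>K[G]\<close>, and the annihilator of
  \<open>u \<otimes> v\<close> is the orthogonal complement of the products of the coordinate functions of \<open>g \<mapsto> gu\<close> and \<open>g \<mapsto> gv\<close>.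
  Hence the functions attached to an idempotent class with a trivial summand form an algebra of functions on \<open>G\<close>
  containing the constants, that is, all functions on the cosets of the stabilizer \<open>H\<close> of \<open>u\<close>. If all other summands
  have dimension greater than \<open>1\<close>, then \<open>H\<close> supplements the derived subgroup. In a nilpotent group this forces
  \<open>H = G\<close>, and a class with such a power is one-dimensional. If \<open>G\<close> is not nilpotent, then some proper \<open>H\<close>
  supplements the derived subgroup, and inducing the trivial glider from \<open>H\<close> gives an idempotent outside the span of
  the one-dimensional classes.
\<close>

section \<open>Linear algebra on function spaces\<close>

text \<open>Two points carry weight beyond this outline. Excluding a class from a rational span
  needs linear independence of the irreducible classes, in a quotient of a free group by
  isomorphisms, direct sums and gliders of length 0. It comes from an additive integer invariant of
  arbitrary gliders: the dimension of the part of the lowest level killed by a given subset of the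
  group algebra, minus that of the span of the parts killed by something more. On an irreducible
  glider this is 1 or 0 according to whether the subset is its annihilator. The supplement statement
  comes from characters: if \<open>H\<close> and the derived subgroup lay in a proper subgroup, some
  nontrivial character would be trivial on it, and its idempotent in the group algebra kills the
  trivial module and every irreducible module of dimension above 1, but not that character.
  Conversely, the existence of a proper supplement in a finite group that is not nilpotent is
  Wielandt's criterion, proved by Frattini's argument. The free groups under the Grothendieck rings
  are not rings, so powers of a class are computed through pointwise products of coordinate
  functions.\<close>

abbreviation flin :: "(('i => 'k::field) => 'j => 'k) => bool" where
 "flin \<equiv> Vector_Spaces.linear fscale fscale"

interpretation fvp: vector_space_pair "fscale :: 'k::field => ('i => 'k) => 'i => 'k"
 "fscale :: 'k::field => ('j => 'k) => 'j => 'k" by unfold_locales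

text \<open>Vectors are functions, and these rules would let the simplifier break vector equations
  into coordinates. Removing them keeps vectors opaque; \<open>fun_apps\<close> opens them where
  coordinates are meant.\<close>

declare plus_fun_apply [simp del] zero_fun_apply [simp del] times_fun_apply [simp del] one_fun_apply [simp del]
 minus_apply [simp del] uminus_apply [simp del]

lemma fscale_apply: "fscale c w i = c * w i"
 by (simp add: fscale_def)

lemmas fun_apps = plus_fun_apply zero_fun_apply times_fun_apply one_fun_apply minus_apply uminus_apply fscale_apply

lemma sum_fun_apply: "(\<Sum>a\<in>A. f a) i = (\<Sum>a\<in>A. f a i)"
 by (induct A rule: infinite_finite_induct) (auto simp: fun_apps)

lemma flinI:
 assumes "!!u v. f (u + v) = f u + f v" "!!c u. f (fscale c u) = fscale c (f u)"
 shows "flin f" by (simp add: Vector_Spaces.linear_iff assms fv.vector_space_axioms)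

lemmas flin_add = fvp.linear_add
 and flin_scale = fvp.linear_scale and flin_diff = fvp.linear_diff and flin_0 = fvp.linear_0
 and flin_sum = fvp.linear_sum

lemma flin_id: "flin (\<lambda>x. x)"
 by (rule flinI) auto

section \<open>Maps that are linear on a subspace\<close>

lemma lin_onI:
 assumes "!!u v. u \<in> V ==> v \<in> V ==> f (u + v) = f u + f v"
  and "!!c u. u \<in> V ==> f (fscale c u) = fscale c (f u)"
 shows "lin_on V f" using assms by (simp add: lin_on_def)

lemma lin_on_add: "lin_on V f ==> u \<in> V ==> v \<in> V ==> f (u + v) = f u + f v"
 by (simp add: lin_on_def)

lemma lin_on_scale: "lin_on V f ==> u \<in> V ==> f (fscale c u) = fscale c (f u)"
 by (simp add: lin_on_def)

lemma flin_lin_on: "flin f ==> lin_on V f"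
 by (auto simp: lin_on_def flin_add flin_scale)

lemma lin_on_subset: "lin_on V f ==> W \<subseteq> V ==> lin_on W f"
 unfolding lin_on_def by blast

text \<open>Module actions are only known to be linear on the module space, whereas facts about
  spans, kernels and bases concern maps that are linear everywhere. Extending from a basis of
  \<open>V\<close> bridges the two, and most \<open>lin_on\<close> facts below are pulled back
  through it.\<close>

lemma lin_on_extend:
 assumes V: "fv.subspace V" and f: "lin_on V f"
 shows "\<exists>F. flin F \<and> (\<forall>v\<in>V. F v = f v)"
proof -
 obtain B where B: "B \<subseteq> V" "fv.independent B" "V \<subseteq> fv.span B"
  using fv.maximal_independent_subset by blast
 obtain F where F: "flin F" "\<forall>x\<in>B. F x = f x" using fvp.linear_independent_extend[OF B(2)] by blast
 have "F v = f v" if "v \<in> V" for v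
 proof -
  have "v \<in> fv.span B" using B that by auto
  hence "v \<in> V \<and> F v = f v"
  proof (induct rule: fv.span_induct_alt)
   case base
   have "f 0 = 0" using lin_on_scale[OF f, of 0 0] fv.subspace_0[OF V] by simp
   thus ?case using fv.subspace_0[OF V] flin_0[OF F(1)] by simp
  next
   case (step c x y)
   have "fscale c x \<in> V" using B step by (auto intro: fv.subspace_scale[OF V])
   thus ?case using step B F(2)
    by (auto simp: flin_add[OF F(1)] flin_scale[OF F(1)] lin_on_add[OF f] lin_on_scale[OF f]
      intro: fv.subspace_add[OF V])
  qed
  thus ?thesis by simp
 qed
 with F(1) show ?thesis by blast
qed

lemma lin_on_0: "lin_on V f ==> 0 \<in> V ==> f 0 = 0"
 using lin_on_scale[of V f 0 0] by simp

lemma lin_on_diff: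
 assumes "fv.subspace V" "lin_on V f" "u \<in> V" "v \<in> V" shows "f (u - v) = f u - f v"
 proof -
 obtain F where F: "flin F" "!!v. v \<in> V ==> F v = f v" using lin_on_extend[OF assms(1,2)] by blast
 have "u - v \<in> V" using assms by (simp add: fv.subspace_diff)
 thus ?thesis using F(2) assms(3,4) flin_diff[OF F(1), of u v] by simp
qed

lemma lin_on_sum:
 assumes V: "fv.subspace V" "lin_on V f" "!!a. a \<in> A ==> u a \<in> V"
 shows "f (\<Sum>a\<in>A. u a) = (\<Sum>a\<in>A. f (u a))"
proof -
 obtain F where F: "flin F" "!!v. v \<in> V ==> F v = f v" using lin_on_extend[OF assms(1,2)] by blast
 have "f (\<Sum>a\<in>A. u a) = F (\<Sum>a\<in>A. u a)" using F(2)[of "\<Sum>a\<in>A. u a"] fv.subspace_sum[OF V(1), of A u] V(3) by simp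
 also have "\<dots> = (\<Sum>a\<in>A. f (u a))" using F V by (simp add: flin_sum)
 finally show ?thesis .
qed

lemma lin_on_comp:
 "lin_on V f ==> f ` V \<subseteq> W ==> lin_on W g ==> lin_on V (\<lambda>x. g (f x))"
 unfolding lin_on_def by (simp add: image_subset_iff)

lemma lin_on_eq_span:
 assumes "lin_on (fv.span S) f" "lin_on (fv.span S) g" "!!s. s \<in> S ==> f s = g s" "v \<in> fv.span S"
 shows "f v = g v"
proof -
 obtain F G where FG: "flin F" "!!v. v \<in> fv.span S ==> F v = f v" "flin G" "!!v. v \<in> fv.span S ==> G v = g v"
  using lin_on_extend[OF fv.subspace_span assms(1)] lin_on_extend[OF fv.subspace_span assms(2)] by blast
 hence "F v = G v" using fvp.linear_eq_on[of F G v S] assms(3,4) by (simp add: fv.span_base)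
 thus ?thesis using FG assms(4) by simp
qed

lemma lin_on_image_span:
 assumes "lin_on (fv.span S) f"
 shows "f ` fv.span S = fv.span (f ` S)"
proof -
 obtain F where F: "flin F" "!!v. v \<in> fv.span S ==> F v = f v"
  using lin_on_extend[OF fv.subspace_span assms] by blast
 have "f ` fv.span S = F ` fv.span S" "f ` S = F ` S" using F by (auto simp: fv.span_base)
 thus ?thesis using fvp.linear_span_image[OF F(1), of S] by metis
qed

lemma lin_on_image_subspace:
 assumes "fv.subspace V" "lin_on V f" shows "fv.subspace (f ` V)"
 using lin_on_image_span[of V f] assms by (metis fv.span_eq_iff fv.subspace_span)

lemma lin_on_kernel:
 assumes "fv.subspace V" "lin_on V f" shows "fv.subspace {v \<in> V. f v = 0}"
proof -
 obtain F where F: "flin F" "!!v. v \<in> V ==> F v = f v" using lin_on_extend[OF assms] by blast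
 have "{v \<in> V. f v = 0} = V \<inter> {v. F v = 0}" using F by auto
 thus ?thesis using fvp.linear_subspace_kernel[OF F(1)] assms(1) fv.subspace_inter by metis
qed

lemma lin_on_inj_iff:
 assumes "fv.subspace V" "lin_on V f"
 shows "inj_on f V \<longleftrightarrow> (\<forall>v\<in>V. f v = 0 --> v = 0)"
proof
 assume "inj_on f V" thus "\<forall>v\<in>V. f v = 0 --> v = 0"
  using lin_on_0[OF assms(2)] fv.subspace_0[OF assms(1)] unfolding inj_on_def by metis
next
 assume *: "\<forall>v\<in>V. f v = 0 --> v = 0"
 show "inj_on f V"
 proof (rule inj_onI)
  fix u v assume "u \<in> V" "v \<in> V" "f u = f v"
  hence "f (u - v) = 0" "u - v \<in> V" using assms by (simp_all add: lin_on_diff fv.subspace_diff)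
  thus "u = v" using * by fastforce
 qed
qed

lemma lin_on_left_inverse:
 assumes V: "fv.subspace V" and f: "lin_on V f" and inj: "inj_on f V"
 obtains g where "flin g" "range g \<subseteq> V" "!!v. v \<in> V ==> g (f v) = v"
proof -
 obtain F where F: "flin F" "!!v. v \<in> V ==> F v = f v" using lin_on_extend[OF V f] by blast
 have "inj_on F V" using inj F(2) by (auto simp: inj_on_def)
 from fvp.linear_exists_left_inverse_on[OF F(1) V this] F(2) that show thesis by metis
qed

lemma exists_projection:
 fixes W :: "('i => 'k::field) set"
 assumes "fv.subspace W"
 obtains p where "flin p" "range p \<subseteq> W" "!!v. v \<in> W ==> p v = v"
 using lin_on_left_inverse[OF assms flin_lin_on[OF flin_id]] by (metis inj_on_id2)

subsection \<open>Finite dimension\<close>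

lemma fin_dim_span: "finite S ==> fin_dim (fv.span S)"
 by (auto simp: fin_dim_def)

lemma fin_dim_subspace: "fin_dim V ==> fv.subspace V"
 by (auto simp: fin_dim_def)

lemma fin_dim_basis:
 assumes "fin_dim V" "fv.subspace W" "W \<subseteq> V"
 obtains B where "finite B" "fv.independent B" "fv.span B = W" "card B = fv.dim W" "B \<subseteq> W"
proof -
 obtain S where S: "finite S" "V = fv.span S" using assms by (auto simp: fin_dim_def)
 obtain B where B: "B \<subseteq> W" "fv.independent B" "W \<subseteq> fv.span B" "card B = fv.dim W"
  using fv.basis_exists by blast
 have "finite B" using fv.independent_span_bound[OF S(1) B(2)] B(1) S(2) assms(3) by auto
 moreover have "fv.span B = W" using B assms(2) by (simp add: fv.span_subspace)
 ultimately show thesis using B that by blast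
qed

lemma fin_dim_basis_ex:
 assumes "fin_dim V"
 shows "\<exists>B. finite B \<and> fv.independent B \<and> fv.span B = V \<and> card B = fv.dim V"
 by (rule fin_dim_basis[OF assms fin_dim_subspace[OF assms] subset_refl]) blast

lemma fin_dim_mono: "fin_dim V ==> fv.subspace W ==> W \<subseteq> V ==> fin_dim W"
 by (metis fin_dim_basis fin_dim_span)

lemma fin_dim_image: "fin_dim V ==> lin_on V f ==> fin_dim (f ` V)"
 unfolding fin_dim_def using lin_on_image_span by blast

lemma dim_mono_fin:
 assumes "fin_dim V" "fv.subspace W" "W \<subseteq> V" shows "fv.dim W \<le> fv.dim V"
proof -
 obtain C where C: "finite C" "fv.independent C" "fv.span C = V" "card C = fv.dim V"
  using fin_dim_basis_ex[OF assms(1)] by blast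
 thus ?thesis using fv.dim_le_card[of W C] assms by simp
qed

lemma dim_eq_imp_eq:
 assumes V: "fin_dim V" and W: "fv.subspace W" "W \<subseteq> V" and d: "fv.dim V \<le> fv.dim W"
 shows "W = V"
proof (rule ccontr)
 assume "W ~= V"
 then obtain v where v: "v \<in> V" "v \<notin> W" using W by auto
 obtain B where B: "finite B" "fv.independent B" "fv.span B = W" "card B = fv.dim W" "B \<subseteq> W"
  by (rule fin_dim_basis[OF V W])
 obtain C where C: "finite C" "fv.independent C" "fv.span C = V" "card C = fv.dim V"
  using fin_dim_basis_ex[OF V] by blast
 have "fv.independent (insert v B)" using v B by (simp add: fv.independent_insert)
 moreover have "insert v B \<subseteq> fv.span C" using C v B W by auto
 ultimately have "card (insert v B) \<le> card C" using fv.independent_span_bound[OF C(1)] by blast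
 moreover have "v \<notin> B" using v B by auto
 ultimately show False using B C d by simp
qed

lemma dim_psubset_fin:
 assumes "fin_dim V" "fv.subspace W" "W \<subset> V" shows "fv.dim W < fv.dim V"
 using dim_eq_imp_eq[of V W] dim_mono_fin[of V W] assms by force

lemma dim_image_inj:
 assumes V: "fv.subspace V" and f: "lin_on V f" and inj: "inj_on f V"
 shows "fv.dim (f ` V) = fv.dim V"
proof -
 obtain F where F: "flin F" "!!v. v \<in> V ==> F v = f v" using lin_on_extend[OF V f] by blast
 obtain B where B: "B \<subseteq> V" "fv.independent B" "V \<subseteq> fv.span B" "card B = fv.dim V"
  using fv.basis_exists by blast
 have sp: "fv.span B = V" using B V by (simp add: fv.span_subspace)
 have iF: "inj_on F V" using inj F(2) by (auto simp: inj_on_def)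
 have "fv.independent (F ` B)" using fvp.linear_independent_injective_image[OF F(1) B(2)] sp iF by simp
 moreover have "F ` V = f ` V" using F(2) by (rule image_cong[OF refl])
 hence "fv.span (F ` B) = f ` V" using fvp.linear_span_image[OF F(1), of B] sp by simp
 ultimately have "fv.dim (f ` V) = card (F ` B)" by (metis fv.dim_span_eq_card_independent)
 thus ?thesis using B iF by (metis card_image inj_on_subset)
qed

lemma dim_zero: "fv.dim {0} = 0"
 by (metis fv.dim_eq_card_independent fv.dim_span fv.independent_empty fv.span_empty card.empty)

lemma dim_line:
 assumes "v ~= 0" shows "fv.dim (fv.span {v}) = 1"
 by (metis assms card_1_singleton_iff fv.dependent_single fv.dim_span_eq_card_independent One_nat_def)

lemma dim_1_line:
 assumes "fv.subspace V" "fv.dim V = 1" "v \<in> V" "v ~= 0"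
 shows "V = fv.span {v}"
proof -
 obtain B where B: "B \<subseteq> V" "fv.independent B" "V \<subseteq> fv.span B" "card B = 1"
  using fv.basis_exists[of V] assms by metis
 hence f: "fin_dim V" using assms(1) by (metis fin_dim_span card_1_singletonE finite.simps fv.span_subspace)
 have "fv.span {v} = V" using dim_eq_imp_eq[OF f fv.subspace_span] dim_line[OF assms(4)] assms
  by (simp add: fv.span_minimal)
 thus ?thesis by simp
qed

lemma dim_pos_fin_dim:
 assumes "fv.subspace V" "fv.dim V > 0" shows "fin_dim V"
proof -
 obtain B where B: "B \<subseteq> V" "fv.independent B" "V \<subseteq> fv.span B" "card B = fv.dim V"
  using fv.basis_exists[of V] by metis
 hence "finite B" "fv.span B = V" using assms card_ge_0_finite[of B] fv.span_subspace[of B V] by auto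
 thus ?thesis using fin_dim_span by blast
qed

lemma dim_pos_nonzero: "fv.dim V > 0 ==> \<exists>v\<in>V. v ~= 0"
 by (metis card_0_eq card_gt_0_iff dim_zero fv.basis_exists fv.dependent_zero subsetD ex_in_conv less_not_refl)

lemma dim_0_fin: "fin_dim V ==> fv.dim V = 0 ==> V = {0}"
 by (metis dim_zero dim_eq_imp_eq fin_dim_subspace fv.subspace_0 fv.subspace_single_0
   order_refl empty_subsetI insert_subset)

text \<open>Enumerate a basis by an initial segment of the naturals and read off coefficients,
  padded by 0. This is how finite-dimensional objects obtain copies with index type
  \<open>nat\<close>.\<close>

lemma exists_coordinates:
 fixes V :: "('i => 'k::field) set"
 assumes "fin_dim V"
 obtains F :: "('i => 'k) => nat => 'k" where "flin F" "inj_on F V"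
proof -
 have V: "fv.subspace V" using assms fin_dim_subspace by blast
 obtain B where B: "finite B" "fv.independent B" "fv.span B = V" using fin_dim_basis_ex[OF assms] by blast
 obtain b where b: "bij_betw b {..<card B} B" using B(1) by (metis bij_betw_from_nat_into_finite)
 define F where "F v = (\<lambda>n::nat. if n < card B then fv.representation B v (b n) else 0)" for v
 have lin: "lin_on V F" by (rule lin_onI) (auto simp: F_def fun_eq_iff fun_apps fv.representation_add[OF B(2)]
    fv.representation_scale[OF B(2)] B(3))
 have inj: "inj_on F V" unfolding lin_on_inj_iff[OF V lin]
 proof (intro ballI impI)
  fix v assume v: "v \<in> V" "F v = 0"
  have "fv.representation B v x = 0" if "x \<in> B" for x
  proof -
   have "x \<in> b ` {..<card B}" using b that by (simp add: bij_betw_def)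
   then obtain n where "n < card B" "x = b n" by blast
   moreover have "F v n = 0" using v(2) by (simp add: zero_fun_apply)
   ultimately show ?thesis by (simp add: F_def)
  qed
  hence "(\<Sum>x\<in>B. fscale (fv.representation B v x) x) = 0" by (simp add: sum.neutral)
  thus "v = 0" using fv.sum_representation_eq[OF B(2), of v B] B v(1) by simp
 qed
 obtain F' where F': "flin F'" "!!v. v \<in> V ==> F' v = F v" using lin_on_extend[OF V lin] by blast
 hence "inj_on F' V" using inj by (auto simp: inj_on_def)
 with F'(1) that show thesis by blast
qed

subsection \<open>Direct sums\<close>

lemma dsum_spaceI: "u \<in> U ==> v \<in> V ==> case_sum u v \<in> dsum_space U V"
 by (auto simp: dsum_space_def)

lemma dsum_spaceD:
 assumes "w \<in> dsum_space U V"
 shows "w \<circ> Inl \<in> U" "w \<circ> Inr \<in> V" using assms by (auto simp: dsum_space_def comp_def)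

lemma dsum_space_iff: "w \<in> dsum_space U V \<longleftrightarrow> w \<circ> Inl \<in> U \<and> w \<circ> Inr \<in> V"
 by (auto simp: dsum_space_def comp_def) (metis (mono_tags, lifting) surjective_sum)

lemma comp_Inl_lin: "(u + v) \<circ> h = (u \<circ> h) + (v \<circ> h)" "fscale c u \<circ> h = fscale c (u \<circ> h)" "0 \<circ> h = 0"
 for u :: "'a => 'k::field" by (auto simp: fun_eq_iff fun_apps)

lemma dsum_subspace: "fv.subspace U ==> fv.subspace V ==> fv.subspace (dsum_space U V)"
 by (auto simp: fv.subspace_def dsum_space_iff comp_Inl_lin)

lemma case_sum_lin:
 "case_sum (u + u') (v + v') = case_sum u v + case_sum u' v'"
 "case_sum (fscale c u) (fscale c v) = fscale c (case_sum u v)" "case_sum 0 0 = 0"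
 by (auto simp: fun_eq_iff fun_apps split: sum.split)

lemma flin_injections: "flin (\<lambda>u. case_sum u 0)" "flin (\<lambda>v. case_sum 0 v)"
 by (auto intro!: flinI simp: fun_eq_iff fun_apps split: sum.split)

lemma dsum_span:
 assumes U: "0 \<in> A" and V: "0 \<in> B"
 shows "dsum_space (fv.span A) (fv.span B) = fv.span (dsum_space A B)"
proof
 show "fv.span (dsum_space A B) \<subseteq> dsum_space (fv.span A) (fv.span B)"
  by (rule fv.span_minimal) (auto simp: dsum_space_iff fv.span_base intro!: dsum_subspace)
 show "dsum_space (fv.span A) (fv.span B) \<subseteq> fv.span (dsum_space A B)"
 proof
  fix w assume "w \<in> dsum_space (fv.span A) (fv.span B)"
  then obtain u v where w: "w = case_sum u v" "u \<in> fv.span A" "v \<in> fv.span B" by (auto simp: dsum_space_def)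
  have "case_sum u 0 \<in> fv.span ((\<lambda>u. case_sum u 0) ` A)"
   unfolding fvp.linear_span_image[OF flin_injections(1)] using w by auto
  moreover have "(\<lambda>u. case_sum u 0) ` A \<subseteq> dsum_space A B" using V by (auto intro: dsum_spaceI)
  ultimately have 1: "case_sum u 0 \<in> fv.span (dsum_space A B)" using fv.span_mono by blast
  have "case_sum 0 v \<in> fv.span ((\<lambda>u. case_sum 0 u) ` B)"
   unfolding fvp.linear_span_image[OF flin_injections(2)] using w by auto
  moreover have "(\<lambda>u. case_sum 0 u) ` B \<subseteq> dsum_space A B" using U by (auto intro: dsum_spaceI)
  ultimately have 2: "case_sum 0 v \<in> fv.span (dsum_space A B)" using fv.span_mono by blast
  have "w = case_sum u 0 + case_sum 0 v" using w by (auto simp: fun_eq_iff fun_apps split: sum.split)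
  thus "w \<in> fv.span (dsum_space A B)" using 1 2 fv.span_add by simp
 qed
qed

lemma fin_dim_dsum:
 assumes "fin_dim U" "fin_dim V" shows "fin_dim (dsum_space U V)"
proof -
 obtain S T where S: "finite S" "U = fv.span S" "finite T" "V = fv.span T" using assms by (auto simp: fin_dim_def)
 have "dsum_space U V = fv.span (dsum_space (insert 0 S) (insert 0 T))"
  using dsum_span[of "insert 0 S" "insert 0 T"] S by simp
 moreover have "dsum_space (insert 0 S) (insert 0 T) = (\<lambda>(u, v). case_sum u v) ` (insert 0 S \<times> insert 0 T)"
  by (auto simp: dsum_space_def)
 ultimately show ?thesis using S by (simp add: fin_dim_span)
qed

text \<open>The embedded bases of the two summands are disjoint, since neither contains 0, and
  together they form a basis. Additivity of glider multiplicities rests on this.\<close>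

lemma dim_dsum:
 fixes U :: "('a => 'c::field) set" and V :: "('b => 'c) set"
 assumes U: "fin_dim U" and V: "fin_dim V"
 shows "fv.dim (dsum_space U V) = fv.dim U + fv.dim V"
proof -
 obtain B where B: "finite B" "fv.independent B" "fv.span B = U" "card B = fv.dim U"
  using fin_dim_basis_ex[OF U] by blast
 obtain C where C: "finite C" "fv.independent C" "fv.span C = V" "card C = fv.dim V"
  using fin_dim_basis_ex[OF V] by blast
 let ?l = "\<lambda>u::'a => 'c. case_sum u (0::'b => 'c)" and ?r = "\<lambda>v::'b => 'c. case_sum (0::'a => 'c) v"
 have il: "inj ?l" "inj ?r" by (auto simp: inj_def fun_eq_iff fun_apps split: sum.split_asm)
 have fl: "flin ?l" "flin ?r" by (rule flin_injections)+
 have disj: "?l ` B \<inter> ?r ` C = {}"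
 proof -
  have "0 \<notin> B" "0 \<notin> C" using B C fv.dependent_zero by blast+
  moreover have "b = 0" if "?l b = ?r c" for b c
   using that by (auto simp: fun_eq_iff fun_apps dest: spec[of _ "Inl x" for x])
  ultimately show ?thesis by auto
 qed
 have ind: "fv.independent (?l ` B \<union> ?r ` C)"
 proof -
  have fin: "finite (?l ` B \<union> ?r ` C)" using B C by auto
  show ?thesis unfolding fv.dependent_finite[OF fin]
  proof (clarify)
   fix a x assume s: "(\<Sum>v\<in>?l ` B \<union> ?r ` C. fscale (a v) v) = 0" and x: "x \<in> ?l ` B \<union> ?r ` C" "a x ~= 0"
   have "(\<Sum>v\<in>?l ` B. fscale (a v) v) + (\<Sum>v\<in>?r ` C. fscale (a v) v) = 0"
    using s B C disj by (simp add: sum.union_disjoint)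
   hence "(\<Sum>b\<in>B. fscale (a (?l b)) (?l b)) + (\<Sum>c\<in>C. fscale (a (?r c)) (?r c)) = 0"
    using il by (simp add: sum.reindex inj_on_subset[OF il(1)] inj_on_subset[OF il(2)])
   hence e: "(\<Sum>b\<in>B. a (?l b) * ?l b i) + (\<Sum>c\<in>C. a (?r c) * ?r c i) = 0" for i
    by (auto simp: fun_eq_iff fun_apps sum_fun_apply)
   have 1: "(\<Sum>b\<in>B. fscale (a (?l b)) b) = 0"
    using e[of "Inl _"] by (auto simp: fun_eq_iff fun_apps sum_fun_apply)
   have 2: "(\<Sum>c\<in>C. fscale (a (?r c)) c) = 0"
    using e[of "Inr _"] by (auto simp: fun_eq_iff fun_apps sum_fun_apply)
   have 3: "\<forall>b\<in>B. a (?l b) = 0"  by (rule ballI, rule fv.independentD[OF B(2,1) subset_refl 1])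
   have 4: "\<forall>c\<in>C. a (?r c) = 0"  by (rule ballI, rule fv.independentD[OF C(2,1) subset_refl 2])
   show False using 3 4 x by auto
  qed
 qed
 have sp: "fv.span (?l ` B \<union> ?r ` C) = dsum_space U V"
 proof
  have U0: "0 \<in> U" "0 \<in> V" using fin_dim_subspace[OF U] fin_dim_subspace[OF V] fv.subspace_0 by blast+
  show "fv.span (?l ` B \<union> ?r ` C) \<subseteq> dsum_space U V"
   using B C U0 fin_dim_subspace[OF U] fin_dim_subspace[OF V]
   by (intro fv.span_minimal dsum_subspace) (auto intro!: dsum_spaceI simp: fv.span_base)
  have 1: "?l ` U \<subseteq> fv.span (?l ` B \<union> ?r ` C)" using fvp.linear_span_image[OF fl(1), of B] B(3)
   by (intro ord_eq_le_trans[OF _ fv.span_mono[OF Un_upper1]]) simp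
  have 2: "?r ` V \<subseteq> fv.span (?l ` B \<union> ?r ` C)" using fvp.linear_span_image[OF fl(2), of C] C(3)
   by (intro ord_eq_le_trans[OF _ fv.span_mono[OF Un_upper2]]) simp
  show "dsum_space U V \<subseteq> fv.span (?l ` B \<union> ?r ` C)"
  proof
   fix w assume "w \<in> dsum_space U V"
   then obtain u v where w: "w = case_sum u v" "u \<in> U" "v \<in> V" by (auto simp: dsum_space_def)
   have "w = case_sum u 0 + case_sum 0 v" using w by (auto simp: fun_eq_iff fun_apps split: sum.split)
   moreover have "?l u \<in> fv.span (?l ` B \<union> ?r ` C)" "?r v \<in> fv.span (?l ` B \<union> ?r ` C)" using 1 2 w by blast+
   ultimately show "w \<in> fv.span (?l ` B \<union> ?r ` C)" by (simp add: fv.span_add)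
  qed
 qed
 have "fv.dim (dsum_space U V) = card (?l ` B \<union> ?r ` C)"
  using fv.dim_span_eq_card_independent[OF ind] sp by simp
 also have "\<dots> = card B + card C"
  using B C disj by (simp add: card_Un_disjoint card_image inj_on_subset[OF il(1)] inj_on_subset[OF il(2)])
 finally show ?thesis using B C by simp
qed

subsection \<open>Tensor products\<close>

lemma tens_apply [simp]: "tens u v (i, j) = u i * v j"
 by (simp add: tens_def)

lemma tens_lin:
 "tens (u + u') v = tens u v + tens u' v" "tens u (v + v') = tens u v + tens u v'"
 "tens (fscale c u) v = fscale c (tens u v)" "tens u (fscale c v) = fscale c (tens u v)"
 "tens 0 v = 0" "tens u 0 = 0" by (auto simp: fun_eq_iff fun_apps algebra_simps)

lemma tens_sum: "tens (\<Sum>a\<in>A. u a) v = (\<Sum>a\<in>A. tens (u a) v)" "tens w (\<Sum>a\<in>A. u' a) = (\<Sum>a\<in>A. tens w (u' a))"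
 by (auto simp: fun_eq_iff fun_apps sum_fun_apply sum_distrib_left sum_distrib_right)

lemma tens_nonzero:
 fixes u :: "'a => 'k::field"
 assumes "u ~= 0" "v ~= 0" shows "tens u v ~= 0"
proof -
 obtain i j where "u i ~= 0" "v j ~= 0" using assms by (auto simp: fun_eq_iff fun_apps)
 hence "tens u v (i, j) ~= 0" by simp
 thus ?thesis by (metis zero_fun_apply)
qed

lemma flin_tens: "flin (\<lambda>u. tens u v)" "flin (\<lambda>v. tens u v)"
 by (auto intro!: flinI simp: tens_lin)

lemma tens_in_space: "u \<in> U ==> v \<in> V ==> tens u v \<in> tens_space U V"
 unfolding tens_space_def by (rule fv.span_base) auto

lemma tens_subspace: "fv.subspace (tens_space U V)"
 by (simp add: tens_space_def)

lemma tens_space_mono: "U \<subseteq> U' ==> V \<subseteq> V' ==> tens_space U V \<subseteq> tens_space U' V'"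
 unfolding tens_space_def by (rule fv.span_mono) auto

lemma tens_space_span:
 "tens_space (fv.span A) (fv.span B) = fv.span {tens u v |u v. u \<in> A \<and> v \<in> B}" (is "_ = ?R")
proof
 have 1: "tens u v \<in> ?R" if "u \<in> fv.span A" "v \<in> B" for u v
 proof -
  have "(\<lambda>u. tens u v) ` fv.span A = fv.span ((\<lambda>u. tens u v) ` A)"
   by (simp add: fvp.linear_span_image[OF flin_tens(1)])
  also have "\<dots> \<subseteq> ?R" using that by (intro fv.span_mono) auto
  finally show ?thesis using that by auto
 qed
 have 2: "tens u v \<in> ?R" if "u \<in> fv.span A" "v \<in> fv.span B" for u v
 proof -
  have "(\<lambda>v. tens u v) ` fv.span B = fv.span ((\<lambda>v. tens u v) ` B)"
   by (simp add: fvp.linear_span_image[OF flin_tens(2)])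
  also have "\<dots> \<subseteq> ?R" using that 1 by (intro fv.span_minimal) auto
  finally show ?thesis using that by auto
 qed
 show "tens_space (fv.span A) (fv.span B) \<subseteq> ?R"
  unfolding tens_space_def using 2 by (intro fv.span_minimal) auto
 show "?R \<subseteq> tens_space (fv.span A) (fv.span B)"
  unfolding tens_space_def by (rule fv.span_mono) (blast intro: fv.span_base)
qed

lemma fin_dim_tens:
 assumes "fin_dim U" "fin_dim V" shows "fin_dim (tens_space U V)"
proof -
 obtain S T where S: "finite S" "U = fv.span S" "finite T" "V = fv.span T" using assms by (auto simp: fin_dim_def)
 have "{tens u v |u v. u \<in> S \<and> v \<in> T} = (\<lambda>(u, v). tens u v) ` (S \<times> T)" by auto
 hence "finite {tens u v |u v. u \<in> S \<and> v \<in> T}" using S by simp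
 thus ?thesis unfolding S tens_space_span by (rule fin_dim_span)
qed

text \<open>There is no scaling case: a multiple of \<open>tens u v\<close> is again a pure tensor,
  because the scalar moves into the first factor.\<close>

lemma tens_space_induct [consumes 3, case_names zero add tens]:
 assumes "w \<in> tens_space U V" "fv.subspace U" "fv.subspace V"
  and "P 0" "!!w w'. w \<in> tens_space U V ==> w' \<in> tens_space U V ==> P w ==> P w' ==> P (w + w')"
  and "!!u v. u \<in> U ==> v \<in> V ==> P (tens u v)"
 shows "P w"
proof -
 have "w \<in> tens_space U V \<and> P w" using assms(1) unfolding tens_space_def
 proof (induct rule: fv.span_induct_alt)
  case base thus ?case using assms(4) by (simp add: fv.span_zero)
 next
  case (step c x y)
  then obtain u v where x: "x = tens u v" "u \<in> U" "v \<in> V" by auto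
  have "fscale c x = tens (fscale c u) v" "fscale c u \<in> U"
   using x assms(2) by (simp_all add: tens_lin fv.subspace_scale)
  hence "P (fscale c x)" "fscale c x \<in> tens_space U V" using x assms(6) tens_in_space by metis+
  thus ?case using step assms(5) by (auto simp: tens_space_def fv.span_add)
 qed
 thus ?thesis by simp
qed

text \<open>The definitions \<^const>\<open>tens_map\<close> and \<^const>\<open>dsum_map\<close> for maps between different index types.\<close>

definition tmap ::
 "(('i => 'k::field) => 'i2 => 'k) => (('j => 'k) => 'j2 => 'k) => ('i \<times> 'j => 'k) => 'i2 \<times> 'j2 => 'k" where
 "tmap f f' w = (\<lambda>(i, j). f' (\<lambda>j'. f (\<lambda>i'. w (i', j')) i) j)"

lemma tens_map_eq_tmap: "tens_map f f' = tmap f f'"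
 by (simp add: fun_eq_iff tens_map_def tmap_def)

definition dmap ::
 "(('i => 'k) => 'i2 => 'k) => (('j => 'k) => 'j2 => 'k) => ('i + 'j => 'k) => 'i2 + 'j2 => 'k" where
 "dmap f f' w = case_sum (f (w \<circ> Inl)) (f' (w \<circ> Inr))"

lemma dsum_map_eq_dmap: "dsum_map f f' = dmap f f'"
 by (simp add: fun_eq_iff dsum_map_def dmap_def)

text \<open>\<open>tmap\<close> works on slices, and \<open>f\<close> and \<open>f'\<close> are only
  controlled on \<open>U\<close> and \<open>V\<close>. Membership of the slices has to be known
  before linearity can be applied to them.\<close>

lemma tmap_wf:
 assumes w: "w \<in> tens_space U V" and U: "fv.subspace U" "lin_on U f" and V: "fv.subspace V"
 shows "(\<lambda>i. w (i, j)) \<in> U" "(\<lambda>j. f (\<lambda>i'. w (i', j)) i) \<in> V"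
proof -
 have "(\<forall>j. (\<lambda>i. w (i, j)) \<in> U) \<and> (\<forall>i. (\<lambda>j. f (\<lambda>i'. w (i', j)) i) \<in> V)"
  using w U(1) V
 proof (induct rule: tens_space_induct)
  case zero
  have "(\<lambda>i. 0) \<in> U" using fv.subspace_0[OF U(1)] by (simp add: zero_fun_def)
  moreover have "(\<lambda>i. 0) \<in> V" using fv.subspace_0[OF V(1)] by (simp add: zero_fun_def)
  moreover have "f (\<lambda>i'. 0) = 0" using lin_on_0[OF U(2)] fv.subspace_0[OF U(1)] by (simp add: zero_fun_def)
  ultimately show ?case by (simp add: zero_fun_apply)
 next
  case (add w w')
  have [simp]: "(\<lambda>i. w (i, j) + w' (i, j)) = (\<lambda>i. w (i, j)) + (\<lambda>i. w' (i, j))" for j by (auto simp: fun_eq_iff fun_apps)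
  have [simp]: "(\<lambda>j. f (\<lambda>i'. w (i', j)) i + f (\<lambda>i'. w' (i', j)) i) = (\<lambda>j. f (\<lambda>i'. w (i', j)) i) + (\<lambda>j. f (\<lambda>i'. w' (i', j)) i)" for i
   by (auto simp: fun_eq_iff fun_apps)
  show ?case using add by (simp add: plus_fun_apply lin_on_add[OF U(2)] fv.subspace_add[OF U(1)] fv.subspace_add[OF V(1)])
 next
  case (tens u v)
  have [simp]: "(\<lambda>i. u i * v j) = fscale (v j) u" for j by (auto simp: fun_eq_iff fun_apps)
  have [simp]: "(\<lambda>j. v j * f u i) = fscale (f u i) v" for i by (auto simp: fun_eq_iff fun_apps)
  show ?case using tens by (simp add: fscale_apply[of _ "f u"] lin_on_scale[OF U(2)] fv.subspace_scale[OF U(1)] fv.subspace_scale[OF V(1)])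
 qed
 thus "(\<lambda>i. w (i, j)) \<in> U" "(\<lambda>j. f (\<lambda>i'. w (i', j)) i) \<in> V" by auto
qed

lemma tmap_tens:
 assumes "lin_on U f" "lin_on V f'" "u \<in> U" "v \<in> V"
 shows "tmap f f' (tens u v) = tens (f u) (f' v)"
proof -
 have [simp]: "(\<lambda>i. u i * v j) = fscale (v j) u" for j by (auto simp: fun_eq_iff fun_apps)
 have [simp]: "(\<lambda>j. v j * f u i) = fscale (f u i) v" for i by (auto simp: fun_eq_iff fun_apps)
 show ?thesis using assms by (auto simp: tmap_def fun_eq_iff fun_apps lin_on_scale)
qed

lemma lin_on_tmap:
 assumes U: "fv.subspace U" "lin_on U f" and V: "fv.subspace V" "lin_on V f'"
 shows "lin_on (tens_space U V) (tmap f f')"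
proof (rule lin_onI)
 fix w w' assume w: "w \<in> tens_space U V" "w' \<in> tens_space U V"
 note wf = tmap_wf[OF w(1) U V(1)] tmap_wf[OF w(2) U V(1)]
 have [simp]: "(\<lambda>i. w (i, j) + w' (i, j)) = (\<lambda>i. w (i, j)) + (\<lambda>i. w' (i, j))" for j by (auto simp: fun_eq_iff fun_apps)
 have [simp]: "(\<lambda>j. f (\<lambda>i'. w (i', j)) i + f (\<lambda>i'. w' (i', j)) i) = (\<lambda>j. f (\<lambda>i'. w (i', j)) i) + (\<lambda>j. f (\<lambda>i'. w' (i', j)) i)" for i
  by (auto simp: fun_eq_iff fun_apps)
 show "tmap f f' (w + w') = tmap f f' w + tmap f f' w'"
  using wf by (auto simp: tmap_def fun_eq_iff fun_apps lin_on_add[OF U(2)] lin_on_add[OF V(2)])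
next
 fix c w assume w: "w \<in> tens_space U V"
 note wf = tmap_wf[OF w U V(1)]
 have [simp]: "(\<lambda>i. c * w (i, j)) = fscale c (\<lambda>i. w (i, j))" for j by (auto simp: fun_eq_iff fun_apps)
 have [simp]: "(\<lambda>j. c * f (\<lambda>i'. w (i', j)) i) = fscale c (\<lambda>j. f (\<lambda>i'. w (i', j)) i)" for i
  by (auto simp: fun_eq_iff fun_apps)
 show "tmap f f' (fscale c w) = fscale c (tmap f f' w)"
  using wf by (auto simp: tmap_def fun_eq_iff fun_apps lin_on_scale[OF U(2)] lin_on_scale[OF V(2)])
qed

lemma tmap_image:
 assumes U: "fv.subspace U" "lin_on U f" and V: "fv.subspace V" "lin_on V f'"
 shows "tmap f f' ` tens_space U V = tens_space (f ` U) (f' ` V)"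
proof -
 have "tmap f f' ` {tens u v |u v. u \<in> U \<and> v \<in> V} = {tens u v |u v. u \<in> f ` U \<and> v \<in> f' ` V}"
  using tmap_tens[OF U(2) V(2)] by (force simp: image_def)
 thus ?thesis using lin_on_image_span[OF lin_on_tmap[OF U V, unfolded tens_space_def]] by (simp add: tens_space_def)
qed

lemma lin_on_eq_tens:
 assumes "lin_on (tens_space U V) f" "lin_on (tens_space U V) g" "w \<in> tens_space U V"
  "!!u v. u \<in> U ==> v \<in> V ==> f (tens u v) = g (tens u v)"
 shows "f w = g w" using assms lin_on_eq_span[of "{tens u v |u v. u \<in> U \<and> v \<in> V}" f g w]
 unfolding tens_space_def by auto

section \<open>Modules over group algebras\<close>

locale finite_grp = group G for G (structure) +
 assumes fin_carrier: "finite (carrier G)"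

text \<open>Equivariance is asked for group elements only; \<open>kg_hom_galg_act\<close> recovers
  it for the whole group algebra.\<close>

definition kg_hom ::
 "('g, 'm) monoid_scheme => ('g, 'k::field, 'i, 'y) kgmod_scheme => ('g, 'k, 'j, 'z) kgmod_scheme
   => (('i => 'k) => 'j => 'k) => bool" where
 "kg_hom G V W f \<longleftrightarrow> lin_on (mod_space V) f \<and> f ` mod_space V \<subseteq> mod_space W \<and>
   (\<forall>g\<in>carrier G. \<forall>v\<in>mod_space V. f (mod_act V g v) = mod_act W g (f v))"

definition submod ::
 "('g, 'm) monoid_scheme => ('g, 'k::field, 'i, 'y) kgmod_scheme => ('i => 'k) set => bool" where
 "submod G V W \<longleftrightarrow> fv.subspace W \<and> W \<subseteq> mod_space V \<and> (\<forall>g\<in>carrier G. mod_act V g ` W \<subseteq> W)"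

lemma kgmodD:
 assumes "is_kgmod G V"
 shows "fv.subspace (mod_space V)" "g \<in> carrier G ==> v \<in> mod_space V ==> mod_act V g v \<in> mod_space V"
  "g \<in> carrier G ==> lin_on (mod_space V) (mod_act V g)"
  "v \<in> mod_space V ==> mod_act V \<one>\<^bsub>G\<^esub> v = v"
  "g \<in> carrier G ==> h \<in> carrier G ==> v \<in> mod_space V ==>
    mod_act V (g \<otimes>\<^bsub>G\<^esub> h) v = mod_act V g (mod_act V h v)"
 using assms unfolding is_kgmod_def by auto

lemma kg_homD:
 assumes "kg_hom G V W f"
 shows "lin_on (mod_space V) f" "v \<in> mod_space V ==> f v \<in> mod_space W"
  "g \<in> carrier G ==> v \<in> mod_space V ==> f (mod_act V g v) = mod_act W g (f v)"
 using assms unfolding kg_hom_def by auto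

lemma kg_homI:
 assumes "lin_on (mod_space V) f" "!!v. v \<in> mod_space V ==> f v \<in> mod_space W"
  "!!g v. g \<in> carrier G ==> v \<in> mod_space V ==> f (mod_act V g v) = mod_act W g (f v)"
 shows "kg_hom G V W f" using assms unfolding kg_hom_def by auto

lemma submodD:
 assumes "submod G V W"
 shows "fv.subspace W" "W \<subseteq> mod_space V" "g \<in> carrier G ==> w \<in> W ==> mod_act V g w \<in> W"
 using assms unfolding submod_def by auto

lemma kg_hom_comp:
 assumes f: "kg_hom G U V f" and g: "kg_hom G V W g" shows "kg_hom G U W (\<lambda>x. g (f x))"
proof (rule kg_homI)
 show "lin_on (mod_space U) (\<lambda>x. g (f x))"
  by (rule lin_on_comp[OF kg_homD(1)[OF f] _ kg_homD(1)[OF g]]) (use kg_homD(2)[OF f] in auto)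
qed (simp_all add: kg_homD(2,3)[OF f] kg_homD(2,3)[OF g])

lemma galg_of_galg: "g \<in> carrier G ==> galg_of g \<in> galg G"
 by (auto simp: galg_def galg_of_def)

lemma galg_subspace: "fv.subspace (galg G)"
 by (auto simp: fv.subspace_def galg_def fun_apps)

lemma kg_hom_galg_act:
 assumes V: "is_kgmod G V" and W: "is_kgmod G W" and f: "kg_hom G V W f" and v: "v \<in> mod_space V"
 shows "f (galg_act G V x v) = galg_act G W x (f v)"
proof -
 have "f (galg_act G V x v) = (\<Sum>g\<in>carrier G. f (fscale (x g) (mod_act V g v)))" unfolding galg_act_def
  by (rule lin_on_sum[OF kgmodD(1)[OF V] kg_homD(1)[OF f]])
   (simp add: fv.subspace_scale[OF kgmodD(1)[OF V]] kgmodD(2)[OF V] v)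
 also have "\<dots> = galg_act G W x (f v)" unfolding galg_act_def by (rule sum.cong[OF refl])
   (simp add: lin_on_scale[OF kg_homD(1)[OF f]] kgmodD(2)[OF V] v kg_homD(3)[OF f])
 finally show ?thesis .
qed

lemma kg_hom_kernel:
 assumes V: "is_kgmod G V" and W: "is_kgmod G W" and f: "kg_hom G V W f"
 shows "submod G V {v \<in> mod_space V. f v = 0}" unfolding submod_def
proof (intro conjI ballI)
 show "fv.subspace {v \<in> mod_space V. f v = 0}" by (rule lin_on_kernel[OF kgmodD(1)[OF V] kg_homD(1)[OF f]])
 show "{v \<in> mod_space V. f v = 0} \<subseteq> mod_space V" by auto
 fix g assume g: "g \<in> carrier G"
 have "mod_act W g 0 = 0" by (rule lin_on_0[OF kgmodD(3)[OF W g] fv.subspace_0[OF kgmodD(1)[OF W]]])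
 thus "mod_act V g ` {v \<in> mod_space V. f v = 0} \<subseteq> {v \<in> mod_space V. f v = 0}"
  using g by (auto simp: kgmodD(2)[OF V] kg_homD(3)[OF f])
qed

lemma kg_hom_image:
 assumes V: "is_kgmod G V" and f: "kg_hom G V W f"
 shows "submod G W (f ` mod_space V)" unfolding submod_def
proof (intro conjI ballI)
 show "fv.subspace (f ` mod_space V)" by (rule lin_on_image_subspace[OF kgmodD(1)[OF V] kg_homD(1)[OF f]])
 show "f ` mod_space V \<subseteq> mod_space W" using kg_homD(2)[OF f] by auto
 fix g assume g: "g \<in> carrier G"
 show "mod_act W g ` f ` mod_space V \<subseteq> f ` mod_space V"
 proof clarify
  fix v assume "v \<in> mod_space V"
  hence "mod_act W g (f v) = f (mod_act V g v)" "mod_act V g v \<in> mod_space V"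
   using g by (simp_all add: kg_homD(3)[OF f] kgmodD(2)[OF V])
  thus "mod_act W g (f v) \<in> f ` mod_space V" by blast
 qed
qed

lemma submod_kgmod:
 assumes V: "is_kgmod G V" and W: "submod G V W"
 shows "is_kgmod G \<lparr>mod_space = W, mod_act = mod_act V\<rparr>"
proof -
 have s: "w \<in> W ==> w \<in> mod_space V" for w using submodD(2)[OF W] by auto
 show ?thesis unfolding is_kgmod_def
  using submodD(1,3)[OF W] kgmodD(4,5)[OF V] lin_on_subset[OF kgmodD(3)[OF V] submodD(2)[OF W]] s
  by (auto simp: Pi_def)
qed

lemma irreducible_kgmod_iff:
 "irreducible_kgmod G V \<longleftrightarrow> is_kgmod G V \<and> mod_space V ~= {0} \<and>
   (\<forall>W. submod G V W --> W = {0} \<or> W = mod_space V)" unfolding irreducible_kgmod_def submod_def by auto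

lemma irreducible_hom_inj:
 assumes V: "irreducible_kgmod G V" and W: "is_kgmod G W" and f: "kg_hom G V W f"
  and x: "x \<in> mod_space V" "f x ~= 0"
 shows "inj_on f (mod_space V)"
proof -
 have k: "is_kgmod G V" using V by (simp add: irreducible_kgmod_iff)
 have "{v \<in> mod_space V. f v = 0} = {0}"
  using V kg_hom_kernel[OF k W f] x unfolding irreducible_kgmod_iff by blast
 thus ?thesis unfolding lin_on_inj_iff[OF kgmodD(1)[OF k] kg_homD(1)[OF f]] by blast
qed

lemma kgmod_isoI:
 assumes V: "is_kgmod G V" and W: "is_kgmod G W" and f: "kg_hom G V W f" "bij_betw f (mod_space V) (mod_space W)"
 shows "kgmod_iso G V W" unfolding kgmod_iso_def using f kg_homD(1)[OF f(1)] kg_hom_galg_act[OF V W f(1)] by blast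

lemma kgmod_iso_refl: "is_kgmod G V ==> kgmod_iso G V V"
 by (rule kgmod_isoI[OF _ _ kg_homI[OF flin_lin_on[OF flin_id]]]) (auto simp: bij_betw_def)

text \<open>Schur's lemma: kernel and image are submodules, and irreducibility of both sides leaves
  no choice for a nonzero map.\<close>

lemma irreducible_hom_iso:
 assumes V: "irreducible_kgmod G V" and W: "irreducible_kgmod G W" and f: "kg_hom G V W f"
  and x: "x \<in> mod_space V" "f x ~= 0"
 shows "kgmod_iso G V W"
proof -
 have k: "is_kgmod G V" "is_kgmod G W" using V W by (simp_all add: irreducible_kgmod_iff)
 have "f ` mod_space V = mod_space W" using W kg_hom_image[OF k(1) f] x unfolding irreducible_kgmod_iff by blast
 hence "bij_betw f (mod_space V) (mod_space W)" using irreducible_hom_inj[OF V k(2) f x] by (simp add: bij_betw_def)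
 with kgmod_isoI[OF k f] show ?thesis .
qed

section \<open>The action of the group algebra and generated submodules\<close>

context finite_grp
begin

lemma galg_act_closed:
 assumes "is_kgmod G V" "v \<in> mod_space V" shows "galg_act G V x v \<in> mod_space V" unfolding galg_act_def
 by (intro fv.subspace_sum[OF kgmodD(1)[OF assms(1)]] fv.subspace_scale[OF kgmodD(1)[OF assms(1)]]
   kgmodD(2)[OF assms(1)] assms(2))

lemma galg_act_galg_of:
 assumes "g \<in> carrier G" shows "galg_act G V (galg_of g) v = mod_act V g v"
proof -
 have "galg_act G V (galg_of g) v = (\<Sum>h\<in>carrier G. if h = g then mod_act V h v else 0)"
  unfolding galg_act_def by (rule sum.cong) (auto simp: galg_of_def)
 thus ?thesis using assms fin_carrier by simp
qed

lemma galg_act_lin_left: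
 "galg_act G V (x + y) v = galg_act G V x v + galg_act G V y v"
 "galg_act G V (fscale c x) v = fscale c (galg_act G V x v)"
 "galg_act G V (x - y) v = galg_act G V x v - galg_act G V y v" "galg_act G V 0 v = 0" unfolding galg_act_def
 by (simp_all add: fun_apps fv.scale_left_distrib fv.scale_left_diff_distrib sum.distrib sum_subtractf
   fv.scale_sum_right sum.neutral)

lemma galg_act_lin_on:
 assumes V: "is_kgmod G V" shows "lin_on (mod_space V) (galg_act G V x)"
proof (rule lin_onI)
 fix u v assume "u \<in> mod_space V" "v \<in> mod_space V"
 thus "galg_act G V x (u + v) = galg_act G V x u + galg_act G V x v" unfolding galg_act_def
  by (simp add: lin_on_add[OF kgmodD(3)[OF V]] fv.scale_right_distrib sum.distrib)
next
 fix c u assume "u \<in> mod_space V"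
 thus "galg_act G V x (fscale c u) = fscale c (galg_act G V x u)" unfolding galg_act_def
  by (simp add: lin_on_scale[OF kgmodD(3)[OF V]] fv.scale_sum_right mult.commute)
qed

lemma galg_act_zero: "is_kgmod G V ==> galg_act G V x 0 = 0"
 by (rule lin_on_0[OF galg_act_lin_on fv.subspace_0[OF kgmodD(1)]])

lemma act_inv:
 assumes V: "is_kgmod G V" and g: "g \<in> carrier G" and v: "v \<in> mod_space V"
 shows "mod_act V (inv g) (mod_act V g v) = v" "mod_act V g (mod_act V (inv g) v) = v"
 using kgmodD(5)[OF V inv_closed[OF g] g v] kgmodD(5)[OF V g inv_closed[OF g] v] kgmodD(4)[OF V v] g by simp_all

lemma act_zero: "is_kgmod G V ==> g \<in> carrier G ==> mod_act V g 0 = 0"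
 by (rule lin_on_0[OF kgmodD(3) fv.subspace_0[OF kgmodD(1)]])

lemma galg_span_eq_span:
 shows "galg_span G V S = fv.span {mod_act V g v |g v. g \<in> carrier G \<and> v \<in> S}" (is "_ = ?R")
proof
 show "galg_span G V S \<subseteq> ?R" unfolding galg_span_def
 proof (rule fv.span_minimal)
  show "{galg_act G V x v |x v. x \<in> galg G \<and> v \<in> S} \<subseteq> ?R"
  proof clarify
   fix x v assume v: "v \<in> S"
   show "galg_act G V x v \<in> ?R"
    unfolding galg_act_def by (intro fv.span_sum fv.span_scale fv.span_base) (use v in blast)
  qed
 qed simp
 show "?R \<subseteq> galg_span G V S" unfolding galg_span_def
 proof (rule fv.span_mono, clarify)
  fix g v assume "g \<in> carrier G" "v \<in> S"
  thus "\<exists>x v'. mod_act V g v = galg_act G V x v' \<and> x \<in> galg G \<and> v' \<in> S"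
   using galg_act_galg_of[of g V v] galg_of_galg[of g G] by metis
 qed
qed

lemma galg_span_submod:
 assumes V: "is_kgmod G V" and S: "S \<subseteq> mod_space V"
 shows "submod G V (galg_span G V S)"
proof -
 let ?A = "{mod_act V g v |g v. g \<in> carrier G \<and> v \<in> S}"
 have A: "?A \<subseteq> mod_space V" using kgmodD(2)[OF V] S by blast
 have sub: "fv.span ?A \<subseteq> mod_space V" by (rule fv.span_minimal[OF A kgmodD(1)[OF V]])
 have "mod_act V g ` fv.span ?A \<subseteq> fv.span ?A" if g: "g \<in> carrier G" for g
 proof -
  have "mod_act V g ` fv.span ?A = fv.span (mod_act V g ` ?A)"
   by (rule lin_on_image_span[OF lin_on_subset[OF kgmodD(3)[OF V g] sub]])
  moreover have "mod_act V g ` ?A \<subseteq> ?A"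
  proof clarify
   fix h v assume h: "h \<in> carrier G" "v \<in> S"
   hence "mod_act V g (mod_act V h v) = mod_act V (g \<otimes> h) v" using kgmodD(5)[OF V g h(1), of v] S by auto
   thus "\<exists>g' v'. mod_act V g (mod_act V h v) = mod_act V g' v' \<and> g' \<in> carrier G \<and> v' \<in> S"
    using g h by blast
  qed
  ultimately show ?thesis using fv.span_mono[of "mod_act V g ` ?A" ?A] by simp
 qed
 thus ?thesis unfolding galg_span_eq_span submod_def using sub by blast
qed

lemma galg_span_base:
 assumes V: "is_kgmod G V" and S: "S \<subseteq> mod_space V" shows "S \<subseteq> galg_span G V S"
proof
 fix v assume v: "v \<in> S"
 hence "v = mod_act V \<one> v" using kgmodD(4)[OF V] S by auto
 thus "v \<in> galg_span G V S" unfolding galg_span_eq_span by (intro fv.span_base) (use v in blast)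
qed

lemma galg_span_fin_dim:
 assumes "fin_dim S" "S \<subseteq> mod_space V" "is_kgmod G V" shows "fin_dim (galg_span G V S)"
proof -
 obtain B where B: "finite B" "S = fv.span B" using assms(1) by (auto simp: fin_dim_def)
 have BV: "B \<subseteq> mod_space V" using B assms(2) fv.span_superset by blast
 let ?A = "{mod_act V g v |g v. g \<in> carrier G \<and> v \<in> B}"
 have "?A = (\<lambda>(g, v). mod_act V g v) ` (carrier G \<times> B)" by auto
 hence fin: "finite ?A" using B fin_carrier by simp
 have "galg_span G V S \<subseteq> fv.span ?A" unfolding galg_span_eq_span
 proof (rule fv.span_minimal, clarify)
  fix g v assume g: "g \<in> carrier G" and v: "v \<in> S"
  have sub: "fv.span B \<subseteq> mod_space V" using assms(2) B by simp
  have "mod_act V g ` fv.span B = fv.span (mod_act V g ` B)"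
   by (rule lin_on_image_span[OF lin_on_subset[OF kgmodD(3)[OF assms(3) g] sub]])
  also have "\<dots> \<subseteq> fv.span ?A" by (rule fv.span_mono) (use g in blast)
  finally show "mod_act V g v \<in> fv.span ?A" using v B by blast
 qed simp
 moreover have "fv.subspace (galg_span G V S)" by (simp add: galg_span_def)
 ultimately show ?thesis using fin_dim_mono[OF fin_dim_span[OF fin]] by blast
qed

lemma galg_span_singleton:
 assumes V: "is_kgmod G V" and v: "v \<in> mod_space V"
 shows "galg_span G V {v} = (\<lambda>x. galg_act G V x v) ` galg G"
proof -
 have "fv.subspace ((\<lambda>x. galg_act G V x v) ` galg G)"
  by (intro lin_on_image_subspace galg_subspace lin_onI) (simp_all add: galg_act_lin_left)
 moreover have "{galg_act G V x u |x u. x \<in> galg G \<and> u \<in> {v}} = (\<lambda>x. galg_act G V x v) ` galg G" by auto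
 ultimately show ?thesis unfolding galg_span_def by simp
qed

lemma fin_dim_galg: "fin_dim (galg G :: ('a => 'k::field) set)"
proof -
 have "x \<in> fv.span (galg_of ` carrier G)" if x: "x \<in> galg G" for x :: "'a => 'k"
 proof -
  have "x = (\<Sum>g\<in>carrier G. fscale (x g) (galg_of g))"
  proof
   fix h
   have "(\<Sum>g\<in>carrier G. fscale (x g) (galg_of g)) h = (\<Sum>g\<in>carrier G. if g = h then x g else 0)"
    unfolding sum_fun_apply by (rule sum.cong) (auto simp: fun_apps galg_of_def)
   thus "x h = (\<Sum>g\<in>carrier G. fscale (x g) (galg_of g)) h" using x fin_carrier by (auto simp: galg_def)
  qed
  also have "\<dots> \<in> fv.span (galg_of ` carrier G)" by (intro fv.span_sum fv.span_scale fv.span_base) auto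
  finally show ?thesis .
 qed
 moreover have "fin_dim (fv.span (galg_of ` carrier G :: ('a => 'k) set))" using fin_carrier by (simp add: fin_dim_span)
 ultimately show ?thesis using fin_dim_mono[OF _ galg_subspace] by blast
qed

lemma irreducible_generated:
 assumes "irreducible_kgmod G V" "v \<in> mod_space V" "v ~= 0"
 shows "galg_span G V {v} = mod_space V"
proof -
 have V: "is_kgmod G V" using assms by (simp add: irreducible_kgmod_iff)
 hence "submod G V (galg_span G V {v})" "v \<in> galg_span G V {v}"
  using galg_span_submod[OF V, of "{v}"] galg_span_base[OF V, of "{v}"] assms(2) by auto
 thus ?thesis using assms unfolding irreducible_kgmod_iff by blast
qed

text \<open>Any nonzero vector generates the module, and the orbit of one vector under a finite
  group is finite.\<close>

lemma irreducible_fin_dim: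
 assumes "irreducible_kgmod G V" shows "fin_dim (mod_space V)"
proof -
 have V: "is_kgmod G V" using assms by (simp add: irreducible_kgmod_iff)
 have "0 \<in> mod_space V" "mod_space V ~= {0}" using fv.subspace_0[OF kgmodD(1)[OF V]] assms
  by (simp_all add: irreducible_kgmod_iff)
 then obtain v where v: "v \<in> mod_space V" "v ~= 0" by blast
 have "fin_dim (fv.span {v})" by (simp add: fin_dim_span)
 moreover have "fv.span {v} \<subseteq> mod_space V" using v kgmodD(1)[OF V] by (simp add: fv.span_minimal)
 ultimately have "fin_dim (galg_span G V (fv.span {v}))" using galg_span_fin_dim V by blast
 moreover have "galg_span G V {v} \<subseteq> galg_span G V (fv.span {v})"
  unfolding galg_span_def by (rule fv.span_mono) (blast intro: fv.span_base)
 ultimately show ?thesis unfolding irreducible_generated[OF assms v] by (rule fin_dim_mono[OF _ kgmodD(1)[OF V]])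
qed

section \<open>Isomorphisms and transport of structure\<close>

lemma hom_inverse:
 assumes V: "is_kgmod G V" and f: "kg_hom G V W f" and b: "bij_betw f (mod_space V) (mod_space W)"
 obtains h where "kg_hom G W V h" "bij_betw h (mod_space W) (mod_space V)"
  "!!v. v \<in> mod_space V ==> h (f v) = v" "!!w. w \<in> mod_space W ==> f (h w) = w"
proof -
 have inj: "inj_on f (mod_space V)" and im: "f ` mod_space V = mod_space W" using b by (auto simp: bij_betw_def)
 obtain h where h: "flin h" "!!v. v \<in> mod_space V ==> h (f v) = v"
  by (rule lin_on_left_inverse[OF kgmodD(1)[OF V] kg_homD(1)[OF f] inj]) blast
 have 1: "h w \<in> mod_space V" "f (h w) = w" if "w \<in> mod_space W" for w
  using that h(2) unfolding im[symmetric] by auto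
 have "kg_hom G W V h"
 proof (rule kg_homI[OF flin_lin_on[OF h(1)] 1(1)])
  fix g w assume g: "g \<in> carrier G" and w: "w \<in> mod_space W"
  have "mod_act W g w = f (mod_act V g (h w))" using 1[OF w] g by (simp add: kg_homD(3)[OF f])
  thus "h (mod_act W g w) = mod_act V g (h w)" using h(2)[OF kgmodD(2)[OF V g 1(1)[OF w]]] by simp
 qed
 moreover have "bij_betw h (mod_space W) (mod_space V)"
  by (rule bij_betwI[where g=f]) (use 1 h(2) kg_homD(2)[OF f] in auto)
 ultimately show thesis using that h(2) 1(2) by blast
qed

lemma kgmod_iso_hom:
 assumes V: "is_kgmod G V" and W: "is_kgmod G W"
 shows "kgmod_iso G V W \<longleftrightarrow> (\<exists>f. kg_hom G V W f \<and> bij_betw f (mod_space V) (mod_space W))"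
proof
 assume "kgmod_iso G V W"
 then obtain f where f: "bij_betw f (mod_space V) (mod_space W)" "lin_on (mod_space V) f"
  "!!x v. x \<in> galg G ==> v \<in> mod_space V ==> f (galg_act G V x v) = galg_act G W x (f v)"
  unfolding kgmod_iso_def by blast
 have "kg_hom G V W f"
 proof (rule kg_homI[OF f(2)])
  show "f v \<in> mod_space W" if "v \<in> mod_space V" for v using f(1) that by (auto simp: bij_betw_def)
  show "f (mod_act V g v) = mod_act W g (f v)" if "g \<in> carrier G" "v \<in> mod_space V" for g v
   using f(3)[OF galg_of_galg, of g v] that by (simp add: galg_act_galg_of)
 qed
 thus "\<exists>f. kg_hom G V W f \<and> bij_betw f (mod_space V) (mod_space W)" using f(1) by blast
next
 assume "\<exists>f. kg_hom G V W f \<and> bij_betw f (mod_space V) (mod_space W)"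
 thus "kgmod_iso G V W" using kgmod_isoI[OF V W] by blast
qed

lemma kgmod_iso_sym:
 assumes V: "is_kgmod G V" and W: "is_kgmod G W" and "kgmod_iso G V W" shows "kgmod_iso G W V"
proof -
 obtain f where f: "kg_hom G V W f" "bij_betw f (mod_space V) (mod_space W)"
  using assms(3) kgmod_iso_hom[OF V W] by blast
 obtain h where "kg_hom G W V h" "bij_betw h (mod_space W) (mod_space V)" by (rule hom_inverse[OF V f])
 thus ?thesis using kgmod_iso_hom[OF W V] by blast
qed

lemma kgmod_iso_trans:
 assumes "is_kgmod G U" "is_kgmod G V" "is_kgmod G W" "kgmod_iso G U V" "kgmod_iso G V W"
 shows "kgmod_iso G U W"
proof -
 obtain f where f: "kg_hom G U V f" "bij_betw f (mod_space U) (mod_space V)" using assms kgmod_iso_hom by blast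
 obtain h where h: "kg_hom G V W h" "bij_betw h (mod_space V) (mod_space W)" using assms kgmod_iso_hom by blast
 have "bij_betw (\<lambda>x. h (f x)) (mod_space U) (mod_space W)"
  using bij_betw_trans[OF f(2) h(2)] by (simp add: comp_def)
 thus ?thesis using kgmod_iso_hom[OF assms(1,3)] kg_hom_comp[OF f(1) h(1)] by blast
qed

lemma kgmod_iso_dim:
 assumes "is_kgmod G V" "kgmod_iso G V W" shows "fv.dim (mod_space W) = fv.dim (mod_space V)"
proof -
 obtain f where f: "bij_betw f (mod_space V) (mod_space W)" "lin_on (mod_space V) f"
  using assms(2) unfolding kgmod_iso_def by blast
 thus ?thesis using dim_image_inj[OF kgmodD(1)[OF assms(1)] f(2)] by (simp add: bij_betw_def)
qed

text \<open>Transport of structure along an injective linear map: the action on the image is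
  conjugated by \<open>F\<close> and its partial inverse \<open>h\<close>. With \<open>F\<close> a
  coordinate map this produces modules with index type \<open>nat\<close>.\<close>

lemma transport_kgmod:
 assumes V: "is_kgmod G V" and F: "flin F" and inj: "inj_on F (mod_space V)"
  and h: "!!v. v \<in> mod_space V ==> h (F v) = v"
 defines "W \<equiv> \<lparr>mod_space = F ` mod_space V, mod_act = \<lambda>g w. F (mod_act V g (h w))\<rparr>"
 shows "is_kgmod G W" "kg_hom G V W F" "bij_betw F (mod_space V) (mod_space W)"
proof -
 note V1 = kgmodD[OF V]
 have [simp]: "mod_space W = F ` mod_space V" "mod_act W = (\<lambda>g w. F (mod_act V g (h w)))"
  by (simp_all add: W_def)
 show "is_kgmod G W" unfolding is_kgmod_def
 proof (intro conjI ballI)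
  show "fv.subspace (mod_space W)" using lin_on_image_subspace[OF V1(1) flin_lin_on[OF F]] by simp
  fix g assume g: "g \<in> carrier G"
  show "mod_act W g \<in> mod_space W \<rightarrow> mod_space W" using g h V1(2) by auto
  show "lin_on (mod_space W) (mod_act W g)"
  proof (rule lin_onI)
   fix u v assume "u \<in> mod_space W" "v \<in> mod_space W"
   then obtain u' v' where u: "u = F u'" "u' \<in> mod_space V" "v = F v'" "v' \<in> mod_space V" by auto
   have "u + v = F (u' + v')" "u' + v' \<in> mod_space V"
    using u by (simp_all add: flin_add[OF F] fv.subspace_add[OF V1(1)])
   hence "mod_act W g (u + v) = F (mod_act V g (u' + v'))" using h by simp
   also have "\<dots> = mod_act W g u + mod_act W g v"
    using u h by (simp add: lin_on_add[OF V1(3)[OF g]] flin_add[OF F])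
   finally show "mod_act W g (u + v) = mod_act W g u + mod_act W g v" .
  next
   fix c u assume "u \<in> mod_space W"
   then obtain u' where u: "u = F u'" "u' \<in> mod_space V" by auto
   have "fscale c u = F (fscale c u')" "fscale c u' \<in> mod_space V"
    using u by (simp_all add: flin_scale[OF F] fv.subspace_scale[OF V1(1)])
   hence "mod_act W g (fscale c u) = F (mod_act V g (fscale c u'))" using h by simp
   also have "\<dots> = fscale c (mod_act W g u)"
    using u h by (simp add: lin_on_scale[OF V1(3)[OF g]] flin_scale[OF F])
   finally show "mod_act W g (fscale c u) = fscale c (mod_act W g u)" .
  qed
 next
  fix v assume "v \<in> mod_space W" thus "mod_act W \<one> v = v" using h V1(4) by auto
 next
  fix g k v assume "g \<in> carrier G" "k \<in> carrier G" "v \<in> mod_space W"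
  thus "mod_act W (g \<otimes> k) v = mod_act W g (mod_act W k v)" using h V1(2,5) by auto
 qed
 show "kg_hom G V W F" by (rule kg_homI[OF flin_lin_on[OF F]]) (use h in auto)
 show "bij_betw F (mod_space V) (mod_space W)" using inj by (simp add: bij_betw_def)
qed

lemma nat_kgmod_exists:
 assumes V: "is_kgmod G V" and fd: "fin_dim (mod_space V)"
 shows "\<exists>(W :: ('a, 'k::field, nat) kgmod) F. is_kgmod G W \<and> kg_hom G V W F \<and> bij_betw F (mod_space V) (mod_space W)"
proof -
 obtain F :: "_ => nat => 'k" where F: "flin F" "inj_on F (mod_space V)" by (rule exists_coordinates[OF fd])
 obtain h where h: "flin h" "!!v. v \<in> mod_space V ==> h (F v) = v"
  by (rule lin_on_left_inverse[OF kgmodD(1)[OF V] flin_lin_on[OF F(1)] F(2)]) blast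
 show ?thesis using transport_kgmod[OF V F h(2)] by blast
qed

text \<open>Maschke's theorem: average a linear projection over the group.\<close>

lemma equivariant_projection:
 fixes V :: "('a, 'k::field_char_0, 'i, 'z) kgmod_scheme"
 assumes V: "is_kgmod G V" and W: "submod G V W"
 obtains p where "kg_hom G V V p" "p ` mod_space V \<subseteq> W" "!!w. w \<in> W ==> p w = w"
proof -
 note V1 = kgmodD[OF V] and W1 = submodD[OF W]
 obtain q where q: "flin q" "range q \<subseteq> W" "!!v. v \<in> W ==> q v = v"
  by (rule exists_projection[OF W1(1)]) blast
 let ?n = "of_nat (card (carrier G)) :: 'k"
 \<comment> \<open>Characteristic 0 enters here: the average divides by the group order.\<close>
 have n0: "?n ~= 0" using fin_carrier one_closed by auto
 define f where "f g v = mod_act V g (q (mod_act V (inv g) v))" for g v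
 define p where "p v = fscale (1 / ?n) (\<Sum>g\<in>carrier G. f g v)" for v
 have fW: "f g v \<in> W" if "g \<in> carrier G" for g v unfolding f_def using that q(2) by (intro W1(3)) auto
 have flin: "lin_on (mod_space V) (f g)" if g: "g \<in> carrier G" for g
 proof -
  have qV: "q x \<in> mod_space V" for x using q(2) W1(2) by auto
  show ?thesis unfolding f_def using qV by (intro lin_onI)
    (simp_all add: lin_on_add[OF V1(3)] lin_on_scale[OF V1(3)] V1(2) g flin_add[OF q(1)] flin_scale[OF q(1)])
 qed
 have pW: "p v \<in> W" for v unfolding p_def by (intro fv.subspace_scale[OF W1(1)] fv.subspace_sum[OF W1(1)] fW)
 have lin: "lin_on (mod_space V) p"
 proof (rule lin_onI)
  fix u v assume "u \<in> mod_space V" "v \<in> mod_space V"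
  hence "(\<Sum>g\<in>carrier G. f g (u + v)) = (\<Sum>g\<in>carrier G. f g u + f g v)"
   by (intro sum.cong[OF refl] lin_on_add[OF flin])
  thus "p (u + v) = p u + p v" by (simp add: p_def sum.distrib fv.scale_right_distrib)
 next
  fix c u assume "u \<in> mod_space V"
  hence "(\<Sum>g\<in>carrier G. f g (fscale c u)) = (\<Sum>g\<in>carrier G. fscale c (f g u))"
   by (intro sum.cong[OF refl] lin_on_scale[OF flin])
  thus "p (fscale c u) = fscale c (p u)" by (simp add: p_def fv.scale_sum_right[symmetric])
 qed
 have eq: "p (mod_act V k v) = mod_act V k (p v)" if k: "k \<in> carrier G" and v: "v \<in> mod_space V" for k v
 proof -
  \<comment> \<open>Replacing \<open>g\<close> by \<open>k \<otimes> g\<close> lets \<open>k\<close>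
    be pulled out of every summand, which makes the average equivariant.\<close>
  have "(\<Sum>g\<in>carrier G. f g (mod_act V k v)) = (\<Sum>g\<in>carrier G. f (k \<otimes> g) (mod_act V k v))"
   by (rule sum.reindex_bij_betw[symmetric]) (use k in \<open>auto intro!: bij_betwI[where g="\<lambda>x. inv k \<otimes> x"] simp: m_assoc[symmetric]\<close>)
  also have "\<dots> = (\<Sum>g\<in>carrier G. mod_act V k (f g v))"
  proof (rule sum.cong[OF refl])
   fix g assume g: "g \<in> carrier G"
   have "mod_act V (inv (k \<otimes> g)) (mod_act V k v) = mod_act V (inv g) v"
    using k g v by (simp add: inv_mult_group V1(5) V1(2) act_inv[OF V])
   hence "f (k \<otimes> g) (mod_act V k v) = mod_act V (k \<otimes> g) (q (mod_act V (inv g) v))"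
    by (simp add: f_def)
   also have "\<dots> = mod_act V k (f g v)" unfolding f_def using q(2) W1(2) by (intro V1(5) k g) auto
   finally show "f (k \<otimes> g) (mod_act V k v) = mod_act V k (f g v)" .
  qed
  also have "\<dots> = mod_act V k (\<Sum>g\<in>carrier G. f g v)"
   by (rule lin_on_sum[OF V1(1) V1(3)[OF k], symmetric]) (use fW W1(2) in auto)
  finally have "(\<Sum>g\<in>carrier G. f g (mod_act V k v)) = mod_act V k (\<Sum>g\<in>carrier G. f g v)" .
  moreover have "(\<Sum>g\<in>carrier G. f g v) \<in> mod_space V"
   by (rule fv.subspace_sum[OF V1(1)]) (use fW W1(2) in auto)
  ultimately show ?thesis unfolding p_def by (simp add: lin_on_scale[OF V1(3)[OF k]])
 qed
 have id: "p w = w" if w: "w \<in> W" for w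
 proof -
  have "f g w = w" if g: "g \<in> carrier G" for g
   unfolding f_def using w g W1 by (simp add: q(3) act_inv[OF V] subsetD)
  hence "p w = fscale (1 / ?n) (\<Sum>g\<in>carrier G. w)" by (simp add: p_def)
  also have "(\<Sum>g\<in>carrier G. w) = fscale ?n w" by (rule fv.sum_constant_scale)
  finally show ?thesis using n0 by simp
 qed
 have "kg_hom G V V p" using lin eq pW W1(2) by (intro kg_homI) auto
 thus thesis using that pW id by blast
qed

text \<open>An equivariant endomorphism of minimal rank not killing \<open>y\<close> has irreducible image.\<close>

lemma irreducible_image_exists:
 fixes V :: "('a, 'k::field_char_0, 'i) kgmod"
 assumes V: "is_kgmod G V" and fd: "fin_dim (mod_space V)" and y: "y \<in> mod_space V" "y ~= 0"
 obtains p where "kg_hom G V V p" "p y ~= 0"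
  "irreducible_kgmod G \<lparr>mod_space = p ` mod_space V, mod_act = mod_act V\<rparr>"
proof -
 define Q where "Q p \<longleftrightarrow> kg_hom G V V p \<and> p y ~= 0" for p
 have "Q (\<lambda>x. x)" using y(2) by (auto simp: Q_def intro!: kg_homI flin_lin_on[OF flin_id])
 then obtain p where p: "Q p" "!!q. Q q ==> fv.dim (p ` mod_space V) \<le> fv.dim (q ` mod_space V)"
  using ex_has_least_nat[of Q "\<lambda>x. x" "\<lambda>p. fv.dim (p ` mod_space V)"] by blast
 have ph: "kg_hom G V V p" "p y ~= 0" using p(1) by (auto simp: Q_def)
 let ?I = "p ` mod_space V"
 let ?M = "\<lparr>mod_space = ?I, mod_act = mod_act V\<rparr>"
 have sI: "submod G V ?I" by (rule kg_hom_image[OF V ph(1)])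
 have fI: "fin_dim ?I" by (rule fin_dim_image[OF fd kg_homD(1)[OF ph(1)]])
 have "irreducible_kgmod G ?M" unfolding irreducible_kgmod_iff
 proof (intro conjI allI impI)
  show "is_kgmod G ?M" by (rule submod_kgmod[OF V sI])
  show "mod_space ?M ~= {0}" using ph(2) y(1) by auto
  fix W assume W: "submod G ?M W"
  hence WV: "submod G V W" "W \<subseteq> ?I" using submodD(2)[OF sI] by (auto simp: submod_def)
  obtain q where q: "kg_hom G V V q" "q ` mod_space V \<subseteq> W" "!!w. w \<in> W ==> q w = w"
   by (rule equivariant_projection[OF V WV(1)]) blast
  show "W = {0} \<or> W = mod_space ?M"
  proof (rule ccontr)
   assume n: "\<not> (W = {0} \<or> W = mod_space ?M)"
   have pV: "p x \<in> mod_space V" if "x \<in> mod_space V" for x using that by (rule kg_homD(2)[OF ph(1)])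
   define r where "r x = p x - q (p x)" for x
   have qp: "kg_hom G V V (\<lambda>x. q (p x))" by (rule kg_hom_comp[OF ph(1) q(1)])
   have r: "kg_hom G V V r"
   proof (rule kg_homI)
    show "lin_on (mod_space V) r" unfolding r_def
     by (rule lin_onI) (simp_all add: lin_on_add[OF kg_homD(1)[OF ph(1)]] lin_on_scale[OF kg_homD(1)[OF ph(1)]]
       lin_on_add[OF kg_homD(1)[OF q(1)]] lin_on_scale[OF kg_homD(1)[OF q(1)]] pV fv.scale_right_diff_distrib)
    show "r v \<in> mod_space V" if "v \<in> mod_space V" for v
     unfolding r_def using that by (intro fv.subspace_diff kgmodD(1)[OF V] kg_homD(2)[OF ph(1)] kg_homD(2)[OF qp])
    show "r (mod_act V g v) = mod_act V g (r v)" if "g \<in> carrier G" "v \<in> mod_space V" for g v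
     unfolding r_def using that by (simp add: kg_homD(3)[OF ph(1)] kg_homD(3)[OF q(1)] pV
       lin_on_diff[OF kgmodD(1)[OF V] kgmodD(3)[OF V]] kg_homD(2)[OF q(1)])
   qed
   have rI: "r ` mod_space V \<subseteq> ?I"
    unfolding r_def using q(2) pV WV(2) by (auto intro!: fv.subspace_diff[OF submodD(1)[OF sI]])
   \<comment> \<open>\<open>p y\<close> is the sum of \<open>q (p y)\<close> and \<open>r y\<close>,
     so one of these two endomorphisms into the image of \<open>p\<close> still does not kill
     \<open>y\<close>. Minimality of the rank applies to it.\<close>
   have "q (p y) ~= 0 \<or> r y ~= 0" using ph(2) by (auto simp: r_def)
   thus False
   proof
    assume "q (p y) ~= 0"
    hence "fv.dim ?I \<le> fv.dim ((\<lambda>x. q (p x)) ` mod_space V)" using p(2) qp by (simp add: Q_def)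
    also have "\<dots> \<le> fv.dim W"
    proof (rule dim_mono_fin)
     show "fin_dim W" by (rule fin_dim_mono[OF fI submodD(1)[OF W] WV(2)])
     show "fv.subspace ((\<lambda>x. q (p x)) ` mod_space V)" by (rule submodD(1)[OF kg_hom_image[OF V qp]])
     show "(\<lambda>x. q (p x)) ` mod_space V \<subseteq> W" using q(2) pV by blast
    qed
    finally have "W = ?I" by (rule dim_eq_imp_eq[OF fI submodD(1)[OF W] WV(2)])
    thus False using n by simp
   next
    assume "r y ~= 0"
    hence "fv.dim ?I \<le> fv.dim (r ` mod_space V)" using p(2) r by (simp add: Q_def)
    hence e: "r ` mod_space V = ?I" by (rule dim_eq_imp_eq[OF fI submodD(1)[OF kg_hom_image[OF V r]] rI])
    \<comment> \<open>The image of \<open>r\<close> is now the whole image of \<open>p\<close>, so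
      it contains \<open>W\<close>. But \<open>q\<close> kills the image of \<open>r\<close>, as it
      fixes its own values on the image of \<open>p\<close>, and it also fixes the elements of
      \<open>W\<close>.\<close>
    obtain w where w: "w \<in> W" "w ~= 0" using n fv.subspace_0[OF submodD(1)[OF W]] by blast
    hence "w \<in> r ` mod_space V" using WV(2) e by blast
    then obtain x where x: "x \<in> mod_space V" "w = r x" by blast
    have "q w = q (p x) - q (q (p x))" unfolding x r_def
     by (rule lin_on_diff[OF kgmodD(1)[OF V] kg_homD(1)[OF q(1)]]) (use pV x kg_homD(2)[OF q(1)] in auto)
    also have "q (q (p x)) = q (p x)" using q(2,3) pV x by blast
    finally show False using q(3) w by simp
   qed
  qed
 qed
 with ph show thesis using that by blast
qed

text \<open>Irreducible quotients from the list \<open>Irr\<close> detect nonzero vectors, which is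
  the form of complete reducibility used to compare annihilators. The irreducible image found inside
  \<open>V\<close> is first moved to index type \<open>nat\<close>, where the list lives.\<close>

lemma irreducible_quotient_exists:
 fixes V :: "('a, 'k::field_char_0, 'i) kgmod" and Irr :: "('a, 'k, nat) kgmod set"
 assumes V: "is_kgmod G V" and fd: "fin_dim (mod_space V)" and y: "y \<in> mod_space V" "y ~= 0"
  and Irr: "irr_reps G Irr"
 obtains U f where "U \<in> Irr" "kg_hom G V U f" "f y ~= 0"
proof -
 obtain p where p: "kg_hom G V V p" "p y ~= 0"
  "irreducible_kgmod G \<lparr>mod_space = p ` mod_space V, mod_act = mod_act V\<rparr>" (is "irreducible_kgmod G ?M")
  by (rule irreducible_image_exists[OF V fd y])
 have kM: "is_kgmod G ?M" using p(3) by (simp add: irreducible_kgmod_iff)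
 have fM: "fin_dim (mod_space ?M)" by (rule irreducible_fin_dim[OF p(3)])
 obtain W :: "('a, 'k, nat) kgmod" and F where W: "is_kgmod G W" "kg_hom G ?M W F" "bij_betw F (mod_space ?M) (mod_space W)"
  using nat_kgmod_exists[OF kM fM] by blast
 obtain h where h: "kg_hom G W ?M h" "bij_betw h (mod_space W) (mod_space ?M)" by (rule hom_inverse[OF kM W(2,3)])
 have irrW: "irreducible_kgmod G W" unfolding irreducible_kgmod_iff
 proof (intro conjI allI impI W(1))
  have py: "p y \<in> mod_space ?M" using y by simp
  hence "F (p y) ~= 0" "F (p y) \<in> mod_space W"
   using lin_on_inj_iff[OF kgmodD(1)[OF kM] kg_homD(1)[OF W(2)]] W(3) p(2) kg_homD(2)[OF W(2)]
   by (auto simp: bij_betw_def)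
  thus "mod_space W ~= {0}" by blast
  fix N assume N: "submod G W N"
  have Nk: "is_kgmod G \<lparr>mod_space = N, mod_act = mod_act W\<rparr>" (is "is_kgmod G ?N") by (rule submod_kgmod[OF W(1) N])
  have hN: "kg_hom G ?N ?M h"
   using submodD(2)[OF N] lin_on_subset[OF kg_homD(1)[OF h(1)] submodD(2)[OF N]] kg_homD(2,3)[OF h(1)]
   by (intro kg_homI) auto
  have "submod G ?M (h ` N)" using kg_hom_image[OF Nk hN] by simp
  then consider "h ` N = {0}" | "h ` N = mod_space ?M" using p(3) unfolding irreducible_kgmod_iff by blast
  thus "N = {0} \<or> N = mod_space W"
  proof cases
   case 1
   have "x = 0" if "x \<in> N" for x
    using that 1 submodD(2)[OF N] h(2) lin_on_inj_iff[OF kgmodD(1)[OF W(1)] kg_homD(1)[OF h(1)]]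
    by (auto simp: bij_betw_def)
   thus ?thesis using fv.subspace_0[OF submodD(1)[OF N]] by blast
  next
   case 2
   hence "h ` N = h ` mod_space W" using h(2) by (simp add: bij_betw_def)
   moreover have "inj_on h (mod_space W)" using h(2) by (simp add: bij_betw_def)
   ultimately have "N = mod_space W" using submodD(2)[OF N] by (metis inj_on_image_eq_iff subset_refl)
   thus ?thesis by simp
  qed
 qed
 then obtain U where U: "U \<in> Irr" "kgmod_iso G W U" using Irr unfolding irr_reps_def by blast
 have kU: "is_kgmod G U" using U(1) Irr unfolding irr_reps_def irreducible_kgmod_iff by blast
 obtain f where f: "kg_hom G W U f" "bij_betw f (mod_space W) (mod_space U)"
  using U(2) kgmod_iso_hom[OF W(1) kU] by blast
 have pM: "kg_hom G V ?M p" using p(1) unfolding kg_hom_def by auto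
 have c: "kg_hom G V U (\<lambda>x. f (F (p x)))" by (intro kg_hom_comp[OF kg_hom_comp[OF pM W(2)] f(1)])
 have py: "p y \<in> mod_space ?M" using y by simp
 have "F (p y) ~= 0"
  using lin_on_inj_iff[OF kgmodD(1)[OF kM] kg_homD(1)[OF W(2)]] W(3) p(2) py by (auto simp: bij_betw_def)
 hence "f (F (p y)) ~= 0"
  using lin_on_inj_iff[OF kgmodD(1)[OF W(1)] kg_homD(1)[OF f(1)]] f(2) kg_homD(2)[OF W(2) py] by (auto simp: bij_betw_def)
 with U(1) c show thesis using that by blast
qed

end

subsection \<open>Direct sums of families\<close>

definition dsum_inj :: "'x => ('i => 'k::field) => 'x \<times> 'i => 'k" where
 "dsum_inj s u = (\<lambda>(t, i). if t = s then u i else 0)"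

abbreviation (input) slice :: "'x => ('x \<times> 'i => 'k) => 'i => 'k" where
 "slice s w \<equiv> \<lambda>i. w (s, i)"

lemma flin_dsum_inj: "flin (dsum_inj s)"
 by (rule flinI) (auto simp: dsum_inj_def fun_eq_iff fun_apps)

lemma comp_dsum_inj: "slice t (dsum_inj s u) = (if t = s then u else 0)"
 by (auto simp: dsum_inj_def fun_eq_iff fun_apps)

lemma comp_lin:
 "slice s (v + w) = slice s v + slice s w" "slice s (fscale c v) = fscale c (slice s v)"
 "slice s 0 = 0" "slice s (\<Sum>a\<in>A. f a) = (\<Sum>a\<in>A. slice s (f a))"
 by (auto simp: fun_eq_iff fun_apps sum_fun_apply)

lemma in_dsum_family:
 "w \<in> mod_space (dsum_family I V) \<longleftrightarrow> (\<forall>s\<in>I. slice s w \<in> mod_space (V s)) \<and> (\<forall>s. s \<notin> I --> slice s w = 0)"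
 by (auto simp: dsum_family_def fun_eq_iff fun_apps)

lemma dsum_family_act:
 "s \<in> I ==> slice s (mod_act (dsum_family I V) g w) = mod_act (V s) g (slice s w)"
 by (auto simp: dsum_family_def)

lemma dsum_family_act_outside:
 "s \<notin> I ==> slice s (mod_act (dsum_family I V) g w) = 0" by (auto simp: dsum_family_def fun_eq_iff fun_apps)

lemma comp_eqI: "(!!s. slice s v = slice s w) ==> v = w"
 by (auto simp: fun_eq_iff)

lemma dsum_family_kgmod:
 assumes "group G" and V: "!!s. s \<in> I ==> is_kgmod G (V s)"
 shows "is_kgmod G (dsum_family I V)" (is "is_kgmod G ?D")
proof -
 interpret group G by fact
 note K = kgmodD[OF V]
 show ?thesis unfolding is_kgmod_def
 proof (intro conjI ballI)
  show "fv.subspace (mod_space ?D)"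
  proof (rule fv.subspaceI)
   show "0 \<in> mod_space ?D" unfolding in_dsum_family by (auto simp: comp_lin fv.subspace_0[OF K(1)])
   fix v w assume "v \<in> mod_space ?D" "w \<in> mod_space ?D"
   thus "v + w \<in> mod_space ?D" unfolding in_dsum_family comp_lin by (auto simp: fv.subspace_add[OF K(1)])
  next
   fix c v assume "v \<in> mod_space ?D"
   thus "fscale c v \<in> mod_space ?D" unfolding in_dsum_family comp_lin by (auto simp: fv.subspace_scale[OF K(1)])
  qed
  fix g assume g: "g \<in> carrier G"
  show "mod_act ?D g \<in> mod_space ?D \<rightarrow> mod_space ?D"
  proof
   fix v assume v: "v \<in> mod_space ?D"
   have cl: "slice s (mod_act ?D g v) \<in> mod_space (V s)" if s: "s \<in> I" for s
    unfolding dsum_family_act[OF s] using v s g unfolding in_dsum_family by (blast intro: K(2))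
   thus "mod_act ?D g v \<in> mod_space ?D"
    unfolding in_dsum_family by (intro conjI ballI allI impI cl dsum_family_act_outside)
  qed
  show "lin_on (mod_space ?D) (mod_act ?D g)"
  proof (rule lin_onI)
   fix u v assume uv: "u \<in> mod_space ?D" "v \<in> mod_space ?D"
   show "mod_act ?D g (u + v) = mod_act ?D g u + mod_act ?D g v"
   proof (rule comp_eqI)
    fix s show "slice s (mod_act ?D g (u + v)) = slice s (mod_act ?D g u + mod_act ?D g v)"
     using uv lin_on_add[OF K(3)[OF _ g], of s "slice s u" "slice s v"]
     by (cases "s \<in> I") (simp_all only: comp_lin dsum_family_act dsum_family_act_outside in_dsum_family not_False_eq_True add_0_right)
   qed
  next
   fix c u assume u: "u \<in> mod_space ?D"
   show "mod_act ?D g (fscale c u) = fscale c (mod_act ?D g u)"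
   proof (rule comp_eqI)
    fix s show "slice s (mod_act ?D g (fscale c u)) = slice s (fscale c (mod_act ?D g u))"
     using u lin_on_scale[OF K(3)[OF _ g], of s "slice s u" c]
     by (cases "s \<in> I") (simp_all only: comp_lin dsum_family_act dsum_family_act_outside in_dsum_family not_False_eq_True fv.scale_zero_right)
   qed
  qed
 next
  fix v assume v: "v \<in> mod_space ?D"
  show "mod_act ?D \<one>\<^bsub>G\<^esub> v = v"
  proof (rule comp_eqI)
   fix s show "slice s (mod_act ?D \<one>\<^bsub>G\<^esub> v) = slice s v" using v K(4)[of s "slice s v"]
    by (cases "s \<in> I") (simp_all only: dsum_family_act dsum_family_act_outside in_dsum_family not_False_eq_True)
  qed
 next
  fix g h v assume gh: "g \<in> carrier G" "h \<in> carrier G" and v: "v \<in> mod_space ?D"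
  show "mod_act ?D (g \<otimes>\<^bsub>G\<^esub> h) v = mod_act ?D g (mod_act ?D h v)"
  proof (rule comp_eqI)
   fix s show "slice s (mod_act ?D (g \<otimes>\<^bsub>G\<^esub> h) v) = slice s (mod_act ?D g (mod_act ?D h v))"
    using v K(5)[of s g h "slice s v"] gh
    by (cases "s \<in> I") (simp_all only: dsum_family_act dsum_family_act_outside in_dsum_family not_False_eq_True)
  qed
 qed
qed

lemma dsum_decomp:
 assumes I: "finite I" and w: "w \<in> mod_space (dsum_family I V)"
 shows "w = (\<Sum>s\<in>I. dsum_inj s (slice s w))"
proof (rule comp_eqI)
 fix t
 have "slice t (\<Sum>s\<in>I. dsum_inj s (slice s w)) = (\<Sum>s\<in>I. if s = t then slice s w else 0)"
  unfolding comp_lin by (rule sum.cong) (auto simp: comp_dsum_inj)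
 thus "slice t w = slice t (\<Sum>s\<in>I. dsum_inj s (slice s w))"
  using I w by (cases "t \<in> I") (auto simp: in_dsum_family)
qed

lemma dsum_fin_dim:
 assumes I: "finite I" and V: "!!s. s \<in> I ==> is_kgmod G (V s)" "!!s. s \<in> I ==> fin_dim (mod_space (V s))"
  and G: "group G"
 shows "fin_dim (mod_space (dsum_family I V))"
proof -
 have "\<forall>s\<in>I. \<exists>B. finite B \<and> mod_space (V s) = fv.span B" using V(2) by (auto simp: fin_dim_def)
 then obtain B where B: "!!s. s \<in> I ==> finite (B s)" "!!s. s \<in> I ==> mod_space (V s) = fv.span (B s)" by metis
 let ?C = "\<Union>s\<in>I. dsum_inj s ` B s"
 have fin: "finite ?C" using I B(1) by auto
 have "w \<in> fv.span ?C" if w: "w \<in> mod_space (dsum_family I V)" for w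
 proof -
  have "dsum_inj s (slice s w) \<in> fv.span ?C" if s: "s \<in> I" for s
  proof -
   have "slice s w \<in> fv.span (B s)" using w s B(2) by (auto simp: in_dsum_family)
   hence "dsum_inj s (slice s w) \<in> fv.span (dsum_inj s ` B s)"
    unfolding fvp.linear_span_image[OF flin_dsum_inj] by blast
   moreover have "fv.span (dsum_inj s ` B s) \<subseteq> fv.span ?C" by (rule fv.span_mono) (use s in blast)
   ultimately show ?thesis by blast
  qed
  hence "(\<Sum>s\<in>I. dsum_inj s (slice s w)) \<in> fv.span ?C" by (rule fv.span_sum)
  thus ?thesis using dsum_decomp[OF I w] by simp
 qed
 hence "mod_space (dsum_family I V) \<subseteq> fv.span ?C" by blast
 moreover have "fv.subspace (mod_space (dsum_family I V))" by (rule kgmodD(1)[OF dsum_family_kgmod[OF G V(1)]])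
 ultimately show ?thesis using fin_dim_mono[OF fin_dim_span[OF fin]] by blast
qed

section \<open>Translations, and finiteness of the set of irreducible modules\<close>

context finite_grp
begin

lemma galg_act_dsum:
 "s \<in> I ==> slice s (galg_act G (dsum_family I V) x w) = galg_act G (V s) x (slice s w)"
 unfolding galg_act_def comp_lin by (rule sum.cong) (auto simp: dsum_family_act)

lemma galg_act_dsum_outside:
 "s \<notin> I ==> slice s (galg_act G (dsum_family I V) x w) = 0"
 unfolding galg_act_def comp_lin by (rule sum.neutral) (auto simp: dsum_family_act_outside)

text \<open>The function \<open>k \<mapsto> x (inv g \<otimes> k)\<close> is the product of
  \<open>g\<close> and \<open>x\<close> in the group algebra, so this is associativity of the action
  with a group element on the left.\<close>

lemma galg_act_translate:
 assumes V: "is_kgmod G V" and v: "v \<in> mod_space V" and g: "g \<in> carrier G"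
 shows "galg_act G V (\<lambda>k. if k \<in> carrier G then x (inv g \<otimes> k) else 0) v = mod_act V g (galg_act G V x v)"
proof -
 have "mod_act V g (galg_act G V x v) = (\<Sum>k\<in>carrier G. mod_act V g (fscale (x k) (mod_act V k v)))"
  unfolding galg_act_def by (rule lin_on_sum[OF kgmodD(1)[OF V] kgmodD(3)[OF V g]])
   (intro fv.subspace_scale kgmodD(1)[OF V] kgmodD(2)[OF V _ v])
 also have "\<dots> = (\<Sum>k\<in>carrier G. fscale (x k) (mod_act V (g \<otimes> k) v))"
  by (rule sum.cong) (simp_all add: lin_on_scale[OF kgmodD(3)[OF V g] kgmodD(2)[OF V _ v]] kgmodD(5)[OF V g _ v])
 also have "\<dots> = galg_act G V (\<lambda>k. if k \<in> carrier G then x (inv g \<otimes> k) else 0) v"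
  unfolding galg_act_def
  by (rule sum.reindex_bij_witness[of _ "\<lambda>k. inv g \<otimes> k" "\<lambda>k. g \<otimes> k"]) (use g in \<open>auto simp: m_assoc[symmetric]\<close>)
 finally show ?thesis ..
qed

text \<open>Given infinitely many irreducible modules \<open>U n\<close> with nonzero vectors \<open>u n\<close>, the left ideals killing
 \<open>u 0\<close>, ...,\<open>u (n - 1)\<close> form a strictly decreasing chain in \<open>K[G]\<close>.\<close>

lemma finite_Irr:
 fixes Irr :: "('a, 'k::field, nat) kgmod set"
 assumes Irr: "irr_reps G Irr" shows "finite Irr"
proof (rule ccontr)
 assume "infinite Irr"
 then obtain U :: "nat => ('a, 'k, nat) kgmod" where U: "inj U" "range U \<subseteq> Irr" using infinite_countable_subset by blast
 have irr: "irreducible_kgmod G (U n)" for n using U(2) Irr unfolding irr_reps_def by blast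
 have K: "is_kgmod G (U n)" for n using irr by (simp add: irreducible_kgmod_iff)
 have "\<exists>u. u \<in> mod_space (U n) \<and> u ~= 0" for n
  using irr[of n] fv.subspace_0[OF kgmodD(1)[OF K]] unfolding irreducible_kgmod_iff by blast
 then obtain u where u: "!!n. u n \<in> mod_space (U n)" "!!n. u n ~= 0" by metis
 define N where "N n = {x \<in> galg G. \<forall>i<n. galg_act G (U i) x (u i) = 0}" for n
 have Nsub: "fv.subspace (N n)" for n
  unfolding fv.subspace_def N_def using fv.subspace_0[OF galg_subspace] fv.subspace_add[OF galg_subspace] fv.subspace_scale[OF galg_subspace]
  by (auto simp: galg_act_lin_left)
 have Ntr: "(\<lambda>k. if k \<in> carrier G then x (inv g \<otimes> k) else 0) \<in> N n" if "x \<in> N n" "g \<in> carrier G" for x g n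
  using that act_zero[OF K] galg_act_translate[OF K u(1) that(2), where x=x] by (simp add: N_def galg_def)
 have strict: "\<exists>x\<in>N k. galg_act G (U k) x (u k) ~= 0" for k
 proof (rule ccontr)
  let ?P = "\<lambda>j. \<forall>x\<in>N j. galg_act G (U k) x (u k) = 0"
  assume "\<not> (\<exists>x\<in>N k. galg_act G (U k) x (u k) ~= 0)"
  hence Pk: "?P k" by blast
  have "galg_of \<one> \<in> N 0" using galg_of_galg[OF one_closed] by (simp add: N_def)
  moreover have "galg_act G (U k) (galg_of \<one>) (u k) ~= 0" using u(2) by (simp add: galg_act_galg_of kgmodD(4)[OF K u(1)])
  ultimately have "\<not> ?P 0" by blast
  \<comment> \<open>\<open>N k\<close> kills \<open>u k\<close>, but \<open>N 0\<close> does not,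
    since it contains the unit of the group algebra. So somewhere below \<open>k\<close> there is a
    step at which this changes.\<close>
  then obtain i where i: "i < k" "\<not> ?P i" "?P (Suc i)" using ex_least_nat_less[of ?P k] Pk by blast
  let ?f = "\<lambda>x. galg_act G (U i) x (u i)" and ?W = "(\<lambda>x. galg_act G (U i) x (u i)) ` N i"
  have "submod G (U i) ?W" unfolding submod_def
  proof (intro conjI ballI)
   show "fv.subspace ?W" by (rule lin_on_image_subspace[OF Nsub]) (rule lin_onI, simp_all add: galg_act_lin_left)
   show "?W \<subseteq> mod_space (U i)" using galg_act_closed[OF K u(1)] by blast
   show "mod_act (U i) g ` ?W \<subseteq> ?W" if g: "g \<in> carrier G" for g
    using Ntr[OF _ g] galg_act_translate[OF K u(1) g, symmetric] by auto
  qed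
  moreover have "?W ~= {0}"
  proof
   assume "?W = {0}"
   hence "N (Suc i) = N i" by (auto simp: N_def less_Suc_eq)
   thus False using i by simp
  qed
  ultimately have W: "?W = mod_space (U i)" using irr[of i] unfolding irreducible_kgmod_iff by blast
  define s where "s y = (SOME x. x \<in> N i \<and> ?f x = y)" for y
  have s: "s y \<in> N i" "?f (s y) = y" if "y \<in> mod_space (U i)" for y
  proof -
   have "\<exists>x. x \<in> N i \<and> ?f x = y" using that unfolding W[symmetric] by (elim imageE) auto
   hence "s y \<in> N i \<and> ?f (s y) = y" unfolding s_def by (rule someI_ex)
   thus "s y \<in> N i" "?f (s y) = y" by simp_all
  qed
  \<comment> \<open>On \<open>N i\<close> the kernel of the action on \<open>u i\<close> is
    \<open>N (Suc i)\<close>, which kills \<open>u k\<close>. Hence sending the image of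
    \<open>u i\<close> under \<open>x\<close> to the image of \<open>u k\<close> under
    \<open>x\<close> is well defined on all of \<open>U i\<close>. The map is nonzero, and Schur's
    lemma makes \<open>U i\<close> and \<open>U k\<close> isomorphic.\<close>
  let ?h = "\<lambda>y. galg_act G (U k) (s y) (u k)"
  have hx: "?h (?f x) = galg_act G (U k) x (u k)" if x: "x \<in> N i" for x
  proof -
   have m: "?f x \<in> mod_space (U i)" using W x by blast
   have "s (?f x) - x \<in> N (Suc i)"
    using fv.subspace_diff[OF Nsub s(1)[OF m] x] s(2)[OF m] by (auto simp: N_def less_Suc_eq galg_act_lin_left)
   thus ?thesis using i(3) by (auto simp: galg_act_lin_left)
  qed
  have "kg_hom G (U i) (U k) ?h"
  proof (rule kg_homI, rule lin_onI)
   fix y y' assume y: "y \<in> mod_space (U i)" "y' \<in> mod_space (U i)"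
   have "?f (s y + s y') = y + y'" using s y by (simp add: galg_act_lin_left)
   thus "?h (y + y') = ?h y + ?h y'" using hx[of "s y + s y'"] fv.subspace_add[OF Nsub s(1) s(1)] y by (simp add: galg_act_lin_left)
  next
   fix c y assume y: "y \<in> mod_space (U i)"
   have e: "?f (fscale c (s y)) = fscale c y" by (simp only: galg_act_lin_left(2) s(2)[OF y])
   have "?h (?f (fscale c (s y))) = fscale c (?h y)"
    unfolding hx[OF fv.subspace_scale[OF Nsub s(1)[OF y]]] by (rule galg_act_lin_left(2))
   thus "?h (fscale c y) = fscale c (?h y)" unfolding e .
  next
   fix g y assume g: "g \<in> carrier G" and y: "y \<in> mod_space (U i)"
   show "?h (mod_act (U i) g y) = mod_act (U k) g (?h y)"
    using hx[OF Ntr[OF s(1)[OF y] g]] s(2)[OF y] by (simp add: galg_act_translate[OF K u(1) g])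
  qed (rule galg_act_closed[OF K u(1)])
  moreover obtain x where x: "x \<in> N i" "galg_act G (U k) x (u k) ~= 0" using i(2) by blast
  moreover have "?f x \<in> mod_space (U i)" using W x by blast
  ultimately have "kgmod_iso G (U i) (U k)" using irreducible_hom_iso[OF irr irr] hx[OF x(1)] by metis
  hence "U i = U k" using Irr irr[of i] kgmod_iso_refl[OF K, of i] U(2) unfolding irr_reps_def by blast
  thus False using U(1) i(1) by (simp add: inj_eq)
 qed
 have "N (Suc k) \<subset> N k" for k using strict[of k] by (auto simp: N_def less_Suc_eq)
 moreover have fN: "fin_dim (N k)" for k by (rule fin_dim_mono[OF fin_dim_galg Nsub]) (auto simp: N_def)
 ultimately have d: "fv.dim (N (Suc k)) < fv.dim (N k)" for k using dim_psubset_fin[OF fN Nsub] by blast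
 \<comment> \<open>A strictly decreasing chain of subspaces loses a dimension at each step, so its
   length is bounded by the dimension of \<open>N 0\<close>.\<close>
 have "fv.dim (N k) + k \<le> fv.dim (N 0)" for k
 proof (induct k)
  case (Suc k) thus ?case using d[of k] by simp
 qed simp
 from this[of "Suc (fv.dim (N 0))"] show False by simp
qed

end

subsection \<open>The irreducible gliders of the parametrization\<close>

locale param = finite_grp G for G :: "('g, 'm) monoid_scheme" (structure) +
 fixes T :: "'g set => ('g, 'k::{alg_closed_field, field_char_0}, nat) kgmod" and Irr :: "('g, 'k, nat) kgmod set"
 assumes T: "ab_param G T" and Irr: "irr_reps G Irr"
begin

lemma T_kgmod: "z \<in> carrier (Gab G) ==> is_kgmod G (T z)"
 and T_dim: "z \<in> carrier (Gab G) ==> fv.dim (mod_space (T z)) = 1" using T unfolding ab_param_def by blast+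

lemma one_dim_irreducible:
 assumes V: "is_kgmod G V" "fv.dim (mod_space V) = 1" shows "irreducible_kgmod G V" unfolding irreducible_kgmod_iff
proof (intro conjI allI impI V(1))
 note sV = kgmodD(1)[OF V(1)]
 show "mod_space V ~= {0}" using V(2) dim_zero by (metis zero_neq_one)
 fix W assume W: "submod G V W"
 have "W = mod_space V" if w: "w \<in> W" "w ~= 0" for w
 proof -
  have "mod_space V = fv.span {w}" using dim_1_line[OF sV V(2)] w submodD(2)[OF W] by blast
  also have "\<dots> \<subseteq> W" using w submodD(1)[OF W] by (simp add: fv.span_minimal)
  finally show ?thesis using submodD(2)[OF W] by blast
 qed
 thus "W = {0} \<or> W = mod_space V" using fv.subspace_0[OF submodD(1)[OF W]] by blast
qed

lemma Irr_irr: "U \<in> Irr ==> irreducible_kgmod G U"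
 and Irr_kgmod: "U \<in> Irr ==> is_kgmod G U" using Irr unfolding irr_reps_def irreducible_kgmod_iff by blast+

lemma T_iso_eq: "z \<in> carrier (Gab G) ==> y \<in> carrier (Gab G) ==> kgmod_iso G (T z) (T y) ==> z = y"
 using T T_kgmod[of z] T_dim[of z] kgmod_iso_refl[OF T_kgmod, of z] unfolding ab_param_def by blast

lemma T_irr: "z \<in> carrier (Gab G) ==> irreducible_kgmod G (T z)"
 by (rule one_dim_irreducible[OF T_kgmod T_dim])

lemma SGD:
 assumes "B \<in> SG Irr" "(U, W) \<in> B"
 shows "U \<in> Irr" "fv.dim (mod_space U) > 1" "fv.subspace W" "W \<subseteq> mod_space U" "fv.dim W \<ge> 1"
  "(U, W') \<in> B ==> W' = W"
proof -
 have 1: "B \<subseteq> (SIGMA U:{U\<in>Irr. fv.dim (mod_space U) > 1}. \<Union>j\<in>{1..fv.dim (mod_space U)}. Grass j U)"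
  and 2: "\<forall>U W W'. (U, W) \<in> B \<and> (U, W') \<in> B --> W = W'" using assms(1) by (auto simp: SG_def)
 from 1 assms(2) have "(U, W) \<in> (SIGMA U:{U\<in>Irr. fv.dim (mod_space U) > 1}. \<Union>j\<in>{1..fv.dim (mod_space U)}. Grass j U)"
  by (rule subsetD)
 then obtain j where "U \<in> Irr" "fv.dim (mod_space U) > 1" "j \<ge> 1" "W \<in> Grass j U" by auto
 thus "U \<in> Irr" "fv.dim (mod_space U) > 1" "fv.subspace W" "W \<subseteq> mod_space U" "fv.dim W \<ge> 1"
  by (auto simp: Grass_def)
 show "(U, W') \<in> B ==> W' = W" using 2 assms(2) by blast
qed

lemma SG_empty: "{} \<in> SG Irr" by (auto simp: SG_def)

text \<open>There is at most one point over each irreducible module, so \<open>B\<close> embeds into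
  the finite set \<open>Irr\<close>. Finitely many summands are what makes
  \<open>param_module\<close> finite-dimensional.\<close>

lemma finite_SG:
 assumes B: "B \<in> SG Irr" shows "finite B"
proof -
 have "inj_on fst B"
 proof (rule inj_onI)
  fix p q assume "p \<in> B" "q \<in> B" "fst p = fst q"
  thus "p = q" using SGD(6)[OF B, of "fst p" "snd p" "snd q"] by (metis prod.collapse)
 qed
 moreover have "fst ` B \<subseteq> Irr" using SGD(1)[OF B] by auto
 ultimately show ?thesis using finite_Irr[OF Irr] finite_subset finite_imageD by metis
qed

lemma finite_Gab: "finite (carrier (Gab G))"
proof -
 have "carrier (Gab G) \<subseteq> Pow (carrier G)"
 proof -
  have "derived G (carrier G) \<subseteq> carrier G" using derived_in_carrier by blast
  thus ?thesis unfolding Gab_def FactGroup_def RCOSETS_def r_coset_def by auto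
 qed
 thus ?thesis using fin_carrier finite_subset by blast
qed

context
 fixes A B assumes A: "A \<subseteq> carrier (Gab G)" and B: "B \<in> SG Irr"
begin

lemma finite_param_index: "finite (param_index A B)"
proof -
 have "{Inr (U, j) |U W j. (U, W) \<in> B \<and> j < fv.dim W} \<subseteq> (\<Union>(U, W)\<in>B. (\<lambda>j. Inr (U, j)) ` {..<fv.dim W})" by auto
 moreover have "finite (\<Union>(U, W)\<in>B. (\<lambda>j. Inr (U, j) :: 'g set + _) ` {..<fv.dim W})" using finite_SG[OF B] by auto
 ultimately have "finite {Inr (U, j) :: 'g set + _ |U W j. (U, W) \<in> B \<and> j < fv.dim W}" using finite_subset by blast
 thus ?thesis unfolding param_index_def using A finite_Gab finite_subset by blast
qed

lemma param_summand_irr: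
 "s \<in> param_index A B ==> irreducible_kgmod G (case_sum T fst s)"
 unfolding param_index_def using A T_irr Irr_irr SGD(1)[OF B] by auto

lemma param_summand:
 "s \<in> param_index A B ==> is_kgmod G (case_sum T fst s)"
 "s \<in> param_index A B ==> fin_dim (mod_space (case_sum T fst s))"
 using param_summand_irr[of s] irreducible_fin_dim[OF param_summand_irr, of s] unfolding irreducible_kgmod_iff by blast+

lemma param_kgmod: "is_kgmod G (param_module T A B)"
 unfolding param_module_def by (rule dsum_family_kgmod[OF is_group param_summand(1)])

lemma param_fin_dim: "fin_dim (mod_space (param_module T A B))"
 unfolding param_module_def by (rule dsum_fin_dim[OF finite_param_index param_summand is_group])

text \<open>This gives meaning to the choice operator in \<open>param_glider\<close>: pick a nonzero
  vector in each line \<open>T z\<close> and a basis of each \<open>W\<close>, and distribute them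
  over the summands.\<close>

lemma param_vector_exists: "\<exists>v. param_vector T A B v"
proof -
 have "\<forall>z\<in>A. \<exists>t. t \<in> mod_space (T z) \<and> t ~= 0"
  using A T_dim dim_pos_nonzero by (metis subsetD zero_less_one)
 then obtain t where t: "!!z. z \<in> A ==> t z \<in> mod_space (T z)" "!!z. z \<in> A ==> t z ~= 0" by metis
 have "\<forall>p\<in>B. \<exists>b. inj_on b {..<fv.dim (snd p)} \<and> fv.independent (b ` {..<fv.dim (snd p)}) \<and>
   fv.span (b ` {..<fv.dim (snd p)}) = snd p"
 proof clarify
  fix U W assume UW: "(U, W) \<in> B"
  have "fin_dim (mod_space U)" using irreducible_fin_dim Irr_irr SGD(1)[OF B UW] by blast
  then obtain C where C: "finite C" "fv.independent C" "fv.span C = W" "card C = fv.dim W"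
   using fin_dim_basis_ex fin_dim_mono SGD(3,4)[OF B UW] by meson
  obtain b where "bij_betw b {..<card C} C" using C(1) by (metis bij_betw_from_nat_into_finite)
  thus "\<exists>b. inj_on b {..<fv.dim (snd (U, W))} \<and> fv.independent (b ` {..<fv.dim (snd (U, W))}) \<and>
   fv.span (b ` {..<fv.dim (snd (U, W))}) = snd (U, W)" using C by (intro exI[of _ b]) (auto simp: bij_betw_def)
 qed
 then obtain b where b: "!!p. p \<in> B ==> inj_on (b p) {..<fv.dim (snd p)} \<and> fv.independent (b p ` {..<fv.dim (snd p)}) \<and>
   fv.span (b p ` {..<fv.dim (snd p)}) = snd p" by metis
 \<comment> \<open>The index of a summand records only \<open>U\<close> and \<open>j\<close>; the
   subspace over \<open>U\<close> is recovered by its uniqueness in \<open>B\<close>.\<close>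
 define w where "w U = (THE W. (U, W) \<in> B)" for U
 have w: "w U = W" if "(U, W) \<in> B" for U W unfolding w_def using that SGD(6)[OF B that] by (rule the_equality)
 define v where "v = (\<lambda>(s, i). if s \<in> param_index A B then
   (case s of Inl z => t z | Inr (U, j) => b (U, w U) j) i else 0)"
 have vl: "slice (Inl z) v = t z" if "z \<in> A" for z using that by (auto simp: v_def param_index_def)
 have vr: "slice (Inr (U, j)) v = b (U, W) j" if "(U, W) \<in> B" "j < fv.dim W" for U W j
 proof -
  have "Inr (U, j) \<in> param_index A B" using that unfolding param_index_def by blast
  thus ?thesis using w[OF that(1)] by (simp add: v_def)
 qed
 have "param_vector T A B v" unfolding param_vector_def Let_def
 proof (intro conjI ballI)
  show "v \<in> mod_space (param_module T A B)" unfolding param_module_def in_dsum_family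
  proof (intro conjI ballI allI impI)
   fix s assume "s \<in> param_index A B"
   then consider z where "s = Inl z" "z \<in> A" | U W j where "s = Inr (U, j)" "(U, W) \<in> B" "j < fv.dim W"
    unfolding param_index_def by blast
   thus "slice s v \<in> mod_space (case_sum T fst s)"
   proof cases
    case 1 thus ?thesis using t(1) vl by simp
   next
    case 2
    have "b (U, W) j \<in> fv.span (b (U, W) ` {..<fv.dim W})" using 2 by (intro fv.span_base) auto
    hence "b (U, W) j \<in> mod_space U" using b[OF 2(2)] SGD(4)[OF B 2(2)] by auto
    thus ?thesis using vr[OF 2(2,3)] 2(1) by simp
   qed
  next
   fix s assume "s \<notin> param_index A B" thus "slice s v = 0" by (simp add: v_def fun_eq_iff fun_apps)
  qed
  show "slice (Inl z) v ~= 0" if "z \<in> A" for z using vl[OF that] t(2)[OF that] by simp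
  fix p assume p: "p \<in> B"
  obtain U W where UW: "p = (U, W)" by (cases p)
  have c: "(\<lambda>j. slice (Inr (U, j)) v) j = b p j" if "j \<in> {..<fv.dim W}" for j
   using vr[of U W j] p UW that by simp
  have im: "(\<lambda>j. slice (Inr (U, j)) v) ` {..<fv.dim W} = b p ` {..<fv.dim W}"
   by (rule image_cong[OF refl c])
  have "inj_on (\<lambda>j. slice (Inr (U, j)) v) {..<fv.dim W} \<longleftrightarrow> inj_on (b p) {..<fv.dim W}"
   by (rule inj_on_cong[OF c])
  thus "case p of (U, W) => inj_on (\<lambda>j. slice (Inr (U, j)) v) {..<fv.dim W} \<and>
    fv.independent ((\<lambda>j. slice (Inr (U, j)) v) ` {..<fv.dim W}) \<and>
    fv.span ((\<lambda>j. slice (Inr (U, j)) v) ` {..<fv.dim W}) = W" using b[OF p] im UW by simp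
 qed
 thus ?thesis by blast
qed

end

end

section \<open>Gliders\<close>

lemma gliderD:
 assumes "is_glider G M"
 shows "is_kgmod G M" "fv.subspace (lev_m1 M)" "fin_dim (lev_m1 M)" "fv.subspace (lev_0 M)" "fin_dim (lev_0 M)"
  "lev_m1 M \<subseteq> lev_0 M" "lev_0 M \<subseteq> mod_space M" "lev_m1 M \<subseteq> mod_space M" "galg_span G M (lev_m1 M) \<subseteq> lev_0 M"
 using assms unfolding is_glider_def by auto

definition Ann :: "('g, 'm) monoid_scheme => ('g, 'k::field, 'i) glider => ('g => 'k) set" where
 "Ann G M = {x \<in> galg G. \<forall>m\<in>lev_m1 M. galg_act G M x m = 0}"

text \<open>The pairing is that of the group algebra with functions on \<open>G\<close>. A set
  \<open>S\<close> enters only through its orthogonal complement, so sets of functions can stand in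
  for the subspaces they span.\<close>

definition perp :: "('g, 'm) monoid_scheme => ('g => 'k::field) set => ('g => 'k) set" where
 "perp G S = {x \<in> galg G. \<forall>c\<in>S. (\<Sum>g\<in>carrier G. x g * c g) = 0}"

text \<open>The coordinates of the orbit map of \<open>u\<close>. An element of the group algebra
  kills \<open>u\<close> exactly if it is orthogonal to all of them, so they encode the annihilator
  by functions, which can be multiplied.\<close>

definition coeff_funs :: "('g, 'k::field, 'i, 'z) kgmod_scheme => ('i => 'k) => ('g => 'k) set" where
 "coeff_funs M u = range (\<lambda>i g. mod_act M g u i)"

definition prod_set :: "('g => 'k::field) set => ('g => 'k) set => ('g => 'k) set" where
 "prod_set S S' = {\<lambda>g. c g * d g |c d. c \<in> S \<and> d \<in> S'}"

text \<open>One bijection replaces the pair of inverse morphisms in \<open>glider_iso\<close>.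
  Equivariance is asked on \<open>lev_m1\<close> only, so outside the submodule that it generates
  nothing but the linear structure of \<open>lev_0\<close> counts.\<close>

definition gl_iso_by ::
 "('g, 'm) monoid_scheme => ('g, 'k::field, 'i) glider => ('g, 'k, 'j) glider
   => (('i => 'k) => 'j => 'k) => bool" where
 "gl_iso_by G M N f \<longleftrightarrow> lin_on (lev_0 M) f \<and> bij_betw f (lev_0 M) (lev_0 N) \<and> f ` lev_m1 M = lev_m1 N \<and>
   (\<forall>g\<in>carrier G. \<forall>m\<in>lev_m1 M. f (mod_act M g m) = mod_act N g (f m))"

lemma gl_iso_byD:
 assumes "gl_iso_by G M N f"
 shows "lin_on (lev_0 M) f" "bij_betw f (lev_0 M) (lev_0 N)" "inj_on f (lev_0 M)" "f ` lev_0 M = lev_0 N"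
  "f ` lev_m1 M = lev_m1 N" "g \<in> carrier G ==> m \<in> lev_m1 M ==> f (mod_act M g m) = mod_act N g (f m)"
 using assms unfolding gl_iso_by_def bij_betw_def by auto

text \<open>\<open>lev_0\<close> may exceed the module generated by \<open>u\<close>. Tensor
  products of irreducible gliders are of this shape, and modulo length 0 the surplus
  disappears.\<close>

definition line_glider :: "('g, 'm) monoid_scheme => ('g, 'k::field, 'i) glider => ('i => 'k) => bool" where
 "line_glider G M u \<longleftrightarrow> is_glider G M \<and> u ~= 0 \<and> lev_m1 M = fv.span {u}"

text \<open>The common kernel of \<open>I\<close> on \<open>M\<^sub>-\<^sub>1\<close>, and the multiplicity in \<open>M\<close> of the irreducible glider with
 annihilator \<open>I\<close>.\<close>

definition kernel_of :: "('g, 'm) monoid_scheme => ('g => 'k::field) set => ('g, 'k, 'i) glider => ('i => 'k) set" where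
 "kernel_of G I M = {m \<in> lev_m1 M. \<forall>x\<in>I. galg_act G M x m = 0}"

definition multiplicity_of :: "('g, 'm) monoid_scheme => ('g => 'k::field) set => ('g, 'k, 'i) glider => int" where
 "multiplicity_of G I M = int (fv.dim (kernel_of G I M)) -
   int (fv.dim (fv.span (\<Union>x\<in>galg G - I. kernel_of G (insert x I) M)))"

section \<open>Isomorphisms of gliders and models over the natural numbers\<close>

context finite_grp
begin

lemma glider_act_closed:
 assumes M: "is_glider G M" and g: "g \<in> carrier G" and m: "m \<in> lev_m1 M"
 shows "mod_act M g m \<in> lev_0 M"
proof -
 have "mod_act M g m \<in> galg_span G M (lev_m1 M)" unfolding galg_span_eq_span
  by (intro fv.span_base) (use g m in blast)
 thus ?thesis using gliderD(9)[OF M] by blast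
qed

lemma galg_act_lev0:
 assumes M: "is_glider G M" and m: "m \<in> lev_m1 M" shows "galg_act G M x m \<in> lev_0 M" unfolding galg_act_def
 by (intro fv.subspace_sum fv.subspace_scale gliderD(4)[OF M] glider_act_closed[OF M _ m])

lemma is_gliderI:
 assumes "is_kgmod G M" "fv.subspace (lev_m1 M)" "fin_dim (lev_0 M)" "lev_m1 M \<subseteq> lev_0 M" "lev_0 M \<subseteq> mod_space M"
  "!!g m. g \<in> carrier G ==> m \<in> lev_m1 M ==> mod_act M g m \<in> lev_0 M"
 shows "is_glider G M" unfolding is_glider_def
proof (intro conjI assms fin_dim_subspace[OF assms(3)] fin_dim_mono[OF assms(3)])
 show "galg_span G M (lev_m1 M) \<subseteq> lev_0 M"
  unfolding galg_span_eq_span by (rule fv.span_minimal) (use assms(6) fin_dim_subspace[OF assms(3)] in auto)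
qed

lemma gl_iso_by_galg:
 assumes M: "is_glider G M" and f: "gl_iso_by G M N f" and m: "m \<in> lev_m1 M"
 shows "f (galg_act G M x m) = galg_act G N x (f m)"
proof -
 have "f (galg_act G M x m) = (\<Sum>g\<in>carrier G. f (fscale (x g) (mod_act M g m)))" unfolding galg_act_def
  by (rule lin_on_sum[OF gliderD(4)[OF M] gl_iso_byD(1)[OF f]])
   (intro fv.subspace_scale gliderD(4)[OF M] glider_act_closed[OF M _ m])
 also have "\<dots> = galg_act G N x (f m)" unfolding galg_act_def by (rule sum.cong[OF refl])
   (simp add: lin_on_scale[OF gl_iso_byD(1)[OF f]] glider_act_closed[OF M _ m] gl_iso_byD(6)[OF f] m)
 finally show ?thesis .
qed

lemma gl_iso_by_inverse:
 assumes M: "is_glider G M" and f: "gl_iso_by G M N f"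
 obtains h where "gl_iso_by G N M h" "!!m. m \<in> lev_0 M ==> h (f m) = m" "!!n. n \<in> lev_0 N ==> f (h n) = n"
proof -
 obtain h where h: "flin h" "!!v. v \<in> lev_0 M ==> h (f v) = v"
  by (rule lin_on_left_inverse[OF gliderD(4)[OF M] gl_iso_byD(1,3)[OF f]]) blast
 have 1: "h w \<in> lev_0 M" "f (h w) = w" if "w \<in> lev_0 N" for w
  using that h(2) unfolding gl_iso_byD(4)[OF f, symmetric] by auto
 have "h ` lev_m1 N = (\<lambda>x. h (f x)) ` lev_m1 M" unfolding gl_iso_byD(5)[OF f, symmetric] by (rule image_image)
 also have "\<dots> = (\<lambda>x. x) ` lev_m1 M" by (rule image_cong[OF refl h(2)]) (use gliderD(6)[OF M] in blast)
 finally have im: "h ` lev_m1 N = lev_m1 M" by simp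
 have "gl_iso_by G N M h" unfolding gl_iso_by_def
 proof (intro conjI ballI im)
  show "lin_on (lev_0 N) h" by (rule flin_lin_on[OF h(1)])
  show "bij_betw h (lev_0 N) (lev_0 M)" by (rule bij_betwI[where g=f]) (use 1 h(2) gl_iso_byD(4)[OF f] in auto)
  fix g n assume g: "g \<in> carrier G" and n: "n \<in> lev_m1 N"
  then obtain m where m: "m \<in> lev_m1 M" "n = f m" using gl_iso_byD(5)[OF f] by blast
  hence "mod_act N g n = f (mod_act M g m)" using gl_iso_byD(6)[OF f g] by simp
  thus "h (mod_act N g n) = mod_act M g (h n)" using h(2) m glider_act_closed[OF M g m(1)] gliderD(6)[OF M] by auto
 qed
 thus thesis using that h(2) 1(2) by blast
qed

lemma glider_iso_iff:
 assumes M: "is_glider G M" and N: "is_glider G N"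
 shows "glider_iso G M N \<longleftrightarrow> (\<exists>f. gl_iso_by G M N f)"
proof
 assume "glider_iso G M N"
 then obtain f h where f: "f \<in> glider_hom G M N" and h: "h \<in> glider_hom G N M"
  and fh: "!!m. m \<in> lev_0 M ==> h (f m) = m" "!!n. n \<in> lev_0 N ==> f (h n) = n"
  unfolding glider_iso_def by blast
 have "gl_iso_by G M N f" unfolding gl_iso_by_def
 proof (intro conjI ballI)
  show "lin_on (lev_0 M) f" using f unfolding glider_hom_def by blast
  show "bij_betw f (lev_0 M) (lev_0 N)"
   by (rule bij_betwI[where g=h]) (use f h fh in \<open>auto simp: glider_hom_def\<close>)
  show "f ` lev_m1 M = lev_m1 N"
  proof
   show "f ` lev_m1 M \<subseteq> lev_m1 N" using f unfolding glider_hom_def by blast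
   show "lev_m1 N \<subseteq> f ` lev_m1 M"
   proof
    fix n assume n: "n \<in> lev_m1 N"
    hence "h n \<in> lev_m1 M" using h unfolding glider_hom_def by blast
    moreover have "n = f (h n)" using fh(2) n gliderD(6)[OF N] by auto
    ultimately show "n \<in> f ` lev_m1 M" by blast
   qed
  qed
  fix g m assume g: "g \<in> carrier G" and m: "m \<in> lev_m1 M"
  have "f (galg_act G M (galg_of g) m) = galg_act G N (galg_of g) (f m)"
   using f m galg_of_galg[OF g] unfolding glider_hom_def by blast
  thus "f (mod_act M g m) = mod_act N g (f m)" using g by (simp add: galg_act_galg_of)
 qed
 thus "\<exists>f. gl_iso_by G M N f" by blast
next
 have hom: "f \<in> glider_hom G M N" if M: "is_glider G M" and f: "gl_iso_by G M N f"
  for M :: "('a, 'k::field, 'i) glider" and N :: "('a, 'k, 'j) glider" and f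
  unfolding glider_hom_def using gl_iso_byD[OF f] gl_iso_by_galg[OF M f] by auto
 assume "\<exists>f. gl_iso_by G M N f"
 then obtain f where f: "gl_iso_by G M N f" by blast
 obtain h where h: "gl_iso_by G N M h" "!!m. m \<in> lev_0 M ==> h (f m) = m" "!!n. n \<in> lev_0 N ==> f (h n) = n"
  by (rule gl_iso_by_inverse[OF M f]) blast
 show "glider_iso G M N" unfolding glider_iso_def using hom[OF M f] hom[OF N h(1)] h(2,3) by blast
qed

lemma glider_isoI: "is_glider G M ==> is_glider G N ==> gl_iso_by G M N f ==> glider_iso G M N"
 using glider_iso_iff by blast

lemma glider_iso_refl: "is_glider G M ==> glider_iso G M M"
 by (rule glider_isoI[where f="\<lambda>x. x"]) (auto simp: gl_iso_by_def flin_lin_on[OF flin_id] bij_betw_def)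

lemma glider_iso_sym: "is_glider G M ==> is_glider G N ==> glider_iso G M N ==> glider_iso G N M"
 unfolding glider_iso_def by blast

lemma glider_iso_trans:
 assumes M: "is_glider G M" and N: "is_glider G N" and P: "is_glider G P"
  and MN: "glider_iso G M N" and NP: "glider_iso G N P"
 shows "glider_iso G M P"
proof -
 obtain f h where f: "gl_iso_by G M N f" and h: "gl_iso_by G N P h"
  using MN NP glider_iso_iff[OF M N] glider_iso_iff[OF N P] by blast
 have "gl_iso_by G M P (\<lambda>x. h (f x))" unfolding gl_iso_by_def
 proof (intro conjI ballI)
  show "lin_on (lev_0 M) (\<lambda>x. h (f x))"
   by (rule lin_on_comp[OF gl_iso_byD(1)[OF f] _ gl_iso_byD(1)[OF h]]) (simp add: gl_iso_byD(4)[OF f])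
  show "bij_betw (\<lambda>x. h (f x)) (lev_0 M) (lev_0 P)"
   using bij_betw_trans[OF gl_iso_byD(2)[OF f] gl_iso_byD(2)[OF h]] by (simp add: o_def)
  show "(\<lambda>x. h (f x)) ` lev_m1 M = lev_m1 P"
   using gl_iso_byD(5)[OF f] gl_iso_byD(5)[OF h] by (metis image_image)
  fix g m assume g: "g \<in> carrier G" and m: "m \<in> lev_m1 M"
  hence "f m \<in> lev_m1 N" using gl_iso_byD(5)[OF f] by blast
  thus "h (f (mod_act M g m)) = mod_act P g (h (f m))" using gl_iso_byD(6)[OF f g m] gl_iso_byD(6)[OF h g] by simp
 qed
 thus ?thesis by (rule glider_isoI[OF M P])
qed

text \<open>\<open>mod_space M\<close> may be infinite-dimensional, but \<open>lev_0 M\<close> is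
  not, and over a finite group it generates a finite-dimensional submodule. That submodule can be
  put into coordinates, and isomorphism of gliders sees nothing beyond it.\<close>

lemma nat_model_exists:
 fixes M :: "('a, 'k::field, 'i) glider"
 assumes M: "is_glider G M"
 shows "\<exists>P. P \<in> nat_gliders G \<and> glider_iso G P M"
proof -
 note K = gliderD(1)[OF M]
 let ?S = "galg_span G M (lev_0 M)"
 have S: "submod G M ?S" by (rule galg_span_submod[OF K gliderD(7)[OF M]])
 have fS: "fin_dim ?S" by (rule galg_span_fin_dim[OF gliderD(5,7)[OF M] K])
 have LS: "lev_0 M \<subseteq> ?S" by (rule galg_span_base[OF K gliderD(7)[OF M]])
 let ?V = "\<lparr>mod_space = ?S, mod_act = mod_act M\<rparr>"
 have V: "is_kgmod G ?V" by (rule submod_kgmod[OF K S])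
 obtain F :: "_ => nat => 'k" where F: "flin F" "inj_on F ?S" by (rule exists_coordinates[OF fS])
 obtain h where h: "flin h" "!!v. v \<in> ?S ==> h (F v) = v"
  by (rule lin_on_left_inverse[OF submodD(1)[OF S] flin_lin_on[OF F(1)] F(2)]) blast
 define P where "P = \<lparr>mod_space = F ` ?S, mod_act = \<lambda>g w. F (mod_act M g (h w)), lev_m1 = F ` lev_m1 M, lev_0 = F ` lev_0 M\<rparr>"
 have P1: "is_kgmod G \<lparr>mod_space = F ` mod_space ?V, mod_act = \<lambda>g w. F (mod_act ?V g (h w))\<rparr>"
  by (rule transport_kgmod(1)[OF V F(1)]) (use F(2) h(2) in auto)
 have PG: "is_glider G P"
 proof (rule is_gliderI)
  show "is_kgmod G P" using P1 by (simp add: P_def is_kgmod_def)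
  show "fv.subspace (lev_m1 P)" using lin_on_image_subspace[OF gliderD(2)[OF M] flin_lin_on[OF F(1)]] by (simp add: P_def)
  show "fin_dim (lev_0 P)" using fin_dim_image[OF gliderD(5)[OF M] flin_lin_on[OF F(1)]] by (simp add: P_def)
  show "lev_m1 P \<subseteq> lev_0 P" using gliderD(6)[OF M] by (auto simp: P_def)
  show "lev_0 P \<subseteq> mod_space P" using LS by (auto simp: P_def)
  fix g m assume g: "g \<in> carrier G" and m: "m \<in> lev_m1 P"
  then obtain m' where m': "m' \<in> lev_m1 M" "m = F m'" by (auto simp: P_def)
  hence "h m = m'" using h(2) LS gliderD(6)[OF M] by auto
  thus "mod_act P g m \<in> lev_0 P" using glider_act_closed[OF M g m'(1)] by (simp add: P_def)
 qed
 have "gl_iso_by G M P F" unfolding gl_iso_by_def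
 proof (intro conjI ballI)
  show "lin_on (lev_0 M) F" by (rule flin_lin_on[OF F(1)])
  show "bij_betw F (lev_0 M) (lev_0 P)" using inj_on_subset[OF F(2) LS] by (simp add: bij_betw_def P_def)
  show "F ` lev_m1 M = lev_m1 P" by (simp add: P_def)
  fix g m assume "g \<in> carrier G" "m \<in> lev_m1 M"
  hence "h (F m) = m" using h(2) LS gliderD(6)[OF M] by auto
  thus "F (mod_act M g m) = mod_act P g (F m)" by (simp add: P_def)
 qed
 hence "glider_iso G P M" using glider_iso_sym[OF M PG] glider_isoI[OF M PG] by blast
 thus ?thesis using PG unfolding nat_gliders_def by blast
qed

lemma nat_model:
 assumes "is_glider G M"
 shows "nat_model G M \<in> nat_gliders G" "is_glider G (nat_model G M)" "glider_iso G (nat_model G M) M"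
 using someI_ex[OF nat_model_exists[OF assms]] unfolding nat_model_def nat_gliders_def by auto

subsection \<open>Multiplicities\<close>

lemma kernel_of_subspace:
 assumes M: "is_glider G M" shows "fv.subspace (kernel_of G I M)"
proof -
 note K = gliderD(1,2,8)[OF M]
 show ?thesis
 proof (rule fv.subspaceI)
  show "0 \<in> kernel_of G I M" using fv.subspace_0[OF K(2)] galg_act_zero[OF K(1)] by (simp add: kernel_of_def)
  fix u v assume "u \<in> kernel_of G I M" "v \<in> kernel_of G I M"
  thus "u + v \<in> kernel_of G I M"
   using K(3) by (auto simp: kernel_of_def fv.subspace_add[OF K(2)] lin_on_add[OF galg_act_lin_on[OF K(1)]] subsetD)
 next
  fix c u assume "u \<in> kernel_of G I M"
  thus "fscale c u \<in> kernel_of G I M"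
   using K(3) by (auto simp: kernel_of_def fv.subspace_scale[OF K(2)] lin_on_scale[OF galg_act_lin_on[OF K(1)]] subsetD)
 qed
qed

lemma kernel_of_fin_dim: "is_glider G M ==> fin_dim (kernel_of G I M)"
 by (rule fin_dim_mono[OF gliderD(3) kernel_of_subspace]) (auto simp: kernel_of_def)

lemma kernel_of_span_fin_dim:
 assumes "is_glider G M" shows "fin_dim (fv.span (\<Union>x\<in>J0. kernel_of G (J x) M))"
proof (rule fin_dim_mono[OF gliderD(3)[OF assms] fv.subspace_span])
 show "fv.span (\<Union>x\<in>J0. kernel_of G (J x) M) \<subseteq> lev_m1 M"
  by (rule fv.span_minimal[OF _ gliderD(2)[OF assms]]) (auto simp: kernel_of_def)
qed

lemma gl_iso_by_kernel:
 assumes M: "is_glider G M" and N: "is_glider G N" and f: "gl_iso_by G M N f"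
 shows "f ` kernel_of G I M = kernel_of G I N"
proof -
 have z: "galg_act G N x (f m) = 0 \<longleftrightarrow> galg_act G M x m = 0" if "m \<in> lev_m1 M" for x m
 proof -
  have "galg_act G N x (f m) = f (galg_act G M x m)" using gl_iso_by_galg[OF M f that] by simp
  moreover have "galg_act G M x m \<in> lev_0 M" by (rule galg_act_lev0[OF M that])
  ultimately show ?thesis
   using gl_iso_byD(1,3)[OF f] lin_on_0[OF gl_iso_byD(1)[OF f] fv.subspace_0[OF gliderD(4)[OF M]]]
    lin_on_inj_iff[OF gliderD(4)[OF M] gl_iso_byD(1)[OF f]] by auto
 qed
 show ?thesis unfolding kernel_of_def gl_iso_byD(5)[OF f, symmetric] using z by auto
qed

lemma multiplicity_iso:
 assumes M: "is_glider G M" and N: "is_glider G N" and "glider_iso G M N"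
 shows "multiplicity_of G I M = multiplicity_of G I N"
proof -
 obtain f where f: "gl_iso_by G M N f" using assms glider_iso_iff by blast
 have L: "lev_m1 M \<subseteq> lev_0 M" by (rule gliderD(6)[OF M])
 have lin: "lin_on V f" "inj_on f V" if "V \<subseteq> lev_m1 M" for V
  using lin_on_subset[OF gl_iso_byD(1)[OF f], of V] inj_on_subset[OF gl_iso_byD(3)[OF f], of V] that L by auto
 have kM: "kernel_of G J M \<subseteq> lev_m1 M" for J by (auto simp: kernel_of_def)
 have 1: "fv.dim (kernel_of G I N) = fv.dim (kernel_of G I M)" unfolding gl_iso_by_kernel[OF assms(1,2) f, symmetric]
  by (rule dim_image_inj[OF kernel_of_subspace[OF M] lin[OF kM]])
 let ?U = "\<lambda>M. \<Union>x\<in>galg G - I. kernel_of G (insert x I) M"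
 have sM: "fv.span (?U M) \<subseteq> lev_m1 M" by (rule fv.span_minimal[OF _ gliderD(2)[OF M]]) (use kM in blast)
 have "f ` fv.span (?U M) = fv.span (f ` ?U M)" by (rule lin_on_image_span[OF lin(1)[OF sM]])
 also have "f ` ?U M = (\<Union>x\<in>galg G - I. f ` kernel_of G (insert x I) M)" by blast
 also have "\<dots> = (\<Union>x\<in>galg G - I. kernel_of G (insert x I) N)"
  by (simp only: gl_iso_by_kernel[OF assms(1,2) f])
 finally have "fv.dim (fv.span (\<Union>x\<in>galg G - I. kernel_of G (insert x I) N)) = fv.dim (f ` fv.span (?U M))" by simp
 also have "\<dots> = fv.dim (fv.span (?U M))" by (rule dim_image_inj[OF fv.subspace_span lin[OF sM]])
 finally show ?thesis using 1 by (simp add: multiplicity_of_def)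
qed

lemma multiplicity_length0:
 assumes M: "is_glider G M" and "length0 M" shows "multiplicity_of G I M = 0"
proof -
 have k: "kernel_of G J M = {0}" for J
  using assms fv.subspace_0[OF kernel_of_subspace[OF M, of J]] by (auto simp: kernel_of_def length0_def)
 have "fv.span (\<Union>x\<in>galg G - I. kernel_of G (insert x I) M) = {0}"
 proof -
  have "fv.span (\<Union>x\<in>galg G - I. kernel_of G (insert x I) M) \<subseteq> {0}"
   by (rule fv.span_minimal) (auto simp: k)
  thus ?thesis using fv.span_zero by blast
 qed
 thus ?thesis by (simp only: multiplicity_of_def k dim_zero)
qed

lemma line_gliderD:
 assumes "line_glider G M u"
 shows "is_glider G M" "u ~= 0" "lev_m1 M = fv.span {u}" "u \<in> lev_m1 M" "u \<in> mod_space M" "u \<in> lev_0 M"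
proof -
 show 1: "is_glider G M" "u ~= 0" "lev_m1 M = fv.span {u}" using assms by (auto simp: line_glider_def)
 thus "u \<in> lev_m1 M" by (simp add: fv.span_base)
 thus "u \<in> mod_space M" "u \<in> lev_0 M" using gliderD(6,8)[OF 1(1)] by auto
qed

lemma Ann_line:
 assumes "line_glider G M u"
 shows "Ann G M = {x \<in> galg G. galg_act G M x u = 0}"
proof -
 note L = line_gliderD[OF assms]
 have "galg_act G M x m = 0" if x: "galg_act G M x u = 0" and m: "m \<in> lev_m1 M" for x m
 proof -
  obtain c where "m = fscale c u" using m L(3) by (auto simp: fv.span_singleton)
  thus ?thesis using x lin_on_scale[OF galg_act_lin_on[OF gliderD(1)[OF L(1)]] L(5), of x c] by simp
 qed
 thus ?thesis using L(4) by (auto simp: Ann_def)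
qed

lemma Ann_subset: "Ann G M \<subseteq> galg G" by (auto simp: Ann_def)

lemma irreducible_line:
 assumes "irreducible_glider G M"
 obtains u where "line_glider G M u" "lev_0 M = galg_span G M (lev_m1 M)"
proof -
 have M: "is_glider G M" "fv.dim (lev_m1 M) = 1" "lev_0 M = galg_span G M (lev_m1 M)"
  using assms by (auto simp: irreducible_glider_def)
 obtain u where "u \<in> lev_m1 M" "u ~= 0" using dim_pos_nonzero[of "lev_m1 M"] M(2) by auto
 hence "line_glider G M u" using M dim_1_line[OF gliderD(2)[OF M(1)] M(2)] by (simp add: line_glider_def)
 thus thesis using that M(3) by blast
qed

lemma line_irreducible:
 assumes "line_glider G M u" "lev_0 M = galg_span G M (lev_m1 M)" shows "irreducible_glider G M"
 using assms line_gliderD[OF assms(1)] dim_line by (simp add: irreducible_glider_def)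

text \<open>On a line the kernel of a set is everything if the set lies in the annihilator, and 0
  otherwise. So the first dimension tests \<open>I \<subseteq> Ann G M\<close>, and the subtracted
  one tests whether some further \<open>x\<close> is still killed, that is, strict
  inclusion.\<close>

lemma multiplicity_line:
 assumes L: "line_glider G M u" and I: "I \<subseteq> galg G"
 shows "multiplicity_of G I M = (if I = Ann G M then 1 else 0)"
proof -
 note LM = line_gliderD[OF L]
 have k: "kernel_of G J M = (if J \<subseteq> Ann G M then lev_m1 M else {0})" if J: "J \<subseteq> galg G" for J
 proof (cases "J \<subseteq> Ann G M")
  case True thus ?thesis by (auto simp: kernel_of_def Ann_def)
 next
  case False
  then obtain x where x: "x \<in> J" "galg_act G M x u ~= 0" unfolding Ann_line[OF L] using J by blast
  have "m = 0" if m: "m \<in> kernel_of G J M" for m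
  proof -
   obtain c where c: "m = fscale c u" using m LM(3) by (auto simp: fv.span_singleton kernel_of_def)
   have "galg_act G M x m = 0" using m x by (simp add: kernel_of_def)
   hence "fscale c (galg_act G M x u) = 0"
    using lin_on_scale[OF galg_act_lin_on[OF gliderD(1)[OF LM(1)]] LM(5), of x c] c by simp
   thus ?thesis using x(2) c by simp
  qed
  thus ?thesis using False fv.subspace_0[OF kernel_of_subspace[OF LM(1)]] by auto
 qed
 have k': "kernel_of G (insert x I) M = (if insert x I \<subseteq> Ann G M then lev_m1 M else {0})" if "x \<in> galg G - I" for x
  using k[of "insert x I"] that I by simp
 let ?U = "\<Union>x\<in>galg G - I. kernel_of G (insert x I) M"
 have U: "fv.span ?U = (if I \<subset> Ann G M then lev_m1 M else {0})"
 proof (cases "I \<subset> Ann G M")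
  case True
  then obtain x where "x \<in> Ann G M" "x \<notin> I" by blast
  hence x: "x \<in> galg G - I" "insert x I \<subseteq> Ann G M" using True Ann_subset by auto
  hence "lev_m1 M \<subseteq> ?U" using k'[OF x(1)] by auto
  moreover have "?U \<subseteq> lev_m1 M" by (auto simp: kernel_of_def)
  ultimately have "?U = lev_m1 M" by blast
  thus ?thesis using True gliderD(2)[OF LM(1)] by simp
 next
  case False
  have "kernel_of G (insert x I) M = {0}" if "x \<in> galg G - I" for x
  proof -
   have "\<not> insert x I \<subseteq> Ann G M" using that False by blast
   thus ?thesis unfolding k'[OF that] by (rule if_not_P)
  qed
  hence "?U \<subseteq> {0}" by blast
  hence "fv.span ?U \<subseteq> {0}" by (simp add: fv.span_minimal)
  thus ?thesis using False fv.span_zero by auto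
 qed
 have d: "fv.dim (lev_m1 M) = 1" unfolding LM(3) by (rule dim_line[OF LM(2)])
 show ?thesis unfolding multiplicity_of_def U k[OF I] using d dim_zero by (auto simp: psubset_eq)
qed

lemma line_glider_span:
 assumes "line_glider G P w"
 shows "galg_span G P (lev_m1 P) = (\<lambda>x. galg_act G P x w) ` galg G"
proof -
 note W = line_gliderD[OF assms] and K = gliderD(1)[OF line_gliderD(1)[OF assms]]
 have "galg_span G P (lev_m1 P) \<subseteq> galg_span G P {w}" unfolding galg_span_eq_span
 proof (rule fv.span_minimal, clarify)
  fix g m assume g: "g \<in> carrier G" and "m \<in> lev_m1 P"
  then obtain c where c: "m = fscale c w" using W(3) by (auto simp: fv.span_singleton)
  have "mod_act P g m = fscale c (mod_act P g w)" using c lin_on_scale[OF kgmodD(3)[OF K g] W(5)] by simp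
  moreover have "mod_act P g w \<in> fv.span {mod_act P g v |g v. g \<in> carrier G \<and> v \<in> {w}}"
   by (rule fv.span_base) (use g in blast)
  ultimately show "mod_act P g m \<in> fv.span {mod_act P g v |g v. g \<in> carrier G \<and> v \<in> {w}}"
   by (simp add: fv.span_scale)
 qed simp
 moreover have "galg_span G P {w} \<subseteq> galg_span G P (lev_m1 P)"
  unfolding galg_span_def by (rule fv.span_mono) (use W(4) in blast)
 ultimately show ?thesis using galg_span_singleton[OF K W(5)] by simp
qed

text \<open>Both gliders are the group algebra modulo the common annihilator, with the class of 1 as
  the distinguished generator. The isomorphism matches the images of the two generators under the
  same \<open>x\<close>.\<close>

lemma irreducible_iso_Ann:
 assumes M: "irreducible_glider G M" and N: "irreducible_glider G N" and A: "Ann G M = Ann G N"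
 shows "glider_iso G M N"
proof -
 obtain u where u: "line_glider G M u" "lev_0 M = galg_span G M (lev_m1 M)" by (rule irreducible_line[OF M])
 obtain v where v: "line_glider G N v" "lev_0 N = galg_span G N (lev_m1 N)" by (rule irreducible_line[OF N])
 note U = line_gliderD[OF u(1)] and V = line_gliderD[OF v(1)]
 have spM: "lev_0 M = (\<lambda>x. galg_act G M x u) ` galg G" using u(2) line_glider_span[OF u(1)] by simp
 have spN: "lev_0 N = (\<lambda>x. galg_act G N x v) ` galg G" using v(2) line_glider_span[OF v(1)] by simp
 have eq: "galg_act G M x u = galg_act G M y u \<longleftrightarrow> galg_act G N x v = galg_act G N y v"
  if "x \<in> galg G" "y \<in> galg G" for x y
 proof -
  have "x - y \<in> galg G" using that by (simp add: fv.subspace_diff galg_subspace)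
  hence "galg_act G M (x - y) u = 0 \<longleftrightarrow> galg_act G N (x - y) v = 0"
   using A unfolding Ann_line[OF u(1)] Ann_line[OF v(1)] by blast
  thus ?thesis by (simp add: galg_act_lin_left)
 qed
 \<comment> \<open>\<open>r m\<close> is some element of the group algebra carrying \<open>u\<close>
   to \<open>m\<close>; by \<open>eq\<close> its effect on \<open>v\<close> does not depend on the
   choice.\<close>
 define r where "r m = (SOME x. x \<in> galg G \<and> galg_act G M x u = m)" for m
 have r: "r m \<in> galg G" "galg_act G M (r m) u = m" if "m \<in> lev_0 M" for m
 proof -
  have "\<exists>x. x \<in> galg G \<and> galg_act G M x u = m" using that unfolding spM by blast
  thus "r m \<in> galg G" "galg_act G M (r m) u = m" unfolding r_def by (rule someI2_ex, blast)+
 qed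
 define f where "f m = galg_act G N (r m) v" for m
 have f: "f (galg_act G M x u) = galg_act G N x v" if "x \<in> galg G" for x
 proof -
  have m: "galg_act G M x u \<in> lev_0 M" using that unfolding spM by blast
  show ?thesis unfolding f_def using eq[OF r(1)[OF m] that] r(2)[OF m] by simp
 qed
 have "gl_iso_by G M N f" unfolding gl_iso_by_def
 proof (intro conjI ballI)
  show "lin_on (lev_0 M) f"
  proof (rule lin_onI)
   fix m m' assume "m \<in> lev_0 M" "m' \<in> lev_0 M"
   then obtain x y where xy: "x \<in> galg G" "m = galg_act G M x u" "y \<in> galg G" "m' = galg_act G M y u" unfolding spM by blast
   have "m + m' = galg_act G M (x + y) u" "x + y \<in> galg G" using xy by (simp_all add: galg_act_lin_left fv.subspace_add galg_subspace)
   thus "f (m + m') = f m + f m'" using f[of "x + y"] f[of x] f[of y] xy by (simp add: galg_act_lin_left)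
  next
   fix c m assume "m \<in> lev_0 M"
   then obtain x where x: "x \<in> galg G" "m = galg_act G M x u" unfolding spM by blast
   have "fscale c m = galg_act G M (fscale c x) u" "fscale c x \<in> galg G" using x by (simp_all add: galg_act_lin_left fv.subspace_scale galg_subspace)
   thus "f (fscale c m) = fscale c (f m)" using f[of "fscale c x"] f[of x] x by (simp add: galg_act_lin_left)
  qed
  show "bij_betw f (lev_0 M) (lev_0 N)" unfolding bij_betw_def
  proof
   show "inj_on f (lev_0 M)" unfolding spM by (rule inj_onI) (use f eq in auto)
   have "f ` lev_0 M = (\<lambda>x. galg_act G N x v) ` galg G" unfolding spM image_image by (rule image_cong[OF refl f])
   also have "\<dots> = lev_0 N" by (rule spN[symmetric])
   finally show "f ` lev_0 M = lev_0 N" .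
  qed
  have f1: "f u = v"
  proof -
   have "galg_act G M (galg_of \<one>) u = u" "galg_act G N (galg_of \<one>) v = v"
    using kgmodD(4)[OF gliderD(1)[OF U(1)] U(5)] kgmodD(4)[OF gliderD(1)[OF V(1)] V(5)] by (simp_all add: galg_act_galg_of)
   thus ?thesis using f[OF galg_of_galg[of \<one> G]] by simp
  qed
  have lin: "f (fscale c u) = fscale c v" for c
  proof -
   have "fscale c u = galg_act G M (fscale c (galg_of \<one>)) u" "fscale c v = galg_act G N (fscale c (galg_of \<one>)) v"
    using kgmodD(4)[OF gliderD(1)[OF U(1)] U(5)] kgmodD(4)[OF gliderD(1)[OF V(1)] V(5)]
    by (simp_all add: galg_act_galg_of galg_act_lin_left)
   thus ?thesis using f[of "fscale c (galg_of \<one>)"] by (simp add: fv.subspace_scale galg_subspace galg_of_galg)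
  qed
  show "f ` lev_m1 M = lev_m1 N" unfolding U(3) V(3) fv.span_singleton image_image using lin by simp
  fix g m assume g: "g \<in> carrier G" and m: "m \<in> lev_m1 M"
  then obtain c where c: "m = fscale c u" using U(3) by (auto simp: fv.span_singleton)
  have "mod_act M g m = galg_act G M (fscale c (galg_of g)) u"
   using c g lin_on_scale[OF kgmodD(3)[OF gliderD(1)[OF U(1)] g] U(5)] by (simp add: galg_act_lin_left galg_act_galg_of)
  moreover have "mod_act N g (f m) = galg_act G N (fscale c (galg_of g)) v"
   using c g lin lin_on_scale[OF kgmodD(3)[OF gliderD(1)[OF V(1)] g] V(5)] by (simp add: galg_act_lin_left galg_act_galg_of)
  moreover have "fscale c (galg_of g) \<in> galg G" using g by (simp add: fv.subspace_scale galg_subspace galg_of_galg)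
  ultimately show "f (mod_act M g m) = mod_act N g (f m)" using f by simp
 qed
 thus ?thesis by (rule glider_isoI[OF U(1) V(1)])
qed

lemma Ann_iso:
 assumes M: "is_glider G M" and N: "is_glider G N" and "glider_iso G M N"
 shows "Ann G M = Ann G N"
proof -
 obtain f where f: "gl_iso_by G M N f" using assms glider_iso_iff by blast
 have z: "galg_act G N x (f m) = 0 \<longleftrightarrow> galg_act G M x m = 0" if "m \<in> lev_m1 M" for x m
 proof -
  have "galg_act G N x (f m) = f (galg_act G M x m)" using gl_iso_by_galg[OF M f that] by simp
  moreover have "galg_act G M x m \<in> lev_0 M" by (rule galg_act_lev0[OF M that])
  ultimately show ?thesis
   using gl_iso_byD(1,3)[OF f] lin_on_0[OF gl_iso_byD(1)[OF f] fv.subspace_0[OF gliderD(4)[OF M]]]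
    lin_on_inj_iff[OF gliderD(4)[OF M] gl_iso_byD(1)[OF f]] by auto
 qed
 show ?thesis unfolding Ann_def gl_iso_byD(5)[OF f, symmetric] using z by auto
qed

lemma irreducible_iso:
 assumes M: "irreducible_glider G M" and N: "is_glider G N" and i: "glider_iso G M N"
 shows "irreducible_glider G N"
proof -
 have gM: "is_glider G M" using M by (simp add: irreducible_glider_def)
 obtain f where f: "gl_iso_by G M N f" using i glider_iso_iff[OF gM N] by blast
 have L: "lev_m1 M \<subseteq> lev_0 M" by (rule gliderD(6)[OF gM])
 have "fv.dim (lev_m1 N) = 1" unfolding gl_iso_byD(5)[OF f, symmetric]
  using dim_image_inj[OF gliderD(2)[OF gM] lin_on_subset[OF gl_iso_byD(1)[OF f] L] inj_on_subset[OF gl_iso_byD(3)[OF f] L]] M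
  by (simp add: irreducible_glider_def)
 moreover have "lev_0 N = galg_span G N (lev_m1 N)"
 proof -
  let ?A = "{mod_act M g m |g m. g \<in> carrier G \<and> m \<in> lev_m1 M}"
  have sp: "lev_0 M = fv.span ?A" using M by (simp add: irreducible_glider_def galg_span_eq_span)
  have "lev_0 N = f ` fv.span ?A" using gl_iso_byD(4)[OF f] sp by simp
  also have "\<dots> = fv.span (f ` ?A)" by (rule lin_on_image_span) (use gl_iso_byD(1)[OF f] sp in simp)
  also have "f ` ?A = {mod_act N g n |g n. g \<in> carrier G \<and> n \<in> lev_m1 N}"
   unfolding gl_iso_byD(5)[OF f, symmetric] using gl_iso_byD(6)[OF f] by (auto simp: image_def) metis+
  finally show ?thesis by (simp add: galg_span_eq_span)
 qed
 ultimately show ?thesis using N by (simp add: irreducible_glider_def)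
qed

subsection \<open>Annihilators and coordinate functions\<close>

lemma galg_act_eq_0_iff:
 "galg_act G M x u = 0 \<longleftrightarrow> (\<forall>c\<in>coeff_funs M u. (\<Sum>g\<in>carrier G. x g * c g) = 0)"
 by (auto simp: galg_act_def coeff_funs_def fun_eq_iff sum_fun_apply fun_apps)

lemma Ann_perp: "line_glider G M u ==> Ann G M = perp G (coeff_funs M u)"
 unfolding Ann_line perp_def galg_act_eq_0_iff by simp

text \<open>A factor \<open>d\<close> can be moved to the other side of the pairing:
  \<open>x\<close> is orthogonal to all products with \<open>d\<close> iff the pointwise product of
  \<open>x\<close> and \<open>d\<close> is orthogonal to \<open>S\<close>. So the annihilator of a
  tensor product depends only on the annihilators of its factors.\<close>

lemma perp_prod_set_left:
 fixes S :: "('a => 'k::field) set"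
 assumes "perp G S = perp G S'" shows "perp G (prod_set S R) = perp G (prod_set S' R)"
proof -
 have *: "x \<in> perp G (prod_set S R) \<longleftrightarrow> x \<in> galg G \<and> (\<forall>d\<in>R. (\<lambda>g. x g * d g) \<in> perp G S)"
  for x S and R :: "('a => 'k) set"
 proof -
  have "(\<lambda>g. x g * d g) \<in> galg G" if "x \<in> galg G" for d using that by (simp add: galg_def)
  moreover have "(\<Sum>g\<in>carrier G. x g * d g * c g) = (\<Sum>g\<in>carrier G. x g * (c g * d g))" for c d
   by (rule sum.cong) (simp_all add: mult_ac)
  ultimately show ?thesis unfolding perp_def prod_set_def by fastforce
 qed
 show ?thesis using * assms by blast
qed

lemma prod_set_commute: "prod_set S R = prod_set R S"
 unfolding prod_set_def by (auto simp: mult.commute) (metis mult.commute)+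

lemma perp_prod_set:
 assumes "perp G S = perp G S'" "perp G R = perp G R'"
 shows "perp G (prod_set S R) = perp G (prod_set S' R')"
 using perp_prod_set_left[OF assms(1), of R] perp_prod_set_left[OF assms(2), of S'] prod_set_commute by metis

end

subsection \<open>Direct sums and tensor products of gliders\<close>

lemma dmap_lin_on:
 assumes "lin_on U f" "lin_on V f'" shows "lin_on (dsum_space U V) (dmap f f')" by (rule lin_onI)
  (auto simp: dsum_space_iff dmap_def comp_Inl_lin lin_on_add[OF assms(1)] lin_on_add[OF assms(2)]
   lin_on_scale[OF assms(1)] lin_on_scale[OF assms(2)] case_sum_lin)

lemma case_sum_comp [simp]: "case_sum u v \<circ> Inl = u" "case_sum u v \<circ> Inr = v"
 by (auto simp: comp_def)

lemma case_sum_eq_self: "case_sum (w \<circ> Inl) (w \<circ> Inr) = w"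
 by (auto simp: fun_eq_iff split: sum.split)

lemma tens_pure_image: "{tens u v |u v. u \<in> U \<and> v \<in> V} = (\<lambda>(u, v). tens u v) ` (U \<times> V)"
 by auto

text \<open>Distributivity of the tensor product over the direct sum; on functions it is a mere
  regrouping of indices.\<close>

definition dsum_tens :: "(('i + 'j) \<times> 'q => 'k) => ('i \<times> 'q) + ('j \<times> 'q) => 'k" where
 "dsum_tens w = case_sum (\<lambda>(i, q). w (Inl i, q)) (\<lambda>(j, q). w (Inr j, q))"

lemma flin_dsum_tens: "flin dsum_tens"
 by (rule flinI) (auto simp: dsum_tens_def fun_eq_iff fun_apps split: sum.split)

lemma inj_dsum_tens: "inj dsum_tens"
proof (rule injI, rule ext)
 fix w w' :: "('a + 'b) \<times> 'c => 'd" and p :: "('a + 'b) \<times> 'c" assume e: "dsum_tens w = dsum_tens w'"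
 obtain s q where p: "p = (s, q)" by (cases p)
 show "w p = w' p"
 proof (cases s)
  case (Inl i) thus ?thesis using fun_cong[OF e, of "Inl (i, q)"] p by (simp add: dsum_tens_def)
 next
  case (Inr i) thus ?thesis using fun_cong[OF e, of "Inr (i, q)"] p by (simp add: dsum_tens_def)
 qed
qed

lemma dsum_tens_pure: "dsum_tens (tens (case_sum a b) c) = case_sum (tens a c) (tens b c)"
 by (auto simp: dsum_tens_def fun_eq_iff split: sum.split)

lemma dsum_tens_image:
 fixes U :: "('i => 'k::field) set" and V :: "('j => 'k) set" and Q :: "('q => 'k) set"
 assumes U: "fv.subspace U" and V: "fv.subspace V" and Q: "fv.subspace Q"
 shows "dsum_tens ` tens_space (dsum_space U V) Q = dsum_space (tens_space U Q) (tens_space V Q)" (is "?L = ?R")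
proof
 have L: "fv.subspace ?L" by (rule lin_on_image_subspace[OF tens_subspace flin_lin_on[OF flin_dsum_tens]])
 have R: "fv.subspace ?R" by (intro dsum_subspace tens_subspace)
 show "?L \<subseteq> ?R"
 proof clarify
  fix w assume "w \<in> tens_space (dsum_space U V) Q"
  thus "dsum_tens w \<in> ?R" using dsum_subspace[OF U V] Q
  proof (induct rule: tens_space_induct)
   case zero thus ?case using fv.subspace_0[OF R] by (simp add: flin_0[OF flin_dsum_tens])
  next
   case (add w w') thus ?case by (simp add: flin_add[OF flin_dsum_tens] fv.subspace_add[OF R])
  next
   case (tens u q)
   then obtain a b where "u = case_sum a b" "a \<in> U" "b \<in> V" by (auto simp: dsum_space_def)
   thus ?case using tens(2) by (simp add: dsum_tens_pure dsum_spaceI tens_in_space)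
  qed
 qed
 have 1: "case_sum w 0 \<in> ?L" if "w \<in> tens_space U Q" for w using that U Q
 proof (induct rule: tens_space_induct)
  case zero thus ?case using fv.subspace_0[OF L] by (simp add: case_sum_lin)
 next
  case (add w w')
  have "case_sum (w + w') 0 = case_sum w 0 + case_sum w' (0 :: 'j \<times> 'q => 'k)" by (simp add: case_sum_lin(1)[symmetric])
  thus ?case using add fv.subspace_add[OF L] by simp
 next
  case (tens u q)
  have "case_sum (tens u q) 0 = dsum_tens (tens (case_sum u 0) q)" by (simp add: dsum_tens_pure tens_lin)
  thus ?case using tens fv.subspace_0[OF V] by (auto intro!: imageI tens_in_space dsum_spaceI)
 qed
 have 2: "case_sum 0 w \<in> ?L" if "w \<in> tens_space V Q" for w using that V Q
 proof (induct rule: tens_space_induct)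
  case zero thus ?case using fv.subspace_0[OF L] by (simp add: case_sum_lin)
 next
  case (add w w')
  have "case_sum 0 (w + w') = case_sum (0 :: 'i \<times> 'q => 'k) w + case_sum 0 w'" by (simp add: case_sum_lin(1)[symmetric])
  thus ?case using add fv.subspace_add[OF L] by simp
 next
  case (tens u q)
  have "case_sum 0 (tens u q) = dsum_tens (tens (case_sum 0 u) q)" by (simp add: dsum_tens_pure tens_lin)
  thus ?case using tens fv.subspace_0[OF U] by (auto intro!: imageI tens_in_space dsum_spaceI)
 qed
 show "?R \<subseteq> ?L"
 proof
  fix w assume "w \<in> ?R"
  then obtain a b where w: "w = case_sum a b" "a \<in> tens_space U Q" "b \<in> tens_space V Q" by (auto simp: dsum_space_def)
  have "w = case_sum a 0 + case_sum 0 b" using w(1) by (simp add: case_sum_lin(1)[symmetric])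
  thus "w \<in> ?L" using 1[OF w(2)] 2[OF w(3)] fv.subspace_add[OF L] by simp
 qed
qed

definition tens_swap :: "('i \<times> 'j => 'k) => 'j \<times> 'i => 'k" where
 "tens_swap w = (\<lambda>(j, i). w (i, j))"

lemma flin_tens_swap: "flin tens_swap"
 by (rule flinI) (auto simp: tens_swap_def fun_eq_iff fun_apps)

lemma tens_swap_swap [simp]: "tens_swap (tens_swap w) = w"
 by (auto simp: tens_swap_def fun_eq_iff)

lemma tens_swap_pure [simp]: "tens_swap (tens u v) = tens v u"
 by (auto simp: tens_swap_def fun_eq_iff)

lemma tens_swap_image: "tens_swap ` tens_space U V = tens_space V U"
proof -
 have "tens_swap ` {tens u v |u v. u \<in> U \<and> v \<in> V} = {tens v u |v u. v \<in> V \<and> u \<in> U}"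
  unfolding tens_pure_image image_image by force
 thus ?thesis unfolding tens_space_def
  using fvp.linear_span_image[OF flin_tens_swap, of "{tens u v |u v. u \<in> U \<and> v \<in> V}"] by simp
qed

context finite_grp
begin

lemma dsum_glider_simps [simp]:
 "mod_space (dsum_glider M N) = dsum_space (mod_space M) (mod_space N)"
 "mod_act (dsum_glider M N) g = dmap (mod_act M g) (mod_act N g)"
 "lev_m1 (dsum_glider M N) = dsum_space (lev_m1 M) (lev_m1 N)"
 "lev_0 (dsum_glider M N) = dsum_space (lev_0 M) (lev_0 N)" by (simp_all add: dsum_glider_def dsum_map_eq_dmap)

lemma tensor_glider_simps [simp]:
 "mod_space (tensor_glider M N) = tens_space (mod_space M) (mod_space N)"
 "mod_act (tensor_glider M N) g = tmap (mod_act M g) (mod_act N g)"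
 "lev_m1 (tensor_glider M N) = tens_space (lev_m1 M) (lev_m1 N)"
 "lev_0 (tensor_glider M N) = tens_space (lev_0 M) (lev_0 N)" by (simp_all add: tensor_glider_def tens_map_eq_tmap)

lemma dsum_is_glider:
 assumes M: "is_glider G M" and N: "is_glider G N" shows "is_glider G (dsum_glider M N)"
proof (rule is_gliderI)
 note K = kgmodD[OF gliderD(1)[OF M]] and L = kgmodD[OF gliderD(1)[OF N]]
 show "is_kgmod G (dsum_glider M N)" unfolding is_kgmod_def
 proof (intro conjI ballI)
  show "fv.subspace (mod_space (dsum_glider M N))" using dsum_subspace[OF K(1) L(1)] by simp
  fix g assume g: "g \<in> carrier G"
  show "mod_act (dsum_glider M N) g \<in> mod_space (dsum_glider M N) \<rightarrow> mod_space (dsum_glider M N)"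
   using K(2)[OF g] L(2)[OF g] by (auto simp: dsum_space_iff dmap_def)
  show "lin_on (mod_space (dsum_glider M N)) (mod_act (dsum_glider M N) g)"
   using dmap_lin_on[OF K(3)[OF g] L(3)[OF g]] by simp
 next
  fix v assume "v \<in> mod_space (dsum_glider M N)"
  thus "mod_act (dsum_glider M N) \<one> v = v" by (simp add: dsum_space_iff dmap_def K(4) L(4) case_sum_eq_self)
 next
  fix g h v assume "g \<in> carrier G" "h \<in> carrier G" "v \<in> mod_space (dsum_glider M N)"
  thus "mod_act (dsum_glider M N) (g \<otimes> h) v = mod_act (dsum_glider M N) g (mod_act (dsum_glider M N) h v)"
   by (simp add: dsum_space_iff dmap_def K(5) L(5))
 qed
 show "fv.subspace (lev_m1 (dsum_glider M N))" using dsum_subspace[OF gliderD(2)[OF M] gliderD(2)[OF N]] by simp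
 show "fin_dim (lev_0 (dsum_glider M N))" using fin_dim_dsum[OF gliderD(5)[OF M] gliderD(5)[OF N]] by simp
 show "lev_m1 (dsum_glider M N) \<subseteq> lev_0 (dsum_glider M N)" "lev_0 (dsum_glider M N) \<subseteq> mod_space (dsum_glider M N)"
  using gliderD(6,7)[OF M] gliderD(6,7)[OF N] by (auto simp: dsum_space_iff)
 fix g m assume "g \<in> carrier G" "m \<in> lev_m1 (dsum_glider M N)"
 thus "mod_act (dsum_glider M N) g m \<in> lev_0 (dsum_glider M N)"
  using glider_act_closed[OF M] glider_act_closed[OF N] by (simp add: dsum_space_iff dmap_def)
qed

lemma galg_act_dsum_glider:
 "galg_act G (dsum_glider M N) x w = case_sum (galg_act G M x (w \<circ> Inl)) (galg_act G N x (w \<circ> Inr))"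
 by (auto simp: galg_act_def dsum_glider_def dsum_map_def fun_eq_iff sum_fun_apply fun_apps split: sum.split)

lemma kernel_of_dsum:
 "kernel_of G I (dsum_glider (M :: ('a, 'k::field, 'i) glider) (N :: ('a, 'k, 'j) glider)) = dsum_space (kernel_of G I M) (kernel_of G I N)"
proof -
 have z: "case_sum (a :: 'i => 'k::field) (b :: 'j => 'k) = 0 \<longleftrightarrow> a = 0 \<and> b = 0" for a b
  by (auto simp: fun_eq_iff fun_apps split: sum.split_asm sum.split)
 show ?thesis by (auto simp: kernel_of_def dsum_space_iff galg_act_dsum_glider z)
qed

lemma span_dsum_UN:
 fixes A :: "'x => ('i => 'k::field) set" and B :: "'x => ('j => 'k) set"
 assumes A: "!!x. x \<in> J0 ==> 0 \<in> A x" and B: "!!x. x \<in> J0 ==> 0 \<in> B x"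
 shows "fv.span (\<Union>x\<in>J0. dsum_space (A x) (B x)) = dsum_space (fv.span (\<Union>x\<in>J0. A x)) (fv.span (\<Union>x\<in>J0. B x))"
  (is "?L = ?R")
proof
 show "?L \<subseteq> ?R"
 proof (rule fv.span_minimal)
  show "(\<Union>x\<in>J0. dsum_space (A x) (B x)) \<subseteq> ?R"
  proof clarify
   fix w x assume x: "x \<in> J0" and w: "w \<in> dsum_space (A x) (B x)"
   have "w \<circ> Inl \<in> fv.span (\<Union>x\<in>J0. A x)" by (rule fv.span_base) (use x dsum_spaceD[OF w] in blast)
   moreover have "w \<circ> Inr \<in> fv.span (\<Union>x\<in>J0. B x)" by (rule fv.span_base) (use x dsum_spaceD[OF w] in blast)
   ultimately show "w \<in> ?R" by (simp add: dsum_space_iff)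
  qed
 qed (intro dsum_subspace fv.subspace_span)
 show "?R \<subseteq> ?L"
 proof
  fix w assume "w \<in> ?R"
  then obtain a b where w: "w = case_sum a b" "a \<in> fv.span (\<Union>x\<in>J0. A x)" "b \<in> fv.span (\<Union>x\<in>J0. B x)" by (auto simp: dsum_space_def)
  have f1: "flin (\<lambda>u :: 'i => 'k. case_sum u (0 :: 'j => 'k))" and f2: "flin (\<lambda>u :: 'j => 'k. case_sum (0 :: 'i => 'k) u)"
   by (rule flin_injections)+
  let ?l = "\<lambda>u :: 'i => 'k. case_sum u (0 :: 'j => 'k)" and ?r = "\<lambda>u :: 'j => 'k. case_sum (0 :: 'i => 'k) u"
  have "?l a \<in> fv.span (?l ` (\<Union>x\<in>J0. A x))"
   unfolding fvp.linear_span_image[OF f1] using w(2) by blast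
  also have "\<dots> \<subseteq> ?L" by (rule fv.span_mono) (use B in \<open>auto intro!: dsum_spaceI\<close>)
  finally have 1: "case_sum a 0 \<in> ?L" .
  have "?r b \<in> fv.span (?r ` (\<Union>x\<in>J0. B x))"
   unfolding fvp.linear_span_image[OF f2] using w(3) by blast
  also have "\<dots> \<subseteq> ?L" by (rule fv.span_mono) (use A in \<open>auto intro!: dsum_spaceI\<close>)
  finally have 2: "case_sum 0 b \<in> ?L" .
  have "w = case_sum a 0 + case_sum 0 b" using w(1) by (simp add: case_sum_lin(1)[symmetric])
  thus "w \<in> ?L" using 1 2 fv.span_add by simp
 qed
qed

text \<open>Kernels split along the direct sum, and so do spans of families of kernels, because each
  kernel contains 0. Dimensions then add up.\<close>

lemma multiplicity_dsum:
 assumes M: "is_glider G M" and N: "is_glider G N"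
 shows "multiplicity_of G I (dsum_glider M N) = multiplicity_of G I M + multiplicity_of G I N"
proof -
 note z = fv.subspace_0[OF kernel_of_subspace[OF M]] fv.subspace_0[OF kernel_of_subspace[OF N]]
 show ?thesis unfolding multiplicity_of_def kernel_of_dsum span_dsum_UN[OF z]
   dim_dsum[OF kernel_of_fin_dim[OF M] kernel_of_fin_dim[OF N]]
   dim_dsum[OF kernel_of_span_fin_dim[OF M] kernel_of_span_fin_dim[OF N]] by simp
qed

lemma tensor_is_glider:
 assumes M: "is_glider G M" and N: "is_glider G N" shows "is_glider G (tensor_glider M N)"
proof (rule is_gliderI)
 note K = kgmodD[OF gliderD(1)[OF M]] and L = kgmodD[OF gliderD(1)[OF N]]
 let ?T = "tens_space (mod_space M) (mod_space N)"
 have lin: "lin_on ?T (tmap (mod_act M g) (mod_act N g))" if "g \<in> carrier G" for g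
  by (rule lin_on_tmap[OF K(1) K(3)[OF that] L(1) L(3)[OF that]])
 have im: "tmap (mod_act M g) (mod_act N g) ` ?T \<subseteq> ?T" if "g \<in> carrier G" for g
  unfolding tmap_image[OF K(1) K(3)[OF that] L(1) L(3)[OF that]]
  by (rule tens_space_mono) (use K(2)[OF that] L(2)[OF that] in auto)
 note pure = tmap_tens[OF K(3) L(3)]
 show "is_kgmod G (tensor_glider M N)" unfolding is_kgmod_def tensor_glider_simps
 proof (intro conjI ballI)
  show "fv.subspace ?T" by (rule tens_subspace)
  fix g assume g: "g \<in> carrier G"
  show "tmap (mod_act M g) (mod_act N g) \<in> ?T \<rightarrow> ?T" using im[OF g] by blast
  show "lin_on ?T (tmap (mod_act M g) (mod_act N g))" by (rule lin[OF g])
 next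
  fix v assume v: "v \<in> ?T"
  show "tmap (mod_act M \<one>) (mod_act N \<one>) v = v"
   by (rule lin_on_eq_tens[OF lin flin_lin_on[OF flin_id] v]) (simp_all add: pure K(4) L(4))
 next
  fix g h v assume gh: "g \<in> carrier G" "h \<in> carrier G" and v: "v \<in> ?T"
  show "tmap (mod_act M (g \<otimes> h)) (mod_act N (g \<otimes> h)) v =
    tmap (mod_act M g) (mod_act N g) (tmap (mod_act M h) (mod_act N h) v)"
   by (rule lin_on_eq_tens[OF lin lin_on_comp[OF lin im lin] v]) (simp_all add: gh pure K(2,5) L(2,5))
 qed
 show "fv.subspace (lev_m1 (tensor_glider M N))" by (simp add: tens_subspace)
 show "fin_dim (lev_0 (tensor_glider M N))" using fin_dim_tens[OF gliderD(5)[OF M] gliderD(5)[OF N]] by simp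
 show "lev_m1 (tensor_glider M N) \<subseteq> lev_0 (tensor_glider M N)" "lev_0 (tensor_glider M N) \<subseteq> mod_space (tensor_glider M N)"
  using gliderD(6,7)[OF M] gliderD(6,7)[OF N] by (simp_all add: tens_space_mono)
 fix g m assume g: "g \<in> carrier G" and m: "m \<in> lev_m1 (tensor_glider M N)"
 have "tmap (mod_act M g) (mod_act N g) ` tens_space (lev_m1 M) (lev_m1 N) \<subseteq> tens_space (lev_0 M) (lev_0 N)"
  unfolding tmap_image[OF gliderD(2)[OF M] lin_on_subset[OF K(3)[OF g] gliderD(8)[OF M]]
    gliderD(2)[OF N] lin_on_subset[OF L(3)[OF g] gliderD(8)[OF N]]]
  by (rule tens_space_mono) (use glider_act_closed[OF M g] glider_act_closed[OF N g] in auto)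
 thus "mod_act (tensor_glider M N) g m \<in> lev_0 (tensor_glider M N)" using m by auto
qed

lemma tensor_iso:
 assumes M: "is_glider G M" and M': "is_glider G M'" and N: "is_glider G N" and N': "is_glider G N'"
  and "glider_iso G M M'" "glider_iso G N N'"
 shows "glider_iso G (tensor_glider M N) (tensor_glider M' N')"
proof -
 obtain f where f: "gl_iso_by G M M' f" using assms(5) glider_iso_iff[OF M M'] by blast
 obtain h where h: "gl_iso_by G N N' h" using assms(6) glider_iso_iff[OF N N'] by blast
 note F = gl_iso_byD[OF f] and H = gl_iso_byD[OF h]
 obtain f' where f': "gl_iso_by G M' M f'" "!!m. m \<in> lev_0 M ==> f' (f m) = m" by (rule gl_iso_by_inverse[OF M f]) blast
 obtain h' where h': "gl_iso_by G N' N h'" "!!m. m \<in> lev_0 N ==> h' (h m) = m" by (rule gl_iso_by_inverse[OF N h]) blast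
 let ?T = "tens_space (lev_0 M) (lev_0 N)"
 have lin: "lin_on ?T (tmap f h)" by (rule lin_on_tmap[OF gliderD(4)[OF M] F(1) gliderD(4)[OF N] H(1)])
 have im: "tmap f h ` ?T = tens_space (lev_0 M') (lev_0 N')"
  using tmap_image[OF gliderD(4)[OF M] F(1) gliderD(4)[OF N] H(1)] F(4) H(4) by simp
 have lin': "lin_on (tens_space (lev_0 M') (lev_0 N')) (tmap f' h')"
  by (rule lin_on_tmap[OF gliderD(4)[OF M'] gl_iso_byD(1)[OF f'(1)] gliderD(4)[OF N'] gl_iso_byD(1)[OF h'(1)]])
 have inv: "tmap f' h' (tmap f h w) = w" if w: "w \<in> ?T" for w
 proof (rule lin_on_eq_tens[OF lin_on_comp[OF lin eq_refl[OF im] lin'] flin_lin_on[OF flin_id] w])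
  fix u v assume u: "u \<in> lev_0 M" and v: "v \<in> lev_0 N"
  hence "f u \<in> lev_0 M'" "h v \<in> lev_0 N'" using F(4) H(4) by blast+
  thus "tmap f' h' (tmap f h (tens u v)) = tens u v" using u v by (simp add: tmap_tens[OF F(1) H(1)] f'(2) h'(2)
     tmap_tens[OF gl_iso_byD(1)[OF f'(1)] gl_iso_byD(1)[OF h'(1)]])
 qed
 note s1 = lin_on_subset[OF F(1) gliderD(6)[OF M]] lin_on_subset[OF H(1) gliderD(6)[OF N]]
 have "gl_iso_by G (tensor_glider M N) (tensor_glider M' N') (tmap f h)" unfolding gl_iso_by_def tensor_glider_simps
 proof (intro conjI ballI)
  show "lin_on ?T (tmap f h)" by (rule lin)
  show "bij_betw (tmap f h) ?T (tens_space (lev_0 M') (lev_0 N'))"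
   unfolding bij_betw_def using im inj_on_inverseI[of ?T "tmap f' h'", OF inv] by simp
  show "tmap f h ` tens_space (lev_m1 M) (lev_m1 N) = tens_space (lev_m1 M') (lev_m1 N')"
   using tmap_image[OF gliderD(2)[OF M] s1(1) gliderD(2)[OF N] s1(2)] F(5) H(5) by simp
  fix g m assume g: "g \<in> carrier G" and m: "m \<in> tens_space (lev_m1 M) (lev_m1 N)"
  note K = kgmodD(3)[OF gliderD(1)[OF M] g] kgmodD(3)[OF gliderD(1)[OF N] g]
  note K' = kgmodD(3)[OF gliderD(1)[OF M'] g] kgmodD(3)[OF gliderD(1)[OF N'] g]
  note k = lin_on_subset[OF K(1) gliderD(8)[OF M]] lin_on_subset[OF K(2) gliderD(8)[OF N]]
  note k' = lin_on_subset[OF K'(1) gliderD(8)[OF M']] lin_on_subset[OF K'(2) gliderD(8)[OF N']]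
  show "tmap f h (tmap (mod_act M g) (mod_act N g) m) = tmap (mod_act M' g) (mod_act N' g) (tmap f h m)"
  proof (rule lin_on_eq_tens[OF _ _ m])
   have 1: "lin_on (tens_space (lev_m1 M) (lev_m1 N)) (tmap (mod_act M g) (mod_act N g))"
    by (rule lin_on_tmap[OF gliderD(2)[OF M] k(1) gliderD(2)[OF N] k(2)])
   have 2: "tmap (mod_act M g) (mod_act N g) ` tens_space (lev_m1 M) (lev_m1 N) \<subseteq> ?T"
    unfolding tmap_image[OF gliderD(2)[OF M] k(1) gliderD(2)[OF N] k(2)]
    by (rule tens_space_mono) (use glider_act_closed[OF M g] glider_act_closed[OF N g] in auto)
   have 3: "lin_on (tens_space (lev_m1 M) (lev_m1 N)) (tmap f h)"
    by (rule lin_on_tmap[OF gliderD(2)[OF M] s1(1) gliderD(2)[OF N] s1(2)])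
   have 4: "tmap f h ` tens_space (lev_m1 M) (lev_m1 N) \<subseteq> tens_space (lev_m1 M') (lev_m1 N')"
    using tmap_image[OF gliderD(2)[OF M] s1(1) gliderD(2)[OF N] s1(2)] F(5) H(5) by simp
   have 5: "lin_on (tens_space (lev_m1 M') (lev_m1 N')) (tmap (mod_act M' g) (mod_act N' g))"
    by (rule lin_on_tmap[OF gliderD(2)[OF M'] k'(1) gliderD(2)[OF N'] k'(2)])
   show "lin_on (tens_space (lev_m1 M) (lev_m1 N)) (\<lambda>m. tmap f h (tmap (mod_act M g) (mod_act N g) m))"
    by (rule lin_on_comp[OF 1 2 lin])
   show "lin_on (tens_space (lev_m1 M) (lev_m1 N)) (\<lambda>m. tmap (mod_act M' g) (mod_act N' g) (tmap f h m))"
    by (rule lin_on_comp[OF 3 4 5])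
   fix u v assume u: "u \<in> lev_m1 M" and v: "v \<in> lev_m1 N"
   have "mod_act M g u \<in> lev_0 M" "mod_act N g v \<in> lev_0 N" "f u \<in> lev_m1 M'" "h v \<in> lev_m1 N'"
    using glider_act_closed[OF M g u] glider_act_closed[OF N g v] F(5) H(5) u v by auto
   thus "tmap f h (tmap (mod_act M g) (mod_act N g) (tens u v)) =
     tmap (mod_act M' g) (mod_act N' g) (tmap f h (tens u v))"
    using u v by (simp add: tmap_tens[OF k] tmap_tens[OF s1] tmap_tens[OF F(1) H(1)] tmap_tens[OF k']
      F(6)[OF g u] H(6)[OF g v])
  qed
 qed
 thus ?thesis by (rule glider_isoI[OF tensor_is_glider[OF M N] tensor_is_glider[OF M' N']])
qed

lemma tensor_act_pure:
 assumes M: "is_glider G M" and N: "is_glider G N" and g: "g \<in> carrier G" and "u \<in> lev_m1 M" "v \<in> lev_m1 N"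
 shows "tmap (mod_act M g) (mod_act N g) (tens u v) = tens (mod_act M g u) (mod_act N g v)"
 by (rule tmap_tens[OF kgmodD(3)[OF gliderD(1)[OF M] g] kgmodD(3)[OF gliderD(1)[OF N] g]])
  (use gliderD(8)[OF M] gliderD(8)[OF N] assms in auto)

lemma tensor_act_lin:
 assumes M: "is_glider G M" and N: "is_glider G N" and g: "g \<in> carrier G"
 shows "lin_on (tens_space (lev_m1 M) (lev_m1 N)) (tmap (mod_act M g) (mod_act N g))"
 using lin_on_tmap[OF gliderD(2)[OF M] lin_on_subset[OF kgmodD(3)[OF gliderD(1)[OF M] g] gliderD(8)[OF M]]
   gliderD(2)[OF N] lin_on_subset[OF kgmodD(3)[OF gliderD(1)[OF N] g] gliderD(8)[OF N]]] .

lemma tensor_swap_iso: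
 assumes M: "is_glider G M" and N: "is_glider G N"
 shows "glider_iso G (tensor_glider M N) (tensor_glider N M)"
proof (rule glider_isoI[OF tensor_is_glider[OF M N] tensor_is_glider[OF N M]])
 show "gl_iso_by G (tensor_glider M N) (tensor_glider N M) tens_swap" unfolding gl_iso_by_def tensor_glider_simps
 proof (intro conjI ballI tens_swap_image)
  show "lin_on (tens_space (lev_0 M) (lev_0 N)) tens_swap" by (rule flin_lin_on[OF flin_tens_swap])
  show "bij_betw tens_swap (tens_space (lev_0 M) (lev_0 N)) (tens_space (lev_0 N) (lev_0 M))"
   unfolding bij_betw_def using tens_swap_image by (auto intro: inj_on_inverseI[where g=tens_swap])
  fix g m assume g: "g \<in> carrier G" and m: "m \<in> tens_space (lev_m1 M) (lev_m1 N)"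
  show "tens_swap (tmap (mod_act M g) (mod_act N g) m) = tmap (mod_act N g) (mod_act M g) (tens_swap m)"
   by (rule lin_on_eq_tens[OF lin_on_comp[OF tensor_act_lin[OF M N g] subset_UNIV flin_lin_on[OF flin_tens_swap]]
      lin_on_comp[OF flin_lin_on[OF flin_tens_swap] eq_refl[OF tens_swap_image] tensor_act_lin[OF N M g]] m])
    (simp add: tensor_act_pure[OF M N g] tensor_act_pure[OF N M g])
 qed
qed

lemma tensor_dsum_iso:
 assumes M: "is_glider G M" and N: "is_glider G N" and Q: "is_glider G Q"
 shows "glider_iso G (tensor_glider (dsum_glider M N) Q) (dsum_glider (tensor_glider M Q) (tensor_glider N Q))"
  (is "glider_iso G ?A ?B")
proof -
 note D = dsum_is_glider[OF M N]
 note MQ = tensor_is_glider[OF M Q] and NQ = tensor_is_glider[OF N Q]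
 have im: "dsum_tens ` tens_space (dsum_space (lev_0 M) (lev_0 N)) (lev_0 Q) = dsum_space (tens_space (lev_0 M) (lev_0 Q)) (tens_space (lev_0 N) (lev_0 Q))"
  by (rule dsum_tens_image[OF gliderD(4)[OF M] gliderD(4)[OF N] gliderD(4)[OF Q]])
 have im1: "dsum_tens ` tens_space (dsum_space (lev_m1 M) (lev_m1 N)) (lev_m1 Q) = dsum_space (tens_space (lev_m1 M) (lev_m1 Q)) (tens_space (lev_m1 N) (lev_m1 Q))"
  by (rule dsum_tens_image[OF gliderD(2)[OF M] gliderD(2)[OF N] gliderD(2)[OF Q]])
 have "gl_iso_by G ?A ?B dsum_tens" unfolding gl_iso_by_def
 proof (intro conjI ballI)
  show "lin_on (lev_0 ?A) dsum_tens" by (rule flin_lin_on[OF flin_dsum_tens])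
  show "bij_betw dsum_tens (lev_0 ?A) (lev_0 ?B)"
   unfolding bij_betw_def using im inj_on_subset[OF inj_dsum_tens] by simp
  show "dsum_tens ` lev_m1 ?A = lev_m1 ?B" using im1 by simp
  fix g m assume g: "g \<in> carrier G" and m: "m \<in> lev_m1 ?A"
  note aM = tensor_act_lin[OF M Q g] and aN = tensor_act_lin[OF N Q g]
  have "dsum_tens (tmap (mod_act (dsum_glider M N) g) (mod_act Q g) m) =
    dmap (tmap (mod_act M g) (mod_act Q g)) (tmap (mod_act N g) (mod_act Q g)) (dsum_tens m)"
  proof (rule lin_on_eq_tens[OF lin_on_comp[OF tensor_act_lin[OF D Q g] subset_UNIV flin_lin_on[OF flin_dsum_tens]]
      lin_on_comp[OF flin_lin_on[OF flin_dsum_tens] _ dmap_lin_on[OF aM aN]]])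
   show "dsum_tens ` tens_space (lev_m1 (dsum_glider M N)) (lev_m1 Q) \<subseteq> dsum_space (tens_space (lev_m1 M) (lev_m1 Q)) (tens_space (lev_m1 N) (lev_m1 Q))"
    using im1 by simp
   show "m \<in> tens_space (lev_m1 (dsum_glider M N)) (lev_m1 Q)" using m by simp
   fix u q assume u: "u \<in> lev_m1 (dsum_glider M N)" and q: "q \<in> lev_m1 Q"
   then obtain a b where ab: "u = case_sum a b" "a \<in> lev_m1 M" "b \<in> lev_m1 N" by (auto simp: dsum_space_def)
   have "dsum_tens (tmap (mod_act (dsum_glider M N) g) (mod_act Q g) (tens u q)) =
     dsum_tens (tens (case_sum (mod_act M g a) (mod_act N g b)) (mod_act Q g q))"
    unfolding tensor_act_pure[OF D Q g u q] by (simp add: ab dmap_def)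
   also have "\<dots> = case_sum (tens (mod_act M g a) (mod_act Q g q)) (tens (mod_act N g b) (mod_act Q g q))"
    by (rule dsum_tens_pure)
   also have "\<dots> = dmap (tmap (mod_act M g) (mod_act Q g)) (tmap (mod_act N g) (mod_act Q g)) (dsum_tens (tens u q))"
    by (simp add: ab dsum_tens_pure dmap_def tensor_act_pure[OF M Q g] tensor_act_pure[OF N Q g] q)
   finally show "dsum_tens (tmap (mod_act (dsum_glider M N) g) (mod_act Q g) (tens u q)) =
     dmap (tmap (mod_act M g) (mod_act Q g)) (tmap (mod_act N g) (mod_act Q g)) (dsum_tens (tens u q))" .
  qed
  thus "dsum_tens (mod_act ?A g m) = mod_act ?B g (dsum_tens m)" by simp
 qed
 thus ?thesis by (rule glider_isoI[OF tensor_is_glider[OF D Q] dsum_is_glider[OF MQ NQ]])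
qed

lemma dsum_iso:
 assumes M: "is_glider G M" and M': "is_glider G M'" and N: "is_glider G N" and N': "is_glider G N'"
  and "glider_iso G M M'" "glider_iso G N N'"
 shows "glider_iso G (dsum_glider M N) (dsum_glider M' N')"
proof -
 obtain f where f: "gl_iso_by G M M' f" using assms(5) glider_iso_iff[OF M M'] by blast
 obtain h where h: "gl_iso_by G N N' h" using assms(6) glider_iso_iff[OF N N'] by blast
 note F = gl_iso_byD[OF f] and H = gl_iso_byD[OF h]
 have im: "dmap f h ` dsum_space U V = dsum_space (f ` U) (h ` V)" for U V
 proof -
  have dm: "dmap f h (case_sum a b) = case_sum (f a) (h b)" for a b by (simp add: dmap_def)
  show ?thesis
  proof (intro equalityI subsetI)
   fix w assume "w \<in> dmap f h ` dsum_space U V"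
   then obtain a b where "w = case_sum (f a) (h b)" "a \<in> U" "b \<in> V" using dm by (auto simp: dsum_space_def)
   thus "w \<in> dsum_space (f ` U) (h ` V)" by (auto intro: dsum_spaceI)
  next
   fix w assume "w \<in> dsum_space (f ` U) (h ` V)"
   then obtain a b where ab: "w = case_sum (f a) (h b)" "a \<in> U" "b \<in> V" by (auto simp: dsum_space_def)
   hence "w = dmap f h (case_sum a b)" by (simp add: dm)
   thus "w \<in> dmap f h ` dsum_space U V" using dsum_spaceI[OF ab(2,3)] by blast
  qed
 qed
 have "gl_iso_by G (dsum_glider M N) (dsum_glider M' N') (dmap f h)" unfolding gl_iso_by_def dsum_glider_simps
 proof (intro conjI ballI)
  show "lin_on (dsum_space (lev_0 M) (lev_0 N)) (dmap f h)" by (rule dmap_lin_on[OF F(1) H(1)])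
  have "inj_on (dmap f h) (dsum_space (lev_0 M) (lev_0 N))"
  proof (rule inj_onI)
   fix v w assume v: "v \<in> dsum_space (lev_0 M) (lev_0 N)" and w: "w \<in> dsum_space (lev_0 M) (lev_0 N)"
    and e: "dmap f h v = dmap f h w"
   have "f (v \<circ> Inl) = f (w \<circ> Inl)" "h (v \<circ> Inr) = h (w \<circ> Inr)"
    using arg_cong[OF e, of "\<lambda>z. z \<circ> Inl"] arg_cong[OF e, of "\<lambda>z. z \<circ> Inr"] by (simp_all add: dmap_def)
   hence "v \<circ> Inl = w \<circ> Inl" "v \<circ> Inr = w \<circ> Inr"
    using v w inj_onD[OF F(3)] inj_onD[OF H(3)] by (simp_all add: dsum_space_iff)
   hence "case_sum (v \<circ> Inl) (v \<circ> Inr) = case_sum (w \<circ> Inl) (w \<circ> Inr)" by (simp only:)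
   thus "v = w" unfolding case_sum_eq_self .
  qed
  thus "bij_betw (dmap f h) (dsum_space (lev_0 M) (lev_0 N)) (dsum_space (lev_0 M') (lev_0 N'))"
   using im F(4) H(4) by (simp add: bij_betw_def)
  show "dmap f h ` dsum_space (lev_m1 M) (lev_m1 N) = dsum_space (lev_m1 M') (lev_m1 N')" using im F(5) H(5) by simp
  fix g m assume "g \<in> carrier G" "m \<in> dsum_space (lev_m1 M) (lev_m1 N)"
  thus "dmap f h (dmap (mod_act M g) (mod_act N g) m) = dmap (mod_act M' g) (mod_act N' g) (dmap f h m)"
   by (simp add: dsum_space_iff dmap_def F(6) H(6))
 qed
 thus ?thesis by (rule glider_isoI[OF dsum_is_glider[OF M N] dsum_is_glider[OF M' N']])
qed

lemma tensor_length0: "length0 M ==> length0 (tensor_glider M N)"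
proof -
 assume "length0 M"
 hence "{tens u v |u v. u \<in> lev_m1 M \<and> v \<in> lev_m1 N} \<subseteq> {0}" by (auto simp: length0_def tens_lin)
 hence "tens_space (lev_m1 M) (lev_m1 N) \<subseteq> {0}" unfolding tens_space_def by (simp add: fv.span_minimal)
 thus ?thesis using fv.subspace_0[OF tens_subspace[of "lev_m1 M" "lev_m1 N"]] by (auto simp: length0_def)
qed

lemma length0_iso:
 assumes M: "is_glider G M" and N: "is_glider G N" and "glider_iso G M N" "length0 M" shows "length0 N"
proof -
 obtain f where f: "gl_iso_by G M N f" using assms(3) glider_iso_iff[OF M N] by blast
 show ?thesis using gl_iso_byD(5)[OF f] assms(4) lin_on_0[OF gl_iso_byD(1)[OF f] fv.subspace_0[OF gliderD(4)[OF M]]]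
  by (simp add: length0_def)
qed

section \<open>Splitting off the part of length 0\<close>

definition cyclic_part :: "('a, 'k::field, 'i) glider => ('a, 'k, 'i) glider" where
 "cyclic_part M = M\<lparr>lev_0 := galg_span G M (lev_m1 M)\<rparr>"

lemma cyclic_part_simps [simp]:
 "mod_space (cyclic_part M) = mod_space M" "mod_act (cyclic_part M) = mod_act M"
 "lev_m1 (cyclic_part M) = lev_m1 M" "lev_0 (cyclic_part M) = galg_span G M (lev_m1 M)"
 by (simp_all add: cyclic_part_def)

lemma cyclic_part_glider:
 assumes M: "is_glider G M" shows "is_glider G (cyclic_part M)"
proof (rule is_gliderI, unfold cyclic_part_simps)
 note K = gliderD(1)[OF M]
 show "is_kgmod G (cyclic_part M)" using K by (simp add: is_kgmod_def)
 show "fin_dim (galg_span G M (lev_m1 M))" by (rule galg_span_fin_dim[OF gliderD(3,8)[OF M] K])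
 show "lev_m1 M \<subseteq> galg_span G M (lev_m1 M)" by (rule galg_span_base[OF K gliderD(8)[OF M]])
 show "galg_span G M (lev_m1 M) \<subseteq> mod_space M" using gliderD(7,9)[OF M] by blast
 show "mod_act M g m \<in> galg_span G M (lev_m1 M)" if "g \<in> carrier G" "m \<in> lev_m1 M" for g m
  unfolding galg_span_eq_span by (rule fv.span_base) (use that in blast)
qed (rule gliderD(2)[OF M])

lemma galg_act_cyclic_part: "galg_act G (cyclic_part M) x v = galg_act G M x v"
 by (simp add: galg_act_def)

lemma Ann_cyclic_part: "Ann G (cyclic_part M) = Ann G M"
 by (simp add: Ann_def galg_act_cyclic_part)

lemma cyclic_part_line: "line_glider G M u ==> line_glider G (cyclic_part M) u"
 by (simp add: line_glider_def cyclic_part_glider)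

lemma cyclic_part_irreducible:
 assumes "line_glider G M u" shows "irreducible_glider G (cyclic_part M)"
 by (rule line_irreducible[OF cyclic_part_line[OF assms]]) (simp add: galg_span_def galg_act_cyclic_part)

text \<open>A morphism of gliders respects the action only on vectors coming from
  \<open>lev_m1\<close>. So any linear complement of the generated submodule in
  \<open>lev_0\<close>, stable or not, splits off as a glider of length 0.\<close>

lemma cyclic_part_split:
 fixes M :: "('a, 'k::field, 'i) glider"
 assumes M: "is_glider G M"
 obtains C :: "('a, 'k, 'i) glider" where "is_glider G C" "length0 C" "glider_iso G M (dsum_glider (cyclic_part M) C)"
proof -
 let ?S = "galg_span G M (lev_m1 M)"
 note P = cyclic_part_glider[OF M]
 have sS: "fv.subspace ?S" by (simp add: galg_span_def)
 obtain p where p: "flin p" "range p \<subseteq> ?S" "!!v. v \<in> ?S ==> p v = v" by (rule exists_projection[OF sS]) blast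
 let ?q = "\<lambda>y. y - p y"
 have q: "flin ?q" by (rule flinI) (simp_all add: flin_add[OF p(1)] flin_scale[OF p(1)] fv.scale_right_diff_distrib)
 \<comment> \<open>The complement is given the trivial action. As \<open>lev_m1 C\<close> is 0, this
   action is never compared with the one on \<open>M\<close>.\<close>
 define C :: "('a, 'k, 'i) glider" where "C = \<lparr>mod_space = ?q ` lev_0 M, mod_act = \<lambda>g v. v, lev_m1 = {0}, lev_0 = ?q ` lev_0 M\<rparr>"
 have sC: "fv.subspace (?q ` lev_0 M)" by (rule lin_on_image_subspace[OF gliderD(4)[OF M] flin_lin_on[OF q]])
 have C: "is_glider G C"
 proof (rule is_gliderI)
  show "is_kgmod G C" using sC by (auto simp: is_kgmod_def C_def flin_lin_on[OF flin_id])
  show "fin_dim (lev_0 C)" using fin_dim_image[OF gliderD(5)[OF M] flin_lin_on[OF q]] by (simp add: C_def)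
 qed (use fv.subspace_0[OF sC] in \<open>auto simp: C_def\<close>)
 have SL: "?S \<subseteq> lev_0 M" by (rule gliderD(9)[OF M])
 have pS: "p y \<in> ?S" for y using p(2) by blast
 have pq: "p (?q y) = 0" for y 
 proof -
  have "p y \<in> ?S" using p(2) by blast
  thus ?thesis using p(3)[of "p y"] by (simp add: flin_diff[OF p(1)])
 qed
 have "gl_iso_by G M (dsum_glider (cyclic_part M) C) (\<lambda>y. case_sum (p y) (?q y))" unfolding gl_iso_by_def
 proof (intro conjI ballI)
  show lin: "lin_on (lev_0 M) (\<lambda>y. case_sum (p y) (?q y))"
   by (rule lin_onI) (simp_all add: flin_add[OF p(1)] flin_scale[OF p(1)] case_sum_lin(1,2)[symmetric]
     fv.scale_right_diff_distrib algebra_simps)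
  have inj: "inj_on (\<lambda>y. case_sum (p y) (?q y)) (lev_0 M)"
  proof (rule inj_onI)
   fix y z assume e: "case_sum (p y) (?q y) = case_sum (p z) (?q z)"
   have "p y = p z" "?q y = ?q z"
    using arg_cong[OF e, of "\<lambda>w. w \<circ> Inl"] arg_cong[OF e, of "\<lambda>w. w \<circ> Inr"] by simp_all
   thus "y = z" by simp
  qed
  have "dsum_space ?S (?q ` lev_0 M) \<subseteq> (\<lambda>y. case_sum (p y) (?q y)) ` lev_0 M"
  proof
   fix w assume "w \<in> dsum_space ?S (?q ` lev_0 M)"
   then obtain s y where w: "w = case_sum s (?q y)" "s \<in> ?S" "y \<in> lev_0 M" by (auto simp: dsum_space_def)
   have "?q y \<in> lev_0 M" using w(3) p(2) SL by (intro fv.subspace_diff[OF gliderD(4)[OF M]]) auto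
   hence m: "s + ?q y \<in> lev_0 M" using w SL by (intro fv.subspace_add[OF gliderD(4)[OF M]]) auto
   have "p (s + ?q y) = s" using p(3)[OF w(2)] pq[of y] flin_add[OF p(1), of s "?q y"] by simp
   hence "w = case_sum (p (s + ?q y)) (?q (s + ?q y))" using w(1) by simp
   thus "w \<in> (\<lambda>y. case_sum (p y) (?q y)) ` lev_0 M" using m by blast
  qed
  thus "bij_betw (\<lambda>y. case_sum (p y) (?q y)) (lev_0 M) (lev_0 (dsum_glider (cyclic_part M) C))"
   unfolding bij_betw_def using inj pS by (auto simp: C_def dsum_space_iff)
  have base: "lev_m1 M \<subseteq> ?S" by (rule galg_span_base[OF gliderD(1)[OF M] gliderD(8)[OF M]])
  have pm: "case_sum (p y) (?q y) = case_sum y 0" if "y \<in> ?S" for y using p(3)[OF that] by simp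
  show "(\<lambda>y. case_sum (p y) (?q y)) ` lev_m1 M = lev_m1 (dsum_glider (cyclic_part M) C)"
  proof -
   have "(\<lambda>y. case_sum (p y) (?q y)) ` lev_m1 M = (\<lambda>y. case_sum y 0) ` lev_m1 M"
    by (rule image_cong[OF refl pm]) (use base in blast)
   thus ?thesis by (auto simp: C_def dsum_space_def)
  qed
  fix g m assume g: "g \<in> carrier G" and m: "m \<in> lev_m1 M"
  have "mod_act M g m \<in> ?S" unfolding galg_span_eq_span by (rule fv.span_base) (use g m in blast)
  hence "p (mod_act M g m) = mod_act M g m" "p m = m" using p(3) base m by blast+
  thus "case_sum (p (mod_act M g m)) (?q (mod_act M g m)) = mod_act (dsum_glider (cyclic_part M) C) g (case_sum (p m) (?q m))"
   by (simp add: dmap_def C_def)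
 qed
 hence "glider_iso G M (dsum_glider (cyclic_part M) C)" by (rule glider_isoI[OF M dsum_is_glider[OF P C]])
 moreover have "length0 C" by (simp add: length0_def C_def)
 ultimately show thesis using that C by blast
qed

text \<open>The group acts diagonally, so the coordinates of the orbit map of
  \<open>tens u v\<close> are the products of those for \<open>u\<close> and
  \<open>v\<close>.\<close>

lemma tensor_line:
 assumes u: "line_glider G M u" and v: "line_glider G N v"
 shows "line_glider G (tensor_glider M N) (tens u v)"
  and "Ann G (tensor_glider M N) = perp G (prod_set (coeff_funs M u) (coeff_funs N v))"
proof -
 note U = line_gliderD[OF u] and V = line_gliderD[OF v]
 have "tens_space (fv.span {u}) (fv.span {v}) = fv.span {tens u v}"
  unfolding tens_space_span by (rule arg_cong[where f=fv.span]) auto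
 thus l: "line_glider G (tensor_glider M N) (tens u v)"
  using U V tens_nonzero by (simp add: line_glider_def tensor_is_glider)
 have p: "mod_act (tensor_glider M N) g (tens u v) (i, j) = mod_act M g u i * mod_act N g v j" if "g \<in> carrier G" for g i j
  using tensor_act_pure[OF U(1) V(1) that U(4) V(4)] by simp
 have "(\<Sum>g\<in>carrier G. x g * mod_act (tensor_glider M N) g (tens u v) (i, j)) =
   (\<Sum>g\<in>carrier G. x g * (mod_act M g u i * mod_act N g v j))" for x i j
  by (rule sum.cong) (simp_all only: p)
 thus "Ann G (tensor_glider M N) = perp G (prod_set (coeff_funs M u) (coeff_funs N v))"
  unfolding Ann_perp[OF l] perp_def prod_set_def coeff_funs_def by (auto; blast)
qed

end

section \<open>Bilinear algebras and their quotients\<close>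

text \<open>Rings without associativity and unit: the free groups from which the Grothendieck rings are built
 are only of this kind.\<close>

locale bilin_alg = abelian_group R for R (structure) +
 assumes bm_closed: "[|x \<in> carrier R; y \<in> carrier R|] ==> x \<otimes> y \<in> carrier R"
  and bl_distr: "[|x \<in> carrier R; y \<in> carrier R; z \<in> carrier R|] ==> (x \<oplus> y) \<otimes> z = x \<otimes> z \<oplus> y \<otimes> z"
  and br_distr: "[|x \<in> carrier R; y \<in> carrier R; z \<in> carrier R|] ==> z \<otimes> (x \<oplus> y) = z \<otimes> x \<oplus> z \<otimes> y"
begin

lemma bl_null: "x \<in> carrier R ==> \<zero> \<otimes> x = \<zero>"
 using bl_distr[of \<zero> \<zero> x] bm_closed[of \<zero> x] by (metis add.l_cancel_one' l_zero zero_closed)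

lemma br_null: "x \<in> carrier R ==> x \<otimes> \<zero> = \<zero>"
 using br_distr[of \<zero> \<zero> x] bm_closed[of x \<zero>] by (metis add.l_cancel_one' l_zero zero_closed)

lemma bl_minus: "x \<in> carrier R ==> y \<in> carrier R ==> (\<ominus> x) \<otimes> y = \<ominus> (x \<otimes> y)"
 using bl_distr[of "\<ominus> x" x y] bl_null[of y] by (simp add: l_neg bm_closed minus_equality)

lemma br_minus: "x \<in> carrier R ==> y \<in> carrier R ==> y \<otimes> (\<ominus> x) = \<ominus> (y \<otimes> x)"
 using br_distr[of "\<ominus> x" x y] br_null[of y] by (simp add: l_neg bm_closed minus_equality)

end

locale bilin_ideal = bilin_alg R + additive_subgroup I R for I and R (structure) +
 assumes absorb_l: "[|x \<in> I; y \<in> carrier R|] ==> x \<otimes> y \<in> I"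
  and absorb_r: "[|x \<in> I; y \<in> carrier R|] ==> y \<otimes> x \<in> I"
begin

sublocale abelian_subgroup I R
 by (rule abelian_subgroupI3[OF additive_subgroup_axioms abelian_group_axioms])

lemma coset_eq_iff:
 assumes "x \<in> carrier R" "y \<in> carrier R" shows "I +> x = I +> y \<longleftrightarrow> x \<ominus> y \<in> I"
proof
 assume "I +> x = I +> y"
 hence "x \<in> I +> y" using a_rcos_self[OF assms(1)] by simp
 then obtain i where "i \<in> I" "x = i \<oplus> y" by (auto simp: a_r_coset_def r_coset_def)
 thus "x \<ominus> y \<in> I" using assms by (simp add: minus_eq a_assoc r_neg a_Hcarr)
next
 assume i: "x \<ominus> y \<in> I"
 have "x = (x \<ominus> y) \<oplus> y" using assms by (simp add: minus_eq a_assoc l_neg)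
 hence "x \<in> I +> y" using i by (auto simp: a_r_coset_def r_coset_def)
 thus "I +> x = I +> y" using a_repr_independence[OF _ assms(2) a_subgroup] by simp
qed

lemma coset_zero_iff: "x \<in> carrier R ==> I +> x = I \<longleftrightarrow> x \<in> I"
 using a_coset_join1 a_coset_join2 a_subgroup by (metis a_rcos_const a_rcos_self)

text \<open>\<open>rcoset_mult\<close> unites the cosets of all products of representatives;
  distributivity and two-sided absorption suffice to make these cosets agree.\<close>

lemma rcoset_mult_bilin:
 assumes "x \<in> carrier R" "y \<in> carrier R"
 shows "[mod I:] (I +> x) \<Otimes> (I +> y) = I +> (x \<otimes> y)"
proof -
 have 1: "I +> (x' \<otimes> y') = I +> (x \<otimes> y)" if "x' \<in> I +> x" "y' \<in> I +> y" for x' y'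
 proof -
  from that obtain h k where h: "h \<in> I" "x' = h \<oplus> x" and k: "k \<in> I" "y' = k \<oplus> y"
   by (auto simp: a_r_coset_def r_coset_def)
  note c = assms a_Hcarr[OF h(1)] a_Hcarr[OF k(1)]
  have "x' \<otimes> y' = (h \<otimes> y' \<oplus> x \<otimes> k) \<oplus> x \<otimes> y"
   using c by (simp add: h k bl_distr br_distr bm_closed a_ac)
  moreover have "h \<otimes> y' \<oplus> x \<otimes> k \<in> I" using h k c by (simp add: absorb_l absorb_r)
  ultimately have "x' \<otimes> y' \<in> I +> (x \<otimes> y)" by (auto simp: a_r_coset_def r_coset_def)
  thus ?thesis using a_repr_independence[OF _ bm_closed[OF assms] a_subgroup] by simp
 qed
 have "x \<in> I +> x" "y \<in> I +> y" using assms by (simp_all add: a_rcos_self)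
 thus ?thesis unfolding rcoset_mult_def using 1 by blast
qed

lemma quot_simps:
 "carrier (R Quot I) = a_rcosets I" "monoid.mult (R Quot I) = rcoset_mult R I" "monoid.one (R Quot I) = I +> \<one>"
 "\<zero>\<^bsub>R Quot I\<^esub> = I" "ring.add (R Quot I) = set_add R" by (simp_all add: FactRing_def)

lemma quot_carrier: "C \<in> carrier (R Quot I) \<longleftrightarrow> (\<exists>x\<in>carrier R. C = I +> x)"
 by (auto simp: quot_simps A_RCOSETS_def RCOSETS_def a_r_coset_def)

lemma quot_closed: "x \<in> carrier R ==> I +> x \<in> carrier (R Quot I)"
 by (auto simp: quot_carrier)

lemma quot_mult: "[|x \<in> carrier R; y \<in> carrier R|] ==> (I +> x) \<otimes>\<^bsub>R Quot I\<^esub> (I +> y) = I +> (x \<otimes> y)"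
 by (simp add: quot_simps rcoset_mult_bilin)

lemma quot_add: "[|x \<in> carrier R; y \<in> carrier R|] ==> (I +> x) \<oplus>\<^bsub>R Quot I\<^esub> (I +> y) = I +> (x \<oplus> y)"
 by (simp add: quot_simps a_rcos_sum)

lemma quot_abelian: "abelian_group (R Quot I)"
 by (rule comm_group_abelian_groupI) (simp add: FactRing_def a_factorgroup_is_comm_group[unfolded A_FactGroup_def'])

lemma quot_bilin: "bilin_alg (R Quot I)"
 by (intro bilin_alg.intro quot_abelian bilin_alg_axioms.intro)
  (auto simp: quot_carrier quot_mult quot_add bm_closed bl_distr br_distr quot_closed)

lemma quot_minus:
 assumes "x \<in> carrier R" shows "\<ominus>\<^bsub>R Quot I\<^esub> (I +> x) = I +> (\<ominus> x)"
proof -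
 interpret Q: abelian_group "R Quot I" by (rule quot_abelian)
 have "(I +> (\<ominus> x)) \<oplus>\<^bsub>R Quot I\<^esub> (I +> x) = \<zero>\<^bsub>R Quot I\<^esub>"
  using assms by (simp add: quot_add l_neg) (simp add: quot_simps coset_zero_iff)
 thus ?thesis using assms by (intro Q.minus_equality) (simp_all add: quot_closed)
qed

lemma quot_diff:
 "[|x \<in> carrier R; y \<in> carrier R|] ==> (I +> x) \<ominus>\<^bsub>R Quot I\<^esub> (I +> y) = I +> (x \<ominus> y)"
 by (simp add: a_minus_def quot_minus quot_add)

text \<open>Invariants of classes are built by this, one quotient after the other: an additive
  function vanishing on \<open>I\<close> is constant on cosets and can be evaluated at a chosen
  representative.\<close>

lemma quot_functional:
 fixes f :: "'a => 'z::ab_group_add"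
 assumes add: "!!x y. x \<in> carrier R ==> y \<in> carrier R ==> f (x \<oplus> y) = f x + f y"
  and I: "!!x. x \<in> I ==> f x = 0"
 obtains F where "!!x. x \<in> carrier R ==> F (I +> x) = f x"
  "!!C Y. C \<in> carrier (R Quot I) ==> Y \<in> carrier (R Quot I) ==> F (C \<oplus>\<^bsub>R Quot I\<^esub> Y) = F C + F Y"
proof -
 define F where "F C = f (SOME x. x \<in> C)" for C
 have F: "F (I +> x) = f x" if x: "x \<in> carrier R" for x
 proof -
  have "(SOME y. y \<in> I +> x) \<in> I +> x" using a_rcos_self[OF x] by (rule someI)
  then obtain i where i: "i \<in> I" "(SOME y. y \<in> I +> x) = i \<oplus> x" by (auto simp: a_r_coset_def r_coset_def)
  thus ?thesis using add[of i x] x I[OF i(1)] by (simp add: F_def a_Hcarr)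
 qed
 have "F (C \<oplus>\<^bsub>R Quot I\<^esub> Y) = F C + F Y" if XY: "C \<in> carrier (R Quot I)" "Y \<in> carrier (R Quot I)" for C Y
 proof -
  obtain x y where xy: "x \<in> carrier R" "C = I +> x" "y \<in> carrier R" "Y = I +> y" using XY by (auto simp: quot_carrier)
  thus ?thesis by (simp add: quot_add F add)
 qed
 with F show thesis using that by blast
qed

end

lemma (in abelian_group) generate_additive_subgroup:
 assumes "X0 \<subseteq> carrier G" shows "additive_subgroup (generate (add_monoid G) X0) G"
 by (rule additive_subgroupI, rule group.generate_is_subgroup[OF a_group]) (use assms in simp)

text \<open>The groups of relations are given by additive generators. Absorption passes from
  generators to everything they generate by bilinearity, so it has to be checked on generators
  only.\<close>

lemma (in bilin_alg) generate_bilin_ideal: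
 assumes X0: "X0 \<subseteq> carrier R"
  and l: "!!x y. x \<in> X0 ==> y \<in> carrier R ==> x \<otimes> y \<in> generate (add_monoid R) X0"
  and r: "!!x y. x \<in> X0 ==> y \<in> carrier R ==> y \<otimes> x \<in> generate (add_monoid R) X0"
 shows "bilin_ideal (generate (add_monoid R) X0) R"
proof -
 let ?I = "generate (add_monoid R) X0"
 interpret additive_subgroup ?I R by (rule generate_additive_subgroup[OF X0])
 have "x \<otimes> y \<in> ?I \<and> y \<otimes> x \<in> ?I" if x: "x \<in> ?I" and y: "y \<in> carrier R" for x y
  using x
 proof (induct rule: generate.induct)
  case one thus ?case using y by (simp add: bl_null br_null)
 next
  case (incl h) thus ?case using l r y by simp
 next
  case (inv h)
  hence h: "h \<in> carrier R" using X0 by blast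
  have e: "inv\<^bsub>add_monoid R\<^esub> h = \<ominus> h" by (simp add: a_inv_def)
  show ?case unfolding e using h y l[OF inv y] r[OF inv y] by (simp add: bl_minus br_minus)
 next
  case (eng h k)
  have "h \<in> carrier R" "k \<in> carrier R" using eng(1,3) a_subset by blast+
  thus ?case using eng y by (simp add: bl_distr br_distr)
 qed
 thus ?thesis by unfold_locales blast+
qed

lemma (in bilin_alg) sub_bilin:
 assumes K: "K \<subseteq> carrier R" "\<zero> \<in> K" "!!x. x \<in> K ==> \<ominus> x \<in> K"
  "!!x y. x \<in> K ==> y \<in> K ==> x \<oplus> y \<in> K" "!!x y. x \<in> K ==> y \<in> K ==> x \<otimes> y \<in> K"
 shows "bilin_alg (R\<lparr>carrier := K\<rparr>)"
proof -
 have "abelian_group (R\<lparr>carrier := K\<rparr>)"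
 proof (rule abelian_groupI)
  fix x assume x: "x \<in> carrier (R\<lparr>carrier := K\<rparr>)"
  thus "\<exists>y\<in>carrier (R\<lparr>carrier := K\<rparr>). y \<oplus>\<^bsub>R\<lparr>carrier := K\<rparr>\<^esub> x = \<zero>\<^bsub>R\<lparr>carrier := K\<rparr>\<^esub>"
   using K by (intro bexI[of _ "\<ominus> x"]) (auto simp: l_neg subsetD)
 qed (use K in \<open>auto simp: a_assoc subsetD intro: a_comm\<close>)
 thus ?thesis
  by (intro bilin_alg.intro bilin_alg_axioms.intro) (use K in \<open>auto simp: bl_distr br_distr subsetD\<close>)
qed

subsection \<open>Free bilinear algebras\<close>

lemma free_alg_simps:
 "carrier (free_alg S m u) = {c. Poly_Mapping.keys c \<subseteq> S}" "\<zero>\<^bsub>free_alg S m u\<^esub> = 0"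
 "x \<oplus>\<^bsub>free_alg S m u\<^esub> y = x + y" "\<one>\<^bsub>free_alg S m u\<^esub> = frag_of u"
 by (simp_all add: free_alg_def)

lemma frag_cmul_single: "frag_cmul d (Poly_Mapping.single c e) = Poly_Mapping.single c (d * e)"
 by (rule poly_mapping_eqI) (simp add: lookup_single when_def)

lemma free_alg_mult:
 "a \<otimes>\<^bsub>free_alg S m u\<^esub> b = frag_extend (\<lambda>x. frag_extend (\<lambda>y. frag_of (m x y)) b) a"
 unfolding free_alg_def frag_extend_def by (simp add: frag_cmul_sum frag_cmul_single)

lemma free_alg_mult_frag_of: "frag_of x \<otimes>\<^bsub>free_alg S m u\<^esub> frag_of y = frag_of (m x y)"
 by (simp add: free_alg_mult)

lemma keys_frag_of_sub [simp]: "Poly_Mapping.keys (frag_of x) \<subseteq> S \<longleftrightarrow> x \<in> S"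
 by (simp add: keys_frag_of)

lemma frag_extend_add_fun: "frag_extend (\<lambda>x. f x + g x) a = frag_extend f a + frag_extend g a"
 by (simp add: frag_extend_def frag_cmul_distrib2 sum.distrib)

lemma frag_extend_diff_fun: "frag_extend (\<lambda>x. f x - g x) a = frag_extend f a - frag_extend g a"
 using frag_extend_add_fun[of "\<lambda>x. f x - g x" g a] by (simp add: algebra_simps)

lemma keys_frag_extend_sub:
 assumes "Poly_Mapping.keys a \<subseteq> S" "!!x. x \<in> S ==> Poly_Mapping.keys (f x) \<subseteq> S'"
 shows "Poly_Mapping.keys (frag_extend f a) \<subseteq> S'" using keys_frag_extend[of f a] assms by blast

lemma free_alg_bilin:
 assumes m: "!!x y. x \<in> S ==> y \<in> S ==> m x y \<in> S" shows "bilin_alg (free_alg S m u)"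
proof (intro bilin_alg.intro bilin_alg_axioms.intro)
 show "abelian_group (free_alg S m u)"
 proof (rule abelian_groupI)
  fix x y assume "x \<in> carrier (free_alg S m u)" "y \<in> carrier (free_alg S m u)"
  thus "x \<oplus>\<^bsub>free_alg S m u\<^esub> y \<in> carrier (free_alg S m u)"
   using keys_add[of x y] by (auto simp: free_alg_simps)
 next
  fix x assume "x \<in> carrier (free_alg S m u)"
  thus "\<exists>y\<in>carrier (free_alg S m u). y \<oplus>\<^bsub>free_alg S m u\<^esub> x = \<zero>\<^bsub>free_alg S m u\<^esub>"
   by (intro bexI[of _ "- x"]) (auto simp: free_alg_simps)
 qed (auto simp: free_alg_simps)
 fix x y assume xy: "x \<in> carrier (free_alg S m u)" "y \<in> carrier (free_alg S m u)"
 have "Poly_Mapping.keys (frag_extend (\<lambda>b. frag_of (m a b)) y) \<subseteq> S" if "a \<in> S" for a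
  by (rule keys_frag_extend_sub[of _ S]) (use xy m that in \<open>auto simp: free_alg_simps keys_frag_of\<close>)
 thus "x \<otimes>\<^bsub>free_alg S m u\<^esub> y \<in> carrier (free_alg S m u)" unfolding free_alg_mult
  using keys_frag_extend_sub[of x S "\<lambda>a. frag_extend (\<lambda>b. frag_of (m a b)) y" S] xy by (simp add: free_alg_simps)
qed (simp_all add: free_alg_mult free_alg_simps(3) frag_extend_add frag_extend_add_fun)

lemma free_alg_minus:
 assumes "bilin_alg (free_alg S m u)" "x \<in> carrier (free_alg S m u)"
 shows "\<ominus>\<^bsub>free_alg S m u\<^esub> x = - x"
proof -
 interpret bilin_alg "free_alg S m u" by fact
 have "- x \<oplus>\<^bsub>free_alg S m u\<^esub> x = \<zero>\<^bsub>free_alg S m u\<^esub>" by (simp add: free_alg_simps)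
 moreover have "- x \<in> carrier (free_alg S m u)" using assms(2) by (simp add: free_alg_simps)
 ultimately show ?thesis using minus_equality assms(2) by blast
qed

lemma free_alg_diff:
 assumes "bilin_alg (free_alg S m u)" "x \<in> carrier (free_alg S m u)" "y \<in> carrier (free_alg S m u)"
 shows "x \<ominus>\<^bsub>free_alg S m u\<^esub> y = x - y"
 using free_alg_minus[OF assms(1,3)] by (simp add: a_minus_def free_alg_simps)

text \<open>The additive extension of \<open>c\<close> to the free abelian group, with values in a
  commutative ring instead of another free group.\<close>

definition frag_sum :: "('a => 'z::comm_ring_1) => ('a \<Rightarrow>\<^sub>0 int) => 'z" where
 "frag_sum c a = (\<Sum>s\<in>Poly_Mapping.keys a. of_int (Poly_Mapping.lookup a s) * c s)"

lemma frag_sum_of [simp]: "frag_sum c (frag_of s) = c s"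
 by (simp add: frag_sum_def)

lemma frag_sum_0 [simp]: "frag_sum c 0 = 0"
 by (simp add: frag_sum_def)

lemma frag_sum_superset:
 assumes "finite K" "Poly_Mapping.keys a \<subseteq> K"
 shows "frag_sum c a = (\<Sum>s\<in>K. of_int (Poly_Mapping.lookup a s) * c s)" unfolding frag_sum_def
 by (rule sum.mono_neutral_left[OF assms]) (simp add: in_keys_iff)

lemma frag_sum_add: "frag_sum c (a + b) = frag_sum c a + frag_sum c b"
proof -
 let ?K = "Poly_Mapping.keys a \<union> Poly_Mapping.keys b"
 have K: "finite ?K" by simp
 have "frag_sum c (a + b) = (\<Sum>s\<in>?K. of_int (Poly_Mapping.lookup (a + b) s) * c s)"
  by (rule frag_sum_superset[OF K keys_add])
 also have "\<dots> = (\<Sum>s\<in>?K. of_int (Poly_Mapping.lookup a s) * c s) + (\<Sum>s\<in>?K. of_int (Poly_Mapping.lookup b s) * c s)"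
  by (simp add: lookup_add distrib_right sum.distrib)
 also have "\<dots> = frag_sum c a + frag_sum c b"
  using frag_sum_superset[OF K, of a c] frag_sum_superset[OF K, of b c] by simp
 finally show ?thesis .
qed

lemma frag_sum_diff: "frag_sum c (a - b) = frag_sum c a - frag_sum c b"
 using frag_sum_add[of c "a - b" b] by simp

lemma (in bilin_alg) generate_zero_functional:
 fixes f :: "'a => 'z::ab_group_add"
 assumes add: "!!x y. x \<in> carrier R ==> y \<in> carrier R ==> f (x \<oplus> y) = f x + f y"
  and X0: "X0 \<subseteq> carrier R" "!!x. x \<in> X0 ==> f x = 0" and x: "x \<in> generate (add_monoid R) X0"
 shows "f x = 0"
proof -
 interpret additive_subgroup "generate (add_monoid R) X0" R by (rule generate_additive_subgroup[OF X0(1)])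
 have f0: "f \<zero> = 0" using add[of \<zero> \<zero>] by simp
 show ?thesis using x
 proof (induct rule: generate.induct)
  case one thus ?case using f0 by simp
 next
  case (incl h) thus ?case using X0 by simp
 next
  case (inv h)
  hence h: "h \<in> carrier R" "f h = 0" using X0 by auto
  have e: "inv\<^bsub>add_monoid R\<^esub> h = \<ominus> h" by (simp add: a_inv_def)
  have "f (\<ominus> h \<oplus> h) = f (\<ominus> h) + f h" using h by (intro add) auto
  thus ?case unfolding e using h f0 by (simp add: l_neg)
 next
  case (eng h k)
  have "h \<in> carrier R" "k \<in> carrier R" using eng(1,3) a_subset by blast+
  thus ?case using eng add by simp
 qed
qed

subsection \<open>Rational coefficients\<close>

text \<open>\<open>rat_scale\<close> is multiplication by the pure tensor of \<open>q\<close> and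
  the unit; the unit law turns this into scaling of the first factor.\<close>

locale bilin_unital = bilin_alg R for R (structure) +
 assumes one_mem: "\<one> \<in> carrier R" and l_unit: "x \<in> carrier R ==> \<one> \<otimes> x = x"
begin

abbreviation "QA \<equiv> rat_tensor_alg R"
abbreviation "QR \<equiv> rat_tensor R"
abbreviation "pt \<equiv> pure_tensor R"

lemma QA_bilin: "bilin_alg QA"
 unfolding rat_tensor_alg_def by (rule free_alg_bilin) (auto simp: bm_closed)

lemma QA_carrier: "x \<in> carrier QA \<longleftrightarrow> Poly_Mapping.keys x \<subseteq> UNIV \<times> carrier R"
 by (simp add: rat_tensor_alg_def free_alg_simps)

lemma QA_frag_of: "a \<in> carrier R ==> frag_of (q, a) \<in> carrier QA"
 by (simp add: QA_carrier)

lemma QA_diff_mem: "x \<in> carrier QA ==> y \<in> carrier QA ==> x - y \<in> carrier QA"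
 using keys_diff[of x y] by (auto simp: QA_carrier)

lemma QA_ops: "x \<oplus>\<^bsub>QA\<^esub> y = x + y" "\<zero>\<^bsub>QA\<^esub> = 0"
 by (simp_all add: rat_tensor_alg_def free_alg_simps)

lemma QA_minus: "x \<in> carrier QA ==> y \<in> carrier QA ==> x \<ominus>\<^bsub>QA\<^esub> y = x - y"
 unfolding rat_tensor_alg_def by (rule free_alg_diff[OF QA_bilin[unfolded rat_tensor_alg_def]])

lemma QA_mult: "frag_of (p, a) \<otimes>\<^bsub>QA\<^esub> frag_of (q, b) = frag_of (p * q, a \<otimes> b)"
 by (simp add: rat_tensor_alg_def free_alg_mult_frag_of)

abbreviation "bilin_gens \<equiv>
   ({frag_of (p + q, a) - frag_of (p, a) - frag_of (q, a) |p q a. a \<in> carrier R} \<union>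
   {frag_of (q, a \<oplus> b) - frag_of (q, a) - frag_of (q, b) |q a b. a \<in> carrier R \<and> b \<in> carrier R})"

lemma bilin_gens_carrier: "bilin_gens \<subseteq> carrier QA"
 by (auto intro!: QA_diff_mem QA_frag_of)

lemma QA_induct [consumes 1]:
 assumes "x \<in> carrier QA" "P 0" "!!q a. a \<in> carrier R ==> P (frag_of (q, a))" "!!x y. P x ==> P y ==> P (x - y)"
 shows "P x"
proof -
 have "Poly_Mapping.keys x \<subseteq> UNIV \<times> carrier R" using assms(1) by (simp add: QA_carrier)
 thus ?thesis by (rule frag_induction) (use assms in auto)
qed

lemma QI_ideal: "bilin_ideal (bilinear_relations R) QA"
proof -
 interpret A: bilin_alg QA by (rule QA_bilin)
 let ?I = "generate (add_monoid QA) bilin_gens"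
 interpret I: additive_subgroup ?I QA by (rule A.generate_additive_subgroup[OF bilin_gens_carrier])
 have sub: "x - y \<in> ?I" if "x \<in> ?I" "y \<in> ?I" for x y
  using that I.a_subset A.minus_closed[of x y] I.a_closed[OF that(1) I.a_inv_closed[OF that(2)]] QA_minus[of x y]
  by (auto simp: a_minus_def)
 have d1: "(x - y) \<otimes>\<^bsub>QA\<^esub> z = x \<otimes>\<^bsub>QA\<^esub> z - y \<otimes>\<^bsub>QA\<^esub> z" "z \<otimes>\<^bsub>QA\<^esub> (x - y) = z \<otimes>\<^bsub>QA\<^esub> x - z \<otimes>\<^bsub>QA\<^esub> y" for x y z
  unfolding rat_tensor_alg_def free_alg_mult frag_extend_diff by (simp_all add: frag_extend_diff_fun)
 have z1: "0 \<otimes>\<^bsub>QA\<^esub> z = 0" "z \<otimes>\<^bsub>QA\<^esub> 0 = 0" for z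
  using d1(1)[of 0 0 z] d1(2)[of z 0 0] by simp_all
 have I0: "0 \<in> ?I" using I.zero_closed by (simp add: QA_ops)
 have gen: "x \<otimes>\<^bsub>QA\<^esub> frag_of (r, c) \<in> ?I \<and> frag_of (r, c) \<otimes>\<^bsub>QA\<^esub> x \<in> ?I" if x: "x \<in> bilin_gens" and c: "c \<in> carrier R" for x r c
  using x
 proof
  assume "x \<in> {frag_of (p + q, a) - frag_of (p, a) - frag_of (q, a) |p q a. a \<in> carrier R}"
  then obtain p q a where "x = frag_of (p + q, a) - frag_of (p, a) - frag_of (q, a)" "a \<in> carrier R" by blast
  hence "x \<otimes>\<^bsub>QA\<^esub> frag_of (r, c) \<in> bilin_gens \<and> frag_of (r, c) \<otimes>\<^bsub>QA\<^esub> x \<in> bilin_gens"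
   using c by (simp add: d1 QA_mult distrib_left distrib_right) (metis bm_closed)
  thus ?thesis using generate.incl[of _ bilin_gens "add_monoid QA"] by blast
 next
  assume "x \<in> {frag_of (q, a \<oplus> b) - frag_of (q, a) - frag_of (q, b) |q a b. a \<in> carrier R \<and> b \<in> carrier R}"
  then obtain q a b where "x = frag_of (q, a \<oplus> b) - frag_of (q, a) - frag_of (q, b)" "a \<in> carrier R" "b \<in> carrier R" by blast
  hence "x \<otimes>\<^bsub>QA\<^esub> frag_of (r, c) \<in> bilin_gens \<and> frag_of (r, c) \<otimes>\<^bsub>QA\<^esub> x \<in> bilin_gens"
   using c by (simp add: d1 QA_mult bl_distr br_distr) (metis bm_closed)
  thus ?thesis using generate.incl[of _ bilin_gens "add_monoid QA"] by blast
 qed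
 have "x \<otimes>\<^bsub>QA\<^esub> y \<in> ?I \<and> y \<otimes>\<^bsub>QA\<^esub> x \<in> ?I" if x: "x \<in> bilin_gens" and y: "y \<in> carrier QA" for x y
  using y
 proof (induct rule: QA_induct)
  case 1 thus ?case using I0 by (simp add: z1)
 next
  case (2 q a) thus ?case using gen[OF x] by blast
 next
  case (3 a b) thus ?case unfolding d1 using sub by blast
 qed
 thus ?thesis unfolding bilinear_relations_def by (intro A.generate_bilin_ideal[OF bilin_gens_carrier]) blast+
qed

sublocale QI: bilin_ideal "bilinear_relations R" QA
 by (rule QI_ideal)

lemma QR_def: "QR = QA Quot bilinear_relations R" by (simp add: rat_tensor_def)

sublocale QR: bilin_alg QR
 unfolding QR_def by (rule QI.quot_bilin)

lemma pt_closed: "a \<in> carrier R ==> pt q a \<in> carrier QR"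
 unfolding pure_tensor_def QR_def by (intro QI.quot_closed QA_frag_of)

lemma pt_mult: "a \<in> carrier R ==> b \<in> carrier R ==> pt p a \<otimes>\<^bsub>QR\<^esub> pt q b = pt (p * q) (a \<otimes> b)"
 unfolding pure_tensor_def QR_def by (simp add: QI.quot_mult QA_frag_of QA_mult)

lemma pt_add_left:
 assumes a: "a \<in> carrier R" shows "pt (p + q) a = pt p a \<oplus>\<^bsub>QR\<^esub> pt q a"
proof -
 have "frag_of (p + q, a) - (frag_of (p, a) + frag_of (q, a)) \<in> bilinear_relations R"
  unfolding bilinear_relations_def diff_diff_eq[symmetric] by (rule generate.incl) (use a in blast)
 moreover have "frag_of (p, a) + frag_of (q, a) \<in> carrier QA" using QI.add.m_closed[OF QA_frag_of[OF a] QA_frag_of[OF a]] by (simp add: QA_ops)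
 ultimately have "bilinear_relations R +>\<^bsub>QA\<^esub> frag_of (p + q, a) = bilinear_relations R +>\<^bsub>QA\<^esub> (frag_of (p, a) + frag_of (q, a))"
  using QA_frag_of[OF a] by (subst QI.coset_eq_iff) (simp_all add: QA_minus)
 thus ?thesis unfolding pure_tensor_def QR_def by (simp add: QI.quot_add QA_frag_of a QA_ops)
qed

lemma pt_add_right:
 assumes a: "a \<in> carrier R" "b \<in> carrier R" shows "pt q (a \<oplus> b) = pt q a \<oplus>\<^bsub>QR\<^esub> pt q b"
proof -
 have "frag_of (q, a \<oplus> b) - (frag_of (q, a) + frag_of (q, b)) \<in> bilinear_relations R"
  unfolding bilinear_relations_def diff_diff_eq[symmetric] by (rule generate.incl) (use a in blast)
 moreover have "frag_of (q, a) + frag_of (q, b) \<in> carrier QA" using QI.add.m_closed[OF QA_frag_of[OF a(1)] QA_frag_of[OF a(2)]] by (simp add: QA_ops)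
 ultimately have "bilinear_relations R +>\<^bsub>QA\<^esub> frag_of (q, a \<oplus> b) = bilinear_relations R +>\<^bsub>QA\<^esub> (frag_of (q, a) + frag_of (q, b))"
  using QA_frag_of a by (subst QI.coset_eq_iff) (simp_all add: QA_minus)
 thus ?thesis unfolding pure_tensor_def QR_def by (simp add: QI.quot_add QA_frag_of a QA_ops)
qed

lemma pt_zero: "pt q \<zero> = \<zero>\<^bsub>QR\<^esub>"
 using pt_add_right[of \<zero> \<zero> q] pt_closed[of \<zero> q] by (metis QR.add.l_cancel_one' l_zero zero_closed)

lemma pt_minus_right: "a \<in> carrier R ==> pt q (\<ominus> a) = \<ominus>\<^bsub>QR\<^esub> pt q a"
 using pt_add_right[of "\<ominus> a" a q] by (intro QR.minus_equality[symmetric]) (simp_all add: l_neg pt_zero pt_closed)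

text \<open>Pure tensors generate the quotient as a group. A single case for differences covers sums
  and negatives at once.\<close>

lemma QR_induct [consumes 1, case_names pt diff]:
 assumes "x \<in> carrier QR" "!!q a. a \<in> carrier R ==> P (pt q a)"
  "!!x y. x \<in> carrier QR ==> y \<in> carrier QR ==> P x ==> P y ==> P (x \<ominus>\<^bsub>QR\<^esub> y)"
 shows "P x"
proof -
 obtain w where w: "w \<in> carrier QA" "x = bilinear_relations R +>\<^bsub>QA\<^esub> w" using assms(1) unfolding QR_def QI.quot_carrier by blast
 have "w \<in> carrier QA \<and> P (bilinear_relations R +>\<^bsub>QA\<^esub> w)" using w(1)
 proof (induct rule: QA_induct)
  case 1
  have "pt 0 \<zero> \<ominus>\<^bsub>QR\<^esub> pt 0 \<zero> = bilinear_relations R +>\<^bsub>QA\<^esub> 0"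
   unfolding pure_tensor_def QR_def by (subst QI.quot_diff) (simp_all add: QA_frag_of QA_minus)
  thus ?case using assms(3)[OF pt_closed pt_closed assms(2) assms(2), of \<zero> \<zero> 0 0] by (simp add: QA_carrier)
 next
  case (2 q a) thus ?case using assms(2)[of a q] by (simp add: pure_tensor_def QA_frag_of)
 next
  case (3 x y)
  hence c: "x \<in> carrier QA" "y \<in> carrier QA" by auto
  have "P ((bilinear_relations R +>\<^bsub>QA\<^esub> x) \<ominus>\<^bsub>QR\<^esub> (bilinear_relations R +>\<^bsub>QA\<^esub> y))"
   using 3 c by (intro assms(3)) (simp_all add: QR_def QI.quot_closed)
  thus ?case unfolding QR_def using c by (simp add: QI.quot_diff QA_minus QA_diff_mem)
 qed
 thus ?thesis using w(2) by simp
qed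

text \<open>The function sending \<open>(q, a)\<close> to \<open>q * f a\<close> is bilinear, so its
  additive extension kills both families of relations. In this way additive invariants of a ring
  extend to its rationalization.\<close>

lemma rat_functional:
 assumes add: "!!a b. a \<in> carrier R ==> b \<in> carrier R ==> f (a \<oplus> b) = (f a + f b :: rat)"
 obtains F where "!!q a. a \<in> carrier R ==> F (pt q a) = q * f a"
  "!!x y. x \<in> carrier QR ==> y \<in> carrier QR ==> F (x \<oplus>\<^bsub>QR\<^esub> y) = F x + F y"
proof -
 let ?f = "frag_sum (\<lambda>(q, a). q * f a)"
 have fadd: "?f (x \<oplus>\<^bsub>QA\<^esub> y) = ?f x + ?f y" for x y by (simp add: QA_ops frag_sum_add)
 have z: "?f x = 0" if "x \<in> bilinear_relations R" for x
  by (rule QI.generate_zero_functional[OF _ bilin_gens_carrier _ that[unfolded bilinear_relations_def]])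
   (auto simp: fadd frag_sum_diff add distrib_left distrib_right)
 obtain F where F: "!!x. x \<in> carrier QA ==> F (bilinear_relations R +>\<^bsub>QA\<^esub> x) = ?f x"
  "!!C Y. C \<in> carrier QR ==> Y \<in> carrier QR ==> F (C \<oplus>\<^bsub>QR\<^esub> Y) = F C + F Y"
  unfolding QR_def by (rule QI.quot_functional[OF fadd z]) blast+
 show thesis by (rule that[of F]) (simp_all add: F(2) pure_tensor_def F(1) QA_frag_of)
qed

abbreviation "sc \<equiv> rat_scale R"

lemma sc_closed: "x \<in> carrier QR ==> sc q x \<in> carrier QR"
 unfolding rat_scale_def by (intro QR.bm_closed pt_closed one_mem)

lemma sc_add: "x \<in> carrier QR ==> y \<in> carrier QR ==> sc q (x \<oplus>\<^bsub>QR\<^esub> y) = sc q x \<oplus>\<^bsub>QR\<^esub> sc q y"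
 unfolding rat_scale_def by (intro QR.br_distr pt_closed one_mem)

lemma sc_minus: "x \<in> carrier QR ==> sc q (\<ominus>\<^bsub>QR\<^esub> x) = \<ominus>\<^bsub>QR\<^esub> sc q x"
 unfolding rat_scale_def by (intro QR.br_minus pt_closed one_mem)

lemma sc_diff: "x \<in> carrier QR ==> y \<in> carrier QR ==> sc q (x \<ominus>\<^bsub>QR\<^esub> y) = sc q x \<ominus>\<^bsub>QR\<^esub> sc q y"
 by (simp add: a_minus_def sc_add sc_minus)

lemma sc_pt: "a \<in> carrier R ==> sc q (pt p a) = pt (q * p) a"
 unfolding rat_scale_def by (simp add: pt_mult one_mem l_unit)

lemma sc_left_add: "x \<in> carrier QR ==> sc (p + q) x = sc p x \<oplus>\<^bsub>QR\<^esub> sc q x"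
 unfolding rat_scale_def by (simp add: pt_add_left one_mem QR.bl_distr pt_closed)

lemma sc_sc: "x \<in> carrier QR ==> sc p (sc q x) = sc (p * q) x"
 by (induct x rule: QR_induct) (simp_all add: sc_pt mult.assoc sc_diff sc_closed)

lemma sc_one: "x \<in> carrier QR ==> sc 1 x = x"
 by (induct x rule: QR_induct) (simp_all add: sc_pt sc_diff sc_closed)

lemma sc_zero: "x \<in> carrier QR ==> sc 0 x = \<zero>\<^bsub>QR\<^esub>"
 using sc_left_add[of x 0 0] sc_closed[of x 0] by (metis QR.add.l_cancel_one' add.right_neutral QR.zero_closed)

lemma sc_zero_right: "sc q \<zero>\<^bsub>QR\<^esub> = \<zero>\<^bsub>QR\<^esub>"
 unfolding rat_scale_def by (intro QR.br_null pt_closed one_mem)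

end

section \<open>Classes of gliders\<close>

text \<open>The argument \<open>ty\<close> fixes the field, since the group alone leaves the
  coefficient type of the abbreviations open.\<close>

locale glider_ring = finite_grp G for G :: "('g, 'm) monoid_scheme" (structure) +
 fixes ty :: "'k::field itself"
begin

abbreviation GA :: "(('g, 'k, nat) glider \<Rightarrow>\<^sub>0 int) ring" where "GA \<equiv> glider_alg G"
abbreviation SR :: "(('g, 'k, nat) glider \<Rightarrow>\<^sub>0 int) set" where "SR \<equiv> split_relations G"
abbreviation SG :: "(('g, 'k, nat) glider \<Rightarrow>\<^sub>0 int) set ring" where "SG \<equiv> split_groth_ring G"
abbreviation L0 :: "(('g, 'k, nat) glider \<Rightarrow>\<^sub>0 int) set set" where "L0 \<equiv> length0_ideal G"
abbreviation RR :: "(('g, 'k, nat) glider \<Rightarrow>\<^sub>0 int) set set ring" where "RR \<equiv> reduced_ring G"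
abbreviation R1 :: "(('g, 'k, nat) glider \<Rightarrow>\<^sub>0 int) set set ring" where "R1 \<equiv> R1bar G"

lemma nat_gliders_iff: "M \<in> nat_gliders G \<longleftrightarrow> is_glider G M"
 by (simp add: nat_gliders_def)

lemma GA_bilin: "bilin_alg GA"
 unfolding glider_alg_def by (rule free_alg_bilin) (intro nat_model(1) tensor_is_glider; simp add: nat_gliders_iff)

lemma GA_carrier: "x \<in> carrier GA \<longleftrightarrow> Poly_Mapping.keys x \<subseteq> nat_gliders G"
 by (simp add: glider_alg_def free_alg_simps)

lemma GA_frag_of: "is_glider G M ==> frag_of M \<in> carrier GA"
 by (simp add: GA_carrier nat_gliders_iff)

lemma GA_diff_mem: "x \<in> carrier GA ==> y \<in> carrier GA ==> x - y \<in> carrier GA"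
 using keys_diff[of x y] by (auto simp: GA_carrier)

lemma GA_ops: "x \<oplus>\<^bsub>GA\<^esub> y = x + y" "\<zero>\<^bsub>GA\<^esub> = 0" "\<one>\<^bsub>GA\<^esub> = frag_of unit_glider"
 by (simp_all add: glider_alg_def free_alg_simps)

lemma GA_minus: "x \<in> carrier GA ==> y \<in> carrier GA ==> x \<ominus>\<^bsub>GA\<^esub> y = x - y"
 unfolding glider_alg_def by (rule free_alg_diff[OF GA_bilin[unfolded glider_alg_def]])

lemma GA_mult: "frag_of M \<otimes>\<^bsub>GA\<^esub> frag_of N = frag_of (nat_model G (tensor_glider M N))"
 by (simp add: glider_alg_def free_alg_mult_frag_of)

lemma GA_mult_diff:
 "(x - y) \<otimes>\<^bsub>GA\<^esub> z = x \<otimes>\<^bsub>GA\<^esub> z - y \<otimes>\<^bsub>GA\<^esub> z" "z \<otimes>\<^bsub>GA\<^esub> (x - y) = z \<otimes>\<^bsub>GA\<^esub> x - z \<otimes>\<^bsub>GA\<^esub> y"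
 unfolding glider_alg_def free_alg_mult frag_extend_diff by (simp_all add: frag_extend_diff_fun)

lemma GA_induct [consumes 1, case_names zero frag_of diff]:
 assumes "x \<in> carrier GA" "P 0" "!!M. is_glider G M ==> P (frag_of M)" "!!x y. P x ==> P y ==> P (x - y)"
 shows "P x"
proof -
 have "Poly_Mapping.keys x \<subseteq> nat_gliders G" using assms(1) by (simp add: GA_carrier)
 thus ?thesis by (rule frag_induction) (use assms in \<open>auto simp: nat_gliders_iff\<close>)
qed

lemma unit_glider_line: "line_glider G (unit_glider :: ('g, 'k, nat) glider) (\<lambda>i. if i = 0 then 1 else 0)"
proof -
 have sp: "unit_line = fv.span {\<lambda>i. if i = 0 then 1 else 0 :: 'k}"
  by (auto simp: unit_line_def fv.span_singleton fun_eq_iff fun_apps image_iff)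
 have "is_glider G (unit_glider :: ('g, 'k, nat) glider)"
 proof (rule is_gliderI)
  have "fv.subspace (unit_line :: (nat => 'k) set)" by (simp add: sp)
  thus "is_kgmod G (unit_glider :: ('g, 'k, nat) glider)" "fv.subspace (lev_m1 (unit_glider :: ('g, 'k, nat) glider))"
   by (auto simp: is_kgmod_def unit_glider_def flin_lin_on[OF flin_id])
  have "fin_dim (fv.span {\<lambda>i::nat. if i = 0 then 1 else 0 :: 'k})" by (simp add: fin_dim_span)
  thus "fin_dim (lev_0 (unit_glider :: ('g, 'k, nat) glider))" by (simp add: unit_glider_def sp)
 qed (auto simp: unit_glider_def)
 moreover have "(\<lambda>i. if i = 0 then 1 else 0 :: 'k) ~= (0 :: nat => 'k)" by (auto simp: fun_eq_iff fun_apps)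
 ultimately show ?thesis using sp by (simp add: line_glider_def unit_glider_def)
qed

abbreviation split_gens :: "(('g, 'k, nat) glider \<Rightarrow>\<^sub>0 int) set" where
 "split_gens \<equiv> {frag_of M - frag_of N |M N. M \<in> nat_gliders G \<and> N \<in> nat_gliders G \<and> glider_iso G M N} \<union>
   {frag_of P - frag_of M - frag_of N |P M N. P \<in> nat_gliders G \<and> M \<in> nat_gliders G \<and>
     N \<in> nat_gliders G \<and> glider_iso G P (dsum_glider M N)}"

lemma split_gens_carrier: "split_gens \<subseteq> carrier GA"
 by (auto intro!: GA_diff_mem GA_frag_of simp: nat_gliders_iff)

lemma nat_model_iso:
 assumes M: "is_glider G M" and N: "is_glider G N" and "glider_iso G M N"
 shows "glider_iso G (nat_model G M) (nat_model G N)"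
proof -
 note m = nat_model[OF M] and n = nat_model[OF N]
 have "glider_iso G (nat_model G M) N" by (rule glider_iso_trans[OF m(2) M N m(3) assms(3)])
 thus ?thesis by (rule glider_iso_trans[OF m(2) N n(2) _ glider_iso_sym[OF n(2) N n(3)]])
qed

text \<open>Tensoring a relation with a glider yields a relation again: isomorphisms can be
  tensored, and the tensor product distributes over direct sums. As the product of generators is a
  \<open>nat_model\<close>, every tensor product has to be exchanged for its model on the
  way.\<close>

lemma SR_ideal: "bilin_ideal SR GA"
proof -
 interpret A: bilin_alg GA by (rule GA_bilin)
 let ?I = "generate (add_monoid GA) split_gens"
 interpret I: additive_subgroup ?I GA by (rule A.generate_additive_subgroup[OF split_gens_carrier])
 have sub: "x - y \<in> ?I" if "x \<in> ?I" "y \<in> ?I" for x y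
  using that I.a_subset A.minus_closed[of x y] I.a_closed[OF that(1) I.a_inv_closed[OF that(2)]] GA_minus[of x y]
  by (auto simp: a_minus_def)
 have z1: "0 \<otimes>\<^bsub>GA\<^esub> z = 0" "z \<otimes>\<^bsub>GA\<^esub> 0 = 0" for z
  using GA_mult_diff(1)[of 0 0 z] GA_mult_diff(2)[of z 0 0] by simp_all
 have I0: "0 \<in> ?I" using I.zero_closed by (simp add: GA_ops)
 have ts: "is_glider G (nat_model G (tensor_glider M N))" "is_glider G (tensor_glider M N)"
  if "is_glider G M" "is_glider G N" for M N :: "('g, 'k, nat) glider"
  using nat_model(2)[OF tensor_is_glider[OF that]] tensor_is_glider[OF that] by auto
 have gen: "x \<otimes>\<^bsub>GA\<^esub> frag_of Q \<in> split_gens \<and> frag_of Q \<otimes>\<^bsub>GA\<^esub> x \<in> split_gens" if x: "x \<in> split_gens" and Q: "is_glider G Q" for x Q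
  using x
 proof
  assume "x \<in> {frag_of M - frag_of N |M N. M \<in> nat_gliders G \<and> N \<in> nat_gliders G \<and> glider_iso G M N}"
  then obtain M N where e: "x = frag_of M - frag_of N" and MN: "is_glider G M" "is_glider G N" "glider_iso G M N"
   by (auto simp: nat_gliders_iff)
  note QQ = glider_iso_refl[OF Q]
  have 1: "glider_iso G (nat_model G (tensor_glider M Q)) (nat_model G (tensor_glider N Q))"
   by (rule nat_model_iso[OF ts(2)[OF MN(1) Q] ts(2)[OF MN(2) Q] tensor_iso[OF MN(1,2) Q Q MN(3) QQ]])
  have 2: "glider_iso G (nat_model G (tensor_glider Q M)) (nat_model G (tensor_glider Q N))"
   by (rule nat_model_iso[OF ts(2)[OF Q MN(1)] ts(2)[OF Q MN(2)] tensor_iso[OF Q Q MN(1,2) QQ MN(3)]])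
  show ?thesis unfolding e GA_mult_diff GA_mult nat_gliders_iff
   using 1 2 ts[OF MN(1) Q] ts[OF MN(2) Q] ts[OF Q MN(1)] ts[OF Q MN(2)] by blast
 next
  assume "x \<in> {frag_of P - frag_of M - frag_of N |P M N. P \<in> nat_gliders G \<and> M \<in> nat_gliders G \<and>
     N \<in> nat_gliders G \<and> glider_iso G P (dsum_glider M N)}"
  then obtain P M N where e: "x = frag_of P - frag_of M - frag_of N"
   and MN: "is_glider G P" "is_glider G M" "is_glider G N" "glider_iso G P (dsum_glider M N)"
   by (auto simp: nat_gliders_iff)
  note QQ = glider_iso_refl[OF Q] and D = dsum_is_glider[OF MN(2,3)]
  let ?m = "\<lambda>M N. nat_model G (tensor_glider M N)"
  note t = ts[OF MN(1) Q] ts[OF MN(2) Q] ts[OF MN(3) Q] ts[OF Q MN(1)] ts[OF Q MN(2)] ts[OF Q MN(3)]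
  have d1: "is_glider G (dsum_glider (tensor_glider M Q) (tensor_glider N Q))"
   "is_glider G (dsum_glider (?m M Q) (?m N Q))" "is_glider G (dsum_glider (?m Q M) (?m Q N))"
   by (intro dsum_is_glider t)+
  have tD: "is_glider G (tensor_glider (dsum_glider M N) Q)" by (rule tensor_is_glider[OF D Q])
  have a: "glider_iso G (tensor_glider P Q) (dsum_glider (tensor_glider M Q) (tensor_glider N Q))"
   by (rule glider_iso_trans[OF t(2) tD d1(1) tensor_iso[OF MN(1) D Q Q MN(4) QQ] tensor_dsum_iso[OF MN(2,3) Q]])
  have b: "glider_iso G (dsum_glider (tensor_glider M Q) (tensor_glider N Q)) (dsum_glider (?m M Q) (?m N Q))"
   by (rule dsum_iso[OF t(4) t(3) t(6) t(5) glider_iso_sym[OF t(3,4) nat_model(3)[OF t(4)]] glider_iso_sym[OF t(5,6) nat_model(3)[OF t(6)]]])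
  have c: "glider_iso G (tensor_glider P Q) (dsum_glider (?m M Q) (?m N Q))"
   by (rule glider_iso_trans[OF t(2) d1(1,2) a b])
  have 1: "glider_iso G (?m P Q) (dsum_glider (?m M Q) (?m N Q))"
   by (rule glider_iso_trans[OF t(1,2) d1(2) nat_model(3)[OF t(2)] c])
  \<comment> \<open>Distributivity is at hand with the sum in the left factor; the other side
    follows by swapping factors.\<close>
  have sw: "glider_iso G (?m M Q) (?m Q M)" "glider_iso G (?m N Q) (?m Q N)" "glider_iso G (?m Q P) (?m P Q)"
   by (intro nat_model_iso t tensor_swap_iso MN Q)+
  have "glider_iso G (dsum_glider (?m M Q) (?m N Q)) (dsum_glider (?m Q M) (?m Q N))" by (intro dsum_iso t sw)
  hence "glider_iso G (?m P Q) (dsum_glider (?m Q M) (?m Q N))" by (rule glider_iso_trans[OF t(1) d1(2,3) 1])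
  hence 2: "glider_iso G (?m Q P) (dsum_glider (?m Q M) (?m Q N))"
   by (rule glider_iso_trans[OF t(7) t(1) d1(3) sw(3)])
  show ?thesis unfolding e GA_mult_diff GA_mult nat_gliders_iff using 1 2 t by blast
 qed
 have "x \<otimes>\<^bsub>GA\<^esub> y \<in> ?I \<and> y \<otimes>\<^bsub>GA\<^esub> x \<in> ?I" if x: "x \<in> split_gens" and y: "y \<in> carrier GA" for x y
  using y
 proof (induct rule: GA_induct)
  case zero thus ?case using I0 unfolding z1 by blast
 next
  case (frag_of M) show ?case using gen[OF x frag_of] generate.incl[of _ split_gens "add_monoid GA"] by blast
 next
  case (diff a b) thus ?case unfolding GA_mult_diff using sub by blast
 qed
 thus ?thesis unfolding split_relations_def by (intro A.generate_bilin_ideal[OF split_gens_carrier]) blast+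
qed

sublocale S: bilin_ideal SR GA by (rule SR_ideal)

section \<open>The split Grothendieck ring\<close>

lemma SG_def: "SG = GA Quot SR" by (simp add: split_groth_ring_def)

lemma SG_bilin: "bilin_alg SG" unfolding SG_def by (rule S.quot_bilin)

lemma sclass_closed: "is_glider G M ==> split_class G M \<in> carrier SG"
 unfolding split_class_def SG_def by (intro S.quot_closed GA_frag_of nat_model(2))

lemma split_iso_coset:
 assumes "is_glider G M" "is_glider G N" "glider_iso G M N"
 shows "SR +>\<^bsub>GA\<^esub> frag_of M = SR +>\<^bsub>GA\<^esub> frag_of N"
proof -
 have "frag_of M - frag_of N \<in> SR"
  unfolding split_relations_def by (rule generate.incl) (use assms in \<open>auto simp: nat_gliders_iff\<close>)
 thus ?thesis using assms by (simp add: S.coset_eq_iff GA_frag_of GA_minus)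
qed

lemma sclass_iso:
 assumes "is_glider G M" "is_glider G N" "glider_iso G M N"
 shows "(split_class G M :: (('g, 'k, nat) glider \<Rightarrow>\<^sub>0 int) set) = split_class G N"
 unfolding split_class_def by (rule split_iso_coset[OF nat_model(2)[OF assms(1)] nat_model(2)[OF assms(2)] nat_model_iso[OF assms]])

lemma sclass_nat: "is_glider G M ==> split_class G M = SR +>\<^bsub>GA\<^esub> frag_of M"
 unfolding split_class_def by (rule split_iso_coset[OF nat_model(2) _ nat_model(3)])

lemma sclass_dsum:
 fixes M :: "('g, 'k, 'i) glider" and N :: "('g, 'k, 'j) glider"
 assumes M: "is_glider G M" and N: "is_glider G N"
 shows "split_class G (dsum_glider M N) = split_class G M \<oplus>\<^bsub>SG\<^esub> split_class G N"
proof -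
 note m = nat_model[OF M] and n = nat_model[OF N] and D = dsum_is_glider[OF M N]
 note p = nat_model[OF D]
 have "glider_iso G (dsum_glider M N) (dsum_glider (nat_model G M) (nat_model G N))"
  by (rule dsum_iso[OF M m(2) N n(2) glider_iso_sym[OF m(2) M m(3)] glider_iso_sym[OF n(2) N n(3)]])
 hence gi: "glider_iso G (nat_model G (dsum_glider M N)) (dsum_glider (nat_model G M) (nat_model G N))"
  by (rule glider_iso_trans[OF p(2) D dsum_is_glider[OF m(2) n(2)] p(3)])
 have "frag_of (nat_model G (dsum_glider M N)) - frag_of (nat_model G M) - frag_of (nat_model G N) \<in> SR"
  unfolding split_relations_def by (rule generate.incl, rule UnI2) (use p(1) m(1) n(1) gi in blast)
 hence r: "frag_of (nat_model G (dsum_glider M N)) - (frag_of (nat_model G M) + frag_of (nat_model G N)) \<in> SR"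
  by (simp add: diff_diff_eq)
 note c = GA_frag_of[OF m(2)] GA_frag_of[OF n(2)] GA_frag_of[OF p(2)]
 have s: "frag_of (nat_model G M) + frag_of (nat_model G N) \<in> carrier GA"
  using S.add.m_closed[OF c(1,2)] by (simp add: GA_ops)
 have "SR +>\<^bsub>GA\<^esub> frag_of (nat_model G (dsum_glider M N)) = SR +>\<^bsub>GA\<^esub> (frag_of (nat_model G M) + frag_of (nat_model G N))"
  using r by (subst S.coset_eq_iff[OF c(3) s]) (simp add: GA_minus c s)
 thus ?thesis unfolding split_class_def SG_def S.quot_add[OF c(1,2)] by (simp add: GA_ops)
qed

lemma sclass_tensor:
 fixes M :: "('g, 'k, 'i) glider" and N :: "('g, 'k, 'j) glider"
 assumes M: "is_glider G M" and N: "is_glider G N"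
 shows "split_class G (tensor_glider M N) = split_class G M \<otimes>\<^bsub>SG\<^esub> split_class G N"
proof -
 note m = nat_model[OF M] and n = nat_model[OF N]
 have i: "glider_iso G (tensor_glider (nat_model G M) (nat_model G N)) (tensor_glider M N)"
  by (rule tensor_iso[OF m(2) M n(2) N m(3) n(3)])
 have "split_class G M \<otimes>\<^bsub>SG\<^esub> split_class G N = split_class G (tensor_glider (nat_model G M) (nat_model G N))"
  unfolding split_class_def SG_def by (simp add: S.quot_mult GA_frag_of m(2) n(2) GA_mult)
 also have "\<dots> = split_class G (tensor_glider M N)"
  by (rule sclass_iso[OF tensor_is_glider[OF m(2) n(2)] tensor_is_glider[OF M N] i])
 finally show ?thesis by simp
qed

lemma SG_induct [consumes 1, case_names sclass diff]:
 assumes "x \<in> carrier SG" "!!M :: ('g, 'k, nat) glider. is_glider G M ==> P (split_class G M)"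
  "!!x y. x \<in> carrier SG ==> y \<in> carrier SG ==> P x ==> P y ==> P (x \<ominus>\<^bsub>SG\<^esub> y)"
 shows "P x"
proof -
 obtain w where w: "w \<in> carrier GA" "x = SR +>\<^bsub>GA\<^esub> w" using assms(1) unfolding SG_def S.quot_carrier by blast
 have fr: "P (SR +>\<^bsub>GA\<^esub> frag_of M)" if "is_glider G M" for M using assms(2)[OF that] sclass_nat[OF that] by simp
 have "w \<in> carrier GA \<and> P (SR +>\<^bsub>GA\<^esub> w)" using w(1)
 proof (induct rule: GA_induct)
  case zero
  interpret A: bilin_alg SG by (rule SG_bilin)
  have c: "0 \<in> carrier GA" by (simp add: GA_carrier)
  note gM = line_gliderD(1)[OF unit_glider_line]
  have "P ((SR +>\<^bsub>GA\<^esub> frag_of unit_glider) \<ominus>\<^bsub>SG\<^esub> (SR +>\<^bsub>GA\<^esub> frag_of unit_glider))"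
   using fr[OF gM] GA_frag_of[OF gM] by (intro assms(3)) (simp_all add: SG_def S.quot_closed)
  thus ?case unfolding SG_def using GA_frag_of[OF gM] c by (simp add: S.quot_diff GA_minus)
 next
  case (frag_of M) thus ?case using fr by (simp add: GA_frag_of)
 next
  case (diff x y)
  hence c: "x \<in> carrier GA" "y \<in> carrier GA" by auto
  have "P ((SR +>\<^bsub>GA\<^esub> x) \<ominus>\<^bsub>SG\<^esub> (SR +>\<^bsub>GA\<^esub> y))"
   using diff c by (intro assms(3)) (simp_all add: SG_def S.quot_closed)
  thus ?case unfolding SG_def using c by (simp add: S.quot_diff GA_minus GA_diff_mem)
 qed
 thus ?thesis using w(2) by simp
qed

section \<open>The quotient by gliders of length 0\<close>

abbreviation l0_gens :: "(('g, 'k, nat) glider \<Rightarrow>\<^sub>0 int) set set" where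
 "l0_gens \<equiv> {split_class G M |M. M \<in> (nat_gliders G :: ('g, 'k, nat) glider set) \<and> length0 M}"

lemma l0_gens_carrier: "l0_gens \<subseteq> carrier SG"
 by (auto simp: nat_gliders_iff sclass_closed)

lemma l0_gensI: "is_glider G (M :: ('g, 'k, 'i) glider) ==> length0 M ==> split_class G M \<in> l0_gens"
 using nat_model[of M] length0_iso[OF _ _ glider_iso_sym[OF nat_model(2) _ nat_model(3)], of M]
  sclass_iso[OF nat_model(2) _ nat_model(3), of M] by blast

lemma L0_ideal: "bilin_ideal L0 SG"
proof -
 interpret A: bilin_alg SG by (rule SG_bilin)
 let ?I = "generate (add_monoid SG) l0_gens"
 interpret I: additive_subgroup ?I SG by (rule A.generate_additive_subgroup[OF l0_gens_carrier])
 have sub: "x \<ominus>\<^bsub>SG\<^esub> y \<in> ?I" if "x \<in> ?I" "y \<in> ?I" for x y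
  unfolding a_minus_def by (rule I.a_closed[OF that(1) I.a_inv_closed[OF that(2)]])
 have "x \<otimes>\<^bsub>SG\<^esub> y \<in> ?I \<and> y \<otimes>\<^bsub>SG\<^esub> x \<in> ?I" if x: "x \<in> l0_gens" and y: "y \<in> carrier SG" for x y
  using y
 proof (induct rule: SG_induct)
  case (sclass Q)
  obtain M :: "('g, 'k, nat) glider" where M: "x = split_class G M" "is_glider G M" "length0 M" using x by (auto simp: nat_gliders_iff)
  note t = tensor_is_glider[OF M(2) sclass] tensor_is_glider[OF sclass M(2)]
  have "length0 (tensor_glider Q M)"
   by (rule length0_iso[OF t tensor_swap_iso[OF M(2) sclass] tensor_length0[OF M(3)]])
  hence "split_class G (tensor_glider M Q) \<in> l0_gens" "split_class G (tensor_glider Q M) \<in> l0_gens"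
   using l0_gensI[OF t(1) tensor_length0[OF M(3)]] l0_gensI[OF t(2)] by blast+
  thus ?case unfolding M(1) sclass_tensor[OF M(2) sclass] sclass_tensor[OF sclass M(2)]
   using generate.incl[of _ l0_gens "add_monoid SG"] by blast
 next
  case (diff a b)
  have xc: "x \<in> carrier SG" using x l0_gens_carrier by blast
  have "x \<otimes>\<^bsub>SG\<^esub> (a \<ominus>\<^bsub>SG\<^esub> b) = x \<otimes>\<^bsub>SG\<^esub> a \<ominus>\<^bsub>SG\<^esub> x \<otimes>\<^bsub>SG\<^esub> b" "(a \<ominus>\<^bsub>SG\<^esub> b) \<otimes>\<^bsub>SG\<^esub> x = a \<otimes>\<^bsub>SG\<^esub> x \<ominus>\<^bsub>SG\<^esub> b \<otimes>\<^bsub>SG\<^esub> x"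
   using diff xc by (simp_all add: a_minus_def A.bl_distr A.br_distr A.bl_minus A.br_minus)
  thus ?case using diff sub by simp
 qed
 thus ?thesis unfolding length0_ideal_def by (intro A.generate_bilin_ideal[OF l0_gens_carrier]) blast+
qed

sublocale L: bilin_ideal L0 SG by (rule L0_ideal)

lemma RR_def: "RR = SG Quot L0" by (simp add: reduced_ring_def)

lemma RR_bilin: "bilin_alg RR" unfolding RR_def by (rule L.quot_bilin)

lemma gclass_closed: "is_glider G M ==> glider_class G M \<in> carrier RR"
 unfolding glider_class_def RR_def by (intro L.quot_closed sclass_closed)

lemma gclass_iso:
 "is_glider G M ==> is_glider G N ==> glider_iso G M N ==>
   (glider_class G M :: (('g, 'k, nat) glider \<Rightarrow>\<^sub>0 int) set set) = glider_class G N"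
 unfolding glider_class_def using sclass_iso by metis

lemma gclass_tensor:
 fixes M :: "('g, 'k, 'i) glider" and N :: "('g, 'k, 'j) glider"
 assumes M: "is_glider G M" and N: "is_glider G N"
 shows "glider_class G (tensor_glider M N) = glider_class G M \<otimes>\<^bsub>RR\<^esub> glider_class G N"
 unfolding glider_class_def RR_def L.quot_mult[OF sclass_closed[OF M] sclass_closed[OF N]] sclass_tensor[OF M N] ..

lemma gclass_cyclic_part:
 fixes M :: "('g, 'k, 'i) glider"
 assumes M: "is_glider G M" shows "glider_class G (cyclic_part M) = glider_class G M"
proof -
 obtain C :: "('g, 'k, 'i) glider" where C: "is_glider G C" "length0 C" "glider_iso G M (dsum_glider (cyclic_part M) C)"
  by (rule cyclic_part_split[OF M])
 note P = cyclic_part_glider[OF M] and c = sclass_closed[OF cyclic_part_glider[OF M]] sclass_closed[OF C(1)]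
 have "split_class G M = split_class G (cyclic_part M) \<oplus>\<^bsub>SG\<^esub> split_class G C"
  using sclass_iso[OF M dsum_is_glider[OF P C(1)] C(3)] sclass_dsum[OF P C(1)] by simp
 moreover have "split_class G C \<in> L0" unfolding length0_ideal_def by (rule generate.incl[OF l0_gensI[OF C(1,2)]])
 ultimately have "split_class G M \<ominus>\<^bsub>SG\<^esub> split_class G (cyclic_part M) \<in> L0"
  using c by (simp add: a_minus_def L.a_comm[of "split_class G (cyclic_part M)"] L.a_assoc L.r_neg)
 thus ?thesis unfolding glider_class_def using L.coset_eq_iff[OF sclass_closed[OF M] c(1)] by simp
qed

text \<open>Modulo length 0 a line glider agrees with the irreducible glider generated by its line,
  and that one is determined by its annihilator.\<close>

lemma gclass_Ann:
 fixes M :: "('g, 'k, 'i) glider" and N :: "('g, 'k, 'j) glider"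
 assumes M: "line_glider G M u" and N: "line_glider G N v" and A: "Ann G M = Ann G N"
 shows "glider_class G M = glider_class G N"
proof -
 note gM = line_gliderD(1)[OF M] and gN = line_gliderD(1)[OF N]
 have "glider_iso G (cyclic_part M) (cyclic_part N)"
  by (rule irreducible_iso_Ann[OF cyclic_part_irreducible[OF M] cyclic_part_irreducible[OF N]]) (simp add: Ann_cyclic_part A)
 hence "glider_class G (cyclic_part M) = glider_class G (cyclic_part N)"
  by (rule gclass_iso[OF cyclic_part_glider[OF gM] cyclic_part_glider[OF gN]])
 thus ?thesis using gclass_cyclic_part[OF gM] gclass_cyclic_part[OF gN] by simp
qed

text \<open>The multiplicity respects isomorphisms and direct sums and vanishes in length 0, and
  these are the relations imposed in the two quotients. It is the means to tell classes
  apart.\<close>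

lemma multiplicity_functional:
 obtains F :: "(('g, 'k, nat) glider \<Rightarrow>\<^sub>0 int) set set => int"
 where "!!M :: ('g, 'k, nat) glider. is_glider G M ==> F (glider_class G M) = multiplicity_of G I M"
  "!!x y. x \<in> carrier RR ==> y \<in> carrier RR ==> F (x \<oplus>\<^bsub>RR\<^esub> y) = F x + F y"
proof -
 let ?f = "frag_sum (\<lambda>M :: ('g, 'k, nat) glider. multiplicity_of G I M)"
 have fadd: "?f (x \<oplus>\<^bsub>GA\<^esub> y) = ?f x + ?f y" for x y by (simp add: GA_ops frag_sum_add)
 have z0: "?f x = 0" if "x \<in> split_gens" for x using that
 proof
  assume "x \<in> {frag_of M - frag_of N |M N. M \<in> nat_gliders G \<and> N \<in> nat_gliders G \<and> glider_iso G M N}"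
  then obtain M N where "x = frag_of M - frag_of N" "is_glider G M" "is_glider G N" "glider_iso G M N"
   by (auto simp: nat_gliders_iff)
  thus ?thesis using multiplicity_iso[of M N] by (simp add: frag_sum_diff)
 next
  assume "x \<in> {frag_of P - frag_of M - frag_of N |P M N. P \<in> nat_gliders G \<and> M \<in> nat_gliders G \<and>
     N \<in> nat_gliders G \<and> glider_iso G P (dsum_glider M N)}"
  then obtain P M N where e: "x = frag_of P - frag_of M - frag_of N"
   and MN: "is_glider G P" "is_glider G M" "is_glider G N" "glider_iso G P (dsum_glider M N)"
   by (auto simp: nat_gliders_iff)
  thus ?thesis using multiplicity_iso[OF MN(1) dsum_is_glider[OF MN(2,3)] MN(4)] multiplicity_dsum[OF MN(2,3)]
   by (simp add: frag_sum_diff)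
 qed
 have z: "?f x = 0" if "x \<in> SR" for x
  by (rule S.generate_zero_functional[OF fadd split_gens_carrier z0 that[unfolded split_relations_def]])
 obtain F1 where F1: "!!x. x \<in> carrier GA ==> F1 (SR +>\<^bsub>GA\<^esub> x) = ?f x"
  "!!C Y. C \<in> carrier SG ==> Y \<in> carrier SG ==> F1 (C \<oplus>\<^bsub>SG\<^esub> Y) = F1 C + F1 Y"
  unfolding SG_def by (rule S.quot_functional[OF fadd z]) blast+
 have F1c: "F1 (split_class G M) = multiplicity_of G I M" if "is_glider G M" for M :: "('g, 'k, nat) glider"
  using F1(1)[OF GA_frag_of[OF that]] sclass_nat[OF that] by simp
 have y0: "F1 x = 0" if "x \<in> l0_gens" for x using that F1c multiplicity_length0 by (auto simp: nat_gliders_iff)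
 have y: "F1 x = 0" if "x \<in> L0" for x
  by (rule L.generate_zero_functional[OF F1(2) l0_gens_carrier y0 that[unfolded length0_ideal_def]])
 obtain F where F: "!!x. x \<in> carrier SG ==> F (L0 +>\<^bsub>SG\<^esub> x) = F1 x"
  "!!C Y. C \<in> carrier RR ==> Y \<in> carrier RR ==> F (C \<oplus>\<^bsub>RR\<^esub> Y) = F C + F Y"
  unfolding RR_def by (rule L.quot_functional[OF F1(2) y]) blast+
 show thesis by (rule that[of F]) (simp_all add: F(2) glider_class_def F(1) sclass_closed F1c)
qed

lemma gclass_one: "\<one>\<^bsub>RR\<^esub> = glider_class G (unit_glider :: ('g, 'k, nat) glider)"
proof -
 have "split_class G (unit_glider :: ('g, 'k, nat) glider) = \<one>\<^bsub>SG\<^esub>"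
  unfolding sclass_nat[OF line_gliderD(1)[OF unit_glider_line]] SG_def by (simp add: S.quot_simps GA_ops)
 thus ?thesis unfolding glider_class_def RR_def by (simp add: L.quot_simps)
qed

section \<open>The subring generated by irreducible classes\<close>

definition irr_classes :: "(('g, 'k, nat) glider \<Rightarrow>\<^sub>0 int) set set set" where
 "irr_classes = {glider_class G M |M. M \<in> (nat_gliders G :: ('g, 'k, nat) glider set) \<and> irreducible_glider G M}"

lemma line_irr_class:
 fixes M :: "('g, 'k, 'i) glider"
 assumes "line_glider G M u" shows "glider_class G M \<in> irr_classes"
proof -
 note M = line_gliderD(1)[OF assms] and P = cyclic_part_glider[OF line_gliderD(1)[OF assms]]
 note n = nat_model[OF P]
 have i: "irreducible_glider G (nat_model G (cyclic_part M))"
  by (rule irreducible_iso[OF cyclic_part_irreducible[OF assms] n(2) glider_iso_sym[OF n(2) P n(3)]])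
 have "glider_class G M = glider_class G (nat_model G (cyclic_part M))"
  using gclass_cyclic_part[OF M] gclass_iso[OF n(2) P n(3)] by simp
 thus ?thesis unfolding irr_classes_def using i n(1) by blast
qed

lemma irr_class_line:
 assumes "c \<in> irr_classes"
 obtains M u where "line_glider G M u" "irreducible_glider G M" "c = glider_class G (M :: ('g, 'k, nat) glider)"
 using assms irreducible_line unfolding irr_classes_def by blast

lemma irr_classes_carrier: "irr_classes \<subseteq> carrier RR"
 by (auto simp: irr_classes_def nat_gliders_iff gclass_closed)

lemma irr_classes_mult:
 assumes "c \<in> irr_classes" "d \<in> irr_classes" shows "c \<otimes>\<^bsub>RR\<^esub> d \<in> irr_classes"
proof -
 obtain M u where M: "line_glider G M u" "c = glider_class G (M :: ('g, 'k, nat) glider)" by (rule irr_class_line[OF assms(1)])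
 obtain N v where N: "line_glider G N v" "d = glider_class G (N :: ('g, 'k, nat) glider)" by (rule irr_class_line[OF assms(2)])
 have "glider_class G (tensor_glider M N) \<in> irr_classes" by (rule line_irr_class[OF tensor_line(1)[OF M(1) N(1)]])
 thus ?thesis using gclass_tensor[OF line_gliderD(1)[OF M(1)] line_gliderD(1)[OF N(1)]] M N by simp
qed

abbreviation "IS \<equiv> generate (add_monoid RR) irr_classes"

text \<open>The tensor product of two lines is a line, so irreducible classes are closed under
  multiplication. The additive group they generate is therefore already a subring.\<close>

lemma R1_carrier: "carrier R1 = IS"
proof -
 interpret A: bilin_alg RR by (rule RR_bilin)
 interpret I: additive_subgroup IS RR by (rule A.generate_additive_subgroup[OF irr_classes_carrier])
 have ops: "\<ominus>\<^bsub>RR\<^esub> x = inv\<^bsub>add_monoid RR\<^esub> x" for x by (simp add: a_inv_def)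
 have m1: "c \<otimes>\<^bsub>RR\<^esub> y \<in> IS" if c: "c \<in> irr_classes" and y: "y \<in> IS" for c y using y
 proof (induct rule: generate.induct)
  case one thus ?case using c irr_classes_carrier I.zero_closed by (simp add: A.br_null subsetD)
 next
  case (incl h) thus ?case using irr_classes_mult[OF c] by (intro generate.incl)
 next
  case (inv h)
  have "c \<otimes>\<^bsub>RR\<^esub> h \<in> IS" using irr_classes_mult[OF c inv] by (intro generate.incl)
  hence "\<ominus>\<^bsub>RR\<^esub> (c \<otimes>\<^bsub>RR\<^esub> h) \<in> IS" by (rule I.a_inv_closed)
  moreover have "c \<otimes>\<^bsub>RR\<^esub> (\<ominus>\<^bsub>RR\<^esub> h) = \<ominus>\<^bsub>RR\<^esub> (c \<otimes>\<^bsub>RR\<^esub> h)"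
   using c inv irr_classes_carrier by (intro A.br_minus) auto
  ultimately show ?case unfolding ops[symmetric] by simp
 next
  case (eng h k)
  hence "c \<otimes>\<^bsub>RR\<^esub> h \<oplus>\<^bsub>RR\<^esub> c \<otimes>\<^bsub>RR\<^esub> k \<in> IS" by (intro I.a_closed)
  moreover have "c \<otimes>\<^bsub>RR\<^esub> (h \<oplus>\<^bsub>RR\<^esub> k) = c \<otimes>\<^bsub>RR\<^esub> h \<oplus>\<^bsub>RR\<^esub> c \<otimes>\<^bsub>RR\<^esub> k"
   using eng(1,3) I.a_subset c irr_classes_carrier by (intro A.br_distr) auto
  ultimately show ?case by simp
 qed
 have m2: "x \<otimes>\<^bsub>RR\<^esub> y \<in> IS" if x: "x \<in> IS" and y: "y \<in> IS" for x y using x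
 proof (induct rule: generate.induct)
  case one thus ?case using y I.a_subset I.zero_closed by (simp add: A.bl_null subsetD)
 next
  case (incl h) thus ?case by (rule m1[OF _ y])
 next
  case (inv h)
  have "\<ominus>\<^bsub>RR\<^esub> (h \<otimes>\<^bsub>RR\<^esub> y) \<in> IS" by (rule I.a_inv_closed[OF m1[OF inv y]])
  moreover have "(\<ominus>\<^bsub>RR\<^esub> h) \<otimes>\<^bsub>RR\<^esub> y = \<ominus>\<^bsub>RR\<^esub> (h \<otimes>\<^bsub>RR\<^esub> y)"
   using y I.a_subset inv irr_classes_carrier by (intro A.bl_minus) auto
  ultimately show ?case unfolding ops[symmetric] by simp
 next
  case (eng h k)
  hence "h \<otimes>\<^bsub>RR\<^esub> y \<oplus>\<^bsub>RR\<^esub> k \<otimes>\<^bsub>RR\<^esub> y \<in> IS" by (intro I.a_closed)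
  moreover have "(h \<oplus>\<^bsub>RR\<^esub> k) \<otimes>\<^bsub>RR\<^esub> y = h \<otimes>\<^bsub>RR\<^esub> y \<oplus>\<^bsub>RR\<^esub> k \<otimes>\<^bsub>RR\<^esub> y"
   using eng(1,3) I.a_subset y by (intro A.bl_distr) auto
  ultimately show ?case by simp
 qed
 have one_irr: "\<one>\<^bsub>RR\<^esub> \<in> irr_classes" unfolding gclass_one by (rule line_irr_class[OF unit_glider_line])
 have "x \<in> IS" if "x \<in> generate_ring RR irr_classes" for x using that
 proof (induct rule: generate_ring.induct)
  case one show ?case by (rule generate.incl[OF one_irr])
 next
  case (incl h) thus ?case by (rule generate.incl)
 next
  case (a_inv h) show ?case by (rule I.a_inv_closed[OF a_inv(2)])
 next
  case (eng_add h k) show ?case by (rule I.a_closed[OF eng_add(2,4)])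
 next
  case (eng_mult h k) show ?case by (rule m2[OF eng_mult(2,4)])
 qed
 moreover have "x \<in> generate_ring RR irr_classes" if "x \<in> IS" for x using that
 proof (induct rule: generate.induct)
  case one
  have "\<ominus>\<^bsub>RR\<^esub> \<one>\<^bsub>RR\<^esub> \<oplus>\<^bsub>RR\<^esub> \<one>\<^bsub>RR\<^esub> \<in> generate_ring RR irr_classes"
   by (intro generate_ring.eng_add generate_ring.a_inv generate_ring.one)
  moreover have "\<one>\<^bsub>RR\<^esub> \<in> carrier RR" using \<open>\<one>\<^bsub>RR\<^esub> \<in> irr_classes\<close> irr_classes_carrier by blast
  ultimately show ?case by (simp add: A.l_neg)
 next
  case (inv h) thus ?case unfolding ops[symmetric] by (intro generate_ring.a_inv generate_ring.incl)
 next
  case (eng h k) thus ?case using generate_ring.eng_add[of h RR irr_classes k] by simp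
 qed (rule generate_ring.incl)
 ultimately show ?thesis unfolding R1bar_def irr_classes_def[symmetric] by auto
qed

lemma R1_ops: "x \<oplus>\<^bsub>R1\<^esub> y = x \<oplus>\<^bsub>RR\<^esub> y" "x \<otimes>\<^bsub>R1\<^esub> y = x \<otimes>\<^bsub>RR\<^esub> y" "\<zero>\<^bsub>R1\<^esub> = \<zero>\<^bsub>RR\<^esub>" "\<one>\<^bsub>R1\<^esub> = \<one>\<^bsub>RR\<^esub>"
 by (simp_all add: R1bar_def)

lemma R1_sub: "carrier R1 \<subseteq> carrier RR"
proof -
 interpret A: bilin_alg RR by (rule RR_bilin)
 interpret I: additive_subgroup IS RR by (rule A.generate_additive_subgroup[OF irr_classes_carrier])
 show ?thesis unfolding R1_carrier by (rule I.a_subset)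
qed

lemma R1_irr: "c \<in> irr_classes ==> c \<in> carrier R1"
 unfolding R1_carrier by (rule generate.incl)

lemma R1_bilin: "bilin_alg R1"
proof -
 interpret A: bilin_alg RR by (rule RR_bilin)
 interpret I: additive_subgroup IS RR by (rule A.generate_additive_subgroup[OF irr_classes_carrier])
 have e: "R1 = RR\<lparr>carrier := generate_ring RR irr_classes\<rparr>" by (simp add: R1bar_def irr_classes_def)
 have c: "generate_ring RR irr_classes = IS" using R1_carrier e by simp
 show ?thesis unfolding e
 proof (rule A.sub_bilin)
  show "generate_ring RR irr_classes \<subseteq> carrier RR" unfolding c by (rule I.a_subset)
  show "\<zero>\<^bsub>RR\<^esub> \<in> generate_ring RR irr_classes" unfolding c by (rule I.zero_closed)
 qed (intro generate_ring.a_inv generate_ring.eng_add generate_ring.eng_mult; assumption)+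
qed

lemma R1_induct [consumes 1, case_names irr diff]:
 assumes "x \<in> carrier R1" "!!c. c \<in> irr_classes ==> P c"
  "!!x y. x \<in> carrier R1 ==> y \<in> carrier R1 ==> P x ==> P y ==> P (x \<ominus>\<^bsub>R1\<^esub> y)"
 shows "P x"
proof -
 interpret A: bilin_alg RR by (rule RR_bilin)
 interpret B: bilin_alg R1 by (rule R1_bilin)
 have neg: "inv\<^bsub>add_monoid RR\<^esub> x = \<ominus>\<^bsub>R1\<^esub> x" if "x \<in> carrier R1" for x
 proof -
  have "\<ominus>\<^bsub>R1\<^esub> x \<oplus>\<^bsub>RR\<^esub> x = \<zero>\<^bsub>RR\<^esub>" using B.l_neg[OF that] by (simp add: R1_ops)
  hence "\<ominus>\<^bsub>RR\<^esub> x = \<ominus>\<^bsub>R1\<^esub> x" using that R1_sub B.a_inv_closed[OF that] by (intro A.minus_equality) auto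
  thus ?thesis by (simp add: a_inv_def)
 qed
 have u: "\<one>\<^bsub>RR\<^esub> \<in> irr_classes" unfolding gclass_one by (rule line_irr_class[OF unit_glider_line])
 have z: "P \<zero>\<^bsub>R1\<^esub>" using assms(3)[OF R1_irr[OF u] R1_irr[OF u] assms(2)[OF u] assms(2)[OF u]] R1_irr[OF u] by (simp add: B.r_neg a_minus_def)
 have ng: "P (\<ominus>\<^bsub>R1\<^esub> x)" if "x \<in> carrier R1" "P x" for x
  using assms(3)[OF B.zero_closed that(1) z that(2)] that(1) by (simp add: a_minus_def)
 have "x \<in> carrier R1 \<and> P x" if "x \<in> IS" for x using that
 proof (induct rule: generate.induct)
  case one thus ?case using z B.zero_closed by (simp add: R1_ops)
 next
  case (incl h) thus ?case using assms(2) R1_irr by simp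
 next
  case (inv h)
  thus ?case unfolding neg[OF R1_irr[OF inv]] using ng[OF R1_irr[OF inv] assms(2)[OF inv]] B.a_inv_closed[OF R1_irr[OF inv]] by simp
 next
  case (eng h k)
  hence "P (h \<ominus>\<^bsub>R1\<^esub> (\<ominus>\<^bsub>R1\<^esub> k))" by (intro assms(3) ng) auto
  thus ?case using eng B.add.m_closed[of h k] by (simp add: a_minus_def R1_ops)
 qed
 thus ?thesis using assms(1) unfolding R1_carrier by simp
qed

text \<open>The coordinate functions of the unit glider are the constants 0 and 1, and multiplying a
  set of functions by these does not change its orthogonal complement.\<close>

sublocale R1: bilin_unital R1
proof -
 interpret B: bilin_alg R1 by (rule R1_bilin)
 have u: "\<one>\<^bsub>R1\<^esub> \<in> irr_classes" unfolding R1_ops gclass_one by (rule line_irr_class[OF unit_glider_line])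
 have "\<one>\<^bsub>R1\<^esub> \<otimes>\<^bsub>R1\<^esub> x = x" if "x \<in> carrier R1" for x using that
 proof (induct rule: R1_induct)
  case (irr c)
  obtain M v where M: "line_glider G M v" "c = glider_class G (M :: ('g, 'k, nat) glider)" by (rule irr_class_line[OF irr])
  have A: "Ann G (tensor_glider (unit_glider :: ('g, 'k, nat) glider) M) = Ann G M"
  proof -
   let ?e = "\<lambda>i::nat. if i = 0 then 1 else 0 :: 'k"
   have cf: "coeff_funs (unit_glider :: ('g, 'k, nat) glider) ?e = {\<lambda>g. 1, \<lambda>g. 0}"
    by (auto simp: coeff_funs_def unit_glider_def image_iff)
   have "perp G (prod_set {\<lambda>g. 1, \<lambda>g. 0} S) = perp G S" for S :: "('g => 'k) set"
   proof (intro equalityI subsetI)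
    fix x assume x: "x \<in> perp G (prod_set {\<lambda>g. 1, \<lambda>g. 0} S)"
    have "(\<lambda>g. 1 * c g) \<in> prod_set {\<lambda>g. 1, \<lambda>g. 0} S" if "c \<in> S" for c
     unfolding prod_set_def mem_Collect_eq
     by (rule exI[of _ "\<lambda>g. 1"], rule exI[of _ c]) (use that in simp)
    thus "x \<in> perp G S" using x by (fastforce simp: perp_def)
   qed (auto simp: perp_def prod_set_def)
   thus ?thesis unfolding tensor_line(2)[OF unit_glider_line M(1)] cf Ann_perp[OF M(1)] by simp
  qed
  have "glider_class G (tensor_glider (unit_glider :: ('g, 'k, nat) glider) M) = glider_class G M"
   by (rule gclass_Ann[OF tensor_line(1)[OF unit_glider_line M(1)] M(1) A])
  thus ?case
   unfolding R1_ops gclass_one M(2) gclass_tensor[OF line_gliderD(1)[OF unit_glider_line] line_gliderD(1)[OF M(1)]] .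
 next
  case (diff x y)
  thus ?case using R1_irr[OF u] by (simp add: a_minus_def B.br_distr B.br_minus)
 qed
 thus "bilin_unital R1" using R1_irr[OF u] by unfold_locales
qed

subsection \<open>The rational glider ring\<close>

abbreviation QG :: "('g, 'k) qglider ring" where "QG \<equiv> QGlider G"

lemma QG_eq: "QG = rat_tensor R1" by (simp add: QGlider_def)

lemma qclass_closed: "line_glider G (M :: ('g, 'k, 'i) glider) u ==> qclass G M \<in> carrier QG"
 unfolding qclass_def QG_eq by (intro R1.pt_closed R1_irr line_irr_class)

lemma qclass_Ann:
 fixes M :: "('g, 'k, 'i) glider" and N :: "('g, 'k, 'j) glider"
 assumes "line_glider G M u" "line_glider G N v" "Ann G M = Ann G N"
 shows "qclass G M = qclass G N" unfolding qclass_def using gclass_Ann[OF assms] by simp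

lemma qclass_mult:
 fixes M :: "('g, 'k, 'i) glider" and N :: "('g, 'k, 'j) glider"
 assumes M: "line_glider G M u" and N: "line_glider G N v"
 shows "qclass G M \<otimes>\<^bsub>QG\<^esub> qclass G N = qclass G (tensor_glider M N)"
 unfolding qclass_def QG_eq R1.pt_mult[OF R1_irr[OF line_irr_class[OF M]] R1_irr[OF line_irr_class[OF N]]]
  gclass_tensor[OF line_gliderD(1)[OF M] line_gliderD(1)[OF N]] R1_ops by simp

lemma QG_one: "\<one>\<^bsub>QG\<^esub> = qclass G (unit_glider :: ('g, 'k, nat) glider)"
 unfolding qclass_def QG_eq pure_tensor_def gclass_one[symmetric] R1_ops(4)[symmetric] rat_tensor_def
 by (simp add: FactRing_def rat_tensor_alg_def free_alg_def)

lemma QG_induct [consumes 1, case_names scale diff]: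
 assumes "x \<in> carrier QG"
  "!!q M. is_glider G M ==> irreducible_glider G M ==> P (rat_scale R1 q (qclass G (M :: ('g, 'k, nat) glider)))"
  "!!x y. x \<in> carrier QG ==> y \<in> carrier QG ==> P x ==> P y ==> P (x \<ominus>\<^bsub>QG\<^esub> y)"
 shows "P x" using assms(1) unfolding QG_eq
proof (induct rule: R1.QR_induct)
 case (pt q a)
 thus ?case
 proof (induct rule: R1_induct)
  case (irr c)
  then obtain M :: "('g, 'k, nat) glider" where M: "c = glider_class G M" "is_glider G M" "irreducible_glider G M"
   by (auto simp: irr_classes_def nat_gliders_iff)
  have "rat_scale R1 q (qclass G M) = pure_tensor R1 q c"
   unfolding qclass_def M(1)[symmetric] using R1.sc_pt[OF R1_irr[OF irr], of q 1] by simp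
  thus ?case using assms(2)[OF M(2,3), of q] by simp
 next
  case (diff x y)
  have "pure_tensor R1 q (x \<ominus>\<^bsub>R1\<^esub> y) = pure_tensor R1 q x \<ominus>\<^bsub>rat_tensor R1\<^esub> pure_tensor R1 q y"
   using diff by (simp add: a_minus_def R1.pt_add_right R1.pt_minus_right)
  thus ?case using assms(3)[OF _ _ diff(3,4)] diff(1,2) R1.pt_closed by (simp add: QG_eq)
 qed
next
 case (diff x y) thus ?case using assms(3) by (simp add: QG_eq)
qed

text \<open>The coefficient of the irreducible class with annihilator \<open>I\<close> in a rational
  combination. The required property determines it on the carrier, because multiples of irreducible
  classes generate it; existence is part of \<open>qcoef_nat\<close>.\<close>

definition qcoef :: "('g => 'k) set => ('g, 'k) qglider => rat" where
 "qcoef I = (SOME F. (\<forall>q. \<forall>M u. line_glider G (M :: ('g, 'k, nat) glider) u -->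
    F (rat_scale R1 q (qclass G M)) = (if I = Ann G M then q else 0)) \<and>
   (\<forall>x\<in>carrier QG. \<forall>y\<in>carrier QG. F (x \<oplus>\<^bsub>QG\<^esub> y) = F x + F y))"

lemma qcoef_nat:
 assumes "I \<subseteq> galg G"
 shows "line_glider G (M :: ('g, 'k, nat) glider) u ==> qcoef I (rat_scale R1 q (qclass G M)) = (if I = Ann G M then q else 0)"
  and "x \<in> carrier QG ==> y \<in> carrier QG ==> qcoef I (x \<oplus>\<^bsub>QG\<^esub> y) = qcoef I x + qcoef I y"
proof -
 obtain F where F: "!!M :: ('g, 'k, nat) glider. is_glider G M ==> F (glider_class G M) = multiplicity_of G I M"
  "!!x y. x \<in> carrier RR ==> y \<in> carrier RR ==> F (x \<oplus>\<^bsub>RR\<^esub> y) = F x + F y"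
  by (rule multiplicity_functional) blast
 obtain H :: "_ => rat" where H: "!!q a. a \<in> carrier R1 ==> H (pure_tensor R1 q a) = q * of_int (F a)"
  "!!x y. x \<in> carrier (rat_tensor R1) ==> y \<in> carrier (rat_tensor R1) ==> H (x \<oplus>\<^bsub>rat_tensor R1\<^esub> y) = H x + H y"
  by (rule R1.rat_functional[of "\<lambda>a. of_int (F a)"]) (use F(2) R1_sub in \<open>auto simp: R1_ops subsetD\<close>)
 have "\<exists>F. (\<forall>q. \<forall>M u. line_glider G (M :: ('g, 'k, nat) glider) u -->
    F (rat_scale R1 q (qclass G M)) = (if I = Ann G M then q else 0)) \<and>
   (\<forall>x\<in>carrier QG. \<forall>y\<in>carrier QG. F (x \<oplus>\<^bsub>QG\<^esub> y) = F x + F y)"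
 proof (intro exI conjI allI impI ballI)
  fix q and M :: "('g, 'k, nat) glider" and u assume M: "line_glider G M u"
  have "rat_scale R1 q (qclass G M) = pure_tensor R1 q (glider_class G M)"
   unfolding qclass_def using R1.sc_pt[OF R1_irr[OF line_irr_class[OF M]], of q 1] by simp
  thus "H (rat_scale R1 q (qclass G M)) = (if I = Ann G M then q else 0)"
   using H(1)[OF R1_irr[OF line_irr_class[OF M]]] F(1)[OF line_gliderD(1)[OF M]] multiplicity_line[OF M assms] by simp
 qed (simp add: H(2) QG_eq)
 from someI_ex[OF this, folded qcoef_def]
 show "line_glider G (M :: ('g, 'k, nat) glider) u ==> qcoef I (rat_scale R1 q (qclass G M)) = (if I = Ann G M then q else 0)"
  and "x \<in> carrier QG ==> y \<in> carrier QG ==> qcoef I (x \<oplus>\<^bsub>QG\<^esub> y) = qcoef I x + qcoef I y"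
  by blast+
qed

lemma nat_line_model:
 fixes M :: "('g, 'k, 'i) glider"
 assumes "line_glider G M u"
 obtains N :: "('g, 'k, nat) glider" and w where "line_glider G N w" "irreducible_glider G N" "Ann G N = Ann G M"
  "qclass G N = qclass G M"
proof -
 note P = cyclic_part_glider[OF line_gliderD(1)[OF assms]]
 note n = nat_model[OF P]
 have i: "irreducible_glider G (nat_model G (cyclic_part M))"
  by (rule irreducible_iso[OF cyclic_part_irreducible[OF assms] n(2) glider_iso_sym[OF n(2) P n(3)]])
 obtain w where w: "line_glider G (nat_model G (cyclic_part M)) w" by (rule irreducible_line[OF i])
 have A: "Ann G (nat_model G (cyclic_part M)) = Ann G M" using Ann_iso[OF n(2) P n(3)] by (simp add: Ann_cyclic_part)
 show thesis by (rule that[OF w i A qclass_Ann[OF w assms A]])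
qed

lemma qcoef_line:
 fixes M :: "('g, 'k, 'i) glider"
 assumes I: "I \<subseteq> galg G" and M: "line_glider G M u"
 shows "qcoef I (rat_scale R1 q (qclass G M)) = (if I = Ann G M then q else 0)"
proof -
 obtain N :: "('g, 'k, nat) glider" and w where N: "line_glider G N w" "Ann G N = Ann G M" "qclass G N = qclass G M"
  by (rule nat_line_model[OF M])
 show ?thesis using qcoef_nat(1)[OF I N(1), of q] N by simp
qed

text \<open>The coefficient at an annihilator separates classes, so no two annihilators are merged
  by the quotients and the passage to rational coefficients.\<close>

lemma qclass_eq_iff:
 fixes M :: "('g, 'k, 'i) glider" and N :: "('g, 'k, 'j) glider"
 assumes M: "line_glider G M u" and N: "line_glider G N v"
 shows "qclass G M = qclass G N \<longleftrightarrow> Ann G M = Ann G N"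
proof
 assume e: "qclass G M = qclass G N"
 have "qcoef (Ann G M) (rat_scale R1 1 (qclass G M)) = 1" using qcoef_line[OF Ann_subset M, of M 1] by simp
 thus "Ann G M = Ann G N" using qcoef_line[OF Ann_subset N, of M 1] e by (simp split: if_splits)
qed (rule qclass_Ann[OF assms])

end

section \<open>Induction\<close>

locale sub_grp = finite_grp G for G :: "('g, 'm) monoid_scheme" (structure) +
 fixes H assumes H: "subgroup H G"
begin

abbreviation "GH \<equiv> G\<lparr>carrier := H\<rparr>"

lemma H_sub: "h \<in> H ==> h \<in> carrier G" using subgroup.subset[OF H] by blast

lemma H_mem: "\<one> \<in> H" "h \<in> H ==> k \<in> H ==> h \<otimes> k \<in> H" "h \<in> H ==> inv h \<in> H"
 using subgroup.one_closed[OF H] subgroup.m_closed[OF H] subgroup.m_inv_closed[OF H] by auto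

lemma fin_H: "finite H" using fin_carrier subgroup.subset[OF H] finite_subset by blast

lemma GH_finite_grp: "finite_grp GH"
 by (intro finite_grp.intro finite_grp_axioms.intro subgroup.subgroup_is_group[OF H is_group]) (simp add: fin_H)

sublocale sub: finite_grp GH by (rule GH_finite_grp)

lemma H_reindex: "l \<in> H ==> (\<Sum>h\<in>H. F h) = (\<Sum>k\<in>H. F (k \<otimes> l))"
 by (rule sum.reindex_bij_betw[symmetric], rule bij_betwI[where g="\<lambda>h. h \<otimes> inv l"])
  (auto simp: H_mem H_sub m_assoc)

lemma G_reindex: "l \<in> carrier G ==> (\<Sum>h\<in>carrier G. F h) = (\<Sum>k\<in>carrier G. F (k \<otimes> l))"
 by (rule sum.reindex_bij_betw[symmetric], rule bij_betwI[where g="\<lambda>h. h \<otimes> inv l"])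
  (auto simp: m_assoc)

text \<open>The part of \<open>x\<close> on the left coset of \<open>g\<close>, shifted back to
  \<open>H\<close> and read as an element of the group algebra of \<open>H\<close>.\<close>

definition res_right :: "('g => 'k::field) => 'g => 'g => 'k" where
 "res_right x g = (\<lambda>h. if h \<in> H then x (g \<otimes> h) else 0)"

lemma res_right_galg: "res_right x g \<in> galg GH"
 by (simp add: res_right_def galg_def)

text \<open>The annihilator of \<open>1 \<otimes> u\<close> in terms of the annihilator of \<open>u\<close>.\<close>

definition ind_Ann :: "('g => 'k::field) set => ('g => 'k) set" where
 "ind_Ann I = {x \<in> galg G. \<forall>g\<in>carrier G. res_right x g \<in> I}"

text \<open>Models the induced module by functions on \<open>G\<close> with values in the given
  module. Summing over \<open>H\<close> forces the values f of the image to satisfy f(gk) = k^-1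
  f(g) for k in \<open>H\<close>, which is what balancing the tensor product over the group algebra
  of \<open>H\<close> amounts to.\<close>

definition ind_map :: "('g, 'k::field, 'i) glider => ('g \<times> 'i => 'k) => 'g \<times> 'i => 'k" where
 "ind_map M w = (\<lambda>(g, i). if g \<in> carrier G then (\<Sum>h\<in>H. mod_act M h (slice (g \<otimes> h) w)) i else 0)"

definition translate :: "'g => ('g \<times> 'i => 'k::field) => 'g \<times> 'i => 'k" where
 "translate a w = (\<lambda>(g, i). if g \<in> carrier G then w (inv a \<otimes> g, i) else 0)"

lemma slice_ind_map: "g \<in> carrier G ==> slice g (ind_map M w) = (\<Sum>h\<in>H. mod_act M h (slice (g \<otimes> h) w))"
 "g \<notin> carrier G ==> slice g (ind_map M w) = 0" by (auto simp: ind_map_def fun_eq_iff fun_apps)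

lemma slice_translate: "g \<in> carrier G ==> slice g (translate a w) = slice (inv a \<otimes> g) w"
 "g \<notin> carrier G ==> slice g (translate a w) = 0" by (auto simp: translate_def fun_eq_iff fun_apps)

lemma flin_translate: "flin (translate a)"
 by (rule flinI) (auto simp: translate_def fun_eq_iff fun_apps)

lemma slice_tens: "slice g (tens x v) = fscale (x g) v"
 by (auto simp: fun_eq_iff fun_apps)

lemma ind_map_translate:
 assumes "a \<in> carrier G" shows "ind_map M (translate a w) = translate a (ind_map M w)"
proof (rule comp_eqI)
 fix g show "slice g (ind_map M (translate a w)) = slice g (translate a (ind_map M w))"
 proof (cases "g \<in> carrier G")
  case True
  have "slice g (ind_map M (translate a w)) = (\<Sum>h\<in>H. mod_act M h (slice (inv a \<otimes> (g \<otimes> h)) w))"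
   unfolding slice_ind_map(1)[OF True] by (rule sum.cong[OF refl]) (simp add: slice_translate True H_sub)
  also have "\<dots> = (\<Sum>h\<in>H. mod_act M h (slice (inv a \<otimes> g \<otimes> h) w))"
   by (rule sum.cong[OF refl]) (simp add: m_assoc assms True H_sub)
  also have "\<dots> = slice g (translate a (ind_map M w))"
   unfolding slice_translate(1)[OF True] using assms True by (simp add: slice_ind_map)
  finally show ?thesis .
 qed (simp add: slice_ind_map slice_translate)
qed

lemma galg_mult_galg: "galg_mult G x y \<in> galg G"
 by (simp add: galg_mult_def galg_def)

lemma galg_mult_of:
 assumes a: "a \<in> carrier G" and x: "x \<in> galg G"
 shows "galg_mult G (galg_of a) x = (\<lambda>g. if g \<in> carrier G then x (inv a \<otimes> g) else 0)"
proof
 fix g show "galg_mult G (galg_of a) x g = (if g \<in> carrier G then x (inv a \<otimes> g) else 0)"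
 proof (cases "g \<in> carrier G")
  case True
  have "g \<otimes> inv h = a \<longleftrightarrow> h = inv a \<otimes> g" if "h \<in> carrier G" for h
   using that a True by (metis inv_closed inv_equality inv_inv m_assoc m_closed r_inv r_one l_inv l_one)
  hence "galg_mult G (galg_of a) x g = (\<Sum>h\<in>carrier G. if h = inv a \<otimes> g then x h else 0)"
   unfolding galg_mult_def using True by (auto simp: galg_of_def intro!: sum.cong)
  thus ?thesis using True a fin_carrier by simp
 qed (simp add: galg_mult_def)
qed

lemma translate_tens: "a \<in> carrier G ==> x \<in> galg G ==> translate a (tens x v) = tens (galg_mult G (galg_of a) x) v"
 by (auto simp: galg_mult_of translate_def fun_eq_iff)

lemma galg_mult_expand:
 assumes y: "y \<in> galg G" and x: "x \<in> galg G"
 shows "galg_mult G y x = (\<Sum>a\<in>carrier G. fscale (y a) (galg_mult G (galg_of a) x))"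
proof
 fix g show "galg_mult G y x g = (\<Sum>a\<in>carrier G. fscale (y a) (galg_mult G (galg_of a) x)) g"
 proof (cases "g \<in> carrier G")
  case True
  have "galg_mult G y x g = (\<Sum>h\<in>carrier G. y (g \<otimes> inv h) * x h)" using True by (simp add: galg_mult_def)
  also have "\<dots> = (\<Sum>a\<in>carrier G. y a * x (inv a \<otimes> g))"
   by (rule sum.reindex_bij_witness[where i="\<lambda>a. inv a \<otimes> g" and j="\<lambda>h. g \<otimes> inv h"])
    (use True in \<open>auto simp: inv_mult_group m_assoc[symmetric], auto simp: m_assoc\<close>)
  also have "\<dots> = (\<Sum>a\<in>carrier G. fscale (y a) (galg_mult G (galg_of a) x)) g"
   unfolding sum_fun_apply by (rule sum.cong[OF refl]) (simp add: galg_mult_of x True fun_apps)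
  finally show ?thesis .
 next
  case False
  thus ?thesis unfolding sum_fun_apply by (simp add: galg_mult_def fun_apps)
 qed
qed

section \<open>The kernel of the averaging map, and the induced glider\<close>

context
 fixes M :: "('g, 'k::field_char_0, 'i) glider"
 assumes M: "is_glider GH M" and sp: "lev_0 M = galg_span GH M (lev_m1 M)"
begin

lemma V_submod: "submod GH M (lev_0 M)"
 unfolding sp by (rule sub.galg_span_submod[OF gliderD(1,8)[OF M]])

lemma V_act: "h \<in> H ==> v \<in> lev_0 M ==> mod_act M h v \<in> lev_0 M"
 using submodD(3)[OF V_submod] by simp

lemma V_sub: "v \<in> lev_0 M ==> v \<in> mod_space M"
 using submodD(2)[OF V_submod] by blast

lemma V_lin: "h \<in> H ==> lin_on (lev_0 M) (mod_act M h)"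
 using lin_on_subset[OF kgmodD(3)[OF gliderD(1)[OF M]] submodD(2)[OF V_submod]] by simp

lemmas V_space = gliderD(4)[OF M]

abbreviation "TT \<equiv> tens_space (galg G) (lev_0 M)"

abbreviation "RelS \<equiv> {tens (galg_mult G x a) v - tens x (galg_act GH M a v) |x a v.
            x \<in> galg G \<and> a \<in> galg GH \<and> v \<in> lev_0 M}"

lemma TT_slice: assumes "w \<in> TT" shows "slice g w \<in> lev_0 M" "g \<notin> carrier G ==> slice g w = 0"
proof -
 have "slice g w \<in> lev_0 M \<and> (g \<notin> carrier G --> slice g w = 0)" using assms galg_subspace V_space
 proof (induct rule: tens_space_induct)
  case zero thus ?case unfolding comp_lin using fv.subspace_0[OF V_space] by simp
 next
  case (add w w') thus ?case unfolding comp_lin using fv.subspace_add[OF V_space] by simp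
 next
  case (tens x v)
  thus ?case unfolding slice_tens using fv.subspace_scale[OF V_space] by (simp add: galg_def)
 qed
 thus "slice g w \<in> lev_0 M" "g \<notin> carrier G ==> slice g w = 0" by auto
qed

lemma galg_act_V: "v \<in> lev_0 M ==> galg_act GH M a v \<in> lev_0 M"
 unfolding galg_act_def by (intro fv.subspace_sum[OF V_space] fv.subspace_scale[OF V_space]) (simp add: V_act)

lemma RelS_TT: "fv.span RelS \<subseteq> TT"
proof (rule fv.span_minimal[OF _ tens_subspace])
 show "RelS \<subseteq> TT"
  by (auto intro!: fv.subspace_diff[OF tens_subspace] tens_in_space galg_mult_galg galg_act_V)
qed

lemma ind_map_lin: "lin_on TT (ind_map M)"
proof (rule lin_onI)
 fix w w' assume w: "w \<in> TT" "w' \<in> TT"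
 show "ind_map M (w + w') = ind_map M w + ind_map M w'"
 proof (rule comp_eqI)
  fix g
  have "(\<Sum>h\<in>H. mod_act M h (slice (g \<otimes> h) (w + w'))) = (\<Sum>h\<in>H. mod_act M h (slice (g \<otimes> h) w) + mod_act M h (slice (g \<otimes> h) w'))"
   unfolding comp_lin by (rule sum.cong[OF refl]) (simp add: lin_on_add[OF V_lin] TT_slice(1)[OF w(1)] TT_slice(1)[OF w(2)])
  hence "slice g (ind_map M (w + w')) = slice g (ind_map M w) + slice g (ind_map M w')"
   by (cases "g \<in> carrier G") (simp_all add: slice_ind_map sum.distrib)
  thus "slice g (ind_map M (w + w')) = slice g (ind_map M w + ind_map M w')" by (simp only: comp_lin(1))
 qed
next
 fix c w assume w: "w \<in> TT"
 show "ind_map M (fscale c w) = fscale c (ind_map M w)"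
 proof (rule comp_eqI)
  fix g
  have "(\<Sum>h\<in>H. mod_act M h (slice (g \<otimes> h) (fscale c w))) = (\<Sum>h\<in>H. fscale c (mod_act M h (slice (g \<otimes> h) w)))"
   unfolding comp_lin by (rule sum.cong[OF refl]) (simp add: lin_on_scale[OF V_lin] TT_slice(1)[OF w])
  hence "slice g (ind_map M (fscale c w)) = fscale c (slice g (ind_map M w))"
   by (cases "g \<in> carrier G") (simp_all add: slice_ind_map fv.scale_sum_right)
  thus "slice g (ind_map M (fscale c w)) = slice g (fscale c (ind_map M w))" by (simp only: comp_lin(2))
 qed
qed

lemma slice_ind_map_tens:
 assumes v: "v \<in> lev_0 M" and g: "g \<in> carrier G"
 shows "slice g (ind_map M (tens x v)) = galg_act GH M (res_right x g) v"
 unfolding slice_ind_map(1)[OF g] galg_act_def slice_tens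
 by (rule sum.cong) (simp_all add: lin_on_scale[OF V_lin] v res_right_def)

text \<open>At \<open>g\<close>, both sides are the double sum over k and l in \<open>H\<close> of
  x(gk) a(l) times the image of \<open>v\<close> under l and then k. On the left this form appears
  after substituting h = kl.\<close>

lemma ind_map_relation:
 assumes x: "x \<in> galg G" and a: "a \<in> galg GH" and v: "v \<in> lev_0 M"
 shows "ind_map M (tens (galg_mult G x a) v) = ind_map M (tens x (galg_act GH M a v))"
proof (rule comp_eqI)
 fix g show "slice g (ind_map M (tens (galg_mult G x a) v)) = slice g (ind_map M (tens x (galg_act GH M a v)))"
 proof (cases "g \<in> carrier G")
  case g: True
  have xa: "galg_mult G x a (g \<otimes> h) = (\<Sum>l\<in>H. x (g \<otimes> h \<otimes> inv l) * a l)" if "h \<in> H" for h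
  proof -
   have "galg_mult G x a (g \<otimes> h) = (\<Sum>l\<in>carrier G. x (g \<otimes> h \<otimes> inv l) * a l)" using g that H_sub by (simp add: galg_mult_def)
   also have "\<dots> = (\<Sum>l\<in>H. x (g \<otimes> h \<otimes> inv l) * a l)"
    by (rule sum.mono_neutral_right[OF fin_carrier subgroup.subset[OF H]]) (use a in \<open>auto simp: galg_def\<close>)
   finally show ?thesis .
  qed
  have "slice g (ind_map M (tens (galg_mult G x a) v)) = (\<Sum>h\<in>H. fscale (galg_mult G x a (g \<otimes> h)) (mod_act M h v))"
   unfolding slice_ind_map_tens[OF v g] galg_act_def by (rule sum.cong) (auto simp: res_right_def)
  also have "\<dots> = (\<Sum>h\<in>H. \<Sum>l\<in>H. fscale (x (g \<otimes> h \<otimes> inv l) * a l) (mod_act M h v))"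
   by (rule sum.cong[OF refl]) (simp add: xa fv.scale_sum_left)
  also have "\<dots> = (\<Sum>l\<in>H. \<Sum>h\<in>H. fscale (x (g \<otimes> h \<otimes> inv l) * a l) (mod_act M h v))"
   by (rule sum.swap)
  also have "\<dots> = (\<Sum>l\<in>H. \<Sum>k\<in>H. fscale (x (g \<otimes> k) * a l) (mod_act M k (mod_act M l v)))"
  proof (rule sum.cong[OF refl])
   fix l assume l: "l \<in> H"
   have "(\<Sum>h\<in>H. fscale (x (g \<otimes> h \<otimes> inv l) * a l) (mod_act M h v)) =
     (\<Sum>k\<in>H. fscale (x (g \<otimes> (k \<otimes> l) \<otimes> inv l) * a l) (mod_act M (k \<otimes> l) v))"
    by (rule H_reindex[OF l])
   also have "\<dots> = (\<Sum>k\<in>H. fscale (x (g \<otimes> k) * a l) (mod_act M k (mod_act M l v)))"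
   proof (rule sum.cong[OF refl])
    fix k assume k: "k \<in> H"
    have "g \<otimes> (k \<otimes> l) \<otimes> inv l = g \<otimes> k" using g H_sub[OF k] H_sub[OF l] by (simp add: m_assoc)
    moreover have "mod_act M (k \<otimes> l) v = mod_act M k (mod_act M l v)"
     using kgmodD(5)[OF gliderD(1)[OF M], of k l v] k l V_sub[OF v] by simp
    ultimately show "fscale (x (g \<otimes> (k \<otimes> l) \<otimes> inv l) * a l) (mod_act M (k \<otimes> l) v) =
      fscale (x (g \<otimes> k) * a l) (mod_act M k (mod_act M l v))" by simp
   qed
   finally show "(\<Sum>h\<in>H. fscale (x (g \<otimes> h \<otimes> inv l) * a l) (mod_act M h v)) =
     (\<Sum>k\<in>H. fscale (x (g \<otimes> k) * a l) (mod_act M k (mod_act M l v)))" .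
  qed
  also have "\<dots> = (\<Sum>k\<in>H. \<Sum>l\<in>H. fscale (x (g \<otimes> k) * a l) (mod_act M k (mod_act M l v)))"
   by (rule sum.swap)
  also have "\<dots> = (\<Sum>k\<in>H. fscale (x (g \<otimes> k)) (mod_act M k (galg_act GH M a v)))"
  proof (rule sum.cong[OF refl])
   fix k assume k: "k \<in> H"
   have "mod_act M k (galg_act GH M a v) = (\<Sum>l\<in>H. mod_act M k (fscale (a l) (mod_act M l v)))"
    unfolding galg_act_def partial_object.simps
    using lin_on_sum[OF V_space V_lin[OF k], of H "\<lambda>l. fscale (a l) (mod_act M l v)"]
     fv.subspace_scale[OF V_space V_act[OF _ v]] by simp
   also have "\<dots> = (\<Sum>l\<in>H. fscale (a l) (mod_act M k (mod_act M l v)))"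
    by (rule sum.cong[OF refl]) (simp add: lin_on_scale[OF V_lin[OF k] V_act[OF _ v]])
   finally show "(\<Sum>l\<in>H. fscale (x (g \<otimes> k) * a l) (mod_act M k (mod_act M l v))) =
     fscale (x (g \<otimes> k)) (mod_act M k (galg_act GH M a v))" by (simp add: fv.scale_sum_right)
  qed
  also have "\<dots> = slice g (ind_map M (tens x (galg_act GH M a v)))"
   unfolding slice_ind_map_tens[OF galg_act_V[OF v] g] unfolding galg_act_def[of _ _ "res_right x g"]
   by (rule sum.cong) (auto simp: res_right_def)
  finally show ?thesis .
 qed (simp add: slice_ind_map)
qed

lemma ind_map_RelS: "w \<in> fv.span RelS ==> ind_map M w = 0"
proof -
 have sub: "fv.subspace {w \<in> TT. ind_map M w = 0}" by (rule lin_on_kernel[OF tens_subspace ind_map_lin])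
 have "RelS \<subseteq> {w \<in> TT. ind_map M w = 0}"
 proof clarify
  fix x a :: "'g => 'k" and v :: "'i => 'k" assume xav: "x \<in> galg G" "a \<in> galg GH" "v \<in> lev_0 M"
  have 1: "tens (galg_mult G x a) v \<in> TT" "tens x (galg_act GH M a v) \<in> TT"
   using xav by (auto intro!: tens_in_space galg_mult_galg galg_act_V)
  show "tens (galg_mult G x a) v - tens x (galg_act GH M a v) \<in> TT \<and>
    ind_map M (tens (galg_mult G x a) v - tens x (galg_act GH M a v)) = 0"
   using lin_on_diff[OF tens_subspace ind_map_lin 1] fv.subspace_diff[OF tens_subspace 1] ind_map_relation[OF xav] by simp
 qed
 hence "fv.span RelS \<subseteq> {w \<in> TT. ind_map M w = 0}" by (rule fv.span_minimal[OF _ sub])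
 thus "w \<in> fv.span RelS ==> ind_map M w = 0" by blast
qed

lemma TT_decomp:
 assumes w: "w \<in> TT" shows "w = (\<Sum>g\<in>carrier G. tens (galg_of g) (slice g w))"
proof (rule comp_eqI)
 fix k
 have "slice k (\<Sum>g\<in>carrier G. tens (galg_of g) (slice g w)) = (\<Sum>g\<in>carrier G. if g = k then slice g w else 0)"
  unfolding comp_lin slice_tens by (rule sum.cong) (auto simp: galg_of_def)
 thus "slice k w = slice k (\<Sum>g\<in>carrier G. tens (galg_of g) (slice g w))"
  using fin_carrier TT_slice(2)[OF w, of k] by auto
qed

lemma galg_of_mult: "g \<in> carrier G ==> h \<in> carrier G ==> galg_mult G (galg_of g) (galg_of h) = galg_of (g \<otimes> h)"
 unfolding galg_mult_of[OF _ galg_of_galg]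
proof
 fix k assume g: "g \<in> carrier G" and h: "h \<in> carrier G"
 have "inv g \<otimes> k = h \<longleftrightarrow> k = g \<otimes> h" if "k \<in> carrier G"
  using that g h by (metis inv_closed inv_inv l_one m_assoc l_inv r_inv)
 thus "(if k \<in> carrier G then galg_of h (inv g \<otimes> k) else 0) = galg_of (g \<otimes> h) k"
  using g h by (auto simp: galg_of_def)
qed

text \<open>Modulo the relations, gh tensor w(gh) may be replaced by g tensor h w(gh). Summed over
  all g and h, the former give |H| times \<open>w\<close>, while the latter give g tensor the value
  of \<open>ind_map\<close> at g, which is 0. Characteristic 0 allows division by |H|.\<close>

lemma ind_map_kernel_RelS:
 assumes w: "w \<in> TT" and z: "ind_map M w = 0" shows "w \<in> fv.span RelS"
proof -
 let ?n = "of_nat (card H) :: 'k"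
 have n0: "?n ~= 0" using fin_H H_mem(1) by auto
 have rel: "tens (galg_of (g \<otimes> h)) (slice (g \<otimes> h) w) - tens (galg_of g) (mod_act M h (slice (g \<otimes> h) w)) \<in> fv.span RelS"
  if g: "g \<in> carrier G" and h: "h \<in> H" for g h
 proof -
  have r: "tens (galg_mult G (galg_of g) (galg_of h)) (slice (g \<otimes> h) w) - tens (galg_of g) (galg_act GH M (galg_of h) (slice (g \<otimes> h) w)) \<in> RelS"
   using galg_of_galg[OF g] galg_of_galg[of h GH] h TT_slice(1)[OF w] by fastforce
  have e: "galg_act GH M (galg_of h) (slice (g \<otimes> h) w) = mod_act M h (slice (g \<otimes> h) w)"
   using sub.galg_act_galg_of[of h M] h by simp
  show ?thesis using fv.span_base[OF r] unfolding e galg_of_mult[OF g H_sub[OF h]] .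
 qed
 have "fscale ?n w = (\<Sum>h\<in>H. w)" by (rule fv.sum_constant_scale[symmetric])
 also have "\<dots> = (\<Sum>h\<in>H. \<Sum>g\<in>carrier G. tens (galg_of (g \<otimes> h)) (slice (g \<otimes> h) w))"
 proof (rule sum.cong[OF refl])
  fix h assume "h \<in> H"
  thus "w = (\<Sum>g\<in>carrier G. tens (galg_of (g \<otimes> h)) (slice (g \<otimes> h) w))"
   using TT_decomp[OF w] G_reindex[OF H_sub, of h "\<lambda>g. tens (galg_of g) (slice g w)"] by simp
 qed
 also have "\<dots> = (\<Sum>g\<in>carrier G. \<Sum>h\<in>H. tens (galg_of (g \<otimes> h)) (slice (g \<otimes> h) w))" by (rule sum.swap)
 finally have 1: "fscale ?n w = (\<Sum>g\<in>carrier G. \<Sum>h\<in>H. tens (galg_of (g \<otimes> h)) (slice (g \<otimes> h) w))" .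
 have "(\<Sum>h\<in>H. tens (galg_of g) (mod_act M h (slice (g \<otimes> h) w))) = 0" if g: "g \<in> carrier G" for g
 proof -
  have "(\<Sum>h\<in>H. mod_act M h (slice (g \<otimes> h) w)) = 0"
   unfolding slice_ind_map(1)[OF g, symmetric] z by (simp add: fun_eq_iff fun_apps)
  hence "tens (galg_of g) (\<Sum>h\<in>H. mod_act M h (slice (g \<otimes> h) w)) = 0" by (simp add: tens_lin)
  thus ?thesis by (simp add: tens_sum)
 qed
 hence 2: "(\<Sum>g\<in>carrier G. \<Sum>h\<in>H. tens (galg_of g) (mod_act M h (slice (g \<otimes> h) w))) = 0" by simp
 have "(\<Sum>g\<in>carrier G. \<Sum>h\<in>H. tens (galg_of (g \<otimes> h)) (slice (g \<otimes> h) w) - tens (galg_of g) (mod_act M h (slice (g \<otimes> h) w))) \<in> fv.span RelS"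
  by (intro fv.span_sum rel)
 hence "fscale ?n w \<in> fv.span RelS" using 1 2 by (simp add: sum_subtractf)
 hence "fscale (inverse ?n) (fscale ?n w) \<in> fv.span RelS" by (rule fv.span_scale)
 thus ?thesis using n0 by simp
qed

lemma ind_map_kernel: "{w \<in> TT. ind_map M w = 0} = fv.span RelS"
 using ind_map_kernel_RelS ind_map_RelS RelS_TT by blast

text \<open>Stated for an arbitrary model \<open>Y\<close> of the induced glider: all models have
  the same annihilator, hence the same class, and \<open>Phi\<close> is well defined on irreducible
  classes.\<close>

lemma induced_line:
 assumes L: "line_glider GH M u" and Y: "induced_glider G H M Y"
 shows "\<exists>y. line_glider G Y y" "Ann G Y = ind_Ann (Ann GH M)"
proof -
 note LM = sub.line_gliderD[OF L]
 obtain t where gY: "is_glider G Y" "lev_0 Y = mod_space Y"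
  and t: "lin_on TT t" "t ` TT = mod_space Y" "{w \<in> TT. t w = 0} = fv.span RelS"
   "\<forall>y\<in>galg G. \<forall>x\<in>galg G. \<forall>v\<in>lev_0 M. t (tens (galg_mult G y x) v) = galg_act G Y y (t (tens x v))"
   "lev_m1 Y = {t (tens (galg_of \<one>) u) |u. u \<in> lev_m1 M}"
  using Y unfolding induced_glider_def by (elim conjE exE) (rule that; assumption)
 have e1: "galg_of \<one> \<in> galg G" by (rule galg_of_galg[OF one_closed])
 have mult1: "galg_mult G x (galg_of \<one>) = x" if x: "x \<in> galg G" for x :: "'g => 'k"
 proof
  fix g
  have "galg_mult G x (galg_of \<one>) g = (\<Sum>h\<in>carrier G. if h = \<one> then x g else 0)" if "g \<in> carrier G"
   unfolding galg_mult_def using that by (auto intro!: sum.cong simp: galg_of_def)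
  thus "galg_mult G x (galg_of \<one>) g = x g" using x fin_carrier by (auto simp: galg_mult_def galg_def)
 qed
 have act: "galg_act G Y x (t (tens (galg_of \<one>) u)) = t (tens x u)" if "x \<in> galg G" for x
  using t(4)[rule_format, OF that e1 LM(6)] mult1[OF that] by simp
 \<comment> \<open>\<open>t\<close> and \<open>ind_map\<close> have the same kernel, so the
   annihilator can be computed in the concrete model by functions.\<close>
 have z: "t (tens x u) = 0 \<longleftrightarrow> (\<forall>g\<in>carrier G. res_right x g \<in> Ann GH M)" if x: "x \<in> galg G" for x
 proof -
  have T: "tens x u \<in> TT" using x LM(6) by (rule tens_in_space)
  have "t (tens x u) = 0 \<longleftrightarrow> ind_map M (tens x u) = 0" using T t(3) ind_map_kernel by blast
  also have "\<dots> \<longleftrightarrow> (\<forall>g. slice g (ind_map M (tens x u)) = 0)"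
   using comp_eqI[of "ind_map M (tens x u)" 0] by (auto simp: fun_eq_iff fun_apps)
  also have "\<dots> \<longleftrightarrow> (\<forall>g\<in>carrier G. galg_act GH M (res_right x g) u = 0)"
  proof -
   have "slice g (ind_map M (tens x u)) = 0 \<longleftrightarrow> (g \<in> carrier G --> galg_act GH M (res_right x g) u = 0)" for g
    by (cases "g \<in> carrier G") (simp_all only: slice_ind_map_tens[OF LM(6)] slice_ind_map(2) simp_thms)
   thus ?thesis by blast
  qed
  finally show ?thesis unfolding sub.Ann_line[OF L] using res_right_galg by blast
 qed
 let ?y = "t (tens (galg_of \<one>) u)"
 have y0: "?y ~= 0"
 proof
  assume "?y = 0"
  hence "res_right (galg_of \<one> :: 'g => 'k) \<one> \<in> Ann GH M" using z[OF e1] one_closed by blast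
  moreover have "res_right (galg_of \<one> :: 'g => 'k) \<one> = galg_of \<one>"
   by (auto simp: res_right_def galg_of_def fun_eq_iff H_mem H_sub)
  ultimately have "mod_act M \<one> u = 0" using sub.galg_act_galg_of[of \<one> M u] H_mem(1) by (simp add: sub.Ann_line[OF L])
  thus False using kgmodD(4)[OF gliderD(1)[OF M] LM(5)] LM(2) by simp
 qed
 have m1: "lev_m1 Y = fv.span {?y}"
 proof -
  have "t (tens (galg_of \<one>) (fscale c u)) = fscale c ?y" for c
   unfolding tens_lin by (rule lin_on_scale[OF t(1) tens_in_space[OF e1 LM(6)]])
  thus ?thesis unfolding t(5) LM(3) fv.span_singleton by (auto simp: image_iff) metis
 qed
 hence l: "line_glider G Y ?y" using gY(1) y0 by (simp add: line_glider_def)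
 thus "\<exists>y. line_glider G Y y" by blast
 show "Ann G Y = ind_Ann (Ann GH M)" unfolding Ann_line[OF l] ind_Ann_def using act z by auto
qed

text \<open>The image of \<open>ind_map\<close> with left translation as action, put into
  coordinates. Existence of a model over \<open>nat\<close> ensures that \<open>Phi\<close> is
  determined on every irreducible class.\<close>

lemma induced_exists:
 assumes L: "line_glider GH M u"
 shows "\<exists>Y \<in> (nat_gliders G :: ('g, 'k, nat) glider set). induced_glider G H M Y"
proof -
 note LM = sub.line_gliderD[OF L]
 let ?S = "ind_map M ` TT"
 have e1: "galg_of \<one> \<in> galg G" by (rule galg_of_galg[OF one_closed])
 have fT: "fin_dim TT" by (rule fin_dim_tens[OF fin_dim_galg gliderD(5)[OF M]])
 have fS: "fin_dim ?S" by (rule fin_dim_image[OF fT ind_map_lin])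
 have sS: "fv.subspace ?S" by (rule fin_dim_subspace[OF fS])
 have trT: "translate a w \<in> TT" if "a \<in> carrier G" "w \<in> TT" for a w using that(2) galg_subspace V_space
 proof (induct rule: tens_space_induct)
  case zero thus ?case by (simp add: flin_0[OF flin_translate] fv.subspace_0[OF tens_subspace])
 next
  case (add w w') thus ?case by (simp add: flin_add[OF flin_translate] fv.subspace_add[OF tens_subspace])
 next
  case (tens x v) thus ?case by (simp add: translate_tens that(1) tens_in_space galg_mult_galg)
 qed
 define P where "P = \<lparr>mod_space = ?S, mod_act = translate\<rparr>"
 have out: "slice g s = 0" if "s \<in> ?S" "g \<notin> carrier G" for s g using that by (auto simp: slice_ind_map)
 have P: "is_kgmod G P" unfolding is_kgmod_def
 proof (intro conjI ballI)
  show "fv.subspace (mod_space P)" using sS by (simp add: P_def)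
  fix g assume g: "g \<in> carrier G"
  show "mod_act P g \<in> mod_space P \<rightarrow> mod_space P"
   using trT[OF g] by (auto simp: P_def ind_map_translate[OF g, symmetric])
  show "lin_on (mod_space P) (mod_act P g)" by (simp add: P_def flin_lin_on[OF flin_translate])
 next
  fix v assume v: "v \<in> mod_space P"
  show "mod_act P \<one> v = v"
  proof (rule comp_eqI)
   fix g show "slice g (mod_act P \<one> v) = slice g v"
    using out[of v g] v by (cases "g \<in> carrier G") (simp_all add: P_def slice_translate)
  qed
 next
  fix g h v assume gh: "g \<in> carrier G" "h \<in> carrier G" and v: "v \<in> mod_space P"
  show "mod_act P (g \<otimes> h) v = mod_act P g (mod_act P h v)"
  proof (rule comp_eqI)
   fix k show "slice k (mod_act P (g \<otimes> h) v) = slice k (mod_act P g (mod_act P h v))"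
    using gh by (cases "k \<in> carrier G") (simp_all add: P_def slice_translate inv_mult_group m_assoc)
  qed
 qed
 obtain F :: "_ => nat => 'k" where F: "flin F" "inj_on F ?S" by (rule exists_coordinates[OF fS])
 obtain h where h: "flin h" "!!v. v \<in> ?S ==> h (F v) = v"
  by (rule lin_on_left_inverse[OF sS flin_lin_on[OF F(1)] F(2)]) blast
 let ?N = "\<lparr>mod_space = F ` mod_space P, mod_act = \<lambda>g w. F (mod_act P g (h w))\<rparr>"
 have inj: "inj_on F (mod_space P)" and hP: "!!v. v \<in> mod_space P ==> h (F v) = v" using F h by (simp_all add: P_def)
 note tr = transport_kgmod[OF P F(1) inj hP]
 define t where "t w = F (ind_map M w)" for w
 define Y where "Y = \<lparr>mod_space = F ` ?S, mod_act = \<lambda>g w. F (translate g (h w)),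
  lev_m1 = {t (tens (galg_of \<one>) u) |u. u \<in> lev_m1 M}, lev_0 = F ` ?S\<rparr>"
 have YN: "is_kgmod G Y" using tr(1) by (simp add: P_def Y_def is_kgmod_def)
 have tl: "lin_on TT t" unfolding t_def by (rule lin_on_comp[OF ind_map_lin subset_UNIV flin_lin_on[OF F(1)]])
 have m1T: "tens (galg_of \<one>) u \<in> TT" if "u \<in> lev_m1 M" for u
  using that gliderD(6)[OF M] by (intro tens_in_space[OF e1]) auto
 have hom: "kg_hom G P Y F" using tr(2) unfolding kg_hom_def by (simp add: P_def Y_def)
 have gY: "is_glider G Y"
 proof (rule is_gliderI[OF YN])
  have "lev_m1 Y = (\<lambda>u. t (tens (galg_of \<one>) u)) ` lev_m1 M" by (auto simp: Y_def)
  moreover have "fv.subspace \<dots>"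
  proof (rule lin_on_image_subspace[OF gliderD(2)[OF M]], rule lin_on_comp[OF flin_lin_on[OF flin_tens(2)] _ tl])
   show "tens (galg_of \<one>) ` lev_m1 M \<subseteq> TT" using m1T by blast
  qed
  ultimately show "fv.subspace (lev_m1 Y)" by simp
  show "fin_dim (lev_0 Y)" using fin_dim_image[OF fS flin_lin_on[OF F(1)]] by (simp add: Y_def)
  show "lev_m1 Y \<subseteq> lev_0 Y" using m1T by (auto simp: Y_def t_def)
  show "lev_0 Y \<subseteq> mod_space Y" by (simp add: Y_def)
  thus "mod_act Y g m \<in> lev_0 Y" if "g \<in> carrier G" "m \<in> lev_m1 Y" for g m
   using kgmodD(2)[OF YN that(1), of m] that(2) \<open>lev_m1 Y \<subseteq> lev_0 Y\<close> by (auto simp: Y_def)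
 qed
 have "induced_glider G H M Y" unfolding induced_glider_def
 proof (intro conjI exI[of _ t] ballI gY tl)
  show "lev_0 Y = mod_space Y" by (simp add: Y_def)
  show "t ` TT = mod_space Y" by (simp add: Y_def t_def image_image)
  have "t w = 0 \<longleftrightarrow> ind_map M w = 0" if "w \<in> TT" for w
   using that lin_on_inj_iff[OF sS flin_lin_on[OF F(1)]] F(2) flin_0[OF F(1)] unfolding t_def by (metis imageI)
  thus "{w \<in> TT. t w = 0} = fv.span RelS" unfolding ind_map_kernel[symmetric] by blast
  show "lev_m1 Y = {t (tens (galg_of \<one>) u) |u. u \<in> lev_m1 M}" by (simp add: Y_def)
  fix y x :: "'g => 'k" and v :: "'i => 'k" assume y: "y \<in> galg G" and x: "x \<in> galg G" and v: "v \<in> lev_0 M"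
  let ?w = "tens x v"
  have w: "?w \<in> TT" by (rule tens_in_space[OF x v])
  have wP: "ind_map M ?w \<in> mod_space P" using w by (simp add: P_def)
  have "tens (galg_mult G y x) v = (\<Sum>a\<in>carrier G. fscale (y a) (translate a ?w))"
   unfolding galg_mult_expand[OF y x] tens_sum by (rule sum.cong[OF refl]) (simp add: tens_lin translate_tens x)
  hence "ind_map M (tens (galg_mult G y x) v) = (\<Sum>a\<in>carrier G. ind_map M (fscale (y a) (translate a ?w)))"
   using lin_on_sum[OF tens_subspace ind_map_lin, of "carrier G" "\<lambda>a. fscale (y a) (translate a ?w)"]
    fv.subspace_scale[OF tens_subspace trT[OF _ w]] by simp
  also have "\<dots> = galg_act G P y (ind_map M ?w)" unfolding galg_act_def
   by (rule sum.cong[OF refl]) (simp add: lin_on_scale[OF ind_map_lin trT[OF _ w]] ind_map_translate P_def)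
  finally have "t (tens (galg_mult G y x) v) = F (galg_act G P y (ind_map M ?w))" by (simp add: t_def)
  also have "\<dots> = galg_act G Y y (F (ind_map M ?w))" by (rule kg_hom_galg_act[OF P YN hom wP])
  finally show "t (tens (galg_mult G y x) v) = galg_act G Y y (t ?w)" by (simp add: t_def)
 qed
 thus ?thesis using gY by (auto simp: nat_gliders_def)
qed

end

end

section \<open>The induction map\<close>

locale ind_ring = sub_grp G H for G :: "('g, 'm) monoid_scheme" (structure) and H +
 fixes ty :: "'k::field_char_0 itself"

sublocale ind_ring \<subseteq> rG: glider_ring G ty by unfold_locales

sublocale ind_ring \<subseteq> rH: glider_ring GH ty by unfold_locales

section \<open>Coefficients and supports in the rational glider ring\<close>

context glider_ring
begin

lemma QG_bilin: "bilin_alg QG" unfolding QG_eq by (rule R1.QR.bilin_alg_axioms)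

sublocale Q: bilin_alg QG by (rule QG_bilin)

lemmas qscale_closed = R1.sc_closed[folded QG_eq]
 and qscale_add = R1.sc_add[folded QG_eq] and qscale_diff = R1.sc_diff[folded QG_eq]
 and qscale_left_add = R1.sc_left_add[folded QG_eq] and qscale_qscale = R1.sc_sc[folded QG_eq]
 and qscale_zero_right = R1.sc_zero_right[folded QG_eq] and qscale_one = R1.sc_one[folded QG_eq]
 and qscale_zero = R1.sc_zero[folded QG_eq]

lemma diff_add: "x \<in> carrier QG ==> y \<in> carrier QG ==> (x \<ominus>\<^bsub>QG\<^esub> y) \<oplus>\<^bsub>QG\<^esub> y = x"
 by (simp add: a_minus_def Q.a_assoc Q.l_neg)

lemma irreducible_gliderD: "irreducible_glider G M ==> is_glider G M" "irreducible_glider G M ==> lev_0 M = galg_span G M (lev_m1 M)"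
 by (simp_all add: irreducible_glider_def)

lemma irreducible_line_ex: "irreducible_glider G M ==> \<exists>u. line_glider G M u"
 using irreducible_line by metis

lemma qclass_irr_closed: "irreducible_glider G M ==> qclass G (M :: ('g, 'k, nat) glider) \<in> carrier QG"
 using irreducible_line_ex qclass_closed by blast

lemma qcoef_diff:
 assumes "I \<subseteq> galg G" "x \<in> carrier QG" "y \<in> carrier QG" shows "qcoef I (x \<ominus>\<^bsub>QG\<^esub> y) = qcoef I x - qcoef I y"
 using qcoef_nat(2)[OF assms(1), of "x \<ominus>\<^bsub>QG\<^esub> y" y] assms diff_add by simp

lemma qcoef_scale:
 assumes I: "I \<subseteq> galg G" and x: "x \<in> carrier QG" shows "qcoef I (rat_scale R1 q x) = q * qcoef I x"
 using x
proof (induct rule: QG_induct)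
 case (scale p M)
 obtain u where u: "line_glider G M u" using irreducible_line_ex scale by blast
 show ?case using qcoef_line[OF I u] by (simp add: qscale_qscale qclass_closed[OF u])
next
 case (diff x y)
 thus ?case by (simp add: qscale_diff qcoef_diff I qscale_closed algebra_simps)
qed

definition qsupp :: "('g, 'k) qglider => ('g => 'k) set set" where
 "qsupp x = {I. I \<subseteq> galg G \<and> qcoef I x ~= 0}"

lemma finite_qsupp: "x \<in> carrier QG ==> finite (qsupp x)"
proof (induct rule: QG_induct)
 case (scale p M)
 obtain u where u: "line_glider G M u" using irreducible_line_ex scale by blast
 have "qsupp (rat_scale R1 p (qclass G M)) \<subseteq> {Ann G M}" using qcoef_line[OF _ u] by (auto simp: qsupp_def split: if_splits)
 thus ?case using finite_subset by blast
next
 case (diff x y)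
 have "qsupp (x \<ominus>\<^bsub>QG\<^esub> y) \<subseteq> qsupp x \<union> qsupp y" using diff(1,2) by (auto simp: qsupp_def qcoef_diff)
 thus ?case using diff finite_subset by blast
qed

end

lemma (in ind_ring) rat_linear_scale:
 "rat_linear rH.R1 rG.R1 f ==> x \<in> carrier rH.QG ==> f (rat_scale rH.R1 q x) = rat_scale rG.R1 q (f x)"
 by (simp add: rat_linear_def rH.QG_eq)

lemma (in ind_ring) rat_linear_diff:
 assumes f: "rat_linear rH.R1 rG.R1 f" and x: "x \<in> carrier rH.QG" "y \<in> carrier rH.QG"
 shows "f (x \<ominus>\<^bsub>rH.QG\<^esub> y) = f x \<ominus>\<^bsub>rG.QG\<^esub> f y"
proof -
 have c: "f z \<in> carrier rG.QG" if "z \<in> carrier rH.QG" for z using f that by (auto simp: rat_linear_def rH.QG_eq rG.QG_eq)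
 have d: "x \<ominus>\<^bsub>rH.QG\<^esub> y \<in> carrier rH.QG" using x by simp
 have "f x = f (x \<ominus>\<^bsub>rH.QG\<^esub> y) \<oplus>\<^bsub>rG.QG\<^esub> f y"
  using f d x unfolding rat_linear_def rH.QG_eq[symmetric] rG.QG_eq[symmetric] by (metis rH.diff_add)
 thus ?thesis using c[OF d] c[OF x(2)] by (simp add: a_minus_def rG.Q.a_assoc rG.Q.r_neg)
qed

section \<open>Existence and uniqueness of the induction map\<close>

context ind_ring
begin

definition induced_pair :: "('g => 'k) set => ('g, 'k, nat) glider => bool" where
 "induced_pair I Y \<longleftrightarrow> (\<exists>M :: ('g, 'k, nat) glider. M \<in> nat_gliders GH \<and> Y \<in> nat_gliders G \<and> irreducible_glider GH M \<and>
   induced_glider G H M Y \<and> I = Ann GH M)"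

text \<open>The choice of \<open>Y\<close> does not matter, since its annihilator is determined by
  \<open>I\<close>. The default 0 is taken at sets that are not annihilators of irreducible gliders
  over \<open>H\<close>.\<close>

definition ind_class :: "('g => 'k) set => ('g, 'k) qglider" where
 "ind_class I = (if \<exists>Y. induced_pair I Y then qclass G (SOME Y. induced_pair I Y) else \<zero>\<^bsub>rG.QG\<^esub>)"

lemma induced_pair_line:
 assumes "induced_pair I Y" shows "\<exists>y. line_glider G Y y" "Ann G Y = ind_Ann I"
proof -
 obtain M :: "('g, 'k, nat) glider" where M: "irreducible_glider GH M" "induced_glider G H M Y" "I = Ann GH M"
  using assms unfolding induced_pair_def by blast
 obtain u where u: "line_glider GH M u" using rH.irreducible_line_ex M(1) by blast
 note g = rH.irreducible_gliderD[OF M(1)]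
 show "\<exists>y. line_glider G Y y" "Ann G Y = ind_Ann I" using induced_line[OF g u M(2)] M(3) by auto
qed

lemma ind_class_eq: assumes "induced_pair I Y" shows "ind_class I = qclass G Y"
proof -
 have s: "induced_pair I (SOME Y. induced_pair I Y)" by (rule someI[of "induced_pair I", OF assms])
 obtain y y' where y: "line_glider G Y y" "line_glider G (SOME Y. induced_pair I Y) y'"
  using induced_pair_line(1)[OF assms] induced_pair_line(1)[OF s] by blast
 have "qclass G (SOME Y. induced_pair I Y) = qclass G Y"
  by (rule rG.qclass_Ann[OF y(2,1)]) (simp only: induced_pair_line(2)[OF assms] induced_pair_line(2)[OF s])
 thus ?thesis using assms unfolding ind_class_def by presburger
qed

lemma ind_class_closed: "ind_class I \<in> carrier rG.QG"
proof (cases "\<exists>Y. induced_pair I Y")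
 case True
 then obtain Y where Y: "induced_pair I Y" by blast
 obtain y where "line_glider G Y y" using induced_pair_line(1)[OF Y] by blast
 thus ?thesis unfolding ind_class_eq[OF Y] by (rule rG.qclass_closed)
qed (simp add: ind_class_def)

text \<open>The linear extension of \<open>ind_class\<close> from the irreducible classes. With
  \<open>qcoef\<close> as coordinates it does not depend on how \<open>x\<close> is written as a
  combination.\<close>

definition ind_lin :: "('g, 'k) qglider => ('g, 'k) qglider" where
 "ind_lin x = finsum rG.QG (\<lambda>I. rat_scale rG.R1 (rH.qcoef I x) (ind_class I)) (rH.qsupp x)"

lemma ind_term_closed: "rat_scale rG.R1 q (ind_class I) \<in> carrier rG.QG"
 by (rule rG.qscale_closed[OF ind_class_closed])

text \<open>Supports vary with the argument; over a common finite set the sums for several arguments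
  can be compared term by term.\<close>

lemma ind_lin_superset:
 assumes "finite S" "rH.qsupp x \<subseteq> S" "S \<subseteq> Pow (galg GH)"
 shows "ind_lin x = finsum rG.QG (\<lambda>I. rat_scale rG.R1 (rH.qcoef I x) (ind_class I)) S" unfolding ind_lin_def
proof (rule rG.Q.add.finprod_mono_neutral_cong_left)
 fix I assume "I \<in> S - rH.qsupp x"
 hence "rH.qcoef I x = 0" using assms(3) by (auto simp: rH.qsupp_def)
 thus "rat_scale rG.R1 (rH.qcoef I x) (ind_class I) = \<zero>\<^bsub>rG.QG\<^esub>"
  using rG.qscale_zero[OF ind_class_closed] by simp
qed (use assms ind_term_closed in auto)

lemma ind_lin_closed: "ind_lin x \<in> carrier rG.QG"
 unfolding ind_lin_def by (rule rG.Q.finsum_closed) (use ind_term_closed in auto)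

lemma ind_lin_linear: "rat_linear rH.R1 rG.R1 (restrict ind_lin (carrier rH.QG))"
proof -
 have qs: "rH.qsupp x \<subseteq> Pow (galg GH)" for x by (auto simp: rH.qsupp_def)
 have add: "ind_lin (x \<oplus>\<^bsub>rH.QG\<^esub> y) = ind_lin x \<oplus>\<^bsub>rG.QG\<^esub> ind_lin y"
  if x: "x \<in> carrier rH.QG" and y: "y \<in> carrier rH.QG" for x y
 proof -
  let ?S = "rH.qsupp x \<union> rH.qsupp y"
  have fS: "finite ?S" using rH.finite_qsupp x y by blast
  have sub: "?S \<subseteq> Pow (galg GH)" using qs by blast
  have sxy: "rH.qsupp (x \<oplus>\<^bsub>rH.QG\<^esub> y) \<subseteq> ?S" using rH.qcoef_nat(2)[OF _ x y] by (auto simp: rH.qsupp_def)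
  have s: "rH.qsupp x \<subseteq> ?S" "rH.qsupp y \<subseteq> ?S" by auto
  have e: "rat_scale rG.R1 (rH.qcoef I (x \<oplus>\<^bsub>rH.QG\<^esub> y)) (ind_class I) =
   rat_scale rG.R1 (rH.qcoef I x) (ind_class I) \<oplus>\<^bsub>rG.QG\<^esub> rat_scale rG.R1 (rH.qcoef I y) (ind_class I)" if "I \<in> ?S" for I
   using rH.qcoef_nat(2)[OF PowD[OF subsetD[OF sub that]] x y] rG.qscale_left_add[OF ind_class_closed] by simp
  have "ind_lin (x \<oplus>\<^bsub>rH.QG\<^esub> y) = finsum rG.QG (\<lambda>I. rat_scale rG.R1 (rH.qcoef I x) (ind_class I) \<oplus>\<^bsub>rG.QG\<^esub>
    rat_scale rG.R1 (rH.qcoef I y) (ind_class I)) ?S"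
   unfolding ind_lin_superset[OF fS sxy sub] by (rule rG.Q.finsum_cong') (use ind_term_closed e in auto)
  also have "\<dots> = ind_lin x \<oplus>\<^bsub>rG.QG\<^esub> ind_lin y"
   unfolding ind_lin_superset[OF fS s(1) sub] ind_lin_superset[OF fS s(2) sub]
   by (rule rG.Q.finsum_addf) (use ind_term_closed in auto)
  finally show ?thesis .
 qed
 have fs: "finsum rG.QG (\<lambda>I. rat_scale rG.R1 (q * c I) (ind_class I)) S =
   rat_scale rG.R1 q (finsum rG.QG (\<lambda>I. rat_scale rG.R1 (c I) (ind_class I)) S)" if "finite S" for S q c
  using that
 proof (induct S rule: finite_induct)
  case empty thus ?case by (simp add: rG.qscale_zero_right)
 next
  case (insert I S)
  have cl: "(\<lambda>I. rat_scale rG.R1 (d I) (ind_class I)) \<in> S \<rightarrow> carrier rG.QG" for d using ind_term_closed by simp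
  show ?case unfolding rG.Q.finsum_insert[OF insert(1,2) cl ind_term_closed] insert(3)
    rG.qscale_add[OF ind_term_closed rG.Q.finsum_closed[OF cl]] rG.qscale_qscale[OF ind_class_closed] ..
 qed
 have scale: "ind_lin (rat_scale rH.R1 q x) = rat_scale rG.R1 q (ind_lin x)" if x: "x \<in> carrier rH.QG" for x q
 proof -
  let ?S = "rH.qsupp x"
  have fS: "finite ?S" by (rule rH.finite_qsupp[OF x])
  have e: "rH.qcoef I (rat_scale rH.R1 q x) = q * rH.qcoef I x" if "I \<subseteq> galg GH" for I by (rule rH.qcoef_scale[OF that x])
  have s: "rH.qsupp (rat_scale rH.R1 q x) \<subseteq> ?S" by (auto simp: rH.qsupp_def e)
  have "ind_lin (rat_scale rH.R1 q x) = finsum rG.QG (\<lambda>I. rat_scale rG.R1 (q * rH.qcoef I x) (ind_class I)) ?S"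
   unfolding ind_lin_superset[OF fS s qs] by (rule rG.Q.finsum_cong') (use ind_term_closed e qs[of x] in auto)
  also have "\<dots> = rat_scale rG.R1 q (ind_lin x)" unfolding fs[OF fS] ind_lin_def ..
  finally show ?thesis .
 qed
 show ?thesis
  using add scale ind_lin_closed by (simp add: rat_linear_def rH.QG_eq[symmetric] rG.QG_eq[symmetric] rH.qscale_closed)
qed

lemma ind_lin_qclass:
 fixes M :: "('g, 'k, nat) glider"
 assumes M: "M \<in> nat_gliders GH" "irreducible_glider GH M" and Y: "Y \<in> nat_gliders G" "induced_glider G H M Y"
 shows "ind_lin (qclass GH M) = qclass G Y"
proof -
 obtain u where u: "line_glider GH M u" using rH.irreducible_line_ex M(2) by blast
 have p: "induced_pair (Ann GH M) Y" using assms unfolding induced_pair_def by blast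
 have e: "rH.qcoef I (qclass GH M) = (if I = Ann GH M then 1 else 0)" if "I \<subseteq> galg GH" for I
  using rH.qcoef_line[OF that u, of 1] rH.qscale_one[OF rH.qclass_closed[OF u]] by simp
 have s: "rH.qsupp (qclass GH M) = {Ann GH M}" using e sub.Ann_subset[of M] by (auto simp: rH.qsupp_def split: if_splits)
 have "ind_lin (qclass GH M) = rat_scale rG.R1 (rH.qcoef (Ann GH M) (qclass GH M)) (ind_class (Ann GH M))"
  unfolding ind_lin_def s
  using rG.Q.finsum_insert[of "{}" "Ann GH M" "\<lambda>I. rat_scale rG.R1 (rH.qcoef I (qclass GH M)) (ind_class I)"]
   ind_term_closed by simp
 also have "\<dots> = ind_class (Ann GH M)"
  unfolding e[OF sub.Ann_subset] if_P[OF refl] by (rule rG.qscale_one[OF ind_class_closed])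
 finally show ?thesis unfolding ind_class_eq[OF p] .
qed

text \<open>\<open>Phi\<close> is a definite description, so both halves are due:
  \<open>ind_lin\<close>, made extensional, has the required property, and any other candidate
  agrees with it on rational multiples of irreducible classes, whose differences exhaust the
  carrier.\<close>

lemma Phi_qclass:
 fixes M :: "('g, 'k, nat) glider"
 assumes M: "M \<in> nat_gliders GH" "irreducible_glider GH M" and Y: "Y \<in> nat_gliders G" "induced_glider G H M Y"
 shows "Phi G H (qclass GH M) = qclass G Y"
proof -
 let ?f = "restrict ind_lin (carrier rH.QG)"
 have "Phi G H = ?f" unfolding Phi_def
 proof (rule the_equality)
  show "?f \<in> extensional (carrier rH.QG) \<and> rat_linear rH.R1 rG.R1 ?f \<and>
   (\<forall>M\<in>nat_gliders GH. \<forall>Y\<in>nat_gliders G. irreducible_glider GH M \<and> induced_glider G H M Y -->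
    ?f (qclass GH M) = qclass G Y)"
   using ind_lin_linear ind_lin_qclass rH.qclass_irr_closed by (simp add: restrict_extensional)
 next
  fix f :: "('g, 'k) qglider => ('g, 'k) qglider"
  assume f: "f \<in> extensional (carrier rH.QG) \<and> rat_linear rH.R1 rG.R1 f \<and>
   (\<forall>M\<in>nat_gliders GH. \<forall>Y\<in>nat_gliders G. irreducible_glider GH M \<and> induced_glider G H M Y -->
    f (qclass GH M) = qclass G Y)"
  hence fl: "rat_linear rH.R1 rG.R1 f" by blast
  have "f x = ?f x" if "x \<in> carrier rH.QG" for x using that
  proof (induct rule: rH.QG_induct)
   case (scale q M)
   obtain u where u: "line_glider GH M u" using rH.irreducible_line_ex scale(2) by blast
   obtain Y where Y: "Y \<in> (nat_gliders G :: ('g, 'k, nat) glider set)" "induced_glider G H M Y"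
    using induced_exists[OF rH.irreducible_gliderD[OF scale(2)] u] by blast
   have Mn: "M \<in> nat_gliders GH" using scale(1) by (simp add: nat_gliders_def)
   note c = rH.qclass_closed[OF u]
   have "f (qclass GH M) = ?f (qclass GH M)" using f ind_lin_qclass[OF Mn scale(2) Y] c Mn scale(2) Y by simp
   thus ?case using c fl ind_lin_linear by (simp only: rat_linear_scale)
  next
   case (diff x y)
   thus ?case using rat_linear_diff[OF fl diff(1,2)] rat_linear_diff[OF ind_lin_linear diff(1,2)] by presburger
  qed
  thus "f = ?f" using f by (intro extensionalityI[of _ "carrier rH.QG"]) (auto simp del: restrict_apply)
 qed
 thus ?thesis using ind_lin_qclass[OF assms] rH.qclass_irr_closed[OF M(2)] by simp
qed

end

section \<open>Nilpotent groups\<close>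

text \<open>\<open>group_action\<close> asks for a homomorphism into \<open>BijGroup E\<close>,
  whose elements are extensional functions, so each permutation is cut down to
  \<open>E\<close>.\<close>

lemma group_action_restrict:
 fixes G (structure)
 assumes G: "group G" and a: "!!g x. g \<in> carrier G ==> x \<in> E ==> a g x \<in> E" "!!x. x \<in> E ==> a \<one>\<^bsub>G\<^esub> x = x"
  "!!g h x. g \<in> carrier G ==> h \<in> carrier G ==> x \<in> E ==> a (g \<otimes>\<^bsub>G\<^esub> h) x = a g (a h x)"
 shows "group_action G E (\<lambda>g. \<lambda>x\<in>E. a g x)"
proof -
 interpret group G by fact
 have bij: "bij_betw (a g) E E" if "g \<in> carrier G" for g
  by (rule bij_betwI[where g="a (inv g)"]) (use that a(1) a(3)[of g "inv g"] a(3)[of "inv g" g] a(2) in auto)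
 have mem: "(\<lambda>x\<in>E. a g x) \<in> carrier (BijGroup E)" if "g \<in> carrier G" for g
  using bij[OF that] by (simp add: BijGroup_def Bij_def)
 have "(\<lambda>g. \<lambda>x\<in>E. a g x) \<in> hom G (BijGroup E)"
 proof (rule homI)
  fix g h assume gh: "g \<in> carrier G" "h \<in> carrier G"
  have "(\<lambda>x\<in>E. a g x) \<otimes>\<^bsub>BijGroup E\<^esub> (\<lambda>x\<in>E. a h x) = compose E (\<lambda>x\<in>E. a g x) (\<lambda>x\<in>E. a h x)"
   using mem[OF gh(1)] mem[OF gh(2)] by (simp add: BijGroup_def)
  thus "(\<lambda>x\<in>E. a (g \<otimes> h) x) = (\<lambda>x\<in>E. a g x) \<otimes>\<^bsub>BijGroup E\<^esub> (\<lambda>x\<in>E. a h x)"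
   using gh a(1,3) by (auto simp: compose_def fun_eq_iff)
 qed (rule mem)
 thus ?thesis by (intro group_action.intro group_hom.intro group_hom_axioms.intro is_group group_BijGroup)
qed

text \<open>By the orbit-stabilizer theorem each orbit has a power of \<open>p\<close> as its size,
  and without fixed points none has size 1.\<close>

lemma p_group_action_dvd:
 assumes G: "group G" and c: "card (carrier G) = p ^ k" and p: "Factorial_Ring.prime (p::nat)" and E: "finite E"
  and a: "!!g x. g \<in> carrier G ==> x \<in> E ==> a g x \<in> E" "!!x. x \<in> E ==> a \<one>\<^bsub>G\<^esub> x = x"
  "!!g h x. g \<in> carrier G ==> h \<in> carrier G ==> x \<in> E ==> a (g \<otimes>\<^bsub>G\<^esub> h) x = a g (a h x)"
  and nofix: "!!x. x \<in> E ==> \<exists>g\<in>carrier G. a g x ~= x"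
 shows "p dvd card E"
proof -
 let ?f = "\<lambda>g. \<lambda>x\<in>E. a g x"
 interpret group_action G E ?f by (rule group_action_restrict[OF G a])
 have orb: "p dvd card X0" if X0: "X0 \<in> orbits G E ?f" for X0
 proof -
  obtain x where x: "x \<in> E" "X0 = orbit G ?f x" using X0 unfolding Group_Action.orbits_def by blast
  have "card X0 * card (stabilizer G ?f x) = p ^ k" using orbit_stabilizer_theorem[OF x(1)] c x(2) by (simp add: Coset.order_def)
  hence "card X0 dvd p ^ k" by (metis dvd_triv_left)
  then obtain j where j: "card X0 = p ^ j" using p by (auto simp: divides_primepow_nat)
  have "card X0 ~= 1"
  proof
   assume "card X0 = 1"
   then obtain y where y: "X0 = {y}" by (metis card_1_singletonE)
   obtain g where g: "g \<in> carrier G" "a g x ~= x" using nofix[OF x(1)] by blast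
   have "?f g x \<in> X0" "?f \<one>\<^bsub>G\<^esub> x \<in> X0" using x g(1) group.is_monoid[OF G] by (auto simp: orbit_def intro: monoid.one_closed)
   thus False using y x(1) a(2)[OF x(1)] g by auto
  qed
  thus ?thesis using j by (cases j) auto
 qed
 have "(\<Sum>X0\<in>orbits G E ?f. \<Sum>x\<in>X0. 1) = (\<Sum>x\<in>E. 1::nat)" by (rule disjoint_sum[OF E])
 hence "card E = (\<Sum>X0\<in>orbits G E ?f. card X0)" by simp
 also have "p dvd \<dots>" by (rule dvd_sum) (rule orb)
 finally show ?thesis .
qed

section \<open>Sylow subgroups, supplements and nilpotency\<close>

context group
begin

lemma comm_cancel:
 assumes "x \<in> carrier G" "y \<in> carrier G"
 shows "inv x \<otimes> (x \<otimes> y) = y" "x \<otimes> (inv x \<otimes> y) = y"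
 using assms by (simp_all add: m_assoc[symmetric])

text \<open>\<open>Q\<close> permutes the right cosets of \<open>P\<close>, and their number
  \<open>m\<close> is prime to \<open>p\<close>. So some coset \<open>P #> x\<close> is fixed, which
  says that \<open>x\<close> conjugates \<open>Q\<close> into \<open>P\<close>.\<close>

lemma sylow_into:
 assumes fin: "finite (carrier G)" and p: "Factorial_Ring.prime (p::nat)" and o: "Coset.order G = p ^ a * m" "\<not> p dvd m"
  and P: "subgroup P G" "card P = p ^ a" and Q: "subgroup Q G" "card Q = p ^ b"
 obtains x where "x \<in> carrier G" "!!q. q \<in> Q ==> x \<otimes> q \<otimes> inv x \<in> P"
proof -
 let ?E = "rcosets P"
 let ?Q = "G\<lparr>carrier := Q\<rparr>"
 interpret Q: group ?Q by (rule subgroup.subgroup_is_group[OF Q(1) is_group])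
 have Qc: "q \<in> carrier G" if "q \<in> Q" for q using subgroup.subset[OF Q(1)] that by blast
 have Pc: "P \<subseteq> carrier G" by (rule subgroup.subset[OF P(1)])
 have "card ?E * p ^ a = p ^ a * m" using lagrange[OF P(1)] P(2) o(1) by simp
 hence cE: "card ?E = m" using p by (simp add: prime_gt_0_nat)
 have fE: "finite ?E" using fin rcosets_subset_PowG[OF P(1)] finite_subset by blast
 have rep: "\<exists>x\<in>carrier G. C = P #> x" if "C \<in> ?E" for C using that by (auto simp: RCOSETS_def)
 have "\<exists>C\<in>?E. \<forall>q\<in>Q. C #> inv q = C"
 proof (rule ccontr)
  assume n: "\<not> (\<exists>C\<in>?E. \<forall>q\<in>Q. C #> inv q = C)"
  have "p dvd card ?E"
  proof (rule p_group_action_dvd[OF Q.is_group _ p fE, where a="\<lambda>q C. C #> inv q"])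
   show "card (carrier ?Q) = p ^ b" using Q(2) by simp
   fix C assume C: "C \<in> ?E"
   then obtain x where x: "x \<in> carrier G" "C = P #> x" using rep by blast
   hence Cc: "C \<subseteq> carrier G" using Pc by (simp add: r_coset_subset_G)
   show "C #> inv \<one>\<^bsub>?Q\<^esub> = C" using Cc by (simp add: coset_mult_one)
   show "\<exists>q\<in>carrier ?Q. C #> inv q ~= C" using n C by auto
   fix g assume g: "g \<in> carrier ?Q"
   hence gc: "g \<in> carrier G" using Qc by simp
   show "C #> inv g \<in> ?E" unfolding x(2) using x(1) gc by (simp add: coset_mult_assoc Pc rcosetsI)
   fix h assume "h \<in> carrier ?Q"
   hence hc: "h \<in> carrier G" using Qc by simp
   show "C #> inv (g \<otimes>\<^bsub>?Q\<^esub> h) = C #> inv h #> inv g" using gc hc Cc by (simp add: coset_mult_assoc inv_mult_group)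
  qed
  thus False using cE o(2) by simp
 qed
 then obtain x where x: "x \<in> carrier G" "!!q. q \<in> Q ==> P #> x #> inv q = P #> x" using rep by metis
 have "x \<otimes> q \<otimes> inv x \<in> P" if q: "q \<in> Q" for q
 proof -
  have "P #> x #> inv (inv q) = P #> x" by (rule x(2)) (rule subgroup.m_inv_closed[OF Q(1) q])
  hence "P #> (x \<otimes> q) = P #> x" using x(1) Qc[OF q] Pc by (simp add: coset_mult_assoc)
  hence "x \<otimes> q \<in> P #> x" using rcos_self[OF _ P(1), of "x \<otimes> q"] x(1) Qc[OF q] by simp
  then obtain y where y: "y \<in> P" "x \<otimes> q = y \<otimes> x" by (auto simp: r_coset_def)
  hence "x \<otimes> q \<otimes> inv x = y" using x(1) Pc by (simp add: m_assoc subsetD)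
  thus ?thesis using y(1) by simp
 qed
 with x(1) show thesis using that by blast
qed

lemma normal_conj: "N \<lhd> G ==> x \<in> carrier G ==> h \<in> N ==> x \<otimes> h \<otimes> inv x \<in> N"
 by (simp add: normal_inv_iff)

lemma conj_hom:
 "x \<in> carrier G ==> a \<in> carrier G ==> b \<in> carrier G ==>
   x \<otimes> (a \<otimes> b) \<otimes> inv x = (x \<otimes> a \<otimes> inv x) \<otimes> (x \<otimes> b \<otimes> inv x)"
 "x \<in> carrier G ==> a \<in> carrier G ==> x \<otimes> inv a \<otimes> inv x = inv (x \<otimes> a \<otimes> inv x)"
 by (simp_all add: m_assoc comm_cancel inv_mult_group)

lemma conj_subgroup:
 assumes P: "subgroup P G" and g: "g \<in> carrier G"
 shows "subgroup ((\<lambda>x. g \<otimes> x \<otimes> inv g) ` P) G" "card ((\<lambda>x. g \<otimes> x \<otimes> inv g) ` P) = card P"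
proof -
 have Pc: "x \<in> carrier G" if "x \<in> P" for x using subgroup.subset[OF P] that by blast
 show "subgroup ((\<lambda>x. g \<otimes> x \<otimes> inv g) ` P) G"
 proof (rule subgroupI)
  show "(\<lambda>x. g \<otimes> x \<otimes> inv g) ` P ~= {}" using subgroup.one_closed[OF P] by blast
  show "(\<lambda>x. g \<otimes> x \<otimes> inv g) ` P \<subseteq> carrier G" using Pc g by auto
 next
  fix a assume "a \<in> (\<lambda>x. g \<otimes> x \<otimes> inv g) ` P"
  then obtain x where "x \<in> P" "a = g \<otimes> x \<otimes> inv g" by blast
  thus "inv a \<in> (\<lambda>x. g \<otimes> x \<otimes> inv g) ` P"
   using conj_hom(2)[OF g Pc, of x] subgroup.m_inv_closed[OF P] by (metis imageI)
 next
  fix a b assume "a \<in> (\<lambda>x. g \<otimes> x \<otimes> inv g) ` P" "b \<in> (\<lambda>x. g \<otimes> x \<otimes> inv g) ` P"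
  then obtain x y where "x \<in> P" "a = g \<otimes> x \<otimes> inv g" "y \<in> P" "b = g \<otimes> y \<otimes> inv g" by blast
  thus "a \<otimes> b \<in> (\<lambda>x. g \<otimes> x \<otimes> inv g) ` P"
   using conj_hom(1)[OF g Pc Pc, of x y] subgroup.m_closed[OF P] by (metis imageI)
 qed
 have "inj_on (\<lambda>x. g \<otimes> x \<otimes> inv g) P"
  by (rule inj_onI) (use Pc g in \<open>simp add: m_assoc\<close>)
 thus "card ((\<lambda>x. g \<otimes> x \<otimes> inv g) ` P) = card P" by (rule card_image)
qed

lemma normal_product:
 assumes H: "subgroup H G" and N: "N \<lhd> G"
 obtains K where "K = {h \<otimes> c |h c. h \<in> H \<and> c \<in> N}" "subgroup K G" "H \<subseteq> K" "N \<subseteq> K"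
proof -
 note Ns = normal_imp_subgroup[OF N]
 have sub: "subgroup (H <#> N) G" using mult_norm_subgroup[OF N H] commut_normal[OF H N] by simp
 have "h \<in> H <#> N" if "h \<in> H" for h
 proof -
  have "h = h \<otimes> \<one>" using that subgroup.subset[OF H] by auto
  thus ?thesis using that subgroup.one_closed[OF Ns] unfolding set_mult_def by blast
 qed
 moreover have "c \<in> H <#> N" if c: "c \<in> N" for c
 proof -
  have "c = \<one> \<otimes> c" using c subgroup.subset[OF Ns] by auto
  thus ?thesis using c subgroup.one_closed[OF H] unfolding set_mult_def by blast
 qed
 moreover have "H <#> N = {h \<otimes> c |h c. h \<in> H \<and> c \<in> N}" by (auto simp: set_mult_def)
 ultimately show ?thesis using that[of "H <#> N"] sub by blast
qed

lemma card_subgroup_dvd: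
 assumes "subgroup P G" "subgroup C G" "P \<subseteq> C" shows "card P dvd card C"
 using group.lagrange[OF subgroup.subgroup_is_group[OF assms(2) is_group] subgroup_incl[OF assms]]
 by (auto simp: Coset.order_def) (metis dvd_triv_right)

lemma lower_central_normal: "lower_central G n \<lhd> G"
proof (induct n)
 case 0 show ?case using subgroup_self by (simp add: normal_inv_iff)
next
 case (Suc n)
 note sL = normal_imp_subgroup[OF Suc]
 let ?S = "\<Union>x\<in>lower_central G n. \<Union>y\<in>carrier G. {x \<otimes> y \<otimes> inv x \<otimes> inv y}"
 have Lc: "x \<in> carrier G" if "x \<in> lower_central G n" for x using subgroup.subset[OF sL] that by blast
 have "generate G ?S \<lhd> G"
 proof (rule normal_generateI)
  show "?S \<subseteq> carrier G" using Lc by auto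
  fix h g assume "h \<in> ?S" and g: "g \<in> carrier G"
  then obtain x y where xy: "x \<in> lower_central G n" "y \<in> carrier G" "h = x \<otimes> y \<otimes> inv x \<otimes> inv y" by blast
  let ?x = "g \<otimes> x \<otimes> inv g" and ?y = "g \<otimes> y \<otimes> inv g"
  have "g \<otimes> h \<otimes> inv g = ?x \<otimes> ?y \<otimes> inv ?x \<otimes> inv ?y"
   using xy g Lc[OF xy(1)] by (simp add: m_assoc inv_mult_group comm_cancel)
  moreover have "?x \<in> lower_central G n" by (rule normal_conj[OF Suc g xy(1)])
  moreover have "?y \<in> carrier G" using g xy by simp
  ultimately show "g \<otimes> h \<otimes> inv g \<in> ?S" by blast
 qed
 thus ?case by simp
qed

text \<open>Closure under inverses comes from finiteness: an injective conjugation of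
  \<open>P\<close> into itself is onto.\<close>

lemma normalizer_subgroup:
 assumes fin: "finite P" and P: "subgroup P G"
 shows "subgroup {g \<in> carrier G. \<forall>x\<in>P. g \<otimes> x \<otimes> inv g \<in> P} G" (is "subgroup ?N G")
proof (rule subgroupI)
 have Pc: "x \<in> carrier G" if "x \<in> P" for x using subgroup.subset[OF P] that by blast
 have "\<one> \<in> ?N" using Pc by simp
 thus "?N ~= {}" by blast
 show "?N \<subseteq> carrier G" by blast
 fix g assume g: "g \<in> ?N"
 hence gc: "g \<in> carrier G" by simp
 have "inj_on (\<lambda>x. g \<otimes> x \<otimes> inv g) P" by (rule inj_onI) (use Pc gc in \<open>simp add: m_assoc\<close>)
 moreover have "(\<lambda>x. g \<otimes> x \<otimes> inv g) ` P \<subseteq> P" using g by blast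
 ultimately have s: "(\<lambda>x. g \<otimes> x \<otimes> inv g) ` P = P" using fin by (simp add: endo_inj_surj)
 have "inv g \<otimes> x \<otimes> inv (inv g) \<in> P" if "x \<in> P" for x
 proof -
  have "x \<in> (\<lambda>x. g \<otimes> x \<otimes> inv g) ` P" using that s by simp
  then obtain y where "y \<in> P" "x = g \<otimes> y \<otimes> inv g" by (elim imageE)
  thus ?thesis using gc Pc by (simp add: m_assoc comm_cancel)
 qed
 thus "inv g \<in> ?N" using gc by simp
 fix h assume h: "h \<in> ?N"
 have "g \<otimes> h \<otimes> x \<otimes> inv (g \<otimes> h) = g \<otimes> (h \<otimes> x \<otimes> inv h) \<otimes> inv g" if "x \<in> P" for x
  using g h Pc[OF that] by (simp add: m_assoc inv_mult_group)
 thus "g \<otimes> h \<in> ?N" using g h by simp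
qed

text \<open>For a finite group this says that the derived subgroup lies in every maximal subgroup,
  that is, in the Frattini subgroup. By Wielandt's criterion it characterizes nilpotency; the two
  halves are \<open>nilpotent_if_supplement_free\<close> and
  \<open>nilpotent_supplement\<close>.\<close>

definition supplement_free :: bool where
 "supplement_free \<longleftrightarrow> (\<forall>H. subgroup H G -->
   (\<forall>x\<in>carrier G. \<exists>h\<in>H. \<exists>c\<in>derived G (carrier G). x = h \<otimes> c) --> H = carrier G)"

text \<open>Frattini's argument, applied to the normal subgroup generated by \<open>P\<close> and the derived subgroup.\<close>

lemma sylow_normal:
 assumes fin: "finite (carrier G)" and S: supplement_free
  and p: "Factorial_Ring.prime (p::nat)" and o: "Coset.order G = p ^ a * m" "\<not> p dvd m" and P: "subgroup P G" "card P = p ^ a"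
 shows "P \<lhd> G"
proof -
 have Pc: "x \<in> carrier G" if "x \<in> P" for x using subgroup.subset[OF P(1)] that by blast
 let ?N = "{g \<in> carrier G. \<forall>x\<in>P. g \<otimes> x \<otimes> inv g \<in> P}"
 have N: "subgroup ?N G" using normalizer_subgroup[OF _ P(1)] fin finite_subset[OF subgroup.subset[OF P(1)]] by blast
 obtain M where M: "M = {h \<otimes> c |h c. h \<in> P \<and> c \<in> derived G (carrier G)}" and Ms: "subgroup M G" and MP: "P \<subseteq> M" "derived G (carrier G) \<subseteq> M"
  by (rule normal_product[OF P(1) derived_self_is_normal])
 have Mc: "x \<in> carrier G" if "x \<in> M" for x using subgroup.subset[OF Ms] that by blast
 \<comment> \<open>A conjugate of \<open>x\<close> differs from \<open>x\<close> by a commutator,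
   and \<open>M\<close> contains the derived subgroup.\<close>
 have Mn: "g \<otimes> x \<otimes> inv g \<in> M" if g: "g \<in> carrier G" and x: "x \<in> M" for g x
 proof -
  have "g \<otimes> x \<otimes> inv g \<otimes> inv x \<in> M"
   using MP(2) g Mc[OF x] unfolding derived_def by (intro subsetD[OF MP(2)[unfolded derived_def]] generate.incl) blast
  hence "(g \<otimes> x \<otimes> inv g \<otimes> inv x) \<otimes> x \<in> M" by (rule subgroup.m_closed[OF Ms _ x])
  thus ?thesis using g Mc[OF x] by (simp add: m_assoc)
 qed
 let ?M = "G\<lparr>carrier := M\<rparr>"
 interpret M: group ?M by (rule subgroup.subgroup_is_group[OF Ms is_group])
 have fM: "finite (carrier ?M)" using fin subgroup.subset[OF Ms] finite_subset by simp
 have P': "subgroup P ?M" by (rule subgroup_incl[OF P(1) Ms MP(1)])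
 have "card (rcosets\<^bsub>?M\<^esub> P) * card P = card M" using M.lagrange[OF P'] by (simp add: Coset.order_def)
 hence oM: "Coset.order ?M = p ^ a * card (rcosets\<^bsub>?M\<^esub> P)" using P(2) by (simp add: Coset.order_def mult.commute)
 have "card (rcosets M) * card M = Coset.order G" by (rule lagrange[OF Ms])
 hence "p ^ a * m = p ^ a * (card (rcosets\<^bsub>?M\<^esub> P) * card (rcosets M))" using o(1) oM by (auto simp: Coset.order_def)
 hence "m = card (rcosets\<^bsub>?M\<^esub> P) * card (rcosets M)" using prime_gt_0_nat[OF p] by simp
 hence nd: "\<not> p dvd card (rcosets\<^bsub>?M\<^esub> P)" using o(2) by auto
 have "\<exists>h\<in>?N. \<exists>c\<in>derived G (carrier G). g' = h \<otimes> c" if g': "g' \<in> carrier G" for g'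
 proof -
  \<comment> \<open>Passing to the inverse brings the factors into the required order at the end:
    normalizer first, derived subgroup second.\<close>
  define g where "g = inv g'"
  have g: "g \<in> carrier G" using g' by (simp add: g_def)
  let ?Q = "(\<lambda>x. g \<otimes> x \<otimes> inv g) ` P"
  have QM: "?Q \<subseteq> M" using Mn[OF g] MP(1) by blast
  have Q': "subgroup ?Q ?M" by (rule subgroup_incl[OF conj_subgroup(1)[OF P(1) g] Ms QM])
  have cQ: "card ?Q = p ^ a" using conj_subgroup(2)[OF P(1) g] P(2) by simp
  obtain x where x: "x \<in> M" "!!q. q \<in> ?Q ==> x \<otimes>\<^bsub>?M\<^esub> q \<otimes>\<^bsub>?M\<^esub> inv\<^bsub>?M\<^esub> x \<in> P"
   by (rule M.sylow_into[OF fM p oM nd P' P(2) Q' cQ]) auto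
  note xc = Mc[OF x(1)]
  have "(x \<otimes> g) \<otimes> y \<otimes> inv (x \<otimes> g) \<in> P" if y: "y \<in> P" for y
  proof -
   have "x \<otimes> (g \<otimes> y \<otimes> inv g) \<otimes> inv x \<in> P" using x(2)[of "g \<otimes> y \<otimes> inv g"] y m_inv_consistent[OF Ms x(1)] by simp
   thus ?thesis using xc g Pc[OF y] by (simp add: m_assoc inv_mult_group)
  qed
  hence xg: "x \<otimes> g \<in> ?N" using xc g by simp
  \<comment> \<open>The element \<open>x\<close> of \<open>M\<close> that moves the conjugate of
    \<open>P\<close> back into \<open>P\<close> has a factor \<open>h\<close> in \<open>P\<close>.
    This factor lies in the normalizer and is absorbed there, so only \<open>c\<close> from the
    derived subgroup remains.\<close>
  obtain h c where hc: "h \<in> P" "c \<in> derived G (carrier G)" "x = h \<otimes> c" using x(1) unfolding M by blast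
  have PN: "h \<in> ?N" using hc(1) subgroup.m_closed[OF P(1)] subgroup.m_inv_closed[OF P(1)] Pc by simp
  have cc: "c \<in> carrier G" using hc(2) MP(2) Mc by blast
  have "inv (x \<otimes> g) \<otimes> h \<in> ?N" by (rule subgroup.m_closed[OF N subgroup.m_inv_closed[OF N xg] PN])
  moreover have "g' = inv (x \<otimes> g) \<otimes> h \<otimes> c"
   using g' Pc[OF hc(1)] cc by (simp add: g_def hc(3) inv_mult_group m_assoc comm_cancel)
  ultimately show ?thesis using hc(2) by blast
 qed
 hence "?N = carrier G" using S N unfolding supplement_free_def by blast
 thus ?thesis using P(1) by (simp add: normal_inv_iff) blast
qed

text \<open>For each prime, the full power dividing the group order divides the order of
  \<open>C\<close> by Lagrange; hence so does the group order itself.\<close>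

lemma subgroup_contains_sylows:
 assumes fin: "finite (carrier G)" and C: "subgroup C G"
  and S: "!!p::nat. Factorial_Ring.prime p ==> \<exists>P\<subseteq>C. subgroup P G \<and> card P = p ^ multiplicity p (Coset.order G)"
 shows "C = carrier G"
proof -
 have o0: "Coset.order G ~= 0" using fin one_closed by (auto simp: Coset.order_def)
 have c0: "card C ~= 0" using finite_subset[OF subgroup.subset[OF C] fin] subgroup.one_closed[OF C] by auto
 have "Coset.order G dvd card C"
 proof (rule multiplicity_le_imp_dvd[OF o0])
  fix p :: nat assume p: "Factorial_Ring.prime p"
  obtain P where P: "subgroup P G" "card P = p ^ multiplicity p (Coset.order G)" "P \<subseteq> C" using S[OF p] by blast
  have "card P dvd card C" by (rule card_subgroup_dvd[OF P(1) C P(3)])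
  thus "multiplicity p (Coset.order G) \<le> multiplicity p (card C)" unfolding P(2) using c0 p by (intro multiplicity_geI) (auto simp: not_prime_unit)
 qed
 hence "Coset.order G \<le> card C" using c0 by (intro dvd_imp_le) auto
 thus ?thesis using card_seteq[OF fin subgroup.subset[OF C]] by (simp add: Coset.order_def)
qed

text \<open>All Sylow subgroups are normal by \<open>sylow_normal\<close>, so those for different
  primes commute elementwise. An element in the center of one of them is then centralized by all of
  them, and its centralizer is the whole group.\<close>

lemma center_nontrivial:
 assumes fin: "finite (carrier G)" and S: supplement_free and ne: "carrier G ~= {\<one>}"
 shows "\<exists>x\<in>carrier G. x ~= \<one> \<and> (\<forall>g\<in>carrier G. g \<otimes> x = x \<otimes> g)"
proof -
 let ?n = "Coset.order G" and ?a = "\<lambda>p. multiplicity p (Coset.order G)"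
 have n0: "?n ~= 0" using fin one_closed by (auto simp: Coset.order_def)
 have "?n ~= 1" using ne one_closed by (metis Coset.order_def card_1_singletonE singletonD)
 then obtain p where p: "Factorial_Ring.prime p" "p dvd ?n" using prime_factor_nat by blast
 have dec: "\<exists>m. ?n = q ^ ?a q * m \<and> \<not> q dvd m" if "Factorial_Ring.prime q" for q
  using multiplicity_decompose'[of ?n q] n0 that by (metis not_prime_unit)
 have syl: "\<exists>Q. subgroup Q G \<and> card Q = q ^ ?a q" if q: "Factorial_Ring.prime q" for q
  using dec[OF q] sylow_thm[OF q is_group _ fin] by blast
 have syln: "Q \<lhd> G" if "Factorial_Ring.prime q" "subgroup Q G" "card Q = q ^ ?a q" for q Q
  using dec[OF that(1)] sylow_normal[OF fin S that(1) _ _ that(2,3)] by blast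
 obtain P where P: "subgroup P G" "card P = p ^ ?a p" using syl[OF p(1)] by blast
 note Pn = syln[OF p(1) P]
 have Pc: "x \<in> carrier G" if "x \<in> P" for x using subgroup.subset[OF P(1)] that by blast
 have fP: "finite P" using fin subgroup.subset[OF P(1)] finite_subset by blast
 have pP: "p dvd card P" unfolding P(2) using p n0 by (simp add: prime_multiplicity_gt_zero_iff)
 let ?P = "G\<lparr>carrier := P\<rparr>"
 have "\<exists>x\<in>P - {\<one>}. \<forall>g\<in>P. g \<otimes> x \<otimes> inv g = x"
 proof (rule ccontr)
  assume n: "\<not> (\<exists>x\<in>P - {\<one>}. \<forall>g\<in>P. g \<otimes> x \<otimes> inv g = x)"
  \<comment> \<open>The subgroup \<open>P\<close> acts by conjugation on its nontrivial elements.
    Without fixed points \<open>p\<close> would divide both |P| and |P| - 1.\<close>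
  have "p dvd card (P - {\<one>})"
  proof (rule p_group_action_dvd[OF subgroup.subgroup_is_group[OF P(1) is_group] _ p(1), where a="\<lambda>g x. g \<otimes> x \<otimes> inv g"])
   show "card (carrier ?P) = p ^ ?a p" using P(2) by simp
   show "finite (P - {\<one>})" using fP by simp
   fix x assume x: "x \<in> P - {\<one>}"
   hence xc: "x \<in> carrier G" using Pc by blast
   show "\<one>\<^bsub>?P\<^esub> \<otimes> x \<otimes> inv \<one>\<^bsub>?P\<^esub> = x" using xc by simp
   show "\<exists>g\<in>carrier ?P. g \<otimes> x \<otimes> inv g ~= x" using n x by auto
   fix g assume "g \<in> carrier ?P"
   hence g: "g \<in> carrier G" using Pc by simp
   have "x = inv g \<otimes> (g \<otimes> x \<otimes> inv g) \<otimes> g" using g xc by (simp add: m_assoc comm_cancel)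
   hence "g \<otimes> x \<otimes> inv g ~= \<one>" using x g by auto
   thus "g \<otimes> x \<otimes> inv g \<in> P - {\<one>}" using normal_conj[OF Pn g] x by simp
   fix h assume "h \<in> carrier ?P"
   thus "(g \<otimes>\<^bsub>?P\<^esub> h) \<otimes> x \<otimes> inv (g \<otimes>\<^bsub>?P\<^esub> h) = g \<otimes> (h \<otimes> x \<otimes> inv h) \<otimes> inv g"
    using g xc Pc by (simp add: m_assoc inv_mult_group)
  qed
  hence d: "p dvd card P - 1" using fP subgroup.one_closed[OF P(1)] by simp
  have "1 \<le> card P" using fP subgroup.one_closed[OF P(1)] by (auto simp: Suc_le_eq card_gt_0_iff)
  thus False using dvd_diffD1[OF d pP] p(1) by (simp add: not_prime_unit)
 qed
 then obtain x where x: "x \<in> P" "x ~= \<one>" "!!g. g \<in> P ==> g \<otimes> x \<otimes> inv g = x" by blast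
 note xc = Pc[OF x(1)]
 let ?C = "{g \<in> carrier G. g \<otimes> x = x \<otimes> g}"
 have Ceq: "g \<otimes> x = x \<otimes> g \<longleftrightarrow> g \<otimes> x \<otimes> inv g = x" if g: "g \<in> carrier G" for g
  using inv_solve_right[of x "g \<otimes> x" g] g xc by (metis m_closed)
 have "?C = carrier G"
 proof (rule subgroup_contains_sylows[OF fin])
  show "subgroup ?C G"
  proof (rule subgroupI)
   show "?C ~= {}" using xc by auto
   fix g assume "g \<in> ?C"
   hence g: "g \<in> carrier G" "g \<otimes> x = x \<otimes> g" by auto
   have "inv g \<otimes> x = inv g \<otimes> (x \<otimes> g) \<otimes> inv g" using g(1) xc by (simp add: m_assoc)
   also have "\<dots> = x \<otimes> inv g" using g(1) xc unfolding g(2)[symmetric] by (simp add: m_assoc comm_cancel)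
   finally show "inv g \<in> ?C" using g(1) by simp
   fix h assume "h \<in> ?C"
   hence h: "h \<in> carrier G" "h \<otimes> x = x \<otimes> h" by auto
   have "g \<otimes> h \<otimes> x = x \<otimes> g \<otimes> h" using g h xc by (simp add: m_assoc) (simp add: m_assoc[symmetric])
   thus "g \<otimes> h \<in> ?C" using g h xc by (simp add: m_assoc)
  qed auto
  fix q :: nat assume q: "Factorial_Ring.prime q"
  show "\<exists>Q\<subseteq>?C. subgroup Q G \<and> card Q = q ^ ?a q"
  proof (cases "q = p")
   case True
   have "P \<subseteq> ?C" using Pc x(3) Ceq by auto
   thus ?thesis using P True by blast
  next
   case False
   obtain Q where Q: "subgroup Q G" "card Q = q ^ ?a q" using syl[OF q] by blast
   note Qn = syln[OF q Q]
   have s: "subgroup (P \<inter> Q) G" by (rule subgroups_Inter_pair[OF P(1) Q(1)])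
   have "card (P \<inter> Q) dvd card P" "card (P \<inter> Q) dvd card Q"
    by (rule card_subgroup_dvd[OF s P(1)] card_subgroup_dvd[OF s Q(1)]; blast)+
   moreover have "coprime (card P) (card Q)" unfolding P(2) Q(2) using p(1) q False by (simp add: primes_coprime)
   ultimately have "card (P \<inter> Q) = 1" by (metis coprime_common_divisor nat_dvd_1_iff_1)
   hence PQ: "y = \<one>" if "y \<in> P" "y \<in> Q" for y using that subgroup.one_closed[OF s] by (metis IntI card_1_singletonE singletonD)
   have "y \<in> ?C" if y: "y \<in> Q" for y
   proof -
    have yc: "y \<in> carrier G" using y subgroup.subset[OF Q(1)] by blast
    \<comment> \<open>The commutator of \<open>y\<close> and \<open>x\<close> lies in
      \<open>P\<close> by normality of \<open>P\<close> and in \<open>Q\<close> by normality of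
      \<open>Q\<close>, and these two meet trivially.\<close>
    have "(y \<otimes> x \<otimes> inv y) \<otimes> inv x \<in> P" by (intro subgroup.m_closed[OF P(1)] normal_conj[OF Pn yc] subgroup.m_inv_closed[OF P(1)] x(1))
    moreover have "y \<otimes> (x \<otimes> inv y \<otimes> inv x) \<in> Q" by (intro subgroup.m_closed[OF Q(1)] normal_conj[OF Qn xc] subgroup.m_inv_closed[OF Q(1)] y)
    ultimately have "y \<otimes> x \<otimes> inv y \<otimes> inv x = \<one>" using PQ yc xc by (simp add: m_assoc)
    hence "y \<otimes> x \<otimes> inv y = x" using yc xc by (metis inv_equality inv_inv inv_closed m_closed)
    thus ?thesis using Ceq[OF yc] yc by simp
   qed
   thus ?thesis using Q by blast
  qed
 qed
 thus ?thesis using x(2) xc by blast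
qed

text \<open>The derived subgroup maps onto that of the quotient, so the preimage of a supplement is
  a supplement.\<close>

lemma supplement_free_quotient:
 assumes S: supplement_free and N: "N \<lhd> G"
 shows "group.supplement_free (G Mod N)"
proof -
 define A where "A = G Mod N"
 interpret A: group A unfolding A_def by (rule normal.factorgroup_is_group[OF N])
 interpret q: group_hom G A "\<lambda>a. N #> a"
  by (intro group_hom.intro group_hom_axioms.intro is_group A.is_group normal.r_coset_hom_Mod[OF N, folded A_def])
 have surj: "(\<lambda>a. N #> a) ` carrier G = carrier A" by (auto simp: A_def FactGroup_def RCOSETS_def)
 show ?thesis unfolding A_def[symmetric] A.supplement_free_def
 proof (intro allI impI)
  fix H assume H: "subgroup H A"
   and HG: "\<forall>x\<in>carrier A. \<exists>h\<in>H. \<exists>c\<in>derived A (carrier A). x = h \<otimes>\<^bsub>A\<^esub> c"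
  let ?K = "{g \<in> carrier G. N #> g \<in> H}"
  have "subgroup ?K G"
  proof (rule subgroupI)
   show "?K ~= {}" using subgroup.one_closed[OF H] q.hom_one one_closed by (metis (mono_tags, lifting) empty_iff mem_Collect_eq)
  qed (use subgroup.m_closed[OF H] subgroup.m_inv_closed[OF H] q.hom_mult q.hom_inv in auto)
  moreover have "\<exists>h\<in>?K. \<exists>c\<in>derived G (carrier G). x = h \<otimes> c" if x: "x \<in> carrier G" for x
  proof -
   obtain h d where hd: "h \<in> H" "d \<in> derived A (carrier A)" "N #> x = h \<otimes>\<^bsub>A\<^esub> d" using HG q.hom_closed[OF x] by blast
   have "derived A (carrier A) = (\<lambda>a. N #> a) ` derived G (carrier G)"
    using q.derived_img[OF order_refl] surj by simp
   then obtain c where c: "c \<in> derived G (carrier G)" "d = N #> c" using hd(2) by blast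
   have cc: "c \<in> carrier G" using c(1) derived_in_carrier by blast
   have hc: "h \<in> carrier A" using subgroup.subset[OF H] hd(1) by blast
   have "N #> (x \<otimes> inv c) = h" using q.hom_mult q.hom_inv x cc hd(3) c(2) hc by (simp add: A.m_assoc)
   thus ?thesis using hd(1) c(1) cc x by (intro bexI[of _ "x \<otimes> inv c"] bexI[of _ c]) (auto simp: m_assoc)
  qed
  ultimately have "?K = carrier G" using S unfolding supplement_free_def by blast
  hence "carrier A \<subseteq> H" unfolding surj[symmetric] by blast
  thus "H = carrier A" using subgroup.subset[OF H] by (rule subset_antisym[rotated])
 qed
qed

text \<open>If the stable term \<open>K\<close> of the lower central series is nontrivial, take \<open>N\<close> maximal among the normal
 subgroups not containing \<open>K\<close>. Then \<open>K\<close> lies in the preimage of the center of the quotient by \<open>N\<close>, so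
 \<open>[K, G]\<close> lies in \<open>N\<close>.\<close>

lemma nilpotent_if_supplement_free:
 assumes fin: "finite (carrier G)" and S: supplement_free
 shows "nilpotent_group G"
proof (rule ccontr)
 assume nn: "\<not> nilpotent_group G"
 note Ls = normal_imp_subgroup[OF lower_central_normal]
 have Lc: "x \<in> carrier G" if "x \<in> lower_central G n" for x n using subgroup.subset[OF Ls] that by blast
 have dec: "lower_central G (Suc n) \<subseteq> lower_central G n" for n unfolding lower_central.simps
 proof (rule generate_subgroup_incl[OF _ Ls], clarify)
  fix x y assume x: "x \<in> lower_central G n" and y: "y \<in> carrier G"
  have "x \<otimes> (y \<otimes> inv x \<otimes> inv y) \<in> lower_central G n"
   by (intro subgroup.m_closed[OF Ls] x normal_conj[OF lower_central_normal y] subgroup.m_inv_closed[OF Ls])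
  thus "x \<otimes> y \<otimes> inv x \<otimes> inv y \<in> lower_central G n" using x y Lc by (simp add: m_assoc)
 qed
 \<comment> \<open>The series decreases, so a term of least size equals the next one.\<close>
 obtain n where mn: "!!m. card (lower_central G n) \<le> card (lower_central G m)"
  using ex_has_least_nat[of "\<lambda>_. True" 0 "\<lambda>n. card (lower_central G n)"] by blast
 have n: "lower_central G (Suc n) = lower_central G n"
  by (rule card_seteq[OF finite_subset[OF subgroup.subset[OF Ls] fin] dec mn])
 let ?K = "lower_central G n"
 let ?F = "{N. N \<lhd> G \<and> \<not> ?K \<subseteq> N}"
 have "?F \<subseteq> Pow (carrier G)" using subgroup.subset[OF normal_imp_subgroup] by blast
 hence fF: "finite ?F" using fin finite_subset by blast
 have "?K ~= {\<one>}" using nn unfolding nilpotent_group_def by blast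
 hence "{\<one>} \<in> ?F" using one_is_normal subgroup.one_closed[OF Ls] by blast
 then obtain N where N: "N \<in> ?F" and mx: "!!M. M \<in> ?F ==> N \<subseteq> M ==> M = N"
  using finite_has_maximal[OF fF] by (metis (no_types, lifting) empty_iff)
 hence Nn: "N \<lhd> G" and KN: "\<not> ?K \<subseteq> N" by auto
 note Ns = normal_imp_subgroup[OF Nn]
 define A where "A = G Mod N"
 interpret A: group A unfolding A_def by (rule normal.factorgroup_is_group[OF Nn])
 interpret q: group_hom G A "\<lambda>a. N #> a"
  by (intro group_hom.intro group_hom_axioms.intro is_group A.is_group normal.r_coset_hom_Mod[OF Nn, folded A_def])
 have surj: "carrier A = (\<lambda>a. N #> a) ` carrier G" by (auto simp: A_def FactGroup_def RCOSETS_def)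
 have qN: "N #> a = \<one>\<^bsub>A\<^esub> \<longleftrightarrow> a \<in> N" if "a \<in> carrier G" for a
  using coset_join1[OF _ that Ns] coset_join2[OF that Ns] by (auto simp: A_def FactGroup_def)
 have finA: "finite (carrier A)" unfolding surj using fin by simp
 have "carrier A ~= {\<one>\<^bsub>A\<^esub>}"
 proof
  assume t: "carrier A = {\<one>\<^bsub>A\<^esub>}"
  have "a \<in> N" if "a \<in> carrier G" for a using q.hom_closed[OF that] qN[OF that] t by simp
  thus False using KN Lc by blast
 qed
 then obtain c where c: "c \<in> carrier A" "c ~= \<one>\<^bsub>A\<^esub>" "!!d. d \<in> carrier A ==> d \<otimes>\<^bsub>A\<^esub> c = c \<otimes>\<^bsub>A\<^esub> d"
  using A.center_nontrivial[OF finA supplement_free_quotient[OF S Nn, folded A_def]] by blast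
 obtain x where x: "x \<in> carrier G" "c = N #> x" using c(1) surj by blast
 \<comment> \<open>The preimage of the center of the quotient. It is normal and contains
   \<open>N\<close> properly because of \<open>x\<close>, so by maximality of \<open>N\<close> it
   contains the stable term.\<close>
 let ?M = "{y \<in> carrier G. \<forall>g\<in>carrier G. y \<otimes> g \<otimes> inv y \<otimes> inv g \<in> N}"
 have comm: "y \<otimes> g \<otimes> inv y \<otimes> inv g \<in> N \<longleftrightarrow> (N #> y) \<otimes>\<^bsub>A\<^esub> (N #> g) = (N #> g) \<otimes>\<^bsub>A\<^esub> (N #> y)"
  if "y \<in> carrier G" "g \<in> carrier G" for y g
 proof -
  let ?y = "N #> y" and ?g = "N #> g"
  have yg: "?y \<in> carrier A" "?g \<in> carrier A" using that by auto
  have "y \<otimes> g \<otimes> inv y \<otimes> inv g \<in> N \<longleftrightarrow> ?y \<otimes>\<^bsub>A\<^esub> ?g \<otimes>\<^bsub>A\<^esub> inv\<^bsub>A\<^esub> (?g \<otimes>\<^bsub>A\<^esub> ?y) = \<one>\<^bsub>A\<^esub>"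
   using qN[of "y \<otimes> g \<otimes> inv y \<otimes> inv g"] that yg by (simp add: A.inv_mult_group A.m_assoc)
  also have "\<dots> \<longleftrightarrow> ?y \<otimes>\<^bsub>A\<^esub> ?g = ?g \<otimes>\<^bsub>A\<^esub> ?y"
   using yg by (metis A.inv_closed A.inv_equality A.inv_inv A.m_closed A.r_inv)
  finally show ?thesis .
 qed
 have Mq: "y \<in> ?M \<longleftrightarrow> y \<in> carrier G \<and> (\<forall>d\<in>carrier A. (N #> y) \<otimes>\<^bsub>A\<^esub> d = d \<otimes>\<^bsub>A\<^esub> (N #> y))" for y
  using comm unfolding surj by auto
 have "?M \<lhd> G" unfolding normal_inv_iff
 proof (intro conjI ballI)
  show "subgroup ?M G"
  proof (rule subgroupI)
   show "?M ~= {}" using subgroup.one_closed[OF Ns] by (auto intro!: exI[of _ \<one>])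
  next
   fix y assume y: "y \<in> ?M"
   hence yc: "y \<in> carrier G" "N #> y \<in> carrier A" by auto
   have "inv\<^bsub>A\<^esub> (N #> y) \<otimes>\<^bsub>A\<^esub> d = d \<otimes>\<^bsub>A\<^esub> inv\<^bsub>A\<^esub> (N #> y)" if d: "d \<in> carrier A" for d
   proof -
    have "(N #> y) \<otimes>\<^bsub>A\<^esub> d = d \<otimes>\<^bsub>A\<^esub> (N #> y)" using y d unfolding Mq by blast
    thus ?thesis using yc d by (metis A.inv_closed A.inv_solve_left A.inv_solve_right A.m_assoc A.m_closed)
   qed
   thus "inv y \<in> ?M" unfolding Mq using yc by simp
   fix z assume z: "z \<in> ?M"
   hence zc: "z \<in> carrier G" "N #> z \<in> carrier A" by auto
   have "(N #> y) \<otimes>\<^bsub>A\<^esub> (N #> z) \<otimes>\<^bsub>A\<^esub> d = d \<otimes>\<^bsub>A\<^esub> ((N #> y) \<otimes>\<^bsub>A\<^esub> (N #> z))" if d: "d \<in> carrier A" for d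
    using y z d yc zc unfolding Mq by (metis A.m_assoc)
   thus "y \<otimes> z \<in> ?M" unfolding Mq using yc zc by simp
  qed auto
  fix g y assume g: "g \<in> carrier G" and y: "y \<in> ?M"
  hence yc: "y \<in> carrier G" "N #> y \<in> carrier A" by auto
  have gc: "N #> g \<in> carrier A" using g by simp
  have "N #> (g \<otimes> y \<otimes> inv g) = (N #> g) \<otimes>\<^bsub>A\<^esub> (N #> y) \<otimes>\<^bsub>A\<^esub> inv\<^bsub>A\<^esub> (N #> g)" using g yc by simp
  also have "(N #> g) \<otimes>\<^bsub>A\<^esub> (N #> y) = (N #> y) \<otimes>\<^bsub>A\<^esub> (N #> g)" using y gc unfolding Mq by simp
  also have "\<dots> \<otimes>\<^bsub>A\<^esub> inv\<^bsub>A\<^esub> (N #> g) = N #> y" using yc gc by (simp add: A.m_assoc)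
  finally show "g \<otimes> y \<otimes> inv g \<in> ?M" using y g unfolding Mq by simp
 qed
 moreover have "N \<subseteq> ?M"
 proof
  fix y assume y: "y \<in> N"
  hence yc: "y \<in> carrier G" using subgroup.subset[OF Ns] by blast
  have "N #> y = \<one>\<^bsub>A\<^esub>" using qN[OF yc] y by simp
  thus "y \<in> ?M" unfolding Mq using yc by simp
 qed
 moreover have "x \<in> ?M" unfolding Mq using x c(3) by simp
 moreover have "x \<notin> N" using qN[OF x(1)] x(2) c(2) by simp
 ultimately have "?K \<subseteq> ?M" using mx[of ?M] by blast
 hence "lower_central G (Suc n) \<subseteq> N"
  unfolding lower_central.simps by (intro generate_subgroup_incl[OF _ Ns]) blast
 thus False using n KN by simp
qed

text \<open>If \<open>H\<close> and one term of the lower central series give \<open>G\<close>, so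
  do \<open>H\<close> and the next term: modulo the next term the former is central, so all
  commutators fall into the image of \<open>H\<close>, and the derived subgroup is absorbed. At the
  trivial term only \<open>H\<close> is left.\<close>

lemma nilpotent_supplement:
 assumes nil: "nilpotent_group G" and H: "subgroup H G" and HG: "!!x. x \<in> carrier G ==> \<exists>h\<in>H. \<exists>c\<in>derived G (carrier G). x = h \<otimes> c"
 shows "H = carrier G"
proof -
 have Hc: "h \<in> carrier G" if "h \<in> H" for h using subgroup.subset[OF H] that by blast
 have L1: "lower_central G (Suc 0) = derived G (carrier G)" by (simp add: derived_def)
 have step: "\<forall>x\<in>carrier G. \<exists>h\<in>H. \<exists>c\<in>lower_central G (Suc n). x = h \<otimes> c" for n
 proof (induct n)
  case 0 thus ?case using HG L1 by simp
 next
  case (Suc n)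
  let ?L = "lower_central G (Suc n)" and ?N = "lower_central G (Suc (Suc n))"
  note Nn = lower_central_normal[of "Suc (Suc n)"]
  note Ns = normal_imp_subgroup[OF Nn]
  have Lc: "c \<in> carrier G" if "c \<in> ?L" for c using subgroup.subset[OF normal_imp_subgroup[OF lower_central_normal]] that by blast
  have Nc: "c \<in> carrier G" if "c \<in> ?N" for c using subgroup.subset[OF Ns] that by blast
  have LN: "c \<otimes> y \<otimes> inv c \<otimes> inv y \<in> ?N" if "c \<in> ?L" "y \<in> carrier G" for c y
   unfolding lower_central.simps(2)[of G "Suc n"] by (rule generate.incl) (use that in blast)
  obtain K where K: "K = {h \<otimes> c |h c. h \<in> H \<and> c \<in> ?N}" and Ksub: "subgroup K G" and KK: "H \<subseteq> K" "?N \<subseteq> K"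
   by (rule normal_product[OF H Nn]) blast
  note K_H = subsetD[OF KK(1)] and K_N = subsetD[OF KK(2)]
  note Kcl = subgroup.m_closed[OF Ksub] subgroup.m_inv_closed[OF Ksub]
  have Kn: "y \<otimes> k \<otimes> inv y \<in> K" if y: "y \<in> carrier G" and k: "k \<in> K" for y k
  proof -
   obtain h c where hc: "h \<in> H" "c \<in> ?L" "y = h \<otimes> c" using Suc y by blast
   have kc: "k \<in> carrier G" using k subgroup.subset[OF Ksub] by blast
   \<comment> \<open>Conjugation by \<open>c\<close> changes \<open>k\<close> only by a commutator
     from the next term.\<close>
   have "h \<otimes> ((c \<otimes> k \<otimes> inv c \<otimes> inv k) \<otimes> k) \<otimes> inv h \<in> K"
    by (intro Kcl K_H hc k K_N LN kc subgroup.m_inv_closed[OF H])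
   thus ?thesis using hc(3) Hc[OF hc(1)] Lc[OF hc(2)] kc by (simp add: m_assoc inv_mult_group comm_cancel)
  qed
  have comm: "x \<otimes> y \<otimes> inv x \<otimes> inv y \<in> K" if x: "x \<in> carrier G" and y: "y \<in> carrier G" for x y
  proof -
   obtain h c where hc: "h \<in> H" "c \<in> ?L" "x = h \<otimes> c" using Suc x by blast
   \<comment> \<open>The commutator of \<open>h \<otimes> c\<close> and \<open>y\<close>, regrouped:
     a conjugate of the commutator of \<open>c\<close> and \<open>y\<close>, then \<open>h\<close>
     times a conjugate of its inverse. The latter lies in \<open>K\<close> by
     \<open>Kn\<close>.\<close>
   have "(h \<otimes> (c \<otimes> y \<otimes> inv c \<otimes> inv y) \<otimes> inv h) \<otimes> (h \<otimes> (y \<otimes> inv h \<otimes> inv y)) \<in> K"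
    by (intro Kcl K_H hc K_N LN y Kn subgroup.m_inv_closed[OF H])
   thus ?thesis using hc(3) Hc[OF hc(1)] Lc[OF hc(2)] y by (simp add: m_assoc inv_mult_group comm_cancel)
  qed
  have "derived G (carrier G) \<subseteq> K" unfolding derived_def by (rule generate_subgroup_incl[OF _ Ksub]) (use comm in blast)
  hence "x \<in> K" if "x \<in> carrier G" for x using HG[OF that] K_H Kcl(1) by blast
  thus ?case unfolding K by blast
 qed
 obtain n where n: "lower_central G n = {\<one>}" using nil unfolding nilpotent_group_def by blast
 have "lower_central G (Suc n) \<subseteq> {\<one>}"
  unfolding lower_central.simps n by (rule generate_subgroup_incl[OF _ triv_subgroup]) auto
 hence "x \<in> H" if "x \<in> carrier G" for x using step[of n] that Hc by force
 thus ?thesis using subgroup.subset[OF H] by blast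
qed

text \<open>By maximality, \<open>H\<close> times the derived subgroup is \<open>H\<close> or
  everything. In the first case \<open>H\<close> contains all commutators and is normal.\<close>

lemma maximal_supplement:
 assumes M: "maximal_subgroup H G" and n: "\<not> H \<lhd> G" and x: "x \<in> carrier G"
 shows "\<exists>h\<in>H. \<exists>c\<in>derived G (carrier G). x = h \<otimes> c"
proof -
 have H: "subgroup H G" using M by (simp add: maximal_subgroup_def)
 have Hc: "h \<in> carrier G" if "h \<in> H" for h using subgroup.subset[OF H] that by blast
 let ?D = "derived G (carrier G)"
 have D: "?D \<lhd> G" using lower_central_normal[of "Suc 0"] by (simp add: derived_def)
 note Ds = normal_imp_subgroup[OF D]
 have Dc: "c \<in> carrier G" if "c \<in> ?D" for c using subgroup.subset[OF Ds] that by blast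
 obtain K where K: "K = {h \<otimes> c |h c. h \<in> H \<and> c \<in> ?D}" and Ksub: "subgroup K G" and KK: "H \<subseteq> K" "?D \<subseteq> K"
  by (rule normal_product[OF H D]) blast
 note K_D = subsetD[OF KK(2)]
 have "K ~= H"
 proof
  assume KH: "K = H"
  have "y \<otimes> h \<otimes> inv y \<in> H" if y: "y \<in> carrier G" and h: "h \<in> H" for y h
  proof -
   have "y \<otimes> h \<otimes> inv y \<otimes> inv h \<in> ?D" unfolding derived_def by (rule generate.incl) (use y Hc[OF h] in blast)
   hence "(y \<otimes> h \<otimes> inv y \<otimes> inv h) \<otimes> h \<in> H" using K_D KH h subgroup.m_closed[OF H] by blast
   thus ?thesis using y Hc[OF h] by (simp add: m_assoc)
  qed
  thus False using n H by (simp add: normal_inv_iff)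
 qed
 hence "K = carrier G" using M Ksub KK(1) unfolding maximal_subgroup_def by blast
 thus ?thesis using x unfolding K by blast
qed

end

section \<open>Fixed vectors and coset sums\<close>

context finite_grp
begin

text \<open>The representative is chosen by a predicate that depends only on the isomorphism class,
  so isomorphic modules receive the same one. It supplies a list for the subgroup \<open>H\<close>,
  since the list of the theorem concerns \<open>G\<close>.\<close>

lemma irr_reps_exists: "\<exists>Irr :: ('a, 'k::field, nat) kgmod set. irr_reps G Irr"
proof -
 define r where "r V = (SOME W :: ('a, 'k, nat) kgmod. irreducible_kgmod G W \<and> kgmod_iso G V W)" for V :: "('a, 'k, nat) kgmod"
 have k: "is_kgmod G V" if "irreducible_kgmod G V" for V :: "('a, 'k, nat) kgmod"
  using that by (simp add: irreducible_kgmod_iff)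
 have r: "irreducible_kgmod G (r V)" "kgmod_iso G V (r V)" if "irreducible_kgmod G V" for V
  using someI[of "\<lambda>W. irreducible_kgmod G W \<and> kgmod_iso G V W" V] that kgmod_iso_refl[OF k[OF that]] unfolding r_def by auto
 have eq: "r V = r V'" if V: "irreducible_kgmod G V" and V': "irreducible_kgmod G V'" and i: "kgmod_iso G V V'" for V V'
 proof -
  have "kgmod_iso G V W \<longleftrightarrow> kgmod_iso G V' W" if W: "irreducible_kgmod G W" for W :: "('a, 'k, nat) kgmod"
   using kgmod_iso_trans[OF k[OF V] k[OF V'] k[OF W] i]
    kgmod_iso_trans[OF k[OF V'] k[OF V] k[OF W] kgmod_iso_sym[OF k[OF V] k[OF V'] i]] by blast
  hence "(\<lambda>W :: ('a, 'k, nat) kgmod. irreducible_kgmod G W \<and> kgmod_iso G V W) = (\<lambda>W. irreducible_kgmod G W \<and> kgmod_iso G V' W)" by (intro ext conj_cong refl)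
  thus ?thesis unfolding r_def by simp
 qed
 have "irr_reps G (r ` {V. irreducible_kgmod G V})" unfolding irr_reps_def
 proof (intro conjI ballI allI impI)
  fix V :: "('a, 'k, nat) kgmod" assume V: "irreducible_kgmod G V"
  show "\<exists>!U. U \<in> r ` {V. irreducible_kgmod G V} \<and> kgmod_iso G V U"
  proof (rule ex1I[of _ "r V"])
   show "r V \<in> r ` {V. irreducible_kgmod G V} \<and> kgmod_iso G V (r V)" using V r by blast
   fix U assume U: "U \<in> r ` {V. irreducible_kgmod G V} \<and> kgmod_iso G V U"
   then obtain V' where V': "irreducible_kgmod G V'" "U = r V'" by blast
   have "kgmod_iso G (r V') V'" by (rule kgmod_iso_sym[OF k[OF V'(1)] k[OF r(1)[OF V'(1)]] r(2)[OF V'(1)]])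
   moreover have "kgmod_iso G V (r V')" using U V'(2) by simp
   ultimately have "kgmod_iso G V V'" using kgmod_iso_trans[OF k[OF V] k[OF r(1)[OF V'(1)]] k[OF V'(1)]] by simp
   thus "U = r V" using eq[OF V V'(1)] V'(2) by simp
  qed
 qed (use r in blast)
 thus ?thesis by blast
qed

text \<open>Elements of the form g - c h test whether g moves a vector to c times its image under h.
  Through them stabilizers and characters are read off from annihilators.\<close>

lemma galg_of_diff_act:
 assumes "g \<in> carrier G" "h \<in> carrier G"
 shows "galg_act G V (galg_of g - fscale c (galg_of h)) v = mod_act V g v - fscale c (mod_act V h v)"
 unfolding galg_act_lin_left galg_act_galg_of[OF assms(1)] galg_act_galg_of[OF assms(2)] ..

lemma galg_of_diff_mem:
 "g \<in> carrier G ==> h \<in> carrier G ==> galg_of g - fscale c (galg_of h) \<in> galg G"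
 by (intro fv.subspace_diff[OF galg_subspace] fv.subspace_scale[OF galg_subspace] galg_of_galg)

lemma sum_galg_of_diff:
 fixes f :: "'a => 'k::field"
 assumes "g \<in> carrier G" "h \<in> carrier G"
 shows "(\<Sum>k\<in>carrier G. (galg_of g - fscale c (galg_of h)) k * f k) = f g - c * f h"
proof -
 have "(\<Sum>k\<in>carrier G. (galg_of g - fscale c (galg_of h)) k * f k) =
   (\<Sum>k\<in>carrier G. (if k = g then f k else 0) - (if k = h then c * f k else 0))"
  by (rule sum.cong) (auto simp: galg_of_def fun_apps algebra_simps)
 thus ?thesis using assms fin_carrier by (simp add: sum_subtractf)
qed

lemma perp_subspace: "fv.subspace (perp G S)"
 unfolding fv.subspace_def
proof (intro conjI ballI allI)
 show "0 \<in> perp G S" using fv.subspace_0[OF galg_subspace] by (simp add: perp_def fun_apps)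
 fix x assume x: "x \<in> perp G S"
 show "x + y \<in> perp G S" if "y \<in> perp G S" for y
  using x that by (auto simp: perp_def fun_apps distrib_right sum.distrib intro: fv.subspace_add[OF galg_subspace])
 show "fscale c x \<in> perp G S" for c
  using x by (auto simp: perp_def fun_apps mult.assoc sum_distrib_left[symmetric] intro: fv.subspace_scale[OF galg_subspace])
qed

end

section \<open>Functions on the left cosets of a subgroup\<close>

context sub_grp
begin

text \<open>The kernel of the map from the group algebra onto the permutation module on the left
  cosets of \<open>H\<close>, in other words the annihilator of the base coset.\<close>

definition coset_ideal :: "('g => 'k::field) set" where
 "coset_ideal = {x \<in> galg G. \<forall>g\<in>carrier G. (\<Sum>h\<in>H. x (g \<otimes> h)) = 0}"

text \<open>Translation by an element of \<open>H\<close> leaves the sum unchanged. Adding up all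
  translates gives |H| times the sum on one side, and on the other the coset sums of
  \<open>x\<close>, which vanish.\<close>

lemma coset_sum_invariant:
 fixes c :: "'g => 'k::field_char_0"
 assumes x: "x \<in> coset_ideal" and c: "!!g h. g \<in> carrier G ==> h \<in> H ==> c (g \<otimes> h) = c g"
 shows "(\<Sum>g\<in>carrier G. x g * c g) = 0"
proof -
 have "(\<Sum>h\<in>H. \<Sum>g\<in>carrier G. x g * c g) = (\<Sum>h\<in>H. \<Sum>g\<in>carrier G. x (g \<otimes> h) * c g)"
 proof (rule sum.cong[OF refl])
  fix h assume h: "h \<in> H"
  show "(\<Sum>g\<in>carrier G. x g * c g) = (\<Sum>g\<in>carrier G. x (g \<otimes> h) * c g)"
   unfolding G_reindex[OF H_sub[OF h], of "\<lambda>g. x g * c g"] by (rule sum.cong) (simp_all add: c h)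
 qed
 also have "\<dots> = (\<Sum>g\<in>carrier G. (\<Sum>h\<in>H. x (g \<otimes> h)) * c g)"
  by (subst sum.swap) (simp add: sum_distrib_right)
 also have "\<dots> = 0" using x by (simp add: coset_ideal_def)
 finally have "of_nat (card H) * (\<Sum>g\<in>carrier G. x g * c g) = 0" by simp
 moreover have "card H ~= 0" using fin_H H_mem(1) by auto
 ultimately show ?thesis by simp
qed

lemma coset_ideal_fixed:
 fixes V :: "('g, 'k::field_char_0, 'i, 'z) kgmod_scheme"
 assumes V: "is_kgmod G V" and u: "u \<in> mod_space V" "!!h. h \<in> H ==> mod_act V h u = u" and x: "x \<in> coset_ideal"
 shows "galg_act G V x u = 0" unfolding galg_act_eq_0_iff coeff_funs_def
 using coset_sum_invariant[OF x] kgmodD(5)[OF V _ H_sub u(1)] u(2) by auto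

lemma coset_ideal_perp:
 "coset_ideal = perp G {c :: 'g => 'k::field_char_0. \<forall>g\<in>carrier G. \<forall>h\<in>H. c (g \<otimes> h) = c g}" (is "_ = perp G ?C")
proof
 show "coset_ideal \<subseteq> perp G ?C"
 proof
  fix x :: "'g => 'k" assume x: "x \<in> coset_ideal"
  hence "x \<in> galg G" by (simp add: coset_ideal_def)
  thus "x \<in> perp G ?C" using coset_sum_invariant[OF x] by (simp add: perp_def)
 qed
 show "perp G ?C \<subseteq> coset_ideal"
 proof
  fix x assume x: "x \<in> perp G ?C"
  have "(\<Sum>h\<in>H. x (g \<otimes> h)) = 0" if g: "g \<in> carrier G" for g
  proof -
   \<comment> \<open>The indicator function of the left coset of \<open>g\<close>; pairing with it
     yields the coset sum.\<close>
   define c :: "'g => 'k" where "c k = (if inv g \<otimes> k \<in> H then 1 else 0)" for k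
   have "inv g \<otimes> (k \<otimes> h) \<in> H \<longleftrightarrow> inv g \<otimes> k \<in> H" if "k \<in> carrier G" "h \<in> H" for k h
   proof -
    have "inv g \<otimes> k = (inv g \<otimes> (k \<otimes> h)) \<otimes> inv h" "inv g \<otimes> (k \<otimes> h) = (inv g \<otimes> k) \<otimes> h"
     using that g H_sub by (simp_all add: m_assoc)
    thus ?thesis using H_mem that(2) by metis
   qed
   hence "c \<in> ?C" by (simp add: c_def)
   hence "0 = (\<Sum>k\<in>carrier G. x k * c k)" using x by (simp add: perp_def)
   also have "\<dots> = (\<Sum>k\<in>(\<lambda>h. g \<otimes> h) ` H. x k * c k)"
   proof (rule sum.mono_neutral_right[OF fin_carrier])
    show "(\<lambda>h. g \<otimes> h) ` H \<subseteq> carrier G" using g H_sub by auto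
    show "\<forall>k\<in>carrier G - (\<lambda>h. g \<otimes> h) ` H. x k * c k = 0"
    proof
     fix k assume k: "k \<in> carrier G - (\<lambda>h. g \<otimes> h) ` H"
     hence "k = g \<otimes> (inv g \<otimes> k)" using g by (simp add: m_assoc[symmetric])
     thus "x k * c k = 0" using k by (auto simp: c_def)
    qed
   qed
   also have "\<dots> = (\<Sum>h\<in>H. x (g \<otimes> h) * c (g \<otimes> h))"
    by (subst sum.reindex) (auto intro: inj_onI simp: g H_sub)
   also have "\<dots> = (\<Sum>h\<in>H. x (g \<otimes> h))"
    by (rule sum.cong) (use g H_sub in \<open>auto simp: c_def m_assoc[symmetric]\<close>)
   finally show ?thesis by simp
  qed
  thus "x \<in> coset_ideal" using x by (auto simp: coset_ideal_def perp_def)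
 qed
qed

lemma coset_ideal_diff:
 assumes "g \<in> carrier G" "h \<in> H" shows "galg_of (g \<otimes> h) - fscale 1 (galg_of g) \<in> (coset_ideal :: ('g => 'k::field_char_0) set)"
 unfolding coset_ideal_perp perp_def
 using assms H_sub by (simp add: sum_galg_of_diff galg_of_diff_mem del: fv.scale_one)

text \<open>On the coset of \<open>g\<close> only \<open>g\<close> itself contributes, as
  \<open>\<one>\<close> lies in another coset. The annihilator of a one-dimensional class contains
  such an element for each \<open>g\<close>, which tells it apart from the coset ideal of a proper
  subgroup.\<close>

lemma coset_ideal_not:
 fixes c :: "'k::field_char_0"
 assumes "g \<in> carrier G" "g \<notin> H" shows "galg_of g - fscale c (galg_of \<one>) \<notin> coset_ideal"
proof
 assume "galg_of g - fscale c (galg_of \<one>) \<in> coset_ideal"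
 hence "(\<Sum>h\<in>H. (galg_of g - fscale c (galg_of \<one>)) (g \<otimes> h)) = 0" using assms(1) by (simp add: coset_ideal_def)
 moreover have "(galg_of g - fscale c (galg_of \<one>)) (g \<otimes> h) = (if h = \<one> then 1 else 0)" if h: "h \<in> H" for h
 proof -
  have "g \<otimes> h = \<one> ==> False" using inv_equality[of h g] assms h H_mem H_sub
   by (metis inv_equality inv_inv)
  moreover have "g \<otimes> h = g \<longleftrightarrow> h = \<one>" using assms(1) H_sub[OF h] by simp
  ultimately show ?thesis by (auto simp: galg_of_def fun_apps)
 qed
 ultimately show False using fin_H H_mem(1) by simp
qed

end

lemma (in glider_ring) unit_glider_generated:
 "lev_0 (unit_glider :: ('g, 'k, nat) glider) = galg_span G (unit_glider :: ('g, 'k, nat) glider) (lev_m1 (unit_glider :: ('g, 'k, nat) glider))"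
proof -
 let ?M = "unit_glider :: ('g, 'k, nat) glider"
 have e: "lev_0 ?M = mod_space ?M" "lev_m1 ?M = mod_space ?M" by (simp_all add: unit_glider_def)
 note K = gliderD(1)[OF line_gliderD(1)[OF unit_glider_line]]
 show ?thesis unfolding e
  using galg_span_base[OF K order_refl] submodD(2)[OF galg_span_submod[OF K order_refl]] by (rule subset_antisym)
qed

lemma (in ind_ring) Ann_unit: "Ann GH (unit_glider :: ('g, 'k, nat) glider) = {x \<in> galg GH. (\<Sum>h\<in>H. x h) = 0}"
proof -
 have "coeff_funs (unit_glider :: ('g, 'k, nat) glider) (\<lambda>i. if i = 0 then 1 else 0) = {\<lambda>g. 1, \<lambda>g. 0}"
  by (auto simp: coeff_funs_def unit_glider_def image_iff)
 thus ?thesis unfolding sub.Ann_perp[OF rH.unit_glider_line] by (simp add: perp_def)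
qed

text \<open>Inducing the trivial glider gives the permutation module with its base coset as
  generator. That \<open>H\<close> fixes the generator is read off from the elements h - 1 in the
  annihilator.\<close>

lemma (in ind_ring) induced_unit:
 obtains Y :: "('g, 'k, nat) glider" and y where "Y \<in> nat_gliders G" "induced_glider G H unit_glider Y"
  "line_glider G Y y" "Ann G Y = coset_ideal" "!!h. h \<in> H ==> mod_act Y h y = y"
proof -
 let ?M = "unit_glider :: ('g, 'k, nat) glider"
 note L = rH.unit_glider_line
 note sp = rH.unit_glider_generated
 note gM = sub.line_gliderD(1)[OF L]
 obtain Y :: "('g, 'k, nat) glider" where Y: "Y \<in> nat_gliders G" "induced_glider G H ?M Y"
  using induced_exists[OF gM sp L] by blast
 obtain y where y: "line_glider G Y y" using induced_line(1)[OF gM sp L Y(2)] by blast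
 have A: "Ann G Y = coset_ideal" unfolding induced_line(2)[OF gM sp L Y(2)] Ann_unit ind_Ann_def coset_ideal_def
  by (auto simp: res_right_galg) (simp_all add: res_right_def)
 have hfix: "mod_act Y h y = y" if h: "h \<in> H" for h
 proof -
  note K = gliderD(1)[OF line_gliderD(1)[OF y]]
  have "galg_of (\<one> \<otimes> h) - fscale 1 (galg_of \<one>) \<in> Ann G Y" unfolding A by (rule coset_ideal_diff[OF one_closed h])
  hence "galg_act G Y (galg_of h - fscale 1 (galg_of \<one>)) y = 0" using h H_sub unfolding Ann_line[OF y] by simp
  thus ?thesis using h H_sub kgmodD(4)[OF K line_gliderD(5)[OF y]] by (simp add: galg_of_diff_act[of h \<one> _ 1, simplified])
 qed
 show ?thesis by (rule that[OF Y y A hfix])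
qed

section \<open>The parametrized gliders\<close>

lemma ball_param_index:
 "(\<forall>s\<in>param_index A B. P s) \<longleftrightarrow> (\<forall>z\<in>A. P (Inl z)) \<and> (\<forall>(U, W)\<in>B. \<forall>j<fv.dim W. P (Inr (U, j)))"
 unfolding param_index_def ball_Un ball_simps by (rule arg_cong2[where f="(\<and>)"]) blast+

context param
begin

lemma T_line:
 assumes "z \<in> carrier (Gab G)" obtains t where "t ~= 0" "mod_space (T z) = fv.span {t}" "t \<in> mod_space (T z)"
proof -
 obtain t where "t \<in> mod_space (T z)" "t ~= 0" using dim_pos_nonzero[of "mod_space (T z)"] T_dim[OF assms] by auto
 thus ?thesis using that dim_1_line[OF kgmodD(1)[OF T_kgmod[OF assms]] T_dim[OF assms]] by blast
qed

text \<open>The annihilator of the parametrized glider, expressed without the chosen vector: killing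
  the components in the copies of \<open>U\<close> is the same as killing the subspace they
  span.\<close>

definition param_ideal :: "'g set set => (('g, 'k, nat) kgmod \<times> (nat => 'k) set) set => ('g => 'k) set" where
 "param_ideal A B = {x \<in> galg G. (\<forall>z\<in>A. \<forall>t\<in>mod_space (T z). galg_act G (T z) x t = 0) \<and>
   (\<forall>(U, W)\<in>B. \<forall>w\<in>W. galg_act G U x w = 0)}"

context
 fixes A B assumes A: "A \<subseteq> carrier (Gab G)" and B: "B \<in> SG Irr" and ne: "\<not> (A = {} \<and> B = {})"
begin

abbreviation "pv \<equiv> SOME v. param_vector T A B v"

lemma pv: "param_vector T A B pv" by (rule someI_ex[OF param_vector_exists[OF A B]])

lemma pv_nonzero: "pv ~= 0"
proof
 assume z: "pv = 0"
 consider z where "z \<in> A" | U W where "(U, W) \<in> B" using ne by fastforce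
 thus False
 proof cases
  case 1
  have "slice (Inl z) pv ~= 0" using pv 1 unfolding param_vector_def by blast
  thus False unfolding z by (simp add: comp_lin)
 next
  case 2
  have "fv.independent ((\<lambda>j. slice (Inr (U, j)) pv) ` {..<fv.dim W})" using pv 2 unfolding param_vector_def Let_def by fastforce
  moreover have "(0::nat) < fv.dim W" using SGD(5)[OF B 2] by simp
  hence "slice (Inr (U, 0)) pv \<in> (\<lambda>j. slice (Inr (U, j)) pv) ` {..<fv.dim W}" by blast
  moreover have "slice (Inr (U, 0)) pv = 0" unfolding z by (simp add: comp_lin)
  ultimately show False using fv.dependent_zero by metis
 qed
qed

lemma param_line: "line_glider G (param_glider T A B) pv"
proof -
 have m: "pv \<in> mod_space (param_module T A B)" using pv unfolding param_vector_def by blast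
 have "is_glider G (param_glider T A B)"
 proof (rule is_gliderI)
  have K: "is_kgmod G (param_module T A B)" by (rule param_kgmod[OF A B])
  show K': "is_kgmod G (param_glider T A B)" using K by (simp add: is_kgmod_def param_glider_def)
  show "fv.subspace (lev_m1 (param_glider T A B))" by (simp add: param_glider_def)
  show "fin_dim (lev_0 (param_glider T A B))" using param_fin_dim[OF A B] by (simp add: param_glider_def)
  show "lev_m1 (param_glider T A B) \<subseteq> lev_0 (param_glider T A B)"
   using m fv.span_minimal[of "{pv}", OF _ kgmodD(1)[OF K]] by (simp add: param_glider_def)
  show "lev_0 (param_glider T A B) \<subseteq> mod_space (param_glider T A B)" by (simp add: param_glider_def)
  thus "mod_act (param_glider T A B) g v \<in> lev_0 (param_glider T A B)" if "g \<in> carrier G" "v \<in> lev_m1 (param_glider T A B)" for g v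
   using kgmodD(2)[OF K', of g v] that \<open>lev_m1 (param_glider T A B) \<subseteq> lev_0 (param_glider T A B)\<close> by (auto simp: param_glider_def)
 qed
 thus ?thesis using pv_nonzero by (simp add: line_glider_def param_glider_def)
qed

lemma pv_slice: "s \<in> param_index A B ==> slice s pv \<in> mod_space (case_sum T fst s)"
 using pv unfolding param_vector_def param_module_def in_dsum_family by blast

lemma pv_T:
 assumes z: "z \<in> A"
 shows "galg_act G (T z) x (slice (Inl z) pv) = 0 \<longleftrightarrow> (\<forall>t\<in>mod_space (T z). galg_act G (T z) x t = 0)"
proof -
 have zc: "z \<in> carrier (Gab G)" using z A by blast
 have s: "slice (Inl z) pv \<in> mod_space (T z)" using pv_slice[of "Inl z"] z by (simp add: param_index_def)
 have s0: "slice (Inl z) pv ~= 0" using pv z unfolding param_vector_def by blast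
 have sp: "mod_space (T z) = fv.span {slice (Inl z) pv}"
  by (rule dim_1_line[OF kgmodD(1)[OF T_kgmod[OF zc]] T_dim[OF zc] s s0])
 have "galg_act G (T z) x t = 0" if t: "t \<in> mod_space (T z)" and e: "galg_act G (T z) x (slice (Inl z) pv) = 0" for t
 proof -
  obtain c where "t = fscale c (slice (Inl z) pv)" using t unfolding sp by (auto simp: fv.span_singleton)
  thus ?thesis using e lin_on_scale[OF galg_act_lin_on[OF T_kgmod[OF zc]] s, of x c] by simp
 qed
 thus ?thesis using s by blast
qed

lemma pv_W:
 assumes UW: "(U, W) \<in> B"
 shows "(\<forall>j<fv.dim W. galg_act G U x (slice (Inr (U, j)) pv) = 0) \<longleftrightarrow> (\<forall>w\<in>W. galg_act G U x w = 0)"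
proof -
 have KU: "is_kgmod G U" by (rule Irr_kgmod[OF SGD(1)[OF B UW]])
 have sp: "W = fv.span ((\<lambda>j. slice (Inr (U, j)) pv) ` {..<fv.dim W})" using pv UW unfolding param_vector_def Let_def by fastforce
 have "w \<in> {u \<in> mod_space U. galg_act G U x u = 0}"
  if e: "!!j. j < fv.dim W ==> galg_act G U x (slice (Inr (U, j)) pv) = 0" and w: "w \<in> W" for w
 proof -
  have "fv.span ((\<lambda>j. slice (Inr (U, j)) pv) ` {..<fv.dim W}) \<subseteq> {u \<in> mod_space U. galg_act G U x u = 0}"
  proof (rule fv.span_minimal[OF _ lin_on_kernel[OF kgmodD(1)[OF KU] galg_act_lin_on[OF KU]]], rule image_subsetI)
   fix j assume j: "j \<in> {..<fv.dim W}"
   hence "Inr (U, j) \<in> param_index A B" using UW unfolding param_index_def by blast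
   thus "slice (Inr (U, j)) pv \<in> {u \<in> mod_space U. galg_act G U x u = 0}" using pv_slice e j by fastforce
  qed
  thus ?thesis using w sp by blast
 qed
 moreover have "slice (Inr (U, j)) pv \<in> W" if "j < fv.dim W" for j
  using sp fv.span_base[of "slice (Inr (U, j)) pv" "(\<lambda>j. slice (Inr (U, j)) pv) ` {..<fv.dim W}"] that by blast
 ultimately show ?thesis by blast
qed

lemma param_Ann: "Ann G (param_glider T A B) = param_ideal A B"
proof -
 let ?D = "dsum_family (param_index A B) (case_sum T fst)"
 have act: "galg_act G (param_glider T A B) x v = galg_act G ?D x v" for x v
  by (simp add: galg_act_def param_glider_def param_module_def)
 have 0: "galg_act G ?D x pv = 0 \<longleftrightarrow> (\<forall>s\<in>param_index A B. galg_act G (case_sum T fst s) x (slice s pv) = 0)" for x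
 proof
  assume z: "galg_act G ?D x pv = 0"
  show "\<forall>s\<in>param_index A B. galg_act G (case_sum T fst s) x (slice s pv) = 0"
  proof
   fix s assume "s \<in> param_index A B"
   thus "galg_act G (case_sum T fst s) x (slice s pv) = 0"
    using galg_act_dsum[of s "param_index A B" "case_sum T fst" x pv] unfolding z comp_lin(3) by simp
  qed
 next
  assume z: "\<forall>s\<in>param_index A B. galg_act G (case_sum T fst s) x (slice s pv) = 0"
  show "galg_act G ?D x pv = 0"
  proof (rule comp_eqI)
   fix s show "slice s (galg_act G ?D x pv) = slice s 0"
   proof (cases "s \<in> param_index A B")
    case True
    show ?thesis unfolding galg_act_dsum[OF True] comp_lin(3) using z True by blast
   next
    case False
    show ?thesis unfolding galg_act_dsum_outside[OF False] comp_lin(3) ..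
   qed
  qed
 qed
 have "(\<forall>s\<in>param_index A B. galg_act G (case_sum T fst s) x (slice s pv) = 0) \<longleftrightarrow>
   (\<forall>z\<in>A. galg_act G (T z) x (slice (Inl z) pv) = 0) \<and>
   (\<forall>(U, W)\<in>B. \<forall>j<fv.dim W. galg_act G U x (slice (Inr (U, j)) pv) = 0)" for x
  unfolding ball_param_index by simp
 thus ?thesis unfolding Ann_line[OF param_line] act 0 param_ideal_def using pv_T pv_W by (auto; blast)
qed

end

end

section \<open>One-dimensional modules\<close>

lemma (in finite_grp) nat_iso_T:
 fixes T :: "'a set => ('a, 'k::field, nat) kgmod" and V :: "('a, 'k, 'i) kgmod"
 assumes T: "ab_param G T" and V: "is_kgmod G V" "fv.dim (mod_space V) = 1"
 obtains z f where "z \<in> carrier (Gab G)" "kg_hom G V (T z) f" "bij_betw f (mod_space V) (mod_space (T z))"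
proof -
 have fd: "fin_dim (mod_space V)" by (rule dim_pos_fin_dim[OF kgmodD(1)[OF V(1)]]) (simp add: V(2))
 obtain W :: "('a, 'k, nat) kgmod" and F where W: "is_kgmod G W" "kg_hom G V W F" "bij_betw F (mod_space V) (mod_space W)"
  using nat_kgmod_exists[OF V(1) fd] by blast
 have "fv.dim (mod_space W) = 1" using kgmod_iso_dim[OF V(1) kgmod_isoI[OF V(1) W]] V(2) by simp
 then obtain z where z: "z \<in> carrier (Gab G)" "kgmod_iso G W (T z)" using T W(1) unfolding ab_param_def by blast
 have Tz: "is_kgmod G (T z)" using T z(1) unfolding ab_param_def by blast
 obtain h where h: "kg_hom G W (T z) h" "bij_betw h (mod_space W) (mod_space (T z))"
  using z(2) kgmod_iso_hom[OF W(1) Tz] by blast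
 have "bij_betw (\<lambda>x. h (F x)) (mod_space V) (mod_space (T z))"
  using bij_betw_trans[OF W(3) h(2)] by (simp add: o_def)
 thus ?thesis using that[OF z(1) kg_hom_comp[OF W(2) h(1)]] by blast
qed

context param
begin

lemma Gab_group: "group (Gab G)"
 unfolding Gab_def by (rule normal.factorgroup_is_group[OF derived_self_is_normal])

lemma T_scalar:
 assumes z: "z \<in> carrier (Gab G)" and g: "g \<in> carrier G"
 obtains c where "c ~= 0" "!!t. t \<in> mod_space (T z) ==> mod_act (T z) g t = fscale c t"
proof -
 obtain t where t: "t ~= 0" "mod_space (T z) = fv.span {t}" "t \<in> mod_space (T z)" by (rule T_line[OF z])
 note K = T_kgmod[OF z]
 have "mod_act (T z) g t \<in> fv.span {t}" using kgmodD(2)[OF K g t(3)] t(2) by simp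
 then obtain c where c: "mod_act (T z) g t = fscale c t" by (auto simp: fv.span_singleton)
 have "c ~= 0"
 proof
  assume "c = 0"
  hence "mod_act (T z) g t = 0" using c by simp
  thus False using act_inv(1)[OF K g t(3)] act_zero[OF K inv_closed[OF g]] t(1) by simp
 qed
 moreover have "mod_act (T z) g s = fscale c s" if s: "s \<in> mod_space (T z)" for s
 proof -
  obtain d where d: "s = fscale d t" using s unfolding t(2) by (auto simp: fv.span_singleton)
  show ?thesis unfolding d lin_on_scale[OF kgmodD(3)[OF K g] t(3)] c by (simp add: mult.commute)
 qed
 ultimately show ?thesis using that by blast
qed

text \<open>The unit of \<open>Gab G\<close> is its own square, so its module is isomorphic to its
  tensor square. The scalar \<open>c\<close> by which \<open>g\<close> acts is thus nonzero with
  \<open>c = c * c\<close>.\<close>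

lemma T_one:
 assumes g: "g \<in> carrier G" and t: "t \<in> mod_space (T \<one>\<^bsub>Gab G\<^esub>)"
 shows "mod_act (T \<one>\<^bsub>Gab G\<^esub>) g t = t"
proof -
 interpret A: group "Gab G" by (rule Gab_group)
 let ?T = "T \<one>\<^bsub>Gab G\<^esub>"
 obtain s where s: "s ~= 0" "mod_space ?T = fv.span {s}" "s \<in> mod_space ?T" by (rule T_line[OF A.one_closed])
 obtain c where c: "c ~= 0" "!!t. t \<in> mod_space ?T ==> mod_act ?T g t = fscale c t" by (rule T_scalar[OF A.one_closed g]) blast
 note K = T_kgmod[OF A.one_closed]
 have sp: "mod_space (tensor_kgmod ?T ?T) = fv.span {tens s s}"
  unfolding tensor_kgmod_def kgmod.select_convs s(2) tens_space_span by (rule arg_cong[where f=fv.span]) auto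
 have "kgmod_iso G ?T (tensor_kgmod ?T ?T)"
  using T A.one_closed A.l_one[OF A.one_closed] unfolding ab_param_def by metis
 then obtain f where f: "bij_betw f (mod_space ?T) (mod_space (tensor_kgmod ?T ?T))" "lin_on (mod_space ?T) f"
  "!!x v. x \<in> galg G ==> v \<in> mod_space ?T ==> f (galg_act G ?T x v) = galg_act G (tensor_kgmod ?T ?T) x (f v)"
  unfolding kgmod_iso_def by blast
 have "f s \<in> fv.span {tens s s}" using f(1) s(3) sp by (auto simp: bij_betw_def)
 then obtain d where d: "f s = fscale d (tens s s)" by (auto simp: fv.span_singleton)
 have fs0: "f s ~= 0" using lin_on_inj_iff[OF kgmodD(1)[OF K] f(2)] f(1) s(1,3) unfolding bij_betw_def by blast
 have e: "mod_act (tensor_kgmod ?T ?T) g (fscale d (tens s s)) = fscale (c * c) (fscale d (tens s s))"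
 proof -
  have "fscale d (tens s s) = tens (fscale d s) s" by (simp add: tens_lin)
  moreover have "fscale d s \<in> mod_space ?T" by (rule fv.subspace_scale[OF kgmodD(1)[OF K] s(3)])
  moreover have "mod_act (tensor_kgmod ?T ?T) g = tmap (mod_act ?T g) (mod_act ?T g)"
   by (simp add: tensor_kgmod_def tens_map_eq_tmap)
  ultimately show ?thesis
   using c(2) s(3) tmap_tens[OF kgmodD(3)[OF K g] kgmodD(3)[OF K g], of "fscale d s" s] by (simp add: tens_lin mult_ac)
 qed
 have "fscale c (f s) = f (galg_act G ?T (galg_of g) s)"
  unfolding galg_act_galg_of[OF g] c(2)[OF s(3)] by (simp add: lin_on_scale[OF f(2) s(3)])
 also have "\<dots> = fscale (c * c) (f s)"
  by (subst f(3)[OF galg_of_galg[OF g] s(3)]) (simp only: galg_act_galg_of[OF g] d e)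
 finally have "c = c * c" using fs0 fv.scale_right_imp_eq by blast
 hence "c = 1" using c(1) by simp
 thus ?thesis using c(2)[OF t] by simp
qed

lemma T_trivial_unique:
 assumes z: "z \<in> carrier (Gab G)" and act: "!!g t. g \<in> carrier G ==> t \<in> mod_space (T z) ==> mod_act (T z) g t = t"
 shows "z = \<one>\<^bsub>Gab G\<^esub>"
proof -
 interpret A: group "Gab G" by (rule Gab_group)
 obtain t where t: "t ~= 0" "mod_space (T z) = fv.span {t}" "t \<in> mod_space (T z)" by (rule T_line[OF z])
 obtain s where s: "s ~= 0" "mod_space (T \<one>\<^bsub>Gab G\<^esub>) = fv.span {s}" "s \<in> mod_space (T \<one>\<^bsub>Gab G\<^esub>)" by (rule T_line[OF A.one_closed])
 obtain F where F: "flin F" "F t = s"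
 proof -
  have "\<exists>F. flin F \<and> (\<forall>v\<in>{t}. F v = (\<lambda>_. s) v)"
   by (rule fvp.linear_independent_extend) (use t(1) in simp)
  thus ?thesis using that by blast
 qed
 have "kg_hom G (T z) (T \<one>\<^bsub>Gab G\<^esub>) F"
 proof (rule kg_homI[OF flin_lin_on[OF F(1)]])
  show *: "F v \<in> mod_space (T \<one>\<^bsub>Gab G\<^esub>)" if "v \<in> mod_space (T z)" for v
   using that unfolding t(2) s(2) by (auto simp: fv.span_singleton flin_scale[OF F(1)] F(2))
  show "F (mod_act (T z) g v) = mod_act (T \<one>\<^bsub>Gab G\<^esub>) g (F v)" if "g \<in> carrier G" "v \<in> mod_space (T z)" for g v
   using act[OF that] T_one[OF that(1) *[OF that(2)]] by simp
 qed
 hence "kgmod_iso G (T z) (T \<one>\<^bsub>Gab G\<^esub>)"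
  using irreducible_hom_iso[OF T_irr[OF z] T_irr[OF A.one_closed] _ t(3)] F(2) s(1) by simp
 thus ?thesis by (rule T_iso_eq[OF z A.one_closed])
qed

lemma ab_elt_trivial: "ab_elt G T trivial_kgmod = \<one>\<^bsub>Gab G\<^esub>"
proof -
 interpret A: group "Gab G" by (rule Gab_group)
 let ?V = "trivial_kgmod :: ('g, 'k, nat) kgmod"
 let ?e = "\<lambda>i::nat. if i = 0 then 1 else 0 :: 'k"
 have sp: "(unit_line :: (nat => 'k) set) = fv.span {?e}"
  by (auto simp: unit_line_def fv.span_singleton fun_eq_iff fscale_apply image_iff intro: exI[of _ "_ 0"])
 have V: "is_kgmod G ?V" "fv.dim (mod_space ?V) = 1"
 proof -
  have "?e ~= 0" by (auto simp: fun_eq_iff fun_apps)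
  thus "fv.dim (mod_space ?V) = 1" unfolding trivial_kgmod_def kgmod.select_convs sp by (rule dim_line)
  show "is_kgmod G ?V" unfolding is_kgmod_def trivial_kgmod_def kgmod.select_convs
   using sp fv.subspace_span[of "{?e}"] flin_lin_on[OF flin_id] by auto
 qed
 obtain z f where z: "z \<in> carrier (Gab G)" "kg_hom G ?V (T z) f" "bij_betw f (mod_space ?V) (mod_space (T z))"
  by (rule nat_iso_T[OF T V])
 have act: "mod_act (T z) g t = t" if g: "g \<in> carrier G" and t: "t \<in> mod_space (T z)" for g t
 proof -
  obtain v where v: "v \<in> mod_space ?V" "t = f v" using z(3) t by (auto simp: bij_betw_def)
  show ?thesis using kg_homD(3)[OF z(2) g v(1)] v(2) by (simp add: trivial_kgmod_def)
 qed
 have z1: "z = \<one>\<^bsub>Gab G\<^esub>" by (rule T_trivial_unique[OF z(1) act])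
 have "kgmod_iso G ?V (T z)" by (rule kgmod_isoI[OF V(1) T_kgmod[OF z(1)] z(2,3)])
 moreover have "\<exists>!z. z \<in> carrier (Gab G) \<and> kgmod_iso G ?V (T z)" using T V unfolding ab_param_def by blast
 ultimately show ?thesis unfolding ab_elt_def using z(1) z1 by (intro the1_equality) auto
qed

text \<open>Carries a one-dimensional module over any index type into the parametrization, along
  with the information which group elements act trivially on it.\<close>

lemma one_dim_param_ideal:
 assumes V: "is_kgmod G (V :: ('g, 'k, 'i) kgmod)" and v: "v ~= 0" "mod_space V = fv.span {v}"
 obtains z where "z \<in> carrier (Gab G)" "param_ideal {z} {} = {x \<in> galg G. galg_act G V x v = 0}"
  "!!g t. g \<in> carrier G ==> mod_act V g v = v ==> t \<in> mod_space (T z) ==> mod_act (T z) g t = t"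
  "!!g t. g \<in> carrier G ==> mod_act V g v ~= v ==> t \<in> mod_space (T z) ==> t ~= 0 ==> mod_act (T z) g t ~= t"
proof -
 have d: "fv.dim (mod_space V) = 1" unfolding v(2) by (rule dim_line[OF v(1)])
 have vV: "v \<in> mod_space V" unfolding v(2) by (simp add: fv.span_base)
 obtain z f where z: "z \<in> carrier (Gab G)" "kg_hom G V (T z) f" "bij_betw f (mod_space V) (mod_space (T z))"
  by (rule nat_iso_T[OF T V d])
 note K = T_kgmod[OF z(1)]
 have f0: "f w = 0 \<longleftrightarrow> w = 0" if "w \<in> mod_space V" for w
  using lin_on_inj_iff[OF kgmodD(1)[OF V] kg_homD(1)[OF z(2)]] z(3) that
   lin_on_0[OF kg_homD(1)[OF z(2)] fv.subspace_0[OF kgmodD(1)[OF V]]] unfolding bij_betw_def by blast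
 have ex: "\<exists>c. t = fscale c (f v)" if t: "t \<in> mod_space (T z)" for t
 proof -
  obtain w where w: "w \<in> mod_space V" "t = f w" using z(3) t by (auto simp: bij_betw_def)
  then obtain c where "w = fscale c v" unfolding v(2) by (auto simp: fv.span_singleton)
  thus ?thesis using w(2) lin_on_scale[OF kg_homD(1)[OF z(2)] vV, of c] by auto
 qed
 have ff: "f v \<in> mod_space (T z)" by (rule kg_homD(2)[OF z(2) vV])
 have act: "galg_act G (T z) x (fscale c (f v)) = fscale c (f (galg_act G V x v))" for x c
  unfolding lin_on_scale[OF galg_act_lin_on[OF K] ff] kg_hom_galg_act[OF V K z(2) vV] ..
 have act': "mod_act (T z) g (fscale c (f v)) = fscale c (f (mod_act V g v))" if "g \<in> carrier G" for g c
  using act[of "galg_of g" c] by (simp add: galg_act_galg_of[OF that])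
 have inj: "f (mod_act V g v) = f v ==> mod_act V g v = v" if "g \<in> carrier G" for g
  using z(3) kgmodD(2)[OF V that vV] vV unfolding bij_betw_def by (meson inj_onD)
 show ?thesis
 proof (rule that[OF z(1)])
  have "(\<forall>t\<in>mod_space (T z). galg_act G (T z) x t = 0) \<longleftrightarrow> galg_act G V x v = 0" for x
  proof
   assume "\<forall>t\<in>mod_space (T z). galg_act G (T z) x t = 0"
   hence "galg_act G (T z) x (fscale 1 (f v)) = 0" using ff by simp
   thus "galg_act G V x v = 0" unfolding act using f0[OF galg_act_closed[OF V vV]] by simp
  next
   assume e: "galg_act G V x v = 0"
   show "\<forall>t\<in>mod_space (T z). galg_act G (T z) x t = 0"
   proof
    fix t assume "t \<in> mod_space (T z)"
    then obtain c where c: "t = fscale c (f v)" using ex by blast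
    show "galg_act G (T z) x t = 0" unfolding c act e using f0[OF fv.subspace_0[OF kgmodD(1)[OF V]]] by simp
   qed
  qed
  thus "param_ideal {z} {} = {x \<in> galg G. galg_act G V x v = 0}" by (simp add: param_ideal_def)
 next
  fix g t assume g: "g \<in> carrier G" and t: "t \<in> mod_space (T z)"
  obtain c where c: "t = fscale c (f v)" using ex[OF t] by blast
  show "mod_act (T z) g t = t" if "mod_act V g v = v" unfolding c act'[OF g] that ..
  assume n: "mod_act V g v ~= v" and t0: "t ~= 0"
  have "c ~= 0" using t0 c by auto
  thus "mod_act (T z) g t ~= t" unfolding c act'[OF g] using n inj[OF g] fv.scale_left_imp_eq by blast
 qed
qed

end

section \<open>Powers and idempotents\<close>

text \<open>Finiteness makes the powers periodic from some exponent \<open>i\<close> on, and an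
  exponent that is at least \<open>i\<close> and a multiple of the period gives an idempotent. Two
  idempotent powers both coincide with the power whose exponent is the product of theirs.\<close>

lemma finite_powers_idempotent:
 fixes a :: "nat => 'q"
 assumes add: "!!m n. a (m + n) = f (a m) (a n)" and fin: "finite {a n |n. n \<ge> 1}"
 shows "\<exists>!y. y \<in> {a n |n. n \<ge> 1} \<and> f y y = y"
proof -
 have uniq: "a m = a n" if m: "m \<ge> 1" "f (a m) (a m) = a m" and n: "n \<ge> 1" "f (a n) (a n) = a n" for m n
 proof -
  have mult: "a (k * Suc j) = a k" if "f (a k) (a k) = a k" for k j using that by (induct j) (simp_all add: add)
  obtain i j where "m = Suc i" "n = Suc j" using m(1) n(1) by (metis Suc_le_D One_nat_def)
  thus ?thesis using mult[OF m(2), of j] mult[OF n(2), of i] by (simp only: mult.commute)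
 qed
 have "\<not> inj_on a {1..}"
 proof
  assume "inj_on a {1..}"
  moreover have "a ` {1..} = {a n |n. n \<ge> 1}" by auto
  ultimately show False using fin finite_imageD infinite_Ici by metis
 qed
 then obtain i j where ij: "i < j" "a i = a j" "i \<ge> 1" unfolding inj_on_def by (metis atLeast_iff linorder_neqE_nat)
 define p where "p = j - i"
 have p: "j = i + p" "p \<ge> 1" using ij(1) by (auto simp: p_def)
 have per: "a (n + p) = a n" if n: "n \<ge> i" for n
 proof -
  obtain k where k: "n = k + i" using n by (metis le_add_diff_inverse2)
  have "a (n + p) = f (a k) (a j)" unfolding k add[symmetric] p(1) by (simp add: add.assoc)
  thus ?thesis using ij(2) by (simp add: k add)
 qed
 have per': "a (n + q * p) = a n" if "n \<ge> i" for n q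
 proof (induct q)
  case (Suc q)
  have "a (n + Suc q * p) = a ((n + q * p) + p)" by (simp add: ac_simps)
  thus ?case using per[of "n + q * p"] that Suc by simp
 qed simp
 have ip: "i * p \<ge> i" "i * p \<ge> 1" using p(2) ij(3) by auto
 have "f (a (i * p)) (a (i * p)) = a (i * p)" using per'[OF ip(1), of i] by (simp add: add)
 thus ?thesis using ip(2) uniq by blast
qed

text \<open>Products of \<open>n\<close> functions from \<open>S\<close>. The empty product is the
  constant 1, matching the unit glider as power 0.\<close>

primrec pset :: "('g => 'k::field) set => nat => ('g => 'k) set" where
 "pset S 0 = {\<lambda>_. 1}"
| "pset S (Suc n) = prod_set (pset S n) S"

lemma prod_set_assoc: "prod_set (prod_set A B) C = prod_set A (prod_set B C)"
proof
 show "prod_set (prod_set A B) C \<subseteq> prod_set A (prod_set B C)"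
 proof
  fix f assume "f \<in> prod_set (prod_set A B) C"
  then obtain a b c where "a \<in> A" "b \<in> B" "c \<in> C" "f = (\<lambda>g. (a g * b g) * c g)" unfolding prod_set_def by fastforce
  thus "f \<in> prod_set A (prod_set B C)"
   unfolding prod_set_def mem_Collect_eq by (intro exI[of _ a] exI[of _ "\<lambda>g. b g * c g"]) (auto simp: mult.assoc)
 qed
 show "prod_set A (prod_set B C) \<subseteq> prod_set (prod_set A B) C"
 proof
  fix f assume "f \<in> prod_set A (prod_set B C)"
  then obtain a b c where "a \<in> A" "b \<in> B" "c \<in> C" "f = (\<lambda>g. a g * (b g * c g))" unfolding prod_set_def by fastforce
  thus "f \<in> prod_set (prod_set A B) C"
   unfolding prod_set_def mem_Collect_eq by (intro exI[of _ "\<lambda>g. a g * b g"] exI[of _ c]) (auto simp: mult.assoc)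
 qed
qed

lemma prod_set_one: "prod_set A {\<lambda>_. 1} = A" "prod_set {\<lambda>_. 1} A = A"
 by (auto simp: prod_set_def)

lemma pset_add: "prod_set (pset S m) (pset S n) = pset S (m + n)"
 by (induct n) (simp_all add: prod_set_one prod_set_assoc[symmetric])

context glider_ring
begin

text \<open>Iterated tensor products change the index type at each step; replacing each by a model
  over \<open>nat\<close> keeps the induction within one type.\<close>

lemma qclass_power_model:
 fixes M :: "('g, 'k, 'i) glider"
 assumes M: "line_glider G M u"
 shows "\<exists>(P :: ('g, 'k, nat) glider) p. line_glider G P p \<and> qclass G M [^]\<^bsub>QG\<^esub> (n::nat) = qclass G P \<and>
  Ann G P = perp G (pset (coeff_funs M u) n)"
proof (induct n)
 case 0
 have "coeff_funs (unit_glider :: ('g, 'k, nat) glider) (\<lambda>i. if i = 0 then 1 else 0) = {\<lambda>g. 1, \<lambda>g. 0}"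
  by (auto simp: coeff_funs_def unit_glider_def image_iff)
 hence "Ann G (unit_glider :: ('g, 'k, nat) glider) = perp G {\<lambda>_. 1}"
  unfolding Ann_perp[OF unit_glider_line] by (simp add: perp_def)
 thus ?case using unit_glider_line QG_one by (auto simp: nat_pow_def)
next
 case (Suc n)
 obtain P :: "('g, 'k, nat) glider" and p where P: "line_glider G P p" "qclass G M [^]\<^bsub>QG\<^esub> n = qclass G P"
  "Ann G P = perp G (pset (coeff_funs M u) n)" using Suc by blast
 note t = tensor_line[OF P(1) M]
 obtain Q :: "('g, 'k, nat) glider" and q where Q: "line_glider G Q q" "Ann G Q = Ann G (tensor_glider P M)"
  "qclass G Q = qclass G (tensor_glider P M)" by (rule nat_line_model[OF t(1)])
 have "qclass G M [^]\<^bsub>QG\<^esub> Suc n = qclass G Q"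
  using P(2) Q(3) qclass_mult[OF P(1) M] by (simp add: nat_pow_def)
 moreover have "Ann G Q = perp G (pset (coeff_funs M u) (Suc n))"
  unfolding Q(2) t(2) pset.simps by (rule perp_prod_set[OF _ refl]) (simp only: P(3) Ann_perp[OF P(1), symmetric])
 ultimately show ?case using Q(1) by blast
qed

lemma qclass_mult_model:
 fixes M :: "('g, 'k, 'i) glider" and N :: "('g, 'k, 'j) glider" and P :: "('g, 'k, 'l) glider"
 assumes M: "line_glider G M u" "Ann G M = perp G S" and N: "line_glider G N v" "Ann G N = perp G R"
  and P: "line_glider G P p"
 shows "qclass G M \<otimes>\<^bsub>QG\<^esub> qclass G N = qclass G P \<longleftrightarrow> Ann G P = perp G (prod_set S R)"
proof -
 note t = tensor_line[OF M(1) N(1)]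
 have "Ann G (tensor_glider M N) = perp G (prod_set S R)"
  unfolding t(2) by (rule perp_prod_set) (simp_all only: M(2) N(2) Ann_perp[OF M(1), symmetric] Ann_perp[OF N(1), symmetric])
 thus ?thesis unfolding qclass_mult[OF M(1) N(1)] qclass_eq_iff[OF t(1) P] by auto
qed

text \<open>The rational glider ring is handled as a bilinear algebra, without an associative law
  for its product. The power law is read off from associativity of products of sets of functions
  instead.\<close>

lemma qclass_power_add:
 fixes M :: "('g, 'k, 'i) glider"
 assumes M: "line_glider G M u"
 shows "qclass G M [^]\<^bsub>QG\<^esub> (m + n :: nat) = qclass G M [^]\<^bsub>QG\<^esub> m \<otimes>\<^bsub>QG\<^esub> qclass G M [^]\<^bsub>QG\<^esub> n"
proof -
 let ?C = "coeff_funs M u"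
 obtain P :: "('g, 'k, nat) glider" and p where P: "line_glider G P p" "qclass G M [^]\<^bsub>QG\<^esub> m = qclass G P"
  "Ann G P = perp G (pset ?C m)" using qclass_power_model[OF M] by blast
 obtain Q :: "('g, 'k, nat) glider" and q where Q: "line_glider G Q q" "qclass G M [^]\<^bsub>QG\<^esub> n = qclass G Q"
  "Ann G Q = perp G (pset ?C n)" using qclass_power_model[OF M] by blast
 obtain R :: "('g, 'k, nat) glider" and r where R: "line_glider G R r" "qclass G M [^]\<^bsub>QG\<^esub> (m + n) = qclass G R"
  "Ann G R = perp G (pset ?C (m + n))" using qclass_power_model[OF M] by blast
 show ?thesis unfolding P(2) Q(2) R(2) using qclass_mult_model[OF P(1,3) Q(1,3) R(1)] R(3) pset_add by metis
qed

lemma qclass_power_one: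
 fixes M :: "('g, 'k, 'i) glider"
 assumes M: "line_glider G M u" shows "qclass G M [^]\<^bsub>QG\<^esub> (1::nat) = qclass G M"
proof -
 obtain P :: "('g, 'k, nat) glider" and p where P: "line_glider G P p" "qclass G M [^]\<^bsub>QG\<^esub> (1::nat) = qclass G P"
  "Ann G P = perp G (pset (coeff_funs M u) 1)" using qclass_power_model[OF M] by blast
 have "Ann G P = Ann G M" using P(3) by (simp add: Ann_perp[OF M] prod_set_one)
 thus ?thesis unfolding P(2) by (rule qclass_Ann[OF P(1) M])
qed

lemma the_idempotent_eq:
 fixes M :: "('g, 'k, 'i) glider"
 assumes M: "line_glider G M u" and fin: "finite (cyclic_semigroup QG (qclass G M))"
 shows "\<exists>n\<ge>1. the_idempotent QG (qclass G M) = qclass G M [^]\<^bsub>QG\<^esub> (n::nat)"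
  "the_idempotent QG (qclass G M) \<otimes>\<^bsub>QG\<^esub> the_idempotent QG (qclass G M) = the_idempotent QG (qclass G M)"
proof -
 have "\<exists>!y. y \<in> cyclic_semigroup QG (qclass G M) \<and> y \<otimes>\<^bsub>QG\<^esub> y = y"
  using fin unfolding cyclic_semigroup_def
  by (rule finite_powers_idempotent[where a="\<lambda>n. qclass G M [^]\<^bsub>QG\<^esub> n", OF qclass_power_add[OF M]])
 hence "the_idempotent QG (qclass G M) \<in> cyclic_semigroup QG (qclass G M) \<and>
  the_idempotent QG (qclass G M) \<otimes>\<^bsub>QG\<^esub> the_idempotent QG (qclass G M) = the_idempotent QG (qclass G M)"
  unfolding the_idempotent_def by (rule theI')
 thus "\<exists>n\<ge>1. the_idempotent QG (qclass G M) = qclass G M [^]\<^bsub>QG\<^esub> (n::nat)"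
  "the_idempotent QG (qclass G M) \<otimes>\<^bsub>QG\<^esub> the_idempotent QG (qclass G M) = the_idempotent QG (qclass G M)"
  unfolding cyclic_semigroup_def by auto
qed

lemma idempotent_powers:
 fixes M :: "('g, 'k, 'i) glider"
 assumes M: "line_glider G M u" and id: "qclass G M \<otimes>\<^bsub>QG\<^esub> qclass G M = qclass G M"
 shows "cyclic_semigroup QG (qclass G M) = {qclass G M}" "the_idempotent QG (qclass G M) = qclass G M"
proof -
 have "qclass G M [^]\<^bsub>QG\<^esub> (Suc n) = qclass G M" for n
  using id qclass_power_one[OF M] by (induct n) (simp_all add: nat_pow_def)
 hence "qclass G M [^]\<^bsub>QG\<^esub> n = qclass G M" if "n \<ge> 1" for n :: nat using that by (cases n) simp_all
 thus c: "cyclic_semigroup QG (qclass G M) = {qclass G M}" unfolding cyclic_semigroup_def by auto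
 show "the_idempotent QG (qclass G M) = qclass G M" unfolding the_idempotent_def c by (rule the_equality) (use id in auto)
qed

end

section \<open>Annihilators of idempotents\<close>

context finite_grp
begin

lemma stabilizer_subgroup:
 assumes V: "is_kgmod G V" and u: "u \<in> mod_space V"
 shows "subgroup {g \<in> carrier G. mod_act V g u = u} G"
proof (rule subgroupI)
 show "{g \<in> carrier G. mod_act V g u = u} ~= {}" using kgmodD(4)[OF V u] by blast
 fix g assume g: "g \<in> {g \<in> carrier G. mod_act V g u = u}"
 show "inv g \<in> {g \<in> carrier G. mod_act V g u = u}" using act_inv(1)[OF V _ u, of g] g by simp
 fix h assume h: "h \<in> {g \<in> carrier G. mod_act V g u = u}"
 show "g \<otimes> h \<in> {g \<in> carrier G. mod_act V g u = u}" using kgmodD(5)[OF V _ _ u, of g h] g h by simp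
qed auto

text \<open>Since products of two functions from \<open>C\<close> impose the same conditions as
  \<open>C\<close>, multiplying \<open>x\<close> by a function from \<open>C\<close> keeps it
  orthogonal to \<open>C\<close>. The shift by \<open>a\<close> is free, as the orthogonal
  complement is a subspace.\<close>

lemma perp_mult_closed:
 assumes I: "perp G (prod_set C C) = perp G C" and x: "x \<in> perp G C" and c: "c \<in> C"
 shows "(\<lambda>g. x g * (c g - a)) \<in> perp G C"
proof -
 have "(\<Sum>g\<in>carrier G. x g * c g * d g) = 0" if d: "d \<in> C" for d
 proof -
  have "(\<lambda>g. c g * d g) \<in> prod_set C C" using c d unfolding prod_set_def by blast
  moreover have "\<forall>e\<in>prod_set C C. (\<Sum>g\<in>carrier G. x g * e g) = 0" using x unfolding I[symmetric] by (simp add: perp_def)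
  ultimately have "(\<Sum>g\<in>carrier G. x g * (c g * d g)) = 0" by (rule bspec[rotated])
  thus ?thesis by (simp add: mult.assoc)
 qed
 hence "(\<lambda>g. x g * c g) \<in> perp G C" using x by (simp add: perp_def galg_def)
 hence "(\<lambda>g. x g * c g) - fscale a x \<in> perp G C"
  by (intro fv.subspace_diff[OF perp_subspace] fv.subspace_scale[OF perp_subspace] x)
 moreover have "(\<lambda>g. x g * c g) - fscale a x = (\<lambda>g. x g * (c g - a))" by (simp add: fun_eq_iff fun_apps algebra_simps)
 ultimately show ?thesis by simp
qed

text \<open>Multiplication by suitable polynomials in the functions from \<open>C\<close> removes from the support of \<open>x\<close> all
 points that \<open>C\<close> separates from \<open>k\<close>.\<close>

lemma perp_separate:
 assumes I: "perp G (prod_set C C) = perp G C" and S: "finite S" "!!s. s \<in> S ==> \<exists>c\<in>C. c s ~= c k"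
 shows "\<exists>p. (\<forall>x\<in>perp G C. (\<lambda>g. x g * p g) \<in> perp G C) \<and> (\<forall>s\<in>S. p s = 0) \<and>
  (\<forall>g. (\<forall>c\<in>C. c g = c k) --> p g = (p k :: 'k::field)) \<and> p k ~= 0" using S
proof (induct S rule: finite_induct)
 case empty
 show ?case by (rule exI[of _ "\<lambda>_. 1"]) simp
next
 case (insert s S)
 obtain p where p: "!!x. x \<in> perp G C ==> (\<lambda>g. x g * p g) \<in> perp G C" "!!s. s \<in> S ==> p s = 0"
  "!!g. \<forall>c\<in>C. c g = c k ==> p g = p k" "p k ~= 0"
 proof -
  have "\<exists>p. (\<forall>x\<in>perp G C. (\<lambda>g. x g * p g) \<in> perp G C) \<and> (\<forall>s\<in>S. p s = 0) \<and>
   (\<forall>g. (\<forall>c\<in>C. c g = c k) --> p g = p k) \<and> p k ~= 0"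
   by (rule insert(3)) (rule insert(4), simp)
  thus ?thesis using that by blast
 qed
 obtain c where c: "c \<in> C" "c s ~= c k" using insert(4) by blast
 show ?case
 \<comment> \<open>The new factor vanishes at \<open>s\<close> but not at \<open>k\<close>, and
   depends on \<open>g\<close> only through the value of \<open>c\<close>.\<close>
 proof (rule exI[of _ "\<lambda>g. p g * (c g - c s)"], intro conjI ballI allI impI)
  fix x assume "x \<in> perp G C"
  hence "(\<lambda>g. x g * p g * (c g - c s)) \<in> perp G C" by (intro perp_mult_closed[OF I _ c(1)] p(1))
  thus "(\<lambda>g. x g * (p g * (c g - c s))) \<in> perp G C" by (simp add: mult.assoc)
 next
  fix t assume "t \<in> insert s S" thus "p t * (c t - c s) = 0" using p(2) by auto
 next
  fix g assume g: "\<forall>c\<in>C. c g = c k"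
  hence "c g = c k" using c(1) by blast
  thus "p g * (c g - c s) = p k * (c k - c s)" using p(3)[OF g] by simp
 qed (use p(4) c in simp)
qed

text \<open>The coordinate functions fail to separate two points exactly if these lie in one left
  coset of the stabilizer. A product of differences as in \<open>perp_separate\<close> isolates one
  coset, and the constant \<open>c0\<close> turns orthogonality into vanishing of the sum over that
  coset.\<close>

lemma idempotent_stabilizer:
 fixes M :: "('a, 'k::field_char_0, 'i) glider"
 assumes M: "line_glider G M v" and I: "perp G (prod_set (coeff_funs M v) (coeff_funs M v)) = perp G (coeff_funs M v)"
  and one: "c0 \<in> coeff_funs M v" "a ~= 0" "!!g. g \<in> carrier G ==> c0 g = a"
 shows "Ann G M = sub_grp.coset_ideal G {g \<in> carrier G. mod_act M g v = v}"
proof -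
 let ?H = "{g \<in> carrier G. mod_act M g v = v}" and ?C = "coeff_funs M v"
 note K = gliderD(1)[OF line_gliderD(1)[OF M]] and v = line_gliderD(5)[OF M]
 interpret S: sub_grp G ?H by (rule sub_grp.intro[OF finite_grp_axioms sub_grp_axioms.intro[OF stabilizer_subgroup[OF K v]]])
 have C: "(\<forall>c\<in>?C. c g = c h) \<longleftrightarrow> mod_act M g v = mod_act M h v" for g h
  by (auto simp: coeff_funs_def fun_eq_iff)
 have coset: "mod_act M s v = mod_act M k v \<longleftrightarrow> s \<in> (\<lambda>h. k \<otimes> h) ` ?H" if s: "s \<in> carrier G" and k: "k \<in> carrier G" for s k
 proof
  assume e: "mod_act M s v = mod_act M k v"
  have "mod_act M (inv k \<otimes> s) v = v" using e kgmodD(5)[OF K inv_closed[OF k] s v] act_inv(1)[OF K k v] by simp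
  thus "s \<in> (\<lambda>h. k \<otimes> h) ` ?H" using s k by (intro image_eqI[of _ _ "inv k \<otimes> s"]) (simp_all add: m_assoc[symmetric])
 next
  assume "s \<in> (\<lambda>h. k \<otimes> h) ` ?H"
  thus "mod_act M s v = mod_act M k v" using kgmodD(5)[OF K k _ v] by auto
 qed
 show ?thesis
 proof
  show "S.coset_ideal \<subseteq> Ann G M"
   using S.coset_ideal_fixed[OF K v] unfolding Ann_line[OF M] by (auto simp: S.coset_ideal_def)
  show "Ann G M \<subseteq> S.coset_ideal"
  proof
   fix x assume "x \<in> Ann G M"
   hence x: "x \<in> perp G ?C" unfolding Ann_perp[OF M] .
   have "(\<Sum>h\<in>?H. x (k \<otimes> h)) = 0" if k: "k \<in> carrier G" for k
   proof -
    let ?S = "{s \<in> carrier G. mod_act M s v ~= mod_act M k v}"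
    have ex: "\<exists>p. (\<forall>x\<in>perp G ?C. (\<lambda>g. x g * p g) \<in> perp G ?C) \<and> (\<forall>s\<in>?S. p s = 0) \<and>
     (\<forall>g. (\<forall>c\<in>?C. c g = c k) --> p g = p k) \<and> p k ~= 0"
     by (rule perp_separate[OF I]) (use fin_carrier C in auto)
    obtain p where p: "!!x. x \<in> perp G ?C ==> (\<lambda>g. x g * p g) \<in> perp G ?C" "!!s. s \<in> ?S ==> p s = 0"
     "!!g. \<forall>c\<in>?C. c g = c k ==> p g = p k" "p k ~= 0" using ex by blast
    have "0 = (\<Sum>g\<in>carrier G. x g * p g * c0 g)" using p(1)[OF x] one(1) by (simp add: perp_def)
    also have "\<dots> = (\<Sum>g\<in>carrier G. x g * p g) * a" unfolding sum_distrib_right by (rule sum.cong) (simp_all add: one(3))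
    finally have "(\<Sum>g\<in>carrier G. x g * p g) = 0" using one(2) by simp
    also have "(\<Sum>g\<in>carrier G. x g * p g) = (\<Sum>g\<in>(\<lambda>h. k \<otimes> h) ` ?H. x g * p g)"
     by (rule sum.mono_neutral_right[OF fin_carrier]) (use k coset p(2) in auto)
    also have "\<dots> = (\<Sum>h\<in>?H. x (k \<otimes> h) * p (k \<otimes> h))"
     by (subst sum.reindex) (auto intro: inj_onI simp: k)
    also have "\<dots> = (\<Sum>h\<in>?H. x (k \<otimes> h) * p k)"
    proof (rule sum.cong[OF refl])
     fix h assume h: "h \<in> ?H"
     have "p (k \<otimes> h) = p k" using coset[of "k \<otimes> h" k] h k by (intro p(3)) (simp add: C)
     thus "x (k \<otimes> h) * p (k \<otimes> h) = x (k \<otimes> h) * p k" by simp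
    qed
    also have "\<dots> = (\<Sum>h\<in>?H. x (k \<otimes> h)) * p k" by (simp add: sum_distrib_right)
    finally show ?thesis using p(4) by simp
   qed
   thus "x \<in> S.coset_ideal" using x by (simp add: S.coset_ideal_def perp_def)
  qed
 qed
qed

end

section \<open>Characters and subgroups\<close>

text \<open>A root of 1 + X + ... + X^(n-1) is an n-th root of unity, and it is not 1 because
  \<open>n\<close> is nonzero in characteristic 0.\<close>

lemma root_of_unity_exists:
 assumes "1 < n" obtains c :: "'c::{alg_closed_field, field_char_0}" where "c ~= 1" "c ^ n = 1"
proof -
 let ?p = "\<Sum>i<n. monom (1 :: 'c) i"
 have p: "poly ?p c = (\<Sum>i<n. c ^ i)" for c by (simp add: poly_sum poly_monom)
 have "coeff ?p 1 = (\<Sum>i<n. if i = 1 then 1 else 0)" unfolding coeff_sum by (rule sum.cong) auto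
 hence "coeff ?p 1 ~= 0" using assms by simp
 hence "degree ?p > 0" using le_degree[of ?p 1] by simp
 then obtain c where c: "poly ?p c = 0" using alg_closed_imp_poly_has_root by blast
 have "c ~= 1" using c assms unfolding p by auto
 moreover have "c ^ n = 1" using one_diff_power_eq[of c n] c unfolding p by simp
 ultimately show ?thesis using that by blast
qed

sublocale param \<subseteq> gr: glider_ring G "TYPE('k)" by unfold_locales

context finite_grp
begin

lemma kgmod_of_glider: "is_kgmod G M ==> is_kgmod G \<lparr>mod_space = mod_space M, mod_act = mod_act M\<rparr>"
 by (simp add: is_kgmod_def)

text \<open>Scalars commute, so the derived subgroup acts trivially on a line; if \<open>H\<close>
  does so too, nothing of \<open>G\<close> is left to act otherwise.\<close>

lemma line_stable_trivial:
 assumes V: "is_kgmod G V" and u: "mod_space V = fv.span {u}"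
  and H: "!!h. h \<in> H ==> h \<in> carrier G \<and> mod_act V h u = u"
  and HG: "!!x. x \<in> carrier G ==> \<exists>h\<in>H. \<exists>c\<in>derived G (carrier G). x = h \<otimes> c" and g: "g \<in> carrier G"
 shows "mod_act V g u = u"
proof -
 have uV: "u \<in> mod_space V" unfolding u by (simp add: fv.span_base)
 let ?K = "{g \<in> carrier G. mod_act V g u = u}"
 have K: "subgroup ?K G" by (rule stabilizer_subgroup[OF V uV])
 have sc: "\<exists>c. \<forall>v\<in>mod_space V. mod_act V x v = fscale c v" if x: "x \<in> carrier G" for x
 proof -
  obtain c where c: "mod_act V x u = fscale c u" using kgmodD(2)[OF V x uV] unfolding u by (auto simp: fv.span_singleton)
  have "mod_act V x v = fscale c v" if v: "v \<in> mod_space V" for v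
  proof -
   obtain d where d: "v = fscale d u" using v unfolding u by (auto simp: fv.span_singleton)
   show ?thesis unfolding d lin_on_scale[OF kgmodD(3)[OF V x] uV] c by (simp add: mult.commute)
  qed
  thus ?thesis by blast
 qed
 have "x \<otimes> y \<otimes> inv x \<otimes> inv y \<in> ?K" if x: "x \<in> carrier G" and y: "y \<in> carrier G" for x y
 proof -
  obtain c where c: "!!v. v \<in> mod_space V ==> mod_act V x v = fscale c v" using sc[OF x] by blast
  obtain d where d: "!!v. v \<in> mod_space V ==> mod_act V y v = fscale d v" using sc[OF y] by blast
  define w where "w = mod_act V (inv x \<otimes> inv y) u"
  have w: "w \<in> mod_space V" unfolding w_def using x y by (intro kgmodD(2)[OF V _ uV]) simp
  have "mod_act V (x \<otimes> y \<otimes> inv x \<otimes> inv y) u = mod_act V (x \<otimes> y) w"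
   using kgmodD(5)[OF V _ _ uV, of "x \<otimes> y" "inv x \<otimes> inv y"] x y by (simp add: w_def m_assoc)
  also have "\<dots> = mod_act V (y \<otimes> x) w"
   using kgmodD(5)[OF V x y w] kgmodD(5)[OF V y x w] c[OF w] d[OF w]
    lin_on_scale[OF kgmodD(3)[OF V x] w] lin_on_scale[OF kgmodD(3)[OF V y] w] by (simp add: mult.commute)
  also have "\<dots> = u"
   using kgmodD(5)[OF V _ _ uV, of "y \<otimes> x" "inv x \<otimes> inv y"] kgmodD(4)[OF V uV] x y
   by (simp add: w_def m_assoc comm_cancel)
  finally show ?thesis using x y by simp
 qed
 hence "derived G (carrier G) \<subseteq> ?K" unfolding derived_def by (intro generate_subgroup_incl[OF _ K]) blast
 moreover obtain h c where "h \<in> H" "c \<in> derived G (carrier G)" "g = h \<otimes> c" using HG[OF g] by blast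
 ultimately have "g \<in> ?K" using subgroup.m_closed[OF K, of h c] H[of h] by blast
 thus ?thesis by blast
qed

end

context param
begin

text \<open>Enlarging \<open>L\<close>, we may assume that it is a maximal proper subgroup, so that its quotient is cyclic.\<close>

lemma character_exists:
 assumes L0: "subgroup L0 G" "derived G (carrier G) \<subseteq> L0" "L0 ~= carrier G"
 obtains z where "z \<in> carrier (Gab G)" "z ~= \<one>\<^bsub>Gab G\<^esub>" "!!l t. l \<in> L0 ==> t \<in> mod_space (T z) ==> mod_act (T z) l t = t"
proof -
 let ?F = "{L. subgroup L G \<and> L0 \<subseteq> L \<and> L ~= carrier G}"
 have "?F \<subseteq> Pow (carrier G)" using subgroup.subset by blast
 hence "finite ?F" using fin_carrier finite_subset by blast
 moreover have "L0 \<in> ?F" using L0 by blast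
 ultimately have "\<exists>L\<in>?F. L0 \<subseteq> L \<and> (\<forall>M\<in>?F. L \<subseteq> M --> L = M)" by (rule finite_has_maximal2)
 then obtain L where L: "L \<in> ?F" and mx: "\<forall>M\<in>?F. L \<subseteq> M --> L = M" by (elim bexE conjE)
 have Ls: "subgroup L G" and LL: "L0 \<subseteq> L" using L by auto
 have Lc: "l \<in> carrier G" if "l \<in> L" for l using that subgroup.subset[OF Ls] by blast
 obtain g where g: "g \<in> carrier G" "g \<notin> L" using L Lc by blast
 have "x \<otimes> l \<otimes> inv x \<in> L" if x: "x \<in> carrier G" and l: "l \<in> L" for x l
 proof -
  have "x \<otimes> l \<otimes> inv x \<otimes> inv l \<in> derived G (carrier G)" unfolding derived_def by (rule generate.incl) (use x Lc[OF l] in blast)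
  hence "(x \<otimes> l \<otimes> inv x \<otimes> inv l) \<otimes> l \<in> L" using L0(2) LL l by (intro subgroup.m_closed[OF Ls _ l]) auto
  thus ?thesis using x Lc[OF l] by (simp add: m_assoc)
 qed
 hence Ln: "L \<lhd> G" using Ls by (simp add: normal_inv_iff)
 define A where "A = G Mod L"
 interpret A: group A unfolding A_def by (rule normal.factorgroup_is_group[OF Ln])
 interpret q: group_hom G A "\<lambda>a. L #> a"
  by (intro group_hom.intro group_hom_axioms.intro is_group A.is_group normal.r_coset_hom_Mod[OF Ln, folded A_def])
 have surj: "carrier A = (\<lambda>a. L #> a) ` carrier G" by (auto simp: A_def FactGroup_def RCOSETS_def)
 have qL: "L #> a = \<one>\<^bsub>A\<^esub> \<longleftrightarrow> a \<in> L" if "a \<in> carrier G" for a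
  using coset_join1[OF _ that Ls] coset_join2[OF that Ls] by (auto simp: A_def FactGroup_def)
 let ?c = "L #> g"
 have c: "?c \<in> carrier A" "?c ~= \<one>\<^bsub>A\<^esub>" using g qL by auto
 have "finite (carrier A)" unfolding surj using fin_carrier by simp
 hence o: "A.ord ?c \<ge> 1" by (rule A.ord_ge_1[OF _ c(1)])
 have "A.ord ?c ~= 1" using A.pow_eq_id[OF c(1), of 1] c by simp
 \<comment> \<open>The intended value of the character at \<open>g\<close> is a power of
   \<open>r\<close>. Any nontrivial root of unity of order dividing that of \<open>?c\<close> will
   do, and one exists as \<open>?c\<close> is not the identity.\<close>
 then obtain r :: 'k where r: "r ~= 1" "r ^ A.ord ?c = 1" using root_of_unity_exists[of "A.ord ?c"] o by (metis le_neq_implies_less)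
 \<comment> \<open>The preimage of the cyclic group generated by \<open>?c\<close>. It contains
   \<open>L\<close> and \<open>g\<close>, so it is all of \<open>G\<close> by maximality of
   \<open>L\<close>.\<close>
 let ?K = "{a \<in> carrier G. \<exists>i::nat. L #> a = ?c [^]\<^bsub>A\<^esub> i}"
 have "subgroup ?K G"
 proof (rule subgroupI)
  show "?K ~= {}" using g by (auto intro!: exI[of _ g] exI[of _ "1::nat"])
  fix a assume "a \<in> ?K"
  then obtain i where a: "a \<in> carrier G" "L #> a = ?c [^]\<^bsub>A\<^esub> (i::nat)" by blast
  have "(?c [^]\<^bsub>A\<^esub> (i * (A.ord ?c - 1))) \<otimes>\<^bsub>A\<^esub> ?c [^]\<^bsub>A\<^esub> i = \<one>\<^bsub>A\<^esub>"
  proof -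
   have "i * (A.ord ?c - 1) + i = A.ord ?c * i" using o by (cases "A.ord ?c") (auto simp: algebra_simps)
   thus ?thesis using c(1) A.pow_eq_id[OF c(1)] by (simp add: A.nat_pow_mult)
  qed
  hence "L #> inv a = ?c [^]\<^bsub>A\<^esub> (i * (A.ord ?c - 1))" using a c(1) A.inv_equality by simp
  thus "inv a \<in> ?K" using a(1) by auto
  fix b assume "b \<in> ?K"
  then obtain j where b: "b \<in> carrier G" "L #> b = ?c [^]\<^bsub>A\<^esub> (j::nat)" by blast
  have "L #> (a \<otimes> b) = ?c [^]\<^bsub>A\<^esub> (i + j)" using a b c(1) by (simp add: A.nat_pow_mult)
  thus "a \<otimes> b \<in> ?K" using a(1) b(1) by auto
 qed auto
 moreover have LK: "L \<subseteq> ?K"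
 proof
  fix l assume l: "l \<in> L"
  hence "L #> l = ?c [^]\<^bsub>A\<^esub> (0::nat)" using qL Lc by simp
  thus "l \<in> ?K" using Lc[OF l] by blast
 qed
 moreover have "g \<in> ?K" using g(1) c(1) by (auto intro!: exI[of _ "1::nat"])
 ultimately have K: "?K = carrier G" using bspec[OF mx, of ?K] g(2) LL by blast
 hence "\<forall>a. \<exists>i::nat. a \<in> carrier G --> L #> a = ?c [^]\<^bsub>A\<^esub> i" by blast
 then obtain n where n: "!!a. a \<in> carrier G ==> L #> a = ?c [^]\<^bsub>A\<^esub> (n a :: nat)" by metis
 \<comment> \<open>Exponents of \<open>?c\<close> are determined up to multiples of its order, and
   these do not change powers of \<open>r\<close>.\<close>
 have chi: "r ^ i = r ^ j" if "?c [^]\<^bsub>A\<^esub> (i::nat) = ?c [^]\<^bsub>A\<^esub> j" for i j using that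
 proof (induct i j rule: linorder_wlog)
  case (le i j)
  have "?c [^]\<^bsub>A\<^esub> i \<otimes>\<^bsub>A\<^esub> ?c [^]\<^bsub>A\<^esub> (j - i) = ?c [^]\<^bsub>A\<^esub> i"
   unfolding A.nat_pow_mult[OF c(1)] le_add_diff_inverse[OF le(1)] by (rule le(2)[symmetric])
  hence "?c [^]\<^bsub>A\<^esub> (j - i) = \<one>\<^bsub>A\<^esub>"  by (simp add: A.r_cancel_one' c(1))
  then obtain d where "j - i = A.ord ?c * d" using A.pow_eq_id[OF c(1)] by (metis dvdE)
  hence "r ^ (j - i) = 1" using r(2) by (simp add: power_mult)
  thus ?case using power_add[of r i "j - i"] le(1) by simp
 qed simp
 have n1: "r ^ n a = 1" if "a \<in> L" for a using chi[of "n a" 0] n[OF Lc[OF that]] qL[OF Lc[OF that]] that by simp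
 have nm: "r ^ n (a \<otimes> b) = r ^ n a * r ^ n b" if "a \<in> carrier G" "b \<in> carrier G" for a b
 proof -
  have "?c [^]\<^bsub>A\<^esub> n (a \<otimes> b) = L #> (a \<otimes> b)" by (rule n[OF m_closed[OF that], symmetric])
  also have "\<dots> = ?c [^]\<^bsub>A\<^esub> n a \<otimes>\<^bsub>A\<^esub> ?c [^]\<^bsub>A\<^esub> n b"
   unfolding q.hom_mult[OF that] by (rule arg_cong2[OF n[OF that(1)] n[OF that(2)]])
  finally show ?thesis using chi[of "n (a \<otimes> b)" "n a + n b"] unfolding A.nat_pow_mult[OF c(1)] by (simp add: power_add)
 qed
 have ng: "r ^ n g ~= 1" using chi[of "n g" 1] n[OF g(1)] c(1) r(1) by simp
 let ?e = "\<lambda>i::nat. if i = 0 then 1 else 0 :: 'k"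
 let ?V = "\<lparr>mod_space = fv.span {?e}, mod_act = \<lambda>g. fscale (r ^ n g)\<rparr> :: ('g, 'k, nat) kgmod"
 have e0: "?e ~= 0" by (auto simp: fun_eq_iff fun_apps)
 have V: "is_kgmod G ?V" unfolding is_kgmod_def
  by (auto simp: nm n1[OF subgroup.one_closed[OF Ls]] lin_on_def fv.scale_right_distrib mult.commute intro: fv.span_scale)
 obtain z where z: "z \<in> carrier (Gab G)"
  "!!g t. g \<in> carrier G ==> mod_act ?V g ?e = ?e ==> t \<in> mod_space (T z) ==> mod_act (T z) g t = t"
  "!!g t. g \<in> carrier G ==> mod_act ?V g ?e ~= ?e ==> t \<in> mod_space (T z) ==> t ~= 0 ==> mod_act (T z) g t ~= t"
  by (rule one_dim_param_ideal[OF V e0]) (simp, blast)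
 have "z ~= \<one>\<^bsub>Gab G\<^esub>"
 proof
  assume e: "z = \<one>\<^bsub>Gab G\<^esub>"
  obtain t where t: "t ~= 0" "t \<in> mod_space (T z)" by (rule T_line[OF z(1)])
  have "mod_act ?V g ?e ~= ?e" using ng e0 by (auto simp: fun_eq_iff fscale_apply)
  thus False using z(3)[OF g(1) _ t(2,1)] T_one[OF g(1)] t(2) unfolding e by simp
 qed
 moreover have "mod_act (T z) l t = t" if "l \<in> L0" "t \<in> mod_space (T z)" for l t
  by (rule z(2)[OF _ _ that(2)]) (use n1[of l] LL Lc that(1) in auto)
 ultimately show ?thesis using that z(1) by blast
qed

text \<open>A multiple of the idempotent of \<open>T z\<close> annihilates all other irreducible modules.\<close>

lemma param_ideal_independent:
 assumes z: "z \<in> carrier (Gab G)" "z ~= \<one>\<^bsub>Gab G\<^esub>" and D: "D \<in> SG Irr"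
 shows "\<not> param_ideal {\<one>\<^bsub>Gab G\<^esub>} D \<subseteq> param_ideal {z} {}"
proof -
 interpret A: group "Gab G" by (rule Gab_group)
 obtain t where t: "t ~= 0" "mod_space (T z) = fv.span {t}" "t \<in> mod_space (T z)" by (rule T_line[OF z(1)])
 note Kz = T_kgmod[OF z(1)]
 have "\<forall>g. \<exists>c. g \<in> carrier G --> (\<forall>t\<in>mod_space (T z). mod_act (T z) g t = fscale c t)" using T_scalar[OF z(1)] by metis
 then obtain l where l: "!!g t. g \<in> carrier G ==> t \<in> mod_space (T z) ==> mod_act (T z) g t = fscale (l g) t" by metis
 have lm: "l (g \<otimes> h) = l g * l h" if "g \<in> carrier G" "h \<in> carrier G" for g h
 proof -
  have "fscale (l (g \<otimes> h)) t = fscale (l g * l h) t"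
   using l t(3) that kgmodD(5)[OF Kz that t(3)] lin_on_scale[OF kgmodD(3)[OF Kz that(1)] t(3)] by (simp add: mult.commute)
  thus ?thesis using t(1) fv.scale_right_imp_eq by blast
 qed
 have l1: "l \<one> = 1" using l[OF one_closed t(3)] kgmodD(4)[OF Kz t(3)] t(1) fv.scale_right_imp_eq[of t "l \<one>" 1] by simp
 define x where "x g = (if g \<in> carrier G then l (inv g) else 0)" for g
 have xg: "x \<in> galg G" by (simp add: galg_def x_def)
 \<comment> \<open>In any module, \<open>x\<close> maps into vectors on which the group acts through
   \<open>l\<close>. If an irreducible module has a nonzero vector of this kind, it is the line
   spanned by it, with character \<open>l\<close>.\<close>
 have eig: "mod_act V h (galg_act G V x v) = fscale (l h) (galg_act G V x v)"
  if V: "is_kgmod G V" and v: "v \<in> mod_space V" and h: "h \<in> carrier G" for V :: "('g, 'k, nat) kgmod" and v h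
 proof -
  have "mod_act V h (galg_act G V x v) = (\<Sum>g\<in>carrier G. mod_act V h (fscale (x g) (mod_act V g v)))"
   unfolding galg_act_def by (rule lin_on_sum[OF kgmodD(1)[OF V] kgmodD(3)[OF V h]])
    (intro fv.subspace_scale kgmodD(1)[OF V] kgmodD(2)[OF V _ v])
  also have "\<dots> = (\<Sum>g\<in>carrier G. fscale (l h * x (h \<otimes> g)) (mod_act V (h \<otimes> g) v))"
  proof (rule sum.cong[OF refl])
   fix g assume g: "g \<in> carrier G"
   have "l h * l (inv (h \<otimes> g)) = l (inv g)"
    using lm[of "inv g" "inv h"] lm[of "inv h" h] l1 g h by (simp add: inv_mult_group) (simp add: mult.commute)
   thus "mod_act V h (fscale (x g) (mod_act V g v)) = fscale (l h * x (h \<otimes> g)) (mod_act V (h \<otimes> g) v)"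
    using g h lin_on_scale[OF kgmodD(3)[OF V h] kgmodD(2)[OF V g v]] kgmodD(5)[OF V h g v] by (simp add: x_def)
  qed
  also have "\<dots> = (\<Sum>k\<in>carrier G. fscale (l h * x k) (mod_act V k v))"
   by (rule sum.reindex_bij_witness[of _ "\<lambda>k. inv h \<otimes> k" "\<lambda>g. h \<otimes> g"]) (use h in \<open>auto simp: comm_cancel\<close>)
  also have "\<dots> = fscale (l h) (galg_act G V x v)" by (simp add: galg_act_def fv.scale_sum_right)
  finally show ?thesis .
 qed
 have kill: "galg_act G V x v = 0" if V: "irreducible_kgmod G V" and v: "v \<in> mod_space V"
  and n: "fv.dim (mod_space V) > 1 \<or> V = T \<one>\<^bsub>Gab G\<^esub>" for V v
 proof (rule ccontr)
  let ?w = "galg_act G V x v"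
  assume w: "?w ~= 0"
  have K: "is_kgmod G V" using V by (simp add: irreducible_kgmod_iff)
  have wV: "?w \<in> mod_space V" by (rule galg_act_closed[OF K v])
  show False using n
  proof
   assume d: "fv.dim (mod_space V) > 1"
   have "submod G V (fv.span {?w})" unfolding submod_def
   proof (intro conjI ballI)
    show "fv.span {?w} \<subseteq> mod_space V" using wV fv.span_minimal[OF _ kgmodD(1)[OF K], of "{?w}"] by simp
    show "mod_act V g ` fv.span {?w} \<subseteq> fv.span {?w}" if "g \<in> carrier G" for g
     using that lin_on_scale[OF kgmodD(3)[OF K] wV] eig[OF K v] by (auto simp: fv.span_singleton)
   qed simp
   moreover have "fv.span {?w} ~= {0}" using w fv.span_base[of ?w "{?w}"] by auto
   ultimately show False using V d dim_line[OF w] unfolding irreducible_kgmod_iff by (metis less_irrefl)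
  next
   assume e: "V = T \<one>\<^bsub>Gab G\<^esub>"
   have "l h = 1" if h: "h \<in> carrier G" for h
    using eig[OF K v h] T_one[OF h] wV w fv.scale_right_imp_eq[of ?w "l h" 1] unfolding e by simp
   thus False using T_trivial_unique[OF z(1)] l z(2) by simp
  qed
 qed
 have "galg_act G (T z) x t = fscale (of_nat (card (carrier G))) t"
 proof -
  have "l (inv g) * l g = 1" if "g \<in> carrier G" for g using lm[of "inv g" g] l1 that by simp
  hence "galg_act G (T z) x t = (\<Sum>g\<in>carrier G. t)" unfolding galg_act_def by (intro sum.cong) (simp_all add: x_def l t(3))
  thus ?thesis by (simp add: fun_eq_iff fun_apps sum_fun_apply)
 qed
 moreover have "card (carrier G) ~= 0" using fin_carrier one_closed by auto
 ultimately have "x \<notin> param_ideal {z} {}" using t unfolding param_ideal_def by auto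
 moreover have "x \<in> param_ideal {\<one>\<^bsub>Gab G\<^esub>} D"
  unfolding param_ideal_def using xg kill[OF T_irr[OF A.one_closed]] kill[OF Irr_irr] SGD(1,2,4)[OF D] by blast
 ultimately show ?thesis by blast
qed

text \<open>If \<open>H\<close> and the derived subgroup lay in a proper subgroup, a nontrivial
  character would be trivial on it. Its vectors are fixed by \<open>H\<close> and hence killed by
  the coset ideal, whereas no ideal built from the trivial module and modules of dimension above 1
  kills them.\<close>

lemma coset_ideal_supplement:
 assumes H: "subgroup H G" and D: "D \<in> SG Irr"
  and e: "param_ideal {\<one>\<^bsub>Gab G\<^esub>} D = sub_grp.coset_ideal G H" and x: "x \<in> carrier G"
 shows "\<exists>h\<in>H. \<exists>c\<in>derived G (carrier G). x = h \<otimes> c"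
proof -
 interpret S: sub_grp G H by (rule sub_grp.intro[OF finite_grp_axioms sub_grp_axioms.intro[OF H]])
 interpret A: group "Gab G" by (rule Gab_group)
 obtain L where L: "L = {h \<otimes> c |h c. h \<in> H \<and> c \<in> derived G (carrier G)}" "subgroup L G" "H \<subseteq> L" "derived G (carrier G) \<subseteq> L"
  by (rule normal_product[OF H derived_self_is_normal]) blast
 have "L = carrier G"
 proof (rule ccontr)
  assume n: "L ~= carrier G"
  obtain z where z: "z \<in> carrier (Gab G)" "z ~= \<one>\<^bsub>Gab G\<^esub>" "!!l t. l \<in> L ==> t \<in> mod_space (T z) ==> mod_act (T z) l t = t"
   by (rule character_exists[OF L(2,4) n]) blast
  have "S.coset_ideal \<subseteq> param_ideal {z} {}"
  proof
   fix x :: "'g => 'k" assume x: "x \<in> S.coset_ideal"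
   hence "x \<in> galg G" by (simp add: S.coset_ideal_def)
   thus "x \<in> param_ideal {z} {}"
    unfolding param_ideal_def using S.coset_ideal_fixed[OF T_kgmod[OF z(1)] _ _ x] z(3) L(3) by auto
  qed
  thus False using param_ideal_independent[OF z(1,2) D] unfolding e by blast
 qed
 thus ?thesis using x L(1) by blast
qed

end

section \<open>The span of the classes with trivial idempotent\<close>

lemma (in glider_ring) rat_span_mono: "S \<subseteq> S' ==> rat_span R1 S \<subseteq> rat_span R1 S'"
 unfolding rat_span_def QG_eq[symmetric] by (rule Q.add.mono_generate) blast

context param
begin

abbreviation "e \<equiv> \<one>\<^bsub>Gab G\<^esub>"

lemma e_mem: "e \<in> carrier (Gab G)" using group.is_monoid[OF Gab_group] by (rule monoid.one_closed)

lemma param_ideal_trivial: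
 assumes z: "z \<in> carrier (Gab G)" and a: "!!g t. g \<in> carrier G ==> t \<in> mod_space (T z) ==> mod_act (T z) g t = t"
 shows "param_ideal {z} {} = {x \<in> galg G. (\<Sum>g\<in>carrier G. x g) = 0}"
proof -
 have "galg_act G (T z) x t = fscale (\<Sum>g\<in>carrier G. x g) t" if "t \<in> mod_space (T z)" for x t
  unfolding galg_act_def fv.scale_sum_left by (rule sum.cong) (simp_all add: a that)
 moreover obtain s where "s ~= 0" "mod_space (T z) = fv.span {s}" "s \<in> mod_space (T z)" by (rule T_line[OF z])
 ultimately show ?thesis unfolding param_ideal_def by fastforce
qed

text \<open>An element g - c for each \<open>g\<close> is the mark of a one-dimensional annihilator;
  \<open>one_dim_class\<close> is the converse.\<close>

lemma T_scalar_ideal: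
 assumes z: "z \<in> carrier (Gab G)" and g: "g \<in> carrier G"
 obtains c where "c ~= 0" "!!t. t \<in> mod_space (T z) ==> mod_act (T z) g t = fscale c t"
  "galg_of g - fscale c (galg_of \<one>) \<in> param_ideal {z} {}"
proof -
 obtain c where c: "c ~= 0" "!!t. t \<in> mod_space (T z) ==> mod_act (T z) g t = fscale c t" by (rule T_scalar[OF z g]) blast
 have "galg_of g - fscale c (galg_of \<one>) \<in> param_ideal {z} {}" unfolding param_ideal_def
  using c(2) kgmodD(4)[OF T_kgmod[OF z]] by (simp add: galg_of_diff_mem[OF g one_closed] galg_of_diff_act[OF g one_closed])
 thus ?thesis using that c by blast
qed

lemma T_param:
 assumes z: "z \<in> carrier (Gab G)"
 shows "line_glider G (param_glider T {z} {}) (SOME v. param_vector T {z} {} v)"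
  "Ann G (param_glider T {z} {}) = param_ideal {z} {}" by (rule param_line param_Ann; use z SG_empty in simp)+

text \<open>An element g - c in the annihilator makes \<open>u\<close> an eigenvector of
  \<open>g\<close>. If this happens for all \<open>g\<close>, the line of \<open>u\<close> is a
  submodule, and the parametrization of one-dimensional modules applies to it.\<close>

lemma one_dim_class:
 fixes M :: "('g, 'k, 'i) glider"
 assumes M: "line_glider G M u" and sc: "!!g. g \<in> carrier G ==> \<exists>c. galg_of g - fscale c (galg_of \<one>) \<in> Ann G M"
 shows "\<exists>z\<in>carrier (Gab G). qclass G M = Mcl G T {z} {}"
proof -
 note K = gliderD(1)[OF line_gliderD(1)[OF M]] and u = line_gliderD(5)[OF M]
 let ?V = "\<lparr>mod_space = fv.span {u}, mod_act = mod_act M\<rparr>"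
 have "submod G M (fv.span {u})" unfolding submod_def
 proof (intro conjI ballI)
  show "fv.span {u} \<subseteq> mod_space M" using fv.span_minimal[OF _ kgmodD(1)[OF K]] u by simp
  fix g assume g: "g \<in> carrier G"
  obtain c where c: "galg_of g - fscale c (galg_of \<one>) \<in> Ann G M" using sc[OF g] by blast
  hence gu: "mod_act M g u = fscale c u"
   unfolding Ann_line[OF M] by (simp add: galg_of_diff_act[OF g one_closed] kgmodD(4)[OF K u])
  have "mod_act M g v \<in> fv.span {u}" if v: "v \<in> fv.span {u}" for v
  proof -
   obtain d where d: "v = fscale d u" using v by (auto simp: fv.span_singleton)
   show ?thesis unfolding d lin_on_scale[OF kgmodD(3)[OF K g] u] gu by (intro fv.span_scale fv.span_base) simp
  qed
  thus "mod_act M g ` fv.span {u} \<subseteq> fv.span {u}" by blast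
 qed simp
 hence KV: "is_kgmod G ?V" by (rule submod_kgmod[OF K])
 have sp: "mod_space ?V = fv.span {u}" by simp
 obtain z where z: "z \<in> carrier (Gab G)" "param_ideal {z} {} = {x \<in> galg G. galg_act G ?V x u = 0}"
  by (rule one_dim_param_ideal[OF KV line_gliderD(2)[OF M] sp])
 have "Ann G M = Ann G (param_glider T {z} {})"
  unfolding Ann_line[OF M] T_param(2)[OF z(1)] z(2) by (simp add: galg_act_def)
 thus ?thesis using gr.qclass_Ann[OF M T_param(1)[OF z(1)]] z(1) unfolding Mcl_def by blast
qed

lemma line_coefficient:
 fixes M :: "('g, 'k, 'i) glider"
 assumes M: "line_glider G M u" obtains d where "d \<in> coeff_funs M u" "d \<one> ~= 0"
proof -
 obtain i where i: "u i ~= 0" using line_gliderD(2)[OF M] by (auto simp: fun_eq_iff fun_apps)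
 have "mod_act M \<one> u = u" by (rule kgmodD(4)[OF gliderD(1)[OF line_gliderD(1)[OF M]] line_gliderD(5)[OF M]])
 thus ?thesis using i that[of "\<lambda>g. mod_act M g u i"] unfolding coeff_funs_def by auto
qed

lemma perp_diff:
 fixes c :: "'k"
 assumes "g \<in> carrier G" "h \<in> carrier G"
 shows "galg_of g - fscale c (galg_of h) \<in> perp G S \<longleftrightarrow> (\<forall>d\<in>S. d g = c * d h)"
 unfolding perp_def by (simp add: galg_of_diff_mem[OF assms] sum_galg_of_diff[OF assms])

text \<open>For a coordinate function \<open>d\<close> not vanishing at \<open>\<one>\<close>, the
  class gives \<open>d g = c * d \<one>\<close> and idempotence gives
  \<open>d g * d g = c * (d \<one> * d \<one>)\<close>. Hence \<open>c * c = c\<close> for the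
  scalar \<open>c\<close> of \<open>g\<close>.\<close>

lemma T_idempotent:
 assumes z: "z \<in> carrier (Gab G)" and i: "Mcl G T {z} {} \<otimes>\<^bsub>gr.QG\<^esub> Mcl G T {z} {} = Mcl G T {z} {}"
 shows "Mcl G T {z} {} = Mcl G T {e} {}"
proof -
 let ?M = "param_glider T {z} {}"
 note M = T_param(1)[OF z]
 let ?C = "coeff_funs ?M (SOME v. param_vector T {z} {} v)"
 obtain d where d: "d \<in> ?C" "d \<one> ~= 0" by (rule line_coefficient[OF M])
 have P: "Ann G ?M = perp G (prod_set ?C ?C)"
  using i gr.qclass_mult_model[OF M Ann_perp[OF M] M Ann_perp[OF M] M] unfolding Mcl_def by blast
 have "mod_act (T z) g t = t" if g: "g \<in> carrier G" and t: "t \<in> mod_space (T z)" for g t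
 proof -
  obtain c where c: "c ~= 0" "!!t. t \<in> mod_space (T z) ==> mod_act (T z) g t = fscale c t"
   "galg_of g - fscale c (galg_of \<one>) \<in> Ann G ?M" unfolding T_param(2)[OF z] by (rule T_scalar_ideal[OF z g]) blast
  have "d g = c * d \<one>" using c(3) d(1) unfolding Ann_perp[OF M] perp_diff[OF g one_closed] by blast
  moreover have "(\<lambda>g. d g * d g) \<in> prod_set ?C ?C" using d(1) unfolding prod_set_def by blast
  hence "d g * d g = c * (d \<one> * d \<one>)"
   using bspec[OF c(3)[unfolded P perp_diff[OF g one_closed]], of "\<lambda>g. d g * d g"] by simp
  ultimately have "c = 1" using d(2) c(1) by simp
  thus ?thesis using c(2)[OF t] by simp
 qed
 hence "Ann G ?M = Ann G (param_glider T {e} {})"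
  unfolding T_param(2)[OF z] T_param(2)[OF e_mem] using param_ideal_trivial[OF z] param_ideal_trivial[OF e_mem T_one] by simp
 thus ?thesis unfolding Mcl_def by (rule gr.qclass_Ann[OF M T_param(1)[OF e_mem]])
qed

text \<open>If \<open>g\<close> acts by \<open>c\<close>, all products of \<open>n\<close>
  coordinate functions are multiplied by \<open>c ^ n\<close> at \<open>g\<close>, so the power is
  one-dimensional again. As \<open>Gab G\<close> is finite, there are only finitely many
  powers.\<close>

lemma T_powers:
 assumes z: "z \<in> carrier (Gab G)"
 shows "\<exists>y\<in>carrier (Gab G). Mcl G T {z} {} [^]\<^bsub>gr.QG\<^esub> (n::nat) = Mcl G T {y} {}"
proof -
 let ?M = "param_glider T {z} {}"
 note M = T_param(1)[OF z]
 let ?C = "coeff_funs ?M (SOME v. param_vector T {z} {} v)"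
 obtain P :: "('g, 'k, nat) glider" and p where P: "line_glider G P p" "qclass G ?M [^]\<^bsub>gr.QG\<^esub> n = qclass G P"
  "Ann G P = perp G (pset ?C n)" using gr.qclass_power_model[OF M] by blast
 have "\<exists>c. galg_of g - fscale c (galg_of \<one>) \<in> Ann G P" if g: "g \<in> carrier G" for g
 proof -
  obtain c where c: "galg_of g - fscale c (galg_of \<one>) \<in> Ann G ?M" unfolding T_param(2)[OF z] by (rule T_scalar_ideal[OF z g])
  have d: "d g = c * d \<one>" if "d \<in> ?C" for d using c that unfolding Ann_perp[OF M] perp_diff[OF g one_closed] by blast
  have "\<forall>d\<in>pset ?C n. d g = c ^ n * d \<one>" by (induct n) (auto simp: prod_set_def d)
  thus ?thesis unfolding P(3) perp_diff[OF g one_closed] by blast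
 qed
 thus ?thesis using one_dim_class[OF P(1)] P(2) unfolding Mcl_def by simp
qed

lemma T_in_generators:
 assumes z: "z \<in> carrier (Gab G)"
 shows "finite (cyclic_semigroup gr.QG (Mcl G T {z} {}))" "the_idempotent gr.QG (Mcl G T {z} {}) = Mcl G T {e} {}"
proof -
 have "cyclic_semigroup gr.QG (Mcl G T {z} {}) \<subseteq> (\<lambda>y. Mcl G T {y} {}) ` carrier (Gab G)"
  using T_powers[OF z] unfolding cyclic_semigroup_def by blast
 thus fin: "finite (cyclic_semigroup gr.QG (Mcl G T {z} {}))" using finite_Gab finite_subset by blast
 note i = gr.the_idempotent_eq[OF T_param(1)[OF z] fin[unfolded Mcl_def], folded Mcl_def]
 obtain y where y: "y \<in> carrier (Gab G)" "the_idempotent gr.QG (Mcl G T {z} {}) = Mcl G T {y} {}"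
  using i(1) T_powers[OF z] by metis
 show "the_idempotent gr.QG (Mcl G T {z} {}) = Mcl G T {e} {}"
  unfolding y(2) by (rule T_idempotent[OF y(1) i(2)[unfolded y(2)]])
qed

lemma QGab_subset_RG: "QGab G T \<subseteq> RG G T Irr"
 unfolding QGab_def RG_def
proof (rule gr.rat_span_mono, clarify)
 fix z assume z: "z \<in> carrier (Gab G)"
 show "\<exists>A B. Mcl G T {z} {} = Mcl G T A B \<and> A \<subseteq> carrier (Gab G) \<and> B \<in> SG Irr \<and> \<not> (A = {} \<and> B = {}) \<and>
    finite (cyclic_semigroup gr.QG (Mcl G T A B)) \<and> (\<exists>D\<in>SG Irr. the_idempotent gr.QG (Mcl G T A B) = Mcl G T {e} D)"
  by (rule exI[of _ "{z}"], rule exI[of _ "{}"]) (use T_in_generators[OF z] z SG_empty in auto)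
qed

lemma e_param:
 assumes "D \<in> SG Irr"
 shows "line_glider G (param_glider T {e} D) (SOME v. param_vector T {e} D v)" "Ann G (param_glider T {e} D) = param_ideal {e} D"
 by (rule param_line param_Ann; use e_mem assms in simp)+

text \<open>The trivial summand contributes a coordinate function that is a nonzero constant, so
  \<open>idempotent_stabilizer\<close> applies, with the stabilizer of the generating vector as
  \<open>H\<close>.\<close>

lemma e_idempotent_ideal:
 assumes D: "D \<in> SG Irr" and i: "Mcl G T {e} D \<otimes>\<^bsub>gr.QG\<^esub> Mcl G T {e} D = Mcl G T {e} D"
 obtains H where "subgroup H G" "param_ideal {e} D = sub_grp.coset_ideal G H"
proof -
 let ?N = "param_glider T {e} D" and ?v = "SOME v. param_vector T {e} D v"
 note N = e_param[OF D]
 let ?C = "coeff_funs ?N ?v"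
 have I: "perp G (prod_set ?C ?C) = perp G ?C"
  using i gr.qclass_mult_model[OF N(1) Ann_perp[OF N(1)] N(1) Ann_perp[OF N(1)] N(1)] Ann_perp[OF N(1)] unfolding Mcl_def by blast
 have eA: "{e} \<subseteq> carrier (Gab G)" "\<not> ({e} = {} \<and> D = {})" using e_mem by auto
 have ei: "Inl e \<in> param_index {e} D" by (simp add: param_index_def)
 have "slice (Inl e) ?v ~= 0" using pv[OF eA(1) D eA(2)] unfolding param_vector_def by blast
 then obtain i where i: "?v (Inl e, i) ~= 0" by (auto simp: fun_eq_iff fun_apps)
 have "mod_act ?N g ?v (Inl e, i) = ?v (Inl e, i)" if g: "g \<in> carrier G" for g
 proof -
  have "slice (Inl e) (mod_act ?N g ?v) = mod_act (T e) g (slice (Inl e) ?v)"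
   using dsum_family_act[OF ei, of "case_sum T fst" g ?v] by (simp add: param_glider_def param_module_def)
  also have "\<dots> = slice (Inl e) ?v" using pv_slice[OF eA(1) D eA(2) ei] by (intro T_one[OF g]) simp
  finally show ?thesis by (rule fun_cong)
 qed
 hence "Ann G ?N = sub_grp.coset_ideal G {g \<in> carrier G. mod_act ?N g ?v = ?v}"
  by (intro idempotent_stabilizer[OF N(1) I, of "\<lambda>g. mod_act ?N g ?v (Inl e, i)"]) (use i in \<open>auto simp: coeff_funs_def\<close>)
 moreover have "subgroup {g \<in> carrier G. mod_act ?N g ?v = ?v} G"
  by (rule stabilizer_subgroup[OF gliderD(1)[OF line_gliderD(1)[OF N(1)]] line_gliderD(5)[OF N(1)]])
 ultimately show ?thesis using that N(2) by simp
qed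

text \<open>Nilpotency makes the supplement \<open>H\<close> equal to \<open>G\<close>, so products
  of \<open>n\<close> coordinate functions are constant. Applied to \<open>n - 1\<close> copies of a
  function \<open>d\<close> with \<open>d \<one> ~= 0\<close> and one arbitrary \<open>s\<close>,
  this shows that passing from \<open>\<one>\<close> to \<open>g\<close> scales all coordinate
  functions by the same factor.\<close>

lemma RG_generator_one_dim:
 assumes nil: "nilpotent_group G" and A: "A \<subseteq> carrier (Gab G)" and B: "B \<in> SG Irr" and ne: "\<not> (A = {} \<and> B = {})"
  and fin: "finite (cyclic_semigroup gr.QG (Mcl G T A B))" and D: "D \<in> SG Irr"
  and id: "the_idempotent gr.QG (Mcl G T A B) = Mcl G T {e} D"
 shows "\<exists>z\<in>carrier (Gab G). Mcl G T A B = Mcl G T {z} {}"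
proof -
 let ?M = "param_glider T A B" and ?u = "SOME v. param_vector T A B v"
 note M = param_line[OF A B ne] and N = e_param[OF D]
 note i = gr.the_idempotent_eq[OF M fin[unfolded Mcl_def], folded Mcl_def, unfolded id]
 obtain H where H: "subgroup H G" "param_ideal {e} D = sub_grp.coset_ideal G H" by (rule e_idempotent_ideal[OF D i(2)])
 have HG: "H = carrier G" by (rule nilpotent_supplement[OF nil H(1) coset_ideal_supplement[OF H(1) D H(2)]])
 interpret S: sub_grp G H by (rule sub_grp.intro[OF finite_grp_axioms sub_grp_axioms.intro[OF H(1)]])
 let ?C = "coeff_funs ?M ?u"
 obtain n where n: "n \<ge> 1" "Mcl G T {e} D = Mcl G T A B [^]\<^bsub>gr.QG\<^esub> (n::nat)" using i(1) by blast
 obtain P :: "('g, 'k, nat) glider" and p where P: "line_glider G P p" "qclass G ?M [^]\<^bsub>gr.QG\<^esub> n = qclass G P"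
  "Ann G P = perp G (pset ?C n)" using gr.qclass_power_model[OF M] by blast
 have AP: "S.coset_ideal = perp G (pset ?C n)"
  using n(2) P gr.qclass_eq_iff[OF N(1) P(1)] N(2) H(2) unfolding Mcl_def by simp
 have const: "s g = s \<one>" if s: "s \<in> pset ?C n" and g: "g \<in> carrier G" for s g
 proof -
  have "galg_of (\<one> \<otimes> g) - fscale 1 (galg_of \<one>) \<in> perp G (pset ?C n)"
   unfolding AP[symmetric] by (rule S.coset_ideal_diff) (use g HG in auto)
  hence "galg_of g - fscale 1 (galg_of \<one>) \<in> perp G (pset ?C n)" by (simp only: l_one[OF g])
  thus ?thesis unfolding perp_diff[OF g one_closed] using s by simp
 qed
 obtain m where m: "n = Suc m" using n(1) by (cases n) auto
 obtain d where d: "d \<in> ?C" "d \<one> ~= 0" by (rule line_coefficient[OF M])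
 have dm: "(\<lambda>g. d g ^ k) \<in> pset ?C k" for k
 proof (induct k)
  case (Suc k)
  thus ?case using d(1) unfolding pset.simps prod_set_def mem_Collect_eq
   by (intro exI[of _ "\<lambda>g. d g ^ k"] exI[of _ d]) (simp add: mult.commute)
 qed simp
 have pw: "d g ^ m * s g = d \<one> ^ m * s \<one>" if s: "s \<in> ?C" and g: "g \<in> carrier G" for s g
 proof -
  have "(\<lambda>g. d g ^ m * s g) \<in> pset ?C n" unfolding m pset.simps prod_set_def mem_Collect_eq
   by (intro exI[of _ "\<lambda>g. d g ^ m"] exI[of _ s] conjI refl dm s)
  thus ?thesis using const[OF _ g, of "\<lambda>g. d g ^ m * s g"] by simp
 qed
 have "\<exists>c. galg_of g - fscale c (galg_of \<one>) \<in> Ann G ?M" if g: "g \<in> carrier G" for g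
 proof -
  \<comment> \<open>\<open>d\<close> has no zero, since its \<open>n\<close>-th power is a nonzero
    constant.\<close>
  have "d g ^ m * d g ~= 0" using pw[OF d(1) g] d(2) by simp
  hence "d g ^ m ~= 0" by simp
  hence "s g = (d \<one> ^ m / d g ^ m) * s \<one>" if "s \<in> ?C" for s
   using pw[OF that g] by (simp add: field_simps)
  thus ?thesis unfolding Ann_perp[OF M] perp_diff[OF g one_closed] by blast
 qed
 thus ?thesis using one_dim_class[OF M] unfolding Mcl_def by blast
qed

lemma nilpotent_RG:
 assumes "nilpotent_group G" shows "RG G T Irr = QGab G T"
proof
 show "RG G T Irr \<subseteq> QGab G T" unfolding QGab_def RG_def
 proof (rule gr.rat_span_mono, clarify)
  fix A B D assume "A \<subseteq> carrier (Gab G)" "B \<in> SG Irr" "\<not> (A = {} \<and> B = {})"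
   "finite (cyclic_semigroup gr.QG (Mcl G T A B))" "D \<in> SG Irr" "the_idempotent gr.QG (Mcl G T A B) = Mcl G T {e} D"
  thus "\<exists>z. Mcl G T A B = Mcl G T {z} {} \<and> z \<in> carrier (Gab G)"
   using RG_generator_one_dim[OF assms] by blast
 qed
qed (rule QGab_subset_RG)

section \<open>The idempotent of a maximal subgroup\<close>

text \<open>The permutation module is generated by an \<open>H\<close>-fixed vector, so the point to
  take over each irreducible module is its space of \<open>H\<close>-fixed vectors. A
  one-dimensional module with a nonzero \<open>H\<close>-fixed vector is trivial, because
  \<open>H\<close> and the derived subgroup give \<open>G\<close>; this is why the first component
  is \<open>{e}\<close>.\<close>

lemma coset_ideal_param:
 assumes H: "subgroup H G" and HG: "!!x. x \<in> carrier G ==> \<exists>h\<in>H. \<exists>c\<in>derived G (carrier G). x = h \<otimes> c"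
 obtains D where "D \<in> SG Irr" "param_ideal {e} D = sub_grp.coset_ideal G H"
proof -
 interpret I: ind_ring G H "TYPE('k)" by (rule ind_ring.intro[OF sub_grp.intro[OF finite_grp_axioms sub_grp_axioms.intro[OF H]]])
 define Fix where "Fix U = {w \<in> mod_space U. \<forall>h\<in>H. mod_act U h w = w}" for U :: "('g, 'k, nat) kgmod"
 define D where "D = {(U, Fix U) |U. U \<in> Irr \<and> fv.dim (mod_space U) > 1 \<and> Fix U ~= {0}}"
 have Fix_sub: "fv.subspace (Fix U)" if U: "U \<in> Irr" for U
 proof -
  note KU = Irr_kgmod[OF U]
  show ?thesis unfolding fv.subspace_def Fix_def
   using fv.subspace_0[OF kgmodD(1)[OF KU]] act_zero[OF KU I.H_sub] fv.subspace_add[OF kgmodD(1)[OF KU]]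
    fv.subspace_scale[OF kgmodD(1)[OF KU]] lin_on_add[OF kgmodD(3)[OF KU I.H_sub]] lin_on_scale[OF kgmodD(3)[OF KU I.H_sub]] by simp
 qed
 have fdU: "fin_dim (mod_space U)" if "U \<in> Irr" for U using irreducible_fin_dim[OF Irr_irr[OF that]] .
 have DS: "D \<in> SG Irr" unfolding SG_def
 proof (intro CollectI conjI)
  show "D \<subseteq> (SIGMA U:{U \<in> Irr. 1 < fv.dim (mod_space U)}. \<Union>j\<in>{1..fv.dim (mod_space U)}. Grass j U)"
  proof
   fix p assume "p \<in> D"
   then obtain U where U: "p = (U, Fix U)" "U \<in> Irr" "fv.dim (mod_space U) > 1" "Fix U ~= {0}" unfolding D_def by blast
   have sub: "Fix U \<subseteq> mod_space U" by (auto simp: Fix_def)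
   have "fv.dim (Fix U) ~= 0" using dim_0_fin[OF fin_dim_mono[OF fdU[OF U(2)] Fix_sub[OF U(2)] sub]] U(4) by blast
   moreover have "fv.dim (Fix U) \<le> fv.dim (mod_space U)" by (rule dim_mono_fin[OF fdU[OF U(2)] Fix_sub[OF U(2)] sub])
   ultimately have "Fix U \<in> (\<Union>j\<in>{1..fv.dim (mod_space U)}. Grass j U)"
    using Fix_sub[OF U(2)] sub by (intro UN_I[of "fv.dim (Fix U)"]) (auto simp: Grass_def)
   thus "p \<in> (SIGMA U:{U \<in> Irr. 1 < fv.dim (mod_space U)}. \<Union>j\<in>{1..fv.dim (mod_space U)}. Grass j U)"
    using U by blast
  qed
  show "\<forall>U W W'. (U, W) \<in> D \<and> (U, W') \<in> D --> W = W'" by (auto simp: D_def)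
 qed
 obtain Y :: "('g, 'k, nat) glider" and y where Y: "line_glider G Y y" "Ann G Y = I.coset_ideal" "!!h. h \<in> H ==> mod_act Y h y = y"
  "induced_glider G H (unit_glider :: ('g, 'k, nat) glider) Y" by (rule I.induced_unit) blast
 let ?V = "\<lparr>mod_space = mod_space Y, mod_act = mod_act Y\<rparr>"
 note KY = gliderD(1)[OF line_gliderD(1)[OF Y(1)]] and yY = line_gliderD(5)[OF Y(1)]
 note KV = kgmod_of_glider[OF KY]
 have fd: "fin_dim (mod_space ?V)"
  using gliderD(5)[OF line_gliderD(1)[OF Y(1)]] Y(4) unfolding induced_glider_def by simp
 have yV: "y \<in> mod_space ?V" using yY by simp
 have "param_ideal {e} D = I.coset_ideal"
 proof
  show "I.coset_ideal \<subseteq> param_ideal {e} D"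
  proof
   fix x :: "'g => 'k" assume x: "x \<in> I.coset_ideal"
   have "galg_act G (T e) x t = 0" if t: "t \<in> mod_space (T e)" for t
    by (rule I.coset_ideal_fixed[OF T_kgmod[OF e_mem] t T_one[OF I.H_sub t] x])
   moreover have "galg_act G U x w = 0" if "U \<in> Irr" "w \<in> Fix U" for U w
    by (rule I.coset_ideal_fixed[OF Irr_kgmod[OF that(1)] _ _ x]) (use that(2) in \<open>auto simp: Fix_def\<close>)
   moreover have "x \<in> galg G" using x by (simp add: I.coset_ideal_def)
   ultimately show "x \<in> param_ideal {e} D" unfolding param_ideal_def D_def by blast
  qed
  show "param_ideal {e} D \<subseteq> I.coset_ideal"
  proof
   fix x assume x: "x \<in> param_ideal {e} D"
   hence xg: "x \<in> galg G" by (simp add: param_ideal_def)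
   have sx: "(\<Sum>g\<in>carrier G. x g) = 0"
   proof -
    have "x \<in> param_ideal {e} {}" using x by (simp add: param_ideal_def)
    thus ?thesis by (simp add: param_ideal_trivial[OF e_mem T_one])
   qed
   \<comment> \<open>If \<open>x\<close> does not kill the generator \<open>y\<close>, some
     irreducible quotient shows it. There \<open>y\<close> goes to an \<open>H\<close>-fixed vector,
     which \<open>x\<close> kills: through \<open>D\<close> in dimension above 1, and by the
     vanishing of its total sum in dimension 1.\<close>
   show "x \<in> I.coset_ideal"
   proof (rule ccontr)
    assume "x \<notin> I.coset_ideal"
    hence n0: "galg_act G ?V x y ~= 0" using xg unfolding Y(2)[symmetric] Ann_line[OF Y(1)] by (simp add: galg_act_def)
    obtain U f where U: "U \<in> Irr" "kg_hom G ?V U f" "f (galg_act G ?V x y) ~= 0"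
     by (rule irreducible_quotient_exists[OF KV fd galg_act_closed[OF KV yV] n0 Irr])
    note KU = Irr_kgmod[OF U(1)]
    have fx: "galg_act G U x (f y) ~= 0" using U(3) kg_hom_galg_act[OF KV KU U(2) yV] by simp
    hence f0: "f y ~= 0" using galg_act_zero[OF KU] by auto
    have fyU: "f y \<in> mod_space U" by (rule kg_homD(2)[OF U(2) yV])
    have hf: "mod_act U h (f y) = f y" if "h \<in> H" for h
     using kg_homD(3)[OF U(2) I.H_sub[OF that] yV] Y(3)[OF that] by simp
    have F: "f y \<in> Fix U" using fyU hf by (simp add: Fix_def)
    show False
    proof (cases "fv.dim (mod_space U) > 1")
     case True
     hence "(U, Fix U) \<in> D" using U(1) F f0 unfolding D_def by blast
     thus False using x F fx unfolding param_ideal_def by blast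
    next
     case False
     have "fv.dim (mod_space U) ~= 0" using dim_0_fin[OF fdU[OF U(1)]] fyU f0 by blast
     hence d1: "fv.dim (mod_space U) = 1" using False by simp
     have sp: "mod_space U = fv.span {f y}" by (rule dim_1_line[OF kgmodD(1)[OF KU] d1 fyU f0])
     have "mod_act U g (f y) = f y" if "g \<in> carrier G" for g
      by (rule line_stable_trivial[OF KU sp _ HG that]) (use hf I.H_sub in auto)
     hence "galg_act G U x (f y) = fscale (\<Sum>g\<in>carrier G. x g) (f y)"
      unfolding galg_act_def fv.scale_sum_left by (intro sum.cong) simp_all
     thus False using fx sx by simp
    qed
   qed
  qed
 qed
 thus ?thesis using that DS by blast
qed

text \<open>The functions constant on left cosets contain 1 and are closed under products, so as a
  set they are idempotent.\<close>

lemma coset_idempotent: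
 assumes H: "subgroup H G" and D: "D \<in> SG Irr" "param_ideal {e} D = sub_grp.coset_ideal G H"
 shows "Mcl G T {e} D \<otimes>\<^bsub>gr.QG\<^esub> Mcl G T {e} D = Mcl G T {e} D"
proof -
 interpret S: sub_grp G H by (rule sub_grp.intro[OF finite_grp_axioms sub_grp_axioms.intro[OF H]])
 let ?C = "{c :: 'g => 'k. \<forall>g\<in>carrier G. \<forall>h\<in>H. c (g \<otimes> h) = c g}"
 note N = e_param[OF D(1)]
 have "prod_set ?C ?C = ?C"
 proof
  show "?C \<subseteq> prod_set ?C ?C"
  proof
   fix c assume "c \<in> ?C"
   thus "c \<in> prod_set ?C ?C" unfolding prod_set_def mem_Collect_eq by (intro exI[of _ "\<lambda>_. 1"] exI[of _ c]) simp
  qed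
 qed (auto simp: prod_set_def)
 moreover have "Ann G (param_glider T {e} D) = perp G ?C" unfolding N(2) D(2) S.coset_ideal_perp ..
 ultimately show ?thesis using gr.qclass_mult_model[OF N(1) _ N(1) _ N(1), of ?C ?C] unfolding Mcl_def by simp
qed

text \<open>The tool for excluding a class from a span: find an annihilator whose coefficient
  vanishes on all generators.\<close>

lemma rat_span_qcoef:
 assumes I: "I \<subseteq> galg G" and S: "!!x. x \<in> S ==> x \<in> carrier gr.QG \<and> (\<forall>q. gr.qcoef I (rat_scale gr.R1 q x) = 0)"
  and y: "y \<in> rat_span gr.R1 S"
 shows "y \<in> carrier gr.QG \<and> gr.qcoef I y = 0"
proof -
 have z: "gr.qcoef I \<zero>\<^bsub>gr.QG\<^esub> = 0" using gr.qcoef_nat(2)[OF I, of "\<zero>\<^bsub>gr.QG\<^esub>" "\<zero>\<^bsub>gr.QG\<^esub>"] by simp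
 show ?thesis using y unfolding rat_span_def gr.QG_eq[symmetric]
 proof (induct rule: generate.induct)
  case one thus ?case using z by simp
 next
  case (incl h) thus ?case using S gr.qscale_closed by auto
 next
  case (inv h)
  hence h: "h \<in> carrier gr.QG" "gr.qcoef I h = 0" using S gr.qscale_closed by auto
  have i: "inv\<^bsub>add_monoid gr.QG\<^esub> h = \<ominus>\<^bsub>gr.QG\<^esub> h" by (simp add: a_inv_def)
  have "gr.qcoef I (\<zero>\<^bsub>gr.QG\<^esub> \<ominus>\<^bsub>gr.QG\<^esub> h) = 0" using gr.qcoef_diff[OF I, of "\<zero>\<^bsub>gr.QG\<^esub>" h] h z by simp
  thus ?case unfolding i using h by (simp add: a_minus_def)
 next
  case (eng h1 h2) thus ?case using gr.qcoef_nat(2)[OF I] by simp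
 qed
qed

lemma coset_class:
 assumes H: "subgroup H G" "H ~= carrier G" and D: "D \<in> SG Irr" "param_ideal {e} D = sub_grp.coset_ideal G H"
 shows "Mcl G T {e} D \<in> RG G T Irr - QGab G T"
proof
 interpret S: sub_grp G H by (rule sub_grp.intro[OF finite_grp_axioms sub_grp_axioms.intro[OF H(1)]])
 note N = e_param[OF D(1)]
 have NQ: "Mcl G T {e} D \<in> carrier gr.QG" unfolding Mcl_def by (rule gr.qclass_closed[OF N(1)])
 have s1: "rat_scale gr.R1 1 (Mcl G T {e} D) = Mcl G T {e} D" by (rule gr.qscale_one[OF NQ])
 note i = gr.idempotent_powers[OF N(1) coset_idempotent[OF H(1) D, unfolded Mcl_def], folded Mcl_def]
 have "Mcl G T {e} D \<in> {Mcl G T A B |A B. A \<subseteq> carrier (Gab G) \<and> B \<in> SG Irr \<and> \<not> (A = {} \<and> B = {}) \<and>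
    finite (cyclic_semigroup gr.QG (Mcl G T A B)) \<and> (\<exists>D\<in>SG Irr. the_idempotent gr.QG (Mcl G T A B) = Mcl G T {e} D)}"
  using i D(1) e_mem by (intro CollectI exI[of _ "{e}"] exI[of _ D]) auto
 hence "rat_scale gr.R1 1 (Mcl G T {e} D) \<in> RG G T Irr"
  unfolding RG_def rat_span_def by (intro generate.incl) blast
 thus "Mcl G T {e} D \<in> RG G T Irr" unfolding s1 .
 show "Mcl G T {e} D \<notin> QGab G T"
 proof
  assume m: "Mcl G T {e} D \<in> QGab G T"
  let ?I = "S.coset_ideal :: ('g => 'k) set"
  have I: "?I \<subseteq> galg G" by (auto simp: S.coset_ideal_def)
  \<comment> \<open>For \<open>g\<close> outside \<open>H\<close> the coset ideal contains no
    element g - c, while each one-dimensional annihilator contains one. So the coefficient at the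
    coset ideal vanishes on all generators of the span, but is 1 on the class itself.\<close>
  obtain g where g: "g \<in> carrier G" "g \<notin> H" using H subgroup.subset[OF H(1)] by blast
  have "gr.qcoef ?I (rat_scale gr.R1 q (Mcl G T {z} {})) = 0" if z: "z \<in> carrier (Gab G)" for q z
  proof -
   obtain c where "galg_of g - fscale c (galg_of \<one>) \<in> param_ideal {z} {}" by (rule T_scalar_ideal[OF z g(1)])
   hence "?I ~= Ann G (param_glider T {z} {})" unfolding T_param(2)[OF z] using S.coset_ideal_not[OF g] by blast
   thus ?thesis unfolding Mcl_def gr.qcoef_line[OF I T_param(1)[OF z]] by simp
  qed
  moreover have "Mcl G T {z} {} \<in> carrier gr.QG" if "z \<in> carrier (Gab G)" for z
   unfolding Mcl_def by (rule gr.qclass_closed[OF T_param(1)[OF that]])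
  ultimately have "gr.qcoef ?I (Mcl G T {e} D) = 0"
   using rat_span_qcoef[OF I, of "{Mcl G T {z} {} |z. z \<in> carrier (Gab G)}" "Mcl G T {e} D"] m unfolding QGab_def by blast
  moreover have "gr.qcoef ?I (rat_scale gr.R1 1 (Mcl G T {e} D)) = 1"
   unfolding Mcl_def gr.qcoef_line[OF I N(1)] N(2) D(2) by simp
  ultimately show False unfolding s1 by simp
 qed
qed

text \<open>The parametrized glider of the trivial module of \<open>H\<close> has the same
  annihilator as the unit glider. So \<open>Phi\<close> may be evaluated on the latter, where the
  induced annihilator is the coset ideal.\<close>

lemma Phi_trivial:
 assumes H: "subgroup H G" and D: "D \<in> SG Irr" "param_ideal {e} D = sub_grp.coset_ideal G H"
  and TH: "ab_param (G\<lparr>carrier := H\<rparr>) TH"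
 shows "Phi G H (Mcl (G\<lparr>carrier := H\<rparr>) TH {ab_elt (G\<lparr>carrier := H\<rparr>) TH trivial_kgmod} {}) = Mcl G T {e} D"
proof -
 interpret I: ind_ring G H "TYPE('k)" by (rule ind_ring.intro[OF sub_grp.intro[OF finite_grp_axioms sub_grp_axioms.intro[OF H]]])
 obtain IrrH :: "('g, 'k, nat) kgmod set" where IrrH: "irr_reps I.GH IrrH" using I.sub.irr_reps_exists by blast
 interpret P: param I.GH TH IrrH by (rule param.intro[OF I.sub.finite_grp_axioms param_axioms.intro[OF TH IrrH]])
 let ?M = "unit_glider :: ('g, 'k, nat) glider"
 note L = I.rH.unit_glider_line
 have "P.param_ideal {P.e} {} = {x \<in> galg I.GH. (\<Sum>g\<in>carrier I.GH. x g) = 0}"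
  by (rule P.param_ideal_trivial[OF P.e_mem P.T_one])
 hence "Ann I.GH (param_glider TH {P.e} {}) = Ann I.GH ?M" unfolding P.T_param(2)[OF P.e_mem] I.Ann_unit by simp
 hence 1: "Mcl I.GH TH {ab_elt I.GH TH trivial_kgmod} {} = qclass I.GH ?M"
  unfolding P.ab_elt_trivial Mcl_def by (rule I.rH.qclass_Ann[OF P.T_param(1)[OF P.e_mem] L])
 obtain Y :: "('g, 'k, nat) glider" and y where Y: "Y \<in> nat_gliders G" "induced_glider G H ?M Y" "line_glider G Y y" "Ann G Y = I.coset_ideal"
  by (rule I.induced_unit) blast
 have "irreducible_glider I.GH ?M" by (rule I.sub.line_irreducible[OF L I.rH.unit_glider_generated])
 moreover have "?M \<in> nat_gliders I.GH" using I.sub.line_gliderD(1)[OF L] by (simp add: nat_gliders_def)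
 ultimately have "Phi G H (qclass I.GH ?M) = qclass G Y" using I.Phi_qclass Y(1,2) by blast
 also have "\<dots> = Mcl G T {e} D" unfolding Mcl_def
  by (rule gr.qclass_Ann[OF Y(3) e_param(1)[OF D(1)]]) (simp only: Y(4) e_param(2)[OF D(1)] D(2))
 finally show ?thesis unfolding 1 .
qed

lemma maximal_class:
 assumes M: "maximal_subgroup H G" "\<not> H \<lhd> G"
 obtains D where "D \<in> SG Irr" "Mcl G T {e} D \<in> RG G T Irr - QGab G T"
  "!!TH. ab_param (G\<lparr>carrier := H\<rparr>) TH ==>
   Phi G H (Mcl (G\<lparr>carrier := H\<rparr>) TH {ab_elt (G\<lparr>carrier := H\<rparr>) TH trivial_kgmod} {}) = Mcl G T {e} D"
proof -
 have H: "subgroup H G" "H ~= carrier G" using M(1) by (auto simp: maximal_subgroup_def)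
 obtain D where D: "D \<in> SG Irr" "param_ideal {e} D = sub_grp.coset_ideal G H"
  by (rule coset_ideal_param[OF H(1) maximal_supplement[OF M]])
 show ?thesis by (rule that[OF D(1) coset_class[OF H D] Phi_trivial[OF H(1) D]])
qed

end

theorem theorem5p1:
  fixes G :: "('g, 'm) monoid_scheme"
    and T :: "'g set \<Rightarrow> ('g, 'k::{alg_closed_field, field_char_0}, nat) kgmod"
    and Irr :: "('g, 'k, nat) kgmod set"
  assumes "group G" and "finite (carrier G)"
    and "ab_param G T" and "irr_reps G Irr"
  shows "(nilpotent_group G \<longleftrightarrow> RG G T Irr = QGab G T) \<and>
    (\<forall>H TH. \<not> nilpotent_group G \<and> maximal_subgroup H G \<and> \<not> H \<lhd> G \<and>
       ab_param (G\<lparr>carrier := H\<rparr>) TH \<longrightarrow>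
       (\<exists>D\<in>SG Irr.
          Phi G H (Mcl (G\<lparr>carrier := H\<rparr>) TH {ab_elt (G\<lparr>carrier := H\<rparr>) TH trivial_kgmod} {}) =
            Mcl G T {ab_elt G T trivial_kgmod} D \<and>
          Mcl G T {ab_elt G T trivial_kgmod} D \<in> RG G T Irr - QGab G T))"
proof -
  interpret param G T Irr
    by (rule param.intro[OF finite_grp.intro[OF assms(1) finite_grp_axioms.intro[OF assms(2)]] param_axioms.intro[OF assms(3,4)]])
  \<comment> \<open>A proper supplement of the derived subgroup would give a class in
    \<open>RG G T Irr\<close> outside \<open>QGab G T\<close>, so equality of the two makes
    \<open>G\<close> supplement-free.\<close>
  have "nilpotent_group G" if eq: "RG G T Irr = QGab G T"
  proof (rule nilpotent_if_supplement_free[OF assms(2)], unfold supplement_free_def, intro allI impI, rule ccontr)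
    fix H assume H: "subgroup H G" "\<forall>x\<in>carrier G. \<exists>h\<in>H. \<exists>c\<in>derived G (carrier G). x = h \<otimes>\<^bsub>G\<^esub> c" "H ~= carrier G"
    obtain D where D: "D \<in> SG Irr" "param_ideal {e} D = sub_grp.coset_ideal G H"
      by (rule coset_ideal_param[OF H(1)]) (use H(2) in blast)
    show False using coset_class[OF H(1,3) D] eq by simp
  qed
  moreover have "\<exists>D\<in>SG Irr.
          Phi G H (Mcl (G\<lparr>carrier := H\<rparr>) TH {ab_elt (G\<lparr>carrier := H\<rparr>) TH trivial_kgmod} {}) =
            Mcl G T {e} D \<and> Mcl G T {e} D \<in> RG G T Irr - QGab G T"
    if H: "maximal_subgroup H G" "\<not> H \<lhd> G" and TH: "ab_param (G\<lparr>carrier := H\<rparr>) TH" for H and TH :: "'g set => ('g, 'k, nat) kgmod"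
    by (rule maximal_class[OF H]) (use TH in blast)
  ultimately show ?thesis using nilpotent_RG unfolding ab_elt_trivial by blast
qed

end
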